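(* Let $W$ be an odd symplectic super vector space with decomposition $W=\operatorname{H}(W)\oplus\mathcal L_s\oplus\Pi\operatorname{im}(d)$ given by a cyclic strong deformation retract $(i,p,s)$ of $\Pi W$ onto its homology, and let $f\in\mathfrak h[W]$. Then $$\int_{\mathcal L_s}e^{\frac f\hbar}e^{\frac{-\sigma}{2\hbar}}=\sum_G\hbar^{-\chi(G)}\frac{F(G)}{|\operatorname{Aut}(G)|},$$ where the sum is over all (isomorphism classes of, possibly disconnected) stable graphs, $\chi(G)$ is the Euler characteristic of $G$ and $F(G)$ its Feynman amplitude.
   Context: **Basics.** A super vector space is a $\mathbb Z/2$-graded real vector space with an odd differential $d$; $|v|$ is parity, $\Pi$ is parity reversion, $\operatorname{H}$ is homology. Odd bilinear forms are compatible with $d$: $\langle dx,y\rangle+(-1)^{|x|}\langle x,dy\rangle=0$. An odd symplectic $W$ (odd, non-degenerate, skew-symmetric form; finite-dimensional) corresponds to $V=\Pi W$ with an odd symmetric non-degenerate form via $\tau(\Pi x,\Pi y)=(-1)^{|x|}\langle x,y\rangle$. $\hat SW^*=\prod_nS^nW^*$ is the algebra of formal functions; $\overline W=W\otimes\mathbb R((\hbar))$, and $S\overline W^*$, $\hat S\overline W^*$ are taken over $\mathbb R((\hbar))$. Give $f\hbar^g$, $f$ a monomial of degree $n$ in $\hat SW^*$, the weight $2g+n$; $\mathfrak h[W]\subset\hat SW^*[[\hbar]]$ is the subspace of elements of weight $>2$. **Cyclic SDR.** A cyclic strong deformation retract from $V$ to $\operatorname{H}(V)$ (with induced form) consists of even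 morphisms $i\colon \operatorname{H}(V)\hookrightarrow V$, $p\colon V\twoheadrightarrow \operatorname{H}(V)$ (commuting with differentials) and an odd linear map $s\colon V\to V$ with $pi=\mathrm{id}$, $ds+sd=\mathrm{id}-ip$, $si=0$, $ps=0$, $s^2=0$, $\langle ix,iy\rangle=\langle x,y\rangle$, $\ker p\perp\operatorname{im} i$, $\langle sx,y\rangle=(-1)^{|x|}\langle x,sy\rangle$. Then $W=\Pi\operatorname{im}(i)\oplus\Pi\operatorname{im}(s)\oplus\Pi\operatorname{im}(d)$; $\Pi\operatorname{im}(i)$ is identified with $\operatorname{H}(W)$ and $\mathcal L_s:=\Pi\operatorname{im}(s)$. **Integral.** $\sigma$ is the non-degenerate quadratic function $w\mapsto\langle w,dw\rangle$ on $\mathcal L_s$. Choose linear coordinates on $\mathcal L_s$, $x_1,\dots,x_k$ even and $\xi_{k+1},\dots,\xi_n$ odd ($n-k$ is even), with $\sigma=\sum_i\epsilon(x_i)x_i^2-(\xi_{k+1}\xi_{k+2}+\dots+\xi_{n-1}\xi_n)$, $\epsilon(x_i)=\pm1$. The integral over $\mathcal L_s$ is the normalized formal Gaussian integral, the $\hbar,\hbar^{-1}$-linear iterated integral determined by: for each even $x=x_i$, $\int e^{-\epsilon(x)x^2/2\hbar}=1$, $\int x^{2r+2}e^{-\epsilon(x)x^2/2\hbar}=\epsilon(x)(2r+1)\hbar\int x^{2r}e^{-\epsilon(x)x^2/2\hbar}$ and odd powers integrate to $0$; for each pair $\xi,\eta$ of consecutive odd coordinates (as paired in $\sigma$), the functions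 $1,\xi,\eta,\xi\eta$ times $e^{\xi\eta/2\hbar}$ are defined to integrate to $1,0,0,\hbar$ respectively. For a polynomial $f\in S\overline W^*$, $\int_{\mathcal L_s}fe^{-\sigma/2\hbar}\in S\overline{\operatorname{H}(W)}^*$ is obtained by restricting $f$ to $\operatorname{H}(W)\oplus\mathcal L_s$ and applying $\mathrm{id}_{\operatorname{H}(W)}\otimes\int_{\mathcal L_s}$; it is extended termwise to $e^{f/\hbar}$, $f\in\mathfrak h[W]$. $\sigma^{-1}$ denotes the inverse form on $\mathcal L_s^*$ of the form $\sigma$, in the convention of Wick's formula for this integral: $\int_{\mathcal L_s}\phi\psi\, e^{-\sigma/2\hbar}=\hbar\,\sigma^{-1}(\phi,\psi)$ for $\phi,\psi\in\mathcal L_s^*$. **Stable graphs.** A graph $G$ consists of finite sets $\operatorname{Half}(G)$, $\operatorname{Vert}(G)$, a map $\operatorname{Half}(G)\to\operatorname{Vert}(G)$ and an involution of $\operatorname{Half}(G)$; edges are the two-cycles and legs the fixed points of the involution; the valence $n(v)$ of a vertex $v$ is the number of half-edges (including legs) attached to it. A stable graph is a graph whose vertices carry non-negative integers $g(v)$ (genus) with $2g(v)+n(v)\ge3$. $\operatorname{H}_\bullet(G)$ is the homology of the associated one-dimensional CW-complex; $g(G)=\dim \operatorname{H}_1(G)+\sum_vg(v)$ and $\chi(G)=\dim \operatorname{H}_0(G)-g(G)$. Isomorphisms and automorphisms ($\operatorname{Aut}(G)$) are bijections on vertices and half-edges preserving all the structure (legs are unlabelled and may be permuted). The empty graph is allowed.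 **Feynman amplitude.** Write the restriction of $f$ to $\operatorname{H}(W)\oplus\mathcal L_s$ as $\sum_{i,j,k}\frac1{j!k!}\hbar^if_{i,j,k}$ with $f_{i,j,k}$ of degree $j$ in $\mathcal L_s^*$ and degree $k$ in $\operatorname{H}(W)^*$, regarded as a symmetric tensor in $(\mathcal L_s^* )^{\otimes j}\otimes(\operatorname{H}(W)^* )^{\otimes k}$. For connected $G$, $F(G)\in(\operatorname{H}(W)^* )^{\otimes|\operatorname{Leg}(G)|}$ ($\operatorname{Leg}(G)$ the set of legs), regarded as an element of the symmetric algebra on $\operatorname{H}(W)^*$, is obtained by placing $f_{i,j,k}$ at every vertex of genus $i$ with $j$ half-edges belonging to edges and $k$ legs, and contracting along each edge with $\sigma^{-1}$. For disconnected $G$, $F(G)$ is the product of the amplitudes of the connected components; the empty graph has amplitude $1$. *)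

theory Defs
  imports Complex_Main
    "HOL-Library.Multiset"
    "HOL-Library.FuncSet"
    "HOL-Library.Function_Algebras"
    "HOL-Combinatorics.Permutations"
    "HOL-Combinatorics.Multiset_Permutations"
    "HOL-Computational_Algebra.Formal_Laurent_Series"
begin

section \<open>Super vector spaces, odd symplectic structures, cyclic retracts\<close>

text \<open>
  The underlying vector space is a type, and a grading sends \<open>False\<close> to the even and \<open>True\<close> to the
  odd subspace.  Parity reversion does not change the underlying vector space, so \<open>\<Pi>W\<close> is \<open>W\<close>
  with the grading \<open>parity_rev W\<close>.  The differential of \<open>\<Pi>W\<close> is taken to be \<open>d\<close> itself; with the
  convention \<open>- d\<close> one obtains the same retracts after replacing \<open>s\<close> by \<open>- s\<close>.
\<close>

type_synonym 'w grading = "bool \<Rightarrow> 'w set"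

definition psign :: "bool \<Rightarrow> real" where
  "psign b = (if b then -1 else 1)"

definition parity_rev :: "'w grading \<Rightarrow> 'w grading" where
  "parity_rev W = (\<lambda>b. W (\<not> b))"

definition super_space :: "'w::real_vector grading \<Rightarrow> ('w \<Rightarrow> 'w) \<Rightarrow> bool" where
  "super_space W d \<longleftrightarrow>
     subspace (W False) \<and> subspace (W True) \<and>
     W False \<inter> W True = {0} \<and> (\<forall>x. \<exists>u\<in>W False. \<exists>v\<in>W True. x = u + v) \<and>
     linear d \<and> (\<forall>b. d ` W b \<subseteq> W (\<not> b)) \<and> (\<forall>x. d (d x) = 0)"

definition odd_symplectic ::
  "'w::real_vector grading \<Rightarrow> ('w \<Rightarrow> 'w) \<Rightarrow> ('w \<Rightarrow> 'w \<Rightarrow> real) \<Rightarrow> bool" where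
  "odd_symplectic W d \<omega> \<longleftrightarrow>
     super_space W d \<and> (\<exists>B. finite B \<and> span B = (UNIV :: 'w set)) \<and>
     (\<forall>x. linear (\<omega> x)) \<and> (\<forall>y. linear (\<lambda>x. \<omega> x y)) \<and>
     (\<forall>b. \<forall>x\<in>W b. \<forall>y\<in>W b. \<omega> x y = 0) \<and>
     (\<forall>a b. \<forall>x\<in>W a. \<forall>y\<in>W b. \<omega> x y = - psign (a \<and> b) * \<omega> y x) \<and>
     (\<forall>x. (\<forall>y. \<omega> x y = 0) \<longrightarrow> x = 0) \<and>
     (\<forall>b. \<forall>x\<in>W b. \<forall>y. \<omega> (d x) y + psign b * \<omega> x (d y) = 0)"

text \<open>The linear operator \<open>x \<mapsto> (-1)\<^bsup>|x|\<^esup> x\<close>.\<close>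

definition parity_op :: "'w::real_vector grading \<Rightarrow> 'w \<Rightarrow> 'w" where
  "parity_op W x = (THE z. \<exists>u\<in>W False. \<exists>v\<in>W True. x = u + v \<and> z = u - v)"

definition shift_form :: "'w::real_vector grading \<Rightarrow> ('w \<Rightarrow> 'w \<Rightarrow> real) \<Rightarrow> 'w \<Rightarrow> 'w \<Rightarrow> real" where
  "shift_form W \<omega> x y = \<omega> (parity_op W x) y"

text \<open>
  Homology is the set of cosets of the image of \<open>d\<close> in its kernel.  Its linear structure, grading,
  zero differential and induced form are the ones induced from representatives.
\<close>

definition hclass :: "('w::real_vector \<Rightarrow> 'w) \<Rightarrow> 'w \<Rightarrow> 'w set" where
  "hclass d x = {x + d y | y. True}"

definition homology :: "('w::real_vector \<Rightarrow> 'w) \<Rightarrow> 'w set set" where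
  "homology d = hclass d ` {x. d x = 0}"

definition cyclic_sdr ::
  "'v::real_vector grading \<Rightarrow> ('v \<Rightarrow> 'v) \<Rightarrow> ('v \<Rightarrow> 'v \<Rightarrow> real) \<Rightarrow>
   ('v set \<Rightarrow> 'v) \<Rightarrow> ('v \<Rightarrow> 'v set) \<Rightarrow> ('v \<Rightarrow> 'v) \<Rightarrow> bool" where
  "cyclic_sdr V d \<tau> i p s \<longleftrightarrow>
     \<comment> \<open>\<open>i\<close> is linear, even and commutes with the differentials\<close>
     (\<forall>a b x y. d x = 0 \<longrightarrow> d y = 0 \<longrightarrow>
        i (hclass d (a *\<^sub>R x + b *\<^sub>R y)) = a *\<^sub>R i (hclass d x) + b *\<^sub>R i (hclass d y)) \<and>
     (\<forall>b. \<forall>x\<in>V b. d x = 0 \<longrightarrow> i (hclass d x) \<in> V b) \<and>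
     (\<forall>X\<in>homology d. d (i X) = 0) \<and>
     \<comment> \<open>\<open>p\<close> is linear, even and commutes with the differentials\<close>
     (\<forall>v. p v \<in> homology d) \<and>
     (\<forall>a b u v x y. d x = 0 \<longrightarrow> d y = 0 \<longrightarrow> p u = hclass d x \<longrightarrow> p v = hclass d y \<longrightarrow>
        p (a *\<^sub>R u + b *\<^sub>R v) = hclass d (a *\<^sub>R x + b *\<^sub>R y)) \<and>
     (\<forall>b. \<forall>v\<in>V b. \<exists>x\<in>V b. d x = 0 \<and> p v = hclass d x) \<and>
     (\<forall>v. p (d v) = hclass d 0) \<and>
     \<comment> \<open>\<open>s\<close> is linear and odd\<close>
     linear s \<and> (\<forall>b. s ` V b \<subseteq> V (\<not> b)) \<and>
     \<comment> \<open>strong deformation retract\<close>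
     (\<forall>X\<in>homology d. p (i X) = X) \<and>
     (\<forall>v. d (s v) + s (d v) = v - i (p v)) \<and>
     (\<forall>X\<in>homology d. s (i X) = 0) \<and>
     (\<forall>v. p (s v) = hclass d 0) \<and>
     (\<forall>v. s (s v) = 0) \<and>
     \<comment> \<open>compatibility with the forms\<close>
     (\<forall>x y. d x = 0 \<longrightarrow> d y = 0 \<longrightarrow> \<tau> (i (hclass d x)) (i (hclass d y)) = \<tau> x y) \<and>
     (\<forall>v. \<forall>X\<in>homology d. p v = hclass d 0 \<longrightarrow> \<tau> v (i X) = 0) \<and>
     (\<forall>b. \<forall>x\<in>V b. \<forall>y. \<tau> (s x) y = psign b * \<tau> x (s y))"


section \<open>Formal functions in coordinates\<close>

text \<open>
  Coordinates are numbered by natural numbers, with a predicate \<open>P\<close> singling out the odd ones.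
  An element of the completed symmetric algebra with coefficients in \<open>\<real>((\<hbar>))\<close> is given by its
  coefficients at the normally ordered monomials (products of coordinates in increasing order); such
  a monomial is encoded as a multiset in which odd coordinates are not repeated.  The variable \<open>\<hbar>\<close>
  is \<open>fls_X\<close>.
\<close>

type_synonym ffun = "nat multiset \<Rightarrow> real fls"

definition monomials :: "(nat \<Rightarrow> bool) \<Rightarrow> nat set \<Rightarrow> nat multiset set" where
  "monomials P A = {m. set_mset m \<subseteq> A \<and> (\<forall>j\<in>#m. P j \<longrightarrow> count m j = 1)}"

text \<open>The Koszul sign relating a product of coordinates to the normally ordered monomial; it is zero
  if an odd coordinate is repeated.\<close>

definition ksign :: "(nat \<Rightarrow> bool) \<Rightarrow> nat list \<Rightarrow> real" where
  "ksign P w =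
     (if distinct (filter P w)
      then (-1) ^ card {(a, b). a < b \<and> b < length w \<and> w ! b < w ! a \<and> P (w ! a) \<and> P (w ! b)}
      else 0)"

definition word_fun :: "(nat \<Rightarrow> bool) \<Rightarrow> nat list \<Rightarrow> ffun" where
  "word_fun P w = (\<lambda>m. if m = mset w then fls_const (ksign P w) else 0)"

abbreviation fone :: "ffun" where
  "fone \<equiv> (\<lambda>m. if m = {#} then 1 else 0)"

definition fscale :: "real fls \<Rightarrow> ffun \<Rightarrow> ffun" where
  "fscale c f = (\<lambda>m. c * f m)"

definition fmult :: "(nat \<Rightarrow> bool) \<Rightarrow> ffun \<Rightarrow> ffun \<Rightarrow> ffun" where
  "fmult P f g = (\<lambda>m. \<Sum>u\<in>{u. u \<subseteq># m}.
     fls_const (ksign P (sorted_list_of_multiset u @ sorted_list_of_multiset (m - u)))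
       * f u * g (m - u))"

definition fprod_list :: "(nat \<Rightarrow> bool) \<Rightarrow> ffun list \<Rightarrow> ffun" where
  "fprod_list P fs = foldr (fmult P) fs fone"

text \<open>
  Infinite sums are taken coefficientwise: every coefficient (of a monomial and a power of \<open>\<hbar>\<close>)
  receives finitely many non-zero contributions, and for every monomial the powers of \<open>\<hbar>\<close> that
  occur are bounded below.
\<close>

definition formal_summable :: "('j \<Rightarrow> ffun) \<Rightarrow> 'j set \<Rightarrow> bool" where
  "formal_summable g J \<longleftrightarrow>
     (\<forall>m K. finite {j\<in>J. fls_nth (g j m) K \<noteq> 0}) \<and>
     (\<forall>m. \<exists>K0. \<forall>j\<in>J. \<forall>K<K0. fls_nth (g j m) K = 0)"

definition formal_sum :: "('j \<Rightarrow> ffun) \<Rightarrow> 'j set \<Rightarrow> ffun" where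
  "formal_sum g J =
     (\<lambda>m. Abs_fls (\<lambda>K. \<Sum>j\<in>{j\<in>J. fls_nth (g j m) K \<noteq> 0}. fls_nth (g j m) K))"

definition fexp_term :: "(nat \<Rightarrow> bool) \<Rightarrow> ffun \<Rightarrow> nat \<Rightarrow> ffun" where
  "fexp_term P u n = fscale (fls_const (1 / fact n)) (fprod_list P (replicate n u))"

definition fexp :: "(nat \<Rightarrow> bool) \<Rightarrow> ffun \<Rightarrow> ffun" where
  "fexp P u = formal_sum (fexp_term P u) UNIV"

text \<open>Formal functions with coefficients in \<open>\<real>[[\<hbar>]]\<close> all of whose terms have weight
  greater than 2.\<close>

definition hfun :: "(nat \<Rightarrow> bool) \<Rightarrow> nat set \<Rightarrow> ffun set" where
  "hfun P A = {f. (\<forall>m. m \<notin> monomials P A \<longrightarrow> f m = 0) \<and>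
                  (\<forall>m g. fls_nth (f m) g \<noteq> 0 \<longrightarrow> g \<ge> 0 \<and> 2 * g + int (size m) > 2)}"


section \<open>Coordinates adapted to the decomposition\<close>

text \<open>
  A homogeneous basis of \<open>W\<close> consisting of bases of the image of \<open>i\<close>, of the image of \<open>s\<close> (the even
  vectors \<open>xvecs\<close> first, then the odd vectors \<open>zvecs\<close>) and of the image of \<open>d\<close>.  The coordinate
  number \<open>j\<close> is the element of the dual basis belonging to \<open>vecs c ! j\<close>; it has the parity of that
  vector.
\<close>

record 'w coords =
  hvecs :: "'w list"
  xvecs :: "'w list"
  zvecs :: "'w list"
  dvecs :: "'w list"
  eps :: "nat \<Rightarrow> real"

definition vecs :: "'w coords \<Rightarrow> 'w list" where
  "vecs c = hvecs c @ xvecs c @ zvecs c @ dvecs c"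

definition podd :: "'w grading \<Rightarrow> 'w coords \<Rightarrow> nat \<Rightarrow> bool" where
  "podd W c j \<longleftrightarrow> j < length (vecs c) \<and> vecs c ! j \<in> W True"

definition hcoord :: "'w coords \<Rightarrow> nat set" where
  "hcoord c = {..<length (hvecs c)}"

definition xcoord :: "'w coords \<Rightarrow> nat \<Rightarrow> nat" where
  "xcoord c t = length (hvecs c) + t"

definition zcoord :: "'w coords \<Rightarrow> nat \<Rightarrow> nat" where
  "zcoord c t = length (hvecs c) + length (xvecs c) + t"

definition lcoord :: "'w coords \<Rightarrow> nat set" where
  "lcoord c = xcoord c ` {..<length (xvecs c)} \<union> zcoord c ` {..<length (zvecs c)}"

definition basis_list :: "'w::real_vector list \<Rightarrow> 'w set \<Rightarrow> bool" where
  "basis_list bs S \<longleftrightarrow> distinct bs \<and> independent (set bs) \<and> span (set bs) = S"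

text \<open>
  The quadratic function \<open>w \<mapsto> \<langle>w, d w\<rangle>\<close> on the image of \<open>s\<close>, as an element of the symmetric square
  of the dual space: the class of the tensor corresponding to the bilinear form
  \<open>B(x, y) = \<langle>x, d y\<rangle>\<close> under \<open>(\<phi> \<otimes> \<psi>)(x, y) = (-1)\<^bsup>|\<psi>||x|\<^esup> \<phi>(x) \<psi>(y)\<close>, which is the source of the
  sign for two odd coordinates.
\<close>

definition sigma ::
  "'w::real_vector grading \<Rightarrow> ('w \<Rightarrow> 'w) \<Rightarrow> ('w \<Rightarrow> 'w \<Rightarrow> real) \<Rightarrow> 'w coords \<Rightarrow> ffun" where
  "sigma W d \<omega> c =
     (\<Sum>a\<in>lcoord c. \<Sum>b\<in>lcoord c.
        fscale (fls_const (psign (podd W c a \<and> podd W c b) * \<omega> (vecs c ! a) (d (vecs c ! b))))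
          (word_fun (podd W c) [a, b]))"

definition sigma_normal_form :: "'w grading \<Rightarrow> 'w coords \<Rightarrow> ffun" where
  "sigma_normal_form W c =
     (\<Sum>t<length (xvecs c). fscale (fls_const (eps c t))
         (word_fun (podd W c) [xcoord c t, xcoord c t])) -
     (\<Sum>t<length (zvecs c) div 2.
         word_fun (podd W c) [zcoord c (2 * t), zcoord c (2 * t + 1)])"

definition adapted_coords ::
  "'w::real_vector grading \<Rightarrow> ('w \<Rightarrow> 'w) \<Rightarrow> ('w \<Rightarrow> 'w \<Rightarrow> real) \<Rightarrow>
   ('w set \<Rightarrow> 'w) \<Rightarrow> ('w \<Rightarrow> 'w) \<Rightarrow> 'w coords \<Rightarrow> bool" where
  "adapted_coords W d \<omega> i s c \<longleftrightarrow>
     basis_list (hvecs c) (i ` homology d) \<and>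
     basis_list (xvecs c @ zvecs c) (range s) \<and>
     basis_list (dvecs c) (range d) \<and>
     set (hvecs c) \<union> set (dvecs c) \<subseteq> W False \<union> W True \<and>
     set (xvecs c) \<subseteq> W False \<and> set (zvecs c) \<subseteq> W True \<and>
     even (length (zvecs c)) \<and>
     (\<forall>t<length (xvecs c). eps c t = 1 \<or> eps c t = -1) \<and>
     sigma W d \<omega> c = sigma_normal_form W c"


section \<open>The normalized formal Gaussian integral\<close>

text \<open>\<open>x_moment e r\<close> is the integral of \<open>x\<^bsup>r\<^esup> exp (- e x\<^sup>2 / 2\<hbar>)\<close>, and \<open>z_moment a b\<close> the integral of
  \<open>\<xi>\<^bsup>a\<^esup> \<eta>\<^bsup>b\<^esup> exp (\<xi> \<eta> / 2\<hbar>)\<close>.\<close>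

fun x_moment :: "real \<Rightarrow> nat \<Rightarrow> real fls" where
  "x_moment e 0 = 1"
| "x_moment e (Suc 0) = 0"
| "x_moment e (Suc (Suc r)) = fls_const (e * real (r + 1)) * fls_X * x_moment e r"

definition z_moment :: "nat \<Rightarrow> nat \<Rightarrow> real fls" where
  "z_moment a b = (if a = 0 \<and> b = 0 then 1 else if a = 1 \<and> b = 1 then fls_X else 0)"

definition moment :: "'w coords \<Rightarrow> nat multiset \<Rightarrow> real fls" where
  "moment c b =
     (\<Prod>t<length (xvecs c). x_moment (eps c t) (count b (xcoord c t))) *
     (\<Prod>t<length (zvecs c) div 2.
        z_moment (count b (zcoord c (2 * t))) (count b (zcoord c (2 * t + 1))))"

text \<open>
  The integral of \<open>E exp (- \<sigma> / 2\<hbar>)\<close>, term by term.  Summands containing a coordinate of the image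
  of \<open>d\<close> are dropped (restriction), and a remaining normally ordered monomial \<open>a + b\<close> is the product
  of a monomial \<open>a\<close> on the homology and a monomial \<open>b\<close> on the image of \<open>s\<close>, in this order.
\<close>

definition integral_term :: "'w coords \<Rightarrow> ffun \<Rightarrow> nat multiset \<Rightarrow> ffun" where
  "integral_term c E b =
     (\<lambda>a. if set_mset a \<subseteq> hcoord c then E (a + b) * moment c b else 0)"

definition gauss_integral :: "'w grading \<Rightarrow> 'w coords \<Rightarrow> ffun \<Rightarrow> ffun" where
  "gauss_integral W c E = formal_sum (integral_term c E) (monomials (podd W c) (lcoord c))"

text \<open>The inverse form of \<open>\<sigma>\<close> on coordinates, normalized by Wick's formula: the integral of
  the product of the coordinates \<open>a\<close> and \<open>b\<close> is \<open>\<hbar> \<sigma>\<^bsup>-1\<^esup>(a, b)\<close> (see \<open>sigma_inv_wick\<close> below).\<close>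

definition sigma_inv :: "'w grading \<Rightarrow> 'w coords \<Rightarrow> nat \<Rightarrow> nat \<Rightarrow> real" where
  "sigma_inv W c a b = fls_nth (gauss_integral W c (word_fun (podd W c) [a, b]) {#}) 1"


definition hbar_homogeneous :: "nat \<Rightarrow> real fls \<Rightarrow> bool" where
  "hbar_homogeneous n F \<longleftrightarrow> (\<exists>r k. F = fls_const r * fls_X ^ k \<and> (r = 0 \<or> 2 * k = n))"

lemma hbar_homogeneous_one: "hbar_homogeneous 0 1"
  unfolding hbar_homogeneous_def by (rule exI[of _ 1], rule exI[of _ 0]) simp

lemma hbar_homogeneous_mult:
  assumes "hbar_homogeneous m F" "hbar_homogeneous n G"
  shows "hbar_homogeneous (m + n) (F * G)"
proof -
  obtain r k where F: "F = fls_const r * fls_X ^ k" "r = 0 \<or> 2 * k = m"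
    using assms(1) unfolding hbar_homogeneous_def by blast
  obtain q l where G: "G = fls_const q * fls_X ^ l" "q = 0 \<or> 2 * l = n"
    using assms(2) unfolding hbar_homogeneous_def by blast
  have "F * G = fls_const (r * q) * fls_X ^ (k + l)"
    by (simp add: F(1) G(1) power_add mult_ac flip: fls_const_mult_const)
  moreover have "r * q = 0 \<or> 2 * (k + l) = m + n"
    using F(2) G(2) by auto
  ultimately show ?thesis
    unfolding hbar_homogeneous_def by blast
qed

lemma hbar_homogeneous_prod:
  assumes "finite A" "\<And>x. x \<in> A \<Longrightarrow> hbar_homogeneous (n x) (F x)"
  shows "hbar_homogeneous (\<Sum>x\<in>A. n x) (\<Prod>x\<in>A. F x)"
  using assms
  by (induction A rule: finite_induct) (auto simp: hbar_homogeneous_one hbar_homogeneous_mult)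

lemma hbar_homogeneous_x_moment: "hbar_homogeneous r (x_moment e r)"
proof (induction e r rule: x_moment.induct)
  case (1 e)
  then show ?case by (simp add: hbar_homogeneous_one)
next
  case (2 e)
  then show ?case
    unfolding hbar_homogeneous_def by (intro exI[of _ 0]) simp
next
  case (3 e r)
  have "hbar_homogeneous 2 (fls_const (e * real (r + 1)) * fls_X)"
    unfolding hbar_homogeneous_def by (rule exI[of _ "e * real (r + 1)"], rule exI[of _ 1]) simp
  from hbar_homogeneous_mult[OF this 3] show ?case by simp
qed

lemma hbar_homogeneous_z_moment: "hbar_homogeneous (a + b) (z_moment a b)"
proof -
  have "hbar_homogeneous 2 fls_X"
    unfolding hbar_homogeneous_def by (rule exI[of _ 1], rule exI[of _ 1]) simp
  moreover have "hbar_homogeneous (a + b) 0"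
    unfolding hbar_homogeneous_def by (rule exI[of _ 0]) simp
  ultimately show ?thesis
    by (auto simp: z_moment_def hbar_homogeneous_one numeral_2_eq_2)
qed

lemma hbar_homogeneous_moment:
  assumes "set_mset b \<subseteq> lcoord c" "even (length (zvecs c))"
  shows "hbar_homogeneous (size b) (moment c b)"
proof -
  let ?X = "{..<length (xvecs c)}" and ?Z = "{..<length (zvecs c)}"
  have fin: "finite (lcoord c)" by (simp add: lcoord_def)
  have "size b = (\<Sum>j\<in>set_mset b. count b j)"
    by (simp add: size_multiset_overloaded_eq)
  also have "\<dots> = (\<Sum>j\<in>lcoord c. count b j)"
    by (rule sum.mono_neutral_left[OF fin assms(1)]) (auto simp: not_in_iff)
  also have "\<dots> = (\<Sum>j\<in>xcoord c ` ?X. count b j) + (\<Sum>j\<in>zcoord c ` ?Z. count b j)"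
    unfolding lcoord_def by (rule sum.union_disjoint) (auto simp: xcoord_def zcoord_def)
  also have "(\<Sum>j\<in>xcoord c ` ?X. count b j) = (\<Sum>t\<in>?X. count b (xcoord c t))"
    by (subst sum.reindex) (auto simp: inj_on_def xcoord_def)
  also have "(\<Sum>j\<in>zcoord c ` ?Z. count b j) = (\<Sum>t\<in>?Z. count b (zcoord c t))"
    by (subst sum.reindex) (auto simp: inj_on_def zcoord_def)
  also have "\<dots> = (\<Sum>t<length (zvecs c) div 2.
                 count b (zcoord c (2 * t)) + count b (zcoord c (2 * t + 1)))"
  proof -
    have "(\<Sum>t<2 * n. g t) = (\<Sum>t<n. g (2 * t) + g (2 * t + 1))" for g :: "nat \<Rightarrow> nat" and n
      by (induction n) (auto simp: algebra_simps)
    from this[of "\<lambda>t. count b (zcoord c t)" "length (zvecs c) div 2"] show ?thesis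
      using assms(2) by simp
  qed
  finally show ?thesis
    unfolding moment_def
    by (simp only:) (intro hbar_homogeneous_mult hbar_homogeneous_prod
        hbar_homogeneous_x_moment hbar_homogeneous_z_moment finite_lessThan)
qed

lemma formal_sum_single:
  assumes "\<And>j. j \<in> J \<Longrightarrow> j \<noteq> j0 \<Longrightarrow> g j m = 0"
  shows "formal_sum g J m = (if j0 \<in> J then g j0 m else 0)"
proof -
  have "(\<Sum>j\<in>{j\<in>J. fls_nth (g j m) K \<noteq> 0}. fls_nth (g j m) K) =
        fls_nth (if j0 \<in> J then g j0 m else 0) K" for K
  proof (cases "j0 \<in> J \<and> fls_nth (g j0 m) K \<noteq> 0")
    case True
    then have "{j\<in>J. fls_nth (g j m) K \<noteq> 0} = {j0}"
      using assms by (auto, metis fls_zero_nth)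
    then show ?thesis using True by simp
  next
    case False
    have "fls_nth (g j m) K = 0" if "j \<in> J" for j
      using assms[OF that] False that by (cases "j = j0") auto
    then have "{j\<in>J. fls_nth (g j m) K \<noteq> 0} = {}"
      by blast
    then show ?thesis using False by auto
  qed
  then show ?thesis
    unfolding formal_sum_def by (simp add: fls_nth_inverse)
qed

lemma sigma_inv_wick:
  assumes a: "a \<in> lcoord c" and b: "b \<in> lcoord c" and ev: "even (length (zvecs c))"
  shows "gauss_integral W c (word_fun (podd W c) [a, b]) =
           fscale (fls_X * fls_const (sigma_inv W c a b)) fone"
proof
  fix m
  define P where "P = podd W c"
  define I where "I = gauss_integral W c (word_fun P [a, b])"
  define j0 where "j0 = mset [a, b]"
  have disj: "hcoord c \<inter> lcoord c = {}"
    by (auto simp: hcoord_def lcoord_def xcoord_def zcoord_def)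
  have j0: "set_mset j0 \<subseteq> lcoord c" "size j0 = 2"
    using a b by (auto simp: j0_def)
  have zero: "integral_term c (word_fun P [a, b]) j m = 0"
    if "m \<noteq> {#} \<or> j \<noteq> j0" for m j
  proof (rule ccontr)
    assume *: "integral_term c (word_fun P [a, b]) j m \<noteq> 0"
    then have m: "set_mset m \<subseteq> hcoord c" and eq: "m + j = j0"
      by (auto simp: integral_term_def word_fun_def j0_def split: if_splits)
    have "set_mset m \<subseteq> set_mset j0" unfolding eq[symmetric] by simp
    with m disj j0 have "set_mset m = {}" by blast
    then show False using that eq by simp
  qed
  have I: "I m = (if j0 \<in> monomials P (lcoord c)
                  then integral_term c (word_fun P [a, b]) j0 m else 0)" for m
    unfolding I_def gauss_integral_def P_def[symmetric]
    by (rule formal_sum_single) (use zero in blast)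
  have nz: "I m = 0" if "m \<noteq> {#}" for m
    using zero[of m j0] that by (simp add: I)
  obtain r k where rk: "moment c j0 = fls_const r * fls_X ^ k" "r = 0 \<or> k = 1"
    using hbar_homogeneous_moment[OF j0(1) ev] j0(2) unfolding hbar_homogeneous_def by auto
  have "moment c j0 = fls_const r * fls_X"
    using rk by auto
  then have "I {#} = fls_const (if j0 \<in> monomials P (lcoord c) then ksign P [a, b] * r else 0)
                     * fls_X"
    unfolding I integral_term_def word_fun_def j0_def[symmetric]
    by (simp add: mult.assoc flip: fls_const_mult_const)
  then obtain q where q: "I {#} = fls_const q * fls_X" by blast
  have "sigma_inv W c a b = q"
    unfolding sigma_inv_def P_def[symmetric] I_def[symmetric] q
    by (simp add: fls_X_times_conv_shift)
  with q nz[of m] show "gauss_integral W c (word_fun (podd W c) [a, b]) m =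
           fscale (fls_X * fls_const (sigma_inv W c a b)) fone m"
    unfolding I_def P_def[symmetric] fscale_def by (auto simp: P_def[symmetric] mult.commute)
qed


section \<open>Stable graphs\<close>

text \<open>Every graph is isomorphic to one whose vertices and half-edges are natural numbers.\<close>

record sgraph =
  halves :: "nat set"
  verts :: "nat set"
  att :: "nat \<Rightarrow> nat"
  flip :: "nat \<Rightarrow> nat"
  genus :: "nat \<Rightarrow> nat"

definition stable_graph :: "sgraph \<Rightarrow> bool" where
  "stable_graph G \<longleftrightarrow>
     finite (halves G) \<and> finite (verts G) \<and> att G ` halves G \<subseteq> verts G \<and>
     flip G ` halves G \<subseteq> halves G \<and> (\<forall>h\<in>halves G. flip G (flip G h) = h) \<and>
     (\<forall>v\<in>verts G. 2 * genus G v + card {h\<in>halves G. att G h = v} \<ge> 3)"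

definition graph_iso :: "sgraph \<Rightarrow> sgraph \<Rightarrow> (nat \<Rightarrow> nat) \<Rightarrow> (nat \<Rightarrow> nat) \<Rightarrow> bool" where
  "graph_iso G G' \<phi> \<psi> \<longleftrightarrow>
     bij_betw \<phi> (verts G) (verts G') \<and> bij_betw \<psi> (halves G) (halves G') \<and>
     (\<forall>h\<in>halves G. att G' (\<psi> h) = \<phi> (att G h) \<and> flip G' (\<psi> h) = \<psi> (flip G h)) \<and>
     (\<forall>v\<in>verts G. genus G' (\<phi> v) = genus G v)"

definition iso_classes :: "sgraph set set" where
  "iso_classes = {G. stable_graph G} //
     {(G, G'). stable_graph G \<and> stable_graph G' \<and> (\<exists>\<phi> \<psi>. graph_iso G G' \<phi> \<psi>)}"

text \<open>The condition \<open>permutes\<close> fixes the maps outside the graph, so that each automorphism is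
  counted once.\<close>

definition Aut :: "sgraph \<Rightarrow> ((nat \<Rightarrow> nat) \<times> (nat \<Rightarrow> nat)) set" where
  "Aut G = {(\<phi>, \<psi>). \<phi> permutes verts G \<and> \<psi> permutes halves G \<and> graph_iso G G \<phi> \<psi>}"

text \<open>
  The cellular chain complex of the associated one-dimensional complex.  A 1-chain is a function on
  half-edges that changes sign when an edge is reversed (hence vanishes on legs, which do not
  contribute to the homology).
\<close>

abbreviation chain_dim :: "(nat \<Rightarrow> real) set \<Rightarrow> nat" where
  "chain_dim \<equiv> vector_space.dim (\<lambda>(a::real) (c::nat \<Rightarrow> real) x. a * c x)"

definition chains0 :: "sgraph \<Rightarrow> (nat \<Rightarrow> real) set" where
  "chains0 G = {c. \<forall>v. v \<notin> verts G \<longrightarrow> c v = 0}"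

definition chains1 :: "sgraph \<Rightarrow> (nat \<Rightarrow> real) set" where
  "chains1 G = {c. (\<forall>h. h \<notin> halves G \<longrightarrow> c h = 0) \<and> (\<forall>h\<in>halves G. c (flip G h) = - c h)}"

definition bdry :: "sgraph \<Rightarrow> (nat \<Rightarrow> real) \<Rightarrow> nat \<Rightarrow> real" where
  "bdry G c v = (\<Sum>h\<in>{h\<in>halves G. att G h = v}. c h)"

definition betti0 :: "sgraph \<Rightarrow> int" where
  "betti0 G = int (chain_dim (chains0 G)) - int (chain_dim (bdry G ` chains1 G))"

definition betti1 :: "sgraph \<Rightarrow> int" where
  "betti1 G = int (chain_dim {c\<in>chains1 G. bdry G c = (\<lambda>v. 0)})"

definition total_genus :: "sgraph \<Rightarrow> int" where
  "total_genus G = betti1 G + (\<Sum>v\<in>verts G. int (genus G v))"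

definition euler_char :: "sgraph \<Rightarrow> int" where
  "euler_char G = betti0 G - total_genus G"

definition components :: "sgraph \<Rightarrow> nat set set" where
  "components G = (\<lambda>v. {u. (v, u) \<in> {(att G h, att G (flip G h)) | h. h \<in> halves G}\<^sup>*}) ` verts G"

definition subgraph :: "sgraph \<Rightarrow> nat set \<Rightarrow> sgraph" where
  "subgraph G C = G\<lparr>verts := C, halves := {h\<in>halves G. att G h \<in> C}\<rparr>"


section \<open>Feynman amplitudes\<close>

text \<open>
  For words \<open>u\<close> of length \<open>j\<close> in the coordinates on the image of \<open>s\<close> and \<open>w\<close> of length \<open>k\<close> in those
  on the homology, \<open>vertex_tensor P f g u w\<close> is the coefficient of \<open>u \<otimes> w\<close> in the symmetric tensor
  of \<open>f\<^bsub>g,j,k\<^esub>\<close>.  Averaging the normal monomial over the \<open>j! k!\<close> permutations of its two kinds of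
  factors produces each rearrangement with coefficient its Koszul sign times the product of the
  factorials of the multiplicities divided by \<open>j! k!\<close>; this denominator cancels against the factor
  in the definition of \<open>f\<^bsub>g,j,k\<^esub>\<close>.
\<close>

definition vertex_tensor :: "(nat \<Rightarrow> bool) \<Rightarrow> ffun \<Rightarrow> nat \<Rightarrow> nat list \<Rightarrow> nat list \<Rightarrow> real" where
  "vertex_tensor P f g u w =
     ksign P (u @ w) * (\<Prod>x\<in>set (u @ w). fact (count (mset (u @ w)) x)) *
     fls_nth (f (mset (u @ w))) (int g)"

definition leg_list :: "sgraph \<Rightarrow> nat list" where
  "leg_list G = filter (\<lambda>h. flip G h = h) (sorted_list_of_set (halves G))"

text \<open>One half-edge of each edge.\<close>

definition edge_list :: "sgraph \<Rightarrow> nat list" where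
  "edge_list G = filter (\<lambda>h. h < flip G h) (sorted_list_of_set (halves G))"

definition inner_at :: "sgraph \<Rightarrow> nat \<Rightarrow> nat list" where
  "inner_at G v = filter (\<lambda>h. att G h = v \<and> flip G h \<noteq> h) (sorted_list_of_set (halves G))"

definition legs_at :: "sgraph \<Rightarrow> nat \<Rightarrow> nat list" where
  "legs_at G v = filter (\<lambda>h. att G h = v \<and> flip G h = h) (sorted_list_of_set (halves G))"

definition before :: "'a list \<Rightarrow> 'a \<Rightarrow> 'a \<Rightarrow> bool" where
  "before xs a b \<longleftrightarrow> (\<exists>k l. k < l \<and> l < length xs \<and> xs ! k = a \<and> xs ! l = b)"

text \<open>The Koszul sign for rearranging factors from the order \<open>xs\<close> to the order \<open>ys\<close>; \<open>Q\<close> singles out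
  the odd factors.\<close>

definition reorder_sign :: "('a \<Rightarrow> bool) \<Rightarrow> 'a list \<Rightarrow> 'a list \<Rightarrow> real" where
  "reorder_sign Q xs ys = (-1) ^ card {(a, b). Q a \<and> Q b \<and> before xs a b \<and> before ys b a}"

definition colourings :: "'w coords \<Rightarrow> sgraph \<Rightarrow> (nat \<Rightarrow> nat) set" where
  "colourings c G = PiE (halves G) (\<lambda>h. if flip G h = h then hcoord c else lcoord c)"

text \<open>
  Contraction of the tensors placed at the vertices, which are multiplied in the order \<open>vs\<close>.  The
  factors are rearranged to the pairs belonging to the edges followed by the legs, the pairs are
  contracted with \<open>\<sigma>\<^bsup>-1\<^esup>\<close>, and the legs are multiplied in the symmetric algebra.  The result does not
  depend on the order of the edges, on their directions or on the order of the legs.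
\<close>

definition contraction :: "'w grading \<Rightarrow> 'w coords \<Rightarrow> ffun \<Rightarrow> sgraph \<Rightarrow> nat list \<Rightarrow> ffun" where
  "contraction W c f G vs =
     (\<Sum>k\<in>colourings c G.
        fscale (fls_const (
            reorder_sign (\<lambda>h. podd W c (k h))
              (concat (map (\<lambda>v. inner_at G v @ legs_at G v) vs))
              (concat (map (\<lambda>h. [h, flip G h]) (edge_list G)) @ leg_list G) *
            (\<Prod>v\<in>verts G. vertex_tensor (podd W c) f (genus G v)
                             (map k (inner_at G v)) (map k (legs_at G v))) *
            (\<Prod>h\<in>set (edge_list G). sigma_inv W c (k h) (k (flip G h)))))
          (word_fun (podd W c) (map k (leg_list G))))"

text \<open>
  If \<open>f\<close> is even, the contraction does not depend on the order of the vertices.  In order to cover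
  functions with an odd part, where a graph alone does not determine an order of its
  vertices, one averages over all orders (the product of a family is symmetrized); the same applies
  to the product over the connected components.
\<close>

definition average_orders :: "'a set \<Rightarrow> ('a list \<Rightarrow> ffun) \<Rightarrow> ffun" where
  "average_orders A F =
     fscale (fls_const (1 / fact (card A))) (\<Sum>xs\<in>permutations_of_set A. F xs)"

definition connected_amplitude :: "'w grading \<Rightarrow> 'w coords \<Rightarrow> ffun \<Rightarrow> sgraph \<Rightarrow> ffun" where
  "connected_amplitude W c f G = average_orders (verts G) (contraction W c f G)"

definition amplitude :: "'w grading \<Rightarrow> 'w coords \<Rightarrow> ffun \<Rightarrow> sgraph \<Rightarrow> ffun" where
  "amplitude W c f G = average_orders (components G)
     (\<lambda>Cs. fprod_list (podd W c) (map (\<lambda>C. connected_amplitude W c f (subgraph G C)) Cs))"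

lemma amplitude_empty_graph: "verts G = {} \<Longrightarrow> amplitude W c f G = fone"
  by (simp add: amplitude_def components_def average_orders_def fprod_list_def fscale_def)

definition graph_term :: "'w grading \<Rightarrow> 'w coords \<Rightarrow> ffun \<Rightarrow> sgraph \<Rightarrow> ffun" where
  "graph_term W c f G =
     fscale (fls_X_intpow (- euler_char G) * fls_const (1 / real (card (Aut G))))
       (amplitude W c f G)"

text \<open>The term of an isomorphism class, computed from an arbitrary representative.\<close>

definition class_term :: "'w grading \<Rightarrow> 'w coords \<Rightarrow> ffun \<Rightarrow> sgraph set \<Rightarrow> ffun" where
  "class_term W c f \<G> = graph_term W c f (SOME G. G \<in> \<G>)"

end

theory Submission
  imports Defs
begin

text \<open>
  Fix the monomial on the homology and the power of \<open>\<hbar>\<close>. The part of degree \<open>N\<close> of \<open>f\<^sup>n\<close>,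
  multiplied by \<open>N!\<close>, is a sum over maps from \<open>N\<close> half-edges to \<open>n\<close> vertices and colourings of the
  half-edges by coordinates. Wick's theorem integrates each of these words as a sum over pairings of
  the half-edges coloured in \<open>\<L>\<^sub>s\<close>; together with the powers of \<open>\<hbar>\<close> occurring in \<open>f\<close> at the vertices
  this is a sum over stable graphs with labelled vertices and half-edges, divided by \<open>n! N!\<close>. By the
  orbit-stabilizer theorem an isomorphism class then receives the factor \<open>1 / |Aut(G)|\<close>. The power of
  \<open>\<hbar>\<close> is the number of edges plus the genera minus \<open>n\<close>, which is \<open>-\<chi>(G)\<close>, and for a given
  coefficient stability leaves finitely many graphs.
\<close>

section \<open>Koszul signs\<close>

text \<open>\<open>f\<close> need not be even, so a graph alone fixes no order of its vertices and
  the amplitude averages over orders twice, within each component and over the components. The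
  labelled sum instead produces one average over all orders of all vertices: the power of
  \<open>f\<close> comes with the order \<open>0, ..., n-1\<close>, and relabelling the vertices
  runs through the others. The two averages agree (\<open>amplitude_eq_average\<close>) because a
  signed sum over orders vanishes as soon as two of the permuted factors are odd, and
  \<open>sigma_inv\<close> pairs only coordinates of equal parity, so that odd vertices and odd legs
  of a component match modulo 2. Signs are read off words of half-edges: these are distinct numbers,
  so \<open>ksign\<close> of such a word is never 0, while colours may repeat. The numerical order
  serves as common reference, and a rearrangement sign splits into a factor for the source word and
  one for the target word. Labelled data with an unstable vertex may be included in the sum, because
  weight greater than 2 makes the factor of \<open>f\<close> at that vertex vanish.\<close>

lemma ksign_Nil [simp]: "ksign P [] = 1"
  by (simp add: ksign_def)

text \<open>Inversions of \<open>a # w\<close> either start at position 0, and count the smaller odd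
  letters behind \<open>a\<close>, or are shifted inversions of \<open>w\<close>. Most sign
  identities below reduce to this recursion.\<close>

lemma ksign_Cons:
  "ksign P (a # w) =
     (if P a then if a \<in> set w then 0 else (-1) ^ length (filter (\<lambda>b. P b \<and> b < a) w) else 1) *
     ksign P w"
proof -
  let ?I = "\<lambda>w. {(i, j). i < j \<and> j < length w \<and> w ! j < w ! i \<and> P (w ! i) \<and> P (w ! j)}"
  let ?A = "{j. j < length w \<and> w ! j < a \<and> P a \<and> P (w ! j)}"
  have "(i, j) \<in> ?I (a # w) \<longleftrightarrow>
        (i, j) \<in> (\<lambda>j. (0, Suc j)) ` ?A \<union> (\<lambda>(i, j). (Suc i, Suc j)) ` ?I w" for i j
    by (cases i; cases j) auto
  then have I: "?I (a # w) = (\<lambda>j. (0, Suc j)) ` ?A \<union> (\<lambda>(i, j). (Suc i, Suc j)) ` ?I w"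
    by (intro set_eqI) (simp only: split_paired_all)
  have fin: "finite (?I w)"
    by (rule finite_subset[of _ "{..<length w} \<times> {..<length w}"]) auto
  have "card (?I (a # w)) = card ?A + card (?I w)"
    unfolding I by (subst card_Un_disjoint)
      (auto simp: fin card_image inj_on_def)
  moreover have "card ?A = (if P a then length (filter (\<lambda>b. P b \<and> b < a) w) else 0)"
  proof -
    have "?A = (if P a then {j. j < length w \<and> P (w ! j) \<and> w ! j < a} else {})"
      by auto
    then show ?thesis by (simp add: length_filter_conv_card)
  qed
  ultimately show ?thesis
    unfolding ksign_def by (simp add: power_add)
qed

text \<open>Graded commutativity. It needs no distinctness: if an odd letter is repeated, both sides
  are 0.\<close>

lemma ksign_swap:
  "ksign P (xs @ a # b # ys) = (if P a \<and> P b then -1 else 1) * ksign P (xs @ b # a # ys)"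
proof (induction xs)
  case Nil
  show ?case by (auto simp: ksign_Cons)
next
  case (Cons x xs)
  then show ?case by (auto simp: ksign_Cons)
qed

lemma ksign_square:
  assumes "distinct (filter P w)"
  shows "ksign P w * ksign P w = 1"
  using assms by (simp add: ksign_def flip: power_add)

lemma ksign_distinct_square [simp]: "distinct w \<Longrightarrow> ksign P w * ksign P w = 1"
  by (simp add: ksign_square)

lemma ksign_square_mult [simp]: "distinct w \<Longrightarrow> ksign P w * (ksign P w * x) = x"
  by (simp flip: mult.assoc)

lemma ksign_nonzero_iff: "ksign P w \<noteq> 0 \<longleftrightarrow> distinct (filter P w)"
  by (simp add: ksign_def)

text \<open>Adjacent transpositions connect any two lists with the same multiset. The swap
  hypothesis is restricted to rearrangements of \<open>u\<close>, so that properties such as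
  distinctness are available when it is checked.\<close>

lemma swap_invariant:
  assumes swap: "\<And>xs a b ys. mset (xs @ a # b # ys) = mset u \<Longrightarrow>
      F (xs @ a # b # ys) = F (xs @ b # a # ys)"
    and "mset u = mset v"
  shows "F u = F v"
  using assms
proof (induction v arbitrary: u F)
  case (Cons a v)
  have "a \<in> set u"
    using Cons.prems(2) by (metis list.set_intros(1) set_mset_mset)
  then obtain p q where u: "u = p @ a # q"
    by (meson split_list)
  have "F (p @ a # q) = F (a # p @ q)"
    using Cons.prems(1) unfolding u
  proof (induction p arbitrary: q rule: rev_induct)
    case (snoc x p)
    have "F (p @ x # a # q) = F (p @ a # x # q)"
      by (rule snoc.prems) simp
    also have "\<dots> = F (a # p @ x # q)"
      by (rule snoc.IH, rule snoc.prems) simp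
    finally show ?case by simp
  qed simp
  also have "\<dots> = F (a # v)"
  proof (rule Cons.IH[where F = "\<lambda>w. F (a # w)"])
    show "mset (p @ q) = mset v"
      using Cons.prems(2) unfolding u by simp
    fix xs b c ys
    assume "mset (xs @ b # c # ys) = mset (p @ q)"
    then show "F (a # xs @ b # c # ys) = F (a # xs @ c # b # ys)"
      using Cons.prems(1)[of "a # xs"] unfolding u by simp
  qed
  finally show ?case by (simp add: u)
qed simp

text \<open>A swap of half-edges and the swap of their colours cost the same sign, so the product is
  invariant. This moves a sign between the word of distinct half-edges and the word of colours,
  where letters may repeat.\<close>

lemma ksign_map_perm:
  assumes "mset u = mset v"
  shows "ksign (\<lambda>h. P (k h)) (p @ u @ s) * ksign P (p' @ map k u @ s') =
         ksign (\<lambda>h. P (k h)) (p @ v @ s) * ksign P (p' @ map k v @ s')"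
proof (rule swap_invariant[OF _ assms])
  fix xs a b ys
  show "ksign (\<lambda>h. P (k h)) (p @ (xs @ a # b # ys) @ s) * ksign P (p' @ map k (xs @ a # b # ys) @ s') =
        ksign (\<lambda>h. P (k h)) (p @ (xs @ b # a # ys) @ s) * ksign P (p' @ map k (xs @ b # a # ys) @ s')"
    using ksign_swap[of "\<lambda>h. P (k h)" "p @ xs" a b "ys @ s"]
      ksign_swap[of P "p' @ map k xs" "k a" "k b" "map k ys @ s'"]
    by simp
qed

text \<open>Reordering inside a block changes the sign of the concatenation and the block's own sign
  alike. The prefix \<open>p\<close> is general so that finished blocks can be absorbed into
  it.\<close>

lemma ksign_blocks:
  assumes "\<And>v. v \<in> set vs \<Longrightarrow> mset (L v) = mset (L' v)"
  shows "ksign (\<lambda>h. P (k h)) (p @ concat (map L vs) @ s) * (\<Prod>v\<leftarrow>vs. ksign P (map k (L v))) =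
         ksign (\<lambda>h. P (k h)) (p @ concat (map L' vs) @ s) * (\<Prod>v\<leftarrow>vs. ksign P (map k (L' v)))"
  using assms
proof (induction vs arbitrary: p)
  case (Cons v vs)
  let ?Q = "\<lambda>h. P (k h)"
  have "ksign ?Q (p @ concat (map L (v # vs)) @ s) * (\<Prod>v\<leftarrow>v # vs. ksign P (map k (L v))) =
        ksign P (map k (L v)) *
        (ksign ?Q ((p @ L v) @ concat (map L vs) @ s) * (\<Prod>v\<leftarrow>vs. ksign P (map k (L v))))"
    by (simp add: mult_ac)
  also have "\<dots> = ksign P (map k (L v)) *
        (ksign ?Q ((p @ L v) @ concat (map L' vs) @ s) * (\<Prod>v\<leftarrow>vs. ksign P (map k (L' v))))"
    by (subst Cons.IH) (use Cons.prems in auto)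
  also have "\<dots> = (ksign ?Q (p @ L v @ concat (map L' vs) @ s) * ksign P ([] @ map k (L v) @ [])) *
        (\<Prod>v\<leftarrow>vs. ksign P (map k (L' v)))"
    by simp
  also have "\<dots> = (ksign ?Q (p @ L' v @ concat (map L' vs) @ s) * ksign P ([] @ map k (L' v) @ [])) *
        (\<Prod>v\<leftarrow>vs. ksign P (map k (L' v)))"
    by (subst ksign_map_perm[of "L v" "L' v"]) (use Cons.prems in auto)
  finally show ?case by (simp add: mult_ac)
qed simp

lemma ksign_concat_perm:
  assumes "\<And>v. v \<in> set vs \<Longrightarrow> mset (L v) = mset (L' v)"
  shows "ksign Q (concat (map L vs)) * (\<Prod>v\<leftarrow>vs. ksign Q (L v)) =
         ksign Q (concat (map L' vs)) * (\<Prod>v\<leftarrow>vs. ksign Q (L' v))"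
  using ksign_blocks[of vs L L' Q "\<lambda>h. h" "[]" "[]"] assms by simp

lemma ksign_move:
  "ksign Q (xs @ u @ a # ys) =
     (if Q a then (-1) ^ length (filter Q u) else 1) * ksign Q (xs @ a # u @ ys)"
proof (induction u arbitrary: ys rule: rev_induct)
  case (snoc x u)
  have "ksign Q (xs @ (u @ [x]) @ a # ys) =
        (if Q x \<and> Q a then -1 else 1) * ksign Q (xs @ u @ a # x # ys)"
    using ksign_swap[of Q "xs @ u" x a ys] by simp
  then show ?case using snoc[of "x # ys"] by simp
qed simp

lemma ksign_swap_blocks:
  "ksign Q (xs @ u @ v @ ys) =
     (-1) ^ (length (filter Q u) * length (filter Q v)) * ksign Q (xs @ v @ u @ ys)"
proof (induction v arbitrary: xs)
  case (Cons a v)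
  have "ksign Q (xs @ u @ (a # v) @ ys) =
        (if Q a then (-1) ^ length (filter Q u) else 1) * ksign Q ((xs @ [a]) @ u @ v @ ys)"
    using ksign_move[of Q xs u a "v @ ys"] by simp
  also have "\<dots> = (if Q a then (-1) ^ length (filter Q u) else 1) *
      (-1) ^ (length (filter Q u) * length (filter Q v)) * ksign Q ((xs @ [a]) @ v @ u @ ys)"
    by (subst Cons) simp
  finally show ?case by (simp add: power_add)
qed simp

text \<open>There are no mixed inversions, and a common letter of \<open>u\<close> and
  \<open>v\<close> is excluded as well, so no odd repetition arises.\<close>

lemma ksign_append_less:
  assumes "\<And>x y. x \<in> set u \<Longrightarrow> y \<in> set v \<Longrightarrow> x < y"
  shows "ksign Q (u @ v) = ksign Q u * ksign Q v"
  using assms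
proof (induction u)
  case (Cons a u)
  have "a < y" if "y \<in> set v" for y
    using Cons.prems[of a y] that by simp
  then have "filter (\<lambda>b. Q b \<and> b < a) v = []" "a \<notin> set v"
    by (fastforce simp: filter_empty_conv)+
  then show ?case using Cons by (simp add: ksign_Cons)
qed simp

lemma ksign_sorted: "sorted w \<Longrightarrow> distinct (filter Q w) \<Longrightarrow> ksign Q w = 1"
proof (induction w)
  case (Cons a w)
  have "filter (\<lambda>b. Q b \<and> b < a) w = []"
    using Cons.prems by (auto simp: filter_empty_conv)
  then show ?case using Cons by (auto simp: ksign_Cons split: if_splits)
qed simp

subsection \<open>Signs of rearrangements\<close>

lemma before_Nil [simp]: "\<not> before [] a b"
  by (simp add: before_def)

lemma before_Cons [simp]: "before (x # xs) a b \<longleftrightarrow> a = x \<and> b \<in> set xs \<or> before xs a b"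
proof
  assume "before (x # xs) a b"
  then obtain k l where *: "k < l" "l < length (x # xs)" "(x # xs) ! k = a" "(x # xs) ! l = b"
    unfolding before_def by blast
  then obtain l' where l': "l = Suc l'" by (cases l) auto
  show "a = x \<and> b \<in> set xs \<or> before xs a b"
    using * unfolding l' before_def by (cases k) auto
next
  assume "a = x \<and> b \<in> set xs \<or> before xs a b"
  then show "before (x # xs) a b"
  proof
    assume "a = x \<and> b \<in> set xs"
    then show ?thesis
      unfolding before_def in_set_conv_nth by (metis Suc_less_eq length_Cons nth_Cons_0 nth_Cons_Suc zero_less_Suc)
  next
    assume "before xs a b"
    then show ?thesis
      unfolding before_def by (metis Suc_less_eq length_Cons nth_Cons_Suc)
  qed
qed

lemma before_append [simp]:
  "before (xs @ ys) a b \<longleftrightarrow> before xs a b \<or> before ys a b \<or> a \<in> set xs \<and> b \<in> set ys"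
  by (induction xs) auto

lemma before_in_set: "before xs a b \<Longrightarrow> a \<in> set xs \<and> b \<in> set xs"
  by (induction xs) auto

lemma before_total: "a \<in> set xs \<Longrightarrow> b \<in> set xs \<Longrightarrow> a \<noteq> b \<Longrightarrow> before xs a b \<or> before xs b a"
  by (induction xs) auto

lemma before_asym: "distinct xs \<Longrightarrow> before xs a b \<Longrightarrow> \<not> before xs b a"
  by (induction xs) (auto dest: before_in_set)

lemma finite_reorder_set: "finite {(a, b). Q a \<and> Q b \<and> before xs a b \<and> before ys b a}"
  by (rule finite_subset[of _ "set xs \<times> set xs"]) (auto dest: before_in_set)

text \<open>Only the pair of \<open>a\<close> and \<open>b\<close> changes its order in the source,
  and exactly one of the two source words has it as an inversion relative to
  \<open>zs\<close>.\<close>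

lemma reorder_sign_swap:
  assumes d: "distinct (xs @ a # b # ys)" "distinct zs" and eq: "mset (xs @ a # b # ys) = mset zs"
  shows "reorder_sign Q (xs @ a # b # ys) zs =
           (if Q a \<and> Q b then -1 else 1) * reorder_sign Q (xs @ b # a # ys) zs"
proof -
  let ?S = "\<lambda>w. {(x, y). Q x \<and> Q y \<and> before w x y \<and> before zs y x}"
  let ?u = "xs @ a # b # ys" and ?v = "xs @ b # a # ys"
  have ab: "a \<in> set zs" "b \<in> set zs" "a \<noteq> b"
    using d(1) mset_eq_setD[OF eq] by auto
  have nb: "\<not> before xs a b" "\<not> before xs b a" "\<not> before ys a b" "\<not> before ys b a"
    "a \<notin> set xs" "b \<notin> set xs" "a \<notin> set ys" "b \<notin> set ys"
    using d(1) by (auto dest: before_in_set)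
  show ?thesis
  proof (cases "Q a \<and> Q b")
    case False
    then have "?S ?u = ?S ?v" by auto
    then show ?thesis using False unfolding reorder_sign_def by simp
  next
    case True
    show ?thesis
    proof (cases "before zs b a")
      case ba: True
      then have "?S ?u = insert (a, b) (?S ?v)" "(a, b) \<notin> ?S ?v"
        using True nb ab before_asym[OF d(2)] by auto
      then show ?thesis
        using True finite_reorder_set[of Q ?v zs] unfolding reorder_sign_def by simp
    next
      case False
      then have ab': "before zs a b" using before_total[of a zs b] ab by auto
      then have "?S ?v = insert (b, a) (?S ?u)" "(b, a) \<notin> ?S ?u"
        using True False nb ab before_asym[OF d(2)] by auto
      then show ?thesis
        using True finite_reorder_set[of Q ?u zs] unfolding reorder_sign_def by simp
    qed
  qed
qed

text \<open>Both sides change by the same sign under adjacent swaps of \<open>xs\<close> and agree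
  for \<open>xs = ys\<close>. The sign thus splits into a source factor and a target factor, each
  measured against the numerical order.\<close>

lemma reorder_sign_eq_ksign:
  assumes d: "distinct xs" "distinct ys" and eq: "set xs = set ys"
  shows "reorder_sign Q xs ys = ksign Q xs * ksign Q ys"
proof -
  have m: "mset xs = mset ys"
    using assms by (simp add: set_eq_iff_mset_eq_distinct)
  have "reorder_sign Q xs ys * ksign Q xs = reorder_sign Q ys ys * ksign Q ys"
  proof (rule swap_invariant[OF _ m])
    fix us a b vs
    assume *: "mset (us @ a # b # vs) = mset xs"
    have "distinct (us @ a # b # vs)"
      using d(1) * by (metis mset_eq_imp_distinct_iff)
    then show "reorder_sign Q (us @ a # b # vs) ys * ksign Q (us @ a # b # vs) =
        reorder_sign Q (us @ b # a # vs) ys * ksign Q (us @ b # a # vs)"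
      using reorder_sign_swap[of us a b vs ys Q] ksign_swap[of Q us a b vs] d(2) * m by simp
  qed
  moreover have "{(a, b). Q a \<and> Q b \<and> before ys a b \<and> before ys b a} = {}"
    using before_asym[OF d(2)] by auto
  then have "reorder_sign Q ys ys = 1"
    unfolding reorder_sign_def by (simp only: card.empty power_0)
  ultimately have "reorder_sign Q xs ys * (ksign Q xs * ksign Q xs) = ksign Q ys * ksign Q xs"
    by (simp flip: mult.assoc)
  then show ?thesis using d by (simp add: mult.commute)
qed

lemma reorder_sign_map:
  assumes "inj_on g (set xs \<union> set ys)"
  shows "reorder_sign Q (map g xs) (map g ys) = reorder_sign (\<lambda>h. Q (g h)) xs ys"
proof -
  have bm: "before (map g zs) a b \<longleftrightarrow> (\<exists>x y. a = g x \<and> b = g y \<and> before zs x y)" for zs a b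
    by (induction zs) auto
  have "{(a, b). Q a \<and> Q b \<and> before (map g xs) a b \<and> before (map g ys) b a} =
        (\<lambda>(a, b). (g a, g b)) ` {(a, b). Q (g a) \<and> Q (g b) \<and> before xs a b \<and> before ys b a}"
  proof (intro set_eqI iffI)
    fix z assume "z \<in> {(a, b). Q a \<and> Q b \<and> before (map g xs) a b \<and> before (map g ys) b a}"
    then obtain a b where z: "z = (a, b)" "Q a" "Q b" "before (map g xs) a b" "before (map g ys) b a"
      by blast
    obtain x y where x: "a = g x" "b = g y" "before xs x y" using z(4) bm by blast
    obtain x' y' where y: "a = g x'" "b = g y'" "before ys y' x'" using z(5) bm by blast
    note * = z x y
    then have "x = x'" "y = y'"
      using assms by (auto dest!: before_in_set simp: inj_on_def)
    with * show "z \<in> (\<lambda>(a, b). (g a, g b)) ` {(a, b). Q (g a) \<and> Q (g b) \<and> before xs a b \<and> before ys b a}"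
      by auto
  qed (auto simp: bm)
  moreover have "inj_on (\<lambda>(a, b). (g a, g b)) {(a, b). Q (g a) \<and> Q (g b) \<and> before xs a b \<and> before ys b a}"
    using assms by (intro inj_onI) (auto dest!: before_in_set simp: inj_on_def)
  ultimately show ?thesis
    unfolding reorder_sign_def by (simp add: card_image)
qed

subsection \<open>Averages over all orders\<close>

text \<open>With two odd elements, exchanging them is a sign-reversing bijection of the set of
  orders, so the sum equals its own negative. With at most one, no swap costs a sign and
  \<open>F\<close> is constant.\<close>

lemma sum_permutations_of_set_sign:
  fixes F :: "'a list \<Rightarrow> 'b::{idom,ring_char_0}"
  assumes fin: "finite A" and xs0: "xs0 \<in> permutations_of_set A"
    and swap: "\<And>xs a b ys. xs @ a # b # ys \<in> permutations_of_set A \<Longrightarrow>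
      F (xs @ a # b # ys) = (if Q a \<and> Q b then -1 else 1) * F (xs @ b # a # ys)"
  shows "(\<Sum>xs\<in>permutations_of_set A. F xs) =
           (if card {a\<in>A. Q a} \<le> 1 then fact (card A) * F xs0 else 0)"
proof (cases "card {a\<in>A. Q a} \<le> 1")
  case True
  have one: "a = b" if "a \<in> A" "b \<in> A" "Q a" "Q b" for a b
    using True that fin card_le_Suc0_iff_eq[of "{a\<in>A. Q a}"] by simp
  have "F xs = F xs0" if "xs \<in> permutations_of_set A" for xs
  proof (rule swap_invariant)
    show m: "mset xs = mset xs0"
      using that xs0 by (metis permutations_of_setD set_eq_iff_mset_eq_distinct)
    fix us a b vs assume "mset (us @ a # b # vs) = mset xs"
    then have *: "us @ a # b # vs \<in> permutations_of_set A"
      using that by (metis mset_eq_imp_distinct_iff mset_eq_setD permutations_of_setD permutations_of_setI)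
    then have "\<not> (Q a \<and> Q b)"
      using one[of a b] * by (auto simp: permutations_of_set_def)
    then show "F (us @ a # b # vs) = F (us @ b # a # vs)"
      using swap[OF *] by (simp only: if_False mult_1)
  qed
  then show ?thesis using True fin by simp
next
  case False
  then obtain a b where ab: "a \<in> A" "b \<in> A" "a \<noteq> b" "Q a" "Q b"
    using fin card_le_Suc0_iff_eq[of "{a\<in>A. Q a}"] by auto
  let ?t = "map (transpose a b)"
  have move: "F (p @ u @ x # s) = (-1) ^ length (filter Q u) * F (p @ x # u @ s)"
    if "p @ u @ x # s \<in> permutations_of_set A" "Q x" for p u x s
    using that
  proof (induction u arbitrary: s rule: rev_induct)
    case (snoc y u)
    have mem: "p @ u @ x # y # s \<in> permutations_of_set A"
      using snoc.prems by (auto simp: permutations_of_set_def)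
    have "F (p @ (u @ [y]) @ x # s) = (if Q y then -1 else 1) * F ((p @ u) @ x # y # s)"
      using swap[of "p @ u" y x s] snoc.prems by simp
    then show ?case using snoc.IH[OF mem \<open>Q x\<close>] by simp
  qed simp
  \<comment> \<open>Each of the two exchanged letters crosses all of \<open>u\<close>, so those
    signs cancel; only the sign of swapping \<open>x\<close> past \<open>y\<close> remains.\<close>
  have neg: "F (p @ x # u @ y # s) = - F (p @ y # u @ x # s)"
    if mem: "p @ x # u @ y # s \<in> permutations_of_set A" and q: "Q x" "Q y" for p u x y s
  proof -
    have mem': "(p @ [x]) @ u @ y # s \<in> permutations_of_set A"
      "(p @ [y]) @ u @ x # s \<in> permutations_of_set A"
      using mem by (auto simp: permutations_of_set_def)
    have mem'': "p @ x # y # u @ s \<in> permutations_of_set A"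
      using mem by (auto simp: permutations_of_set_def)
    show ?thesis
      using move[OF mem'(1) q(2)] move[OF mem'(2) q(1)] swap[OF mem''] q by simp
  qed
  have "F (?t xs) = - F xs" if mem: "xs \<in> permutations_of_set A" for xs
  proof -
    have d: "distinct xs" and "a \<in> set xs" "b \<in> set xs"
      using mem ab by (auto simp: permutations_of_set_def)
    then obtain x y p u s where xs: "xs = p @ x # u @ y # s" and xy: "{x, y} = {a, b}" "x \<noteq> y"
    proof -
      obtain p r where pr: "xs = p @ a # r"
        using split_list[OF \<open>a \<in> set xs\<close>] by blast
      then consider "b \<in> set p" | "b \<in> set r"
        using \<open>b \<in> set xs\<close> ab(3) by auto
      then show thesis
      proof cases
        case 1
        then obtain p' u where "p = p' @ b # u" by (meson split_list)
        with pr ab(3) that[of p' b u a r] show thesis by auto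
      next
        case 2
        then obtain u s where "r = u @ b # s" by (meson split_list)
        with pr ab(3) that[of p a u b s] show thesis by auto
      qed
    qed
    have t: "transpose a b x = y" "transpose a b y = x" "Q x" "Q y"
      using xy ab by (auto simp: doubleton_eq_iff)
    have id: "map (transpose a b) zs = zs" if "a \<notin> set zs" "b \<notin> set zs" for zs
      using that by (intro map_idI) (auto simp: transpose_def)
    have "a \<notin> set p" "b \<notin> set p" "a \<notin> set u" "b \<notin> set u" "a \<notin> set s" "b \<notin> set s"
      using d xy unfolding xs by (auto simp: doubleton_eq_iff)
    then have "?t xs = p @ y # u @ x # s"
      unfolding xs by (simp add: t id)
    then show ?thesis
      using neg[of p x u y s] mem t unfolding xs by simp
  qed
  moreover have "bij_betw ?t (permutations_of_set A) (permutations_of_set A)"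
  proof (rule bij_betwI[where g = ?t])
    have "transpose a b ` A = A" using ab by (simp add: transpose_image_eq)
    then show "?t \<in> permutations_of_set A \<rightarrow> permutations_of_set A"
      by (auto simp: permutations_of_set_def distinct_map)
    then show "?t \<in> permutations_of_set A \<rightarrow> permutations_of_set A" .
  qed (simp_all add: o_def)
  then have "(\<Sum>xs\<in>permutations_of_set A. F (?t xs)) = (\<Sum>xs\<in>permutations_of_set A. F xs)"
    by (rule sum.reindex_bij_betw)
  ultimately have "(\<Sum>xs\<in>permutations_of_set A. F xs) = - (\<Sum>xs\<in>permutations_of_set A. F xs)"
    by (simp add: sum_negf)
  then show ?thesis using False by simp
qed

section \<open>Products of formal functions\<close>

lemma finite_submultisets: "finite {u. u \<subseteq># (m :: 'a multiset)}"
proof (rule finite_subset)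
  show "{u. u \<subseteq># m} \<subseteq> mset ` {xs. set xs \<subseteq> set_mset m \<and> length xs \<le> size m}"
  proof
    fix u assume "u \<in> {u. u \<subseteq># m}"
    then have "u \<subseteq># m" by simp
    moreover obtain xs where "u = mset xs" by (metis ex_mset)
    ultimately show "u \<in> mset ` {xs. set xs \<subseteq> set_mset m \<and> length xs \<le> size m}"
      using set_mset_mono size_mset_mono by fastforce
  qed
qed (auto intro: finite_lists_length_le)

lemma sum_ffun_apply: "(\<Sum>k\<in>A. F k) m = (\<Sum>k\<in>A. F k m)" for F :: "'k \<Rightarrow> ffun"
  by (induction A rule: infinite_finite_induct) auto

lemma fscale_fscale [simp]: "fscale c (fscale d f) = fscale (c * d) f"
  by (rule ext) (simp add: fscale_def mult.assoc)

lemma fscale_one [simp]: "fscale 1 f = f"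
  by (simp add: fscale_def)

lemma fscale_zero [simp]: "fscale 0 f = (\<lambda>m. 0)"
  by (simp add: fscale_def)

lemma fmult_sum:
  "fmult P (\<Sum>k\<in>A. F k) (\<Sum>l\<in>B. G l) = (\<Sum>k\<in>A. \<Sum>l\<in>B. fmult P (F k) (G l))"
proof
  fix m
  let ?s = "\<lambda>u. fls_const (ksign P (sorted_list_of_multiset u @ sorted_list_of_multiset (m - u)))"
  have "fmult P (\<Sum>k\<in>A. F k) (\<Sum>l\<in>B. G l) m =
        (\<Sum>u\<in>{u. u \<subseteq># m}. \<Sum>k\<in>A. \<Sum>l\<in>B. ?s u * F k u * G l (m - u))"
    unfolding fmult_def sum_ffun_apply
    by (intro sum.cong refl) (subst mult.assoc, subst sum_product, simp only: sum_distrib_left mult.assoc)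
  also have "\<dots> = (\<Sum>k\<in>A. \<Sum>u\<in>{u. u \<subseteq># m}. \<Sum>l\<in>B. ?s u * F k u * G l (m - u))"
    by (rule sum.swap)
  also have "\<dots> = (\<Sum>k\<in>A. \<Sum>l\<in>B. \<Sum>u\<in>{u. u \<subseteq># m}. ?s u * F k u * G l (m - u))"
    by (rule sum.cong[OF refl], rule sum.swap)
  finally show "fmult P (\<Sum>k\<in>A. F k) (\<Sum>l\<in>B. G l) m = (\<Sum>k\<in>A. \<Sum>l\<in>B. fmult P (F k) (G l)) m"
    by (simp add: fmult_def sum_ffun_apply)
qed

lemma fmult_fscale: "fmult P (fscale a f) (fscale b g) = fscale (a * b) (fmult P f g)"
  by (rule ext) (simp add: fmult_def fscale_def sum_distrib_left mult_ac)

lemma word_fun_Nil: "word_fun P [] = fone"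
  by (auto simp: word_fun_def fun_eq_iff)

lemma ksign_mset_eq:
  assumes "mset u = mset v" "mset w = mset x"
  shows "ksign P (u @ w) * (ksign P u * ksign P w) = ksign P (v @ x) * (ksign P v * ksign P x)"
proof -
  have "ksign P (u @ w) * (ksign P u * ksign P w) = (ksign P (u @ w) * ksign P u) * ksign P w"
    by simp
  also have "ksign P (u @ w) * ksign P u = ksign P (v @ w) * ksign P v"
    using ksign_map_perm[OF assms(1), of P "\<lambda>h. h" "[]" w "[]" "[]"] by simp
  also have "\<dots> * ksign P w = (ksign P (v @ w) * ksign P w) * ksign P v"
    by simp
  also have "ksign P (v @ w) * ksign P w = ksign P (v @ x) * ksign P x"
    using ksign_map_perm[OF assms(2), of P "\<lambda>h. h" v "[]" "[]" "[]"] by simp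
  finally show ?thesis by (simp add: mult_ac)
qed

lemma ksign_append_zero: "ksign P u = 0 \<or> ksign P w = 0 \<Longrightarrow> ksign P (u @ w) = 0"
  by (auto simp: ksign_def split: if_splits)

text \<open>The two factors are sorted with signs \<open>ksign P u\<close> and
  \<open>ksign P w\<close>, and \<open>fmult\<close> supplies the sign of merging the sorted words;
  together they give the sign of \<open>u @ w\<close>. A repeated odd letter in one factor makes
  both sides 0.\<close>

lemma fmult_word: "fmult P (word_fun P u) (word_fun P w) = word_fun P (u @ w)"
proof
  fix m
  let ?s = "\<lambda>m. sorted_list_of_multiset m"
  have iff: "m - mset u = mset w \<longleftrightarrow> m = mset u + mset w" if "mset u \<subseteq># m"
    using that by (metis add_diff_cancel_left' subset_mset.add_diff_inverse)
  have "fmult P (word_fun P u) (word_fun P w) m =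
        (\<Sum>x\<in>{x. x \<subseteq># m}. if x = mset u then
           (if mset u \<subseteq># m \<and> m = mset u + mset w
            then fls_const (ksign P (?s (mset u) @ ?s (mset w)) * ksign P u * ksign P w) else 0) else 0)"
    unfolding fmult_def
    by (intro sum.cong refl) (auto simp: word_fun_def mult.assoc iff
          simp flip: fls_const_mult_const)
  also have "\<dots> = (if m = mset u + mset w
            then fls_const (ksign P (?s (mset u) @ ?s (mset w)) * ksign P u * ksign P w) else 0)"
    using finite_submultisets[of m] by (auto simp: sum.delta)
  also have "ksign P (?s (mset u) @ ?s (mset w)) * ksign P u * ksign P w = ksign P (u @ w)"
  proof (cases "ksign P u = 0 \<or> ksign P w = 0")
    case True
    then show ?thesis using ksign_append_zero[of P u w] by auto
  next
    case False
    then have d: "distinct (filter P u)" "distinct (filter P w)"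
      by (auto simp: ksign_nonzero_iff)
    have ds: "ksign P (?s (mset v)) = 1" if "distinct (filter P v)" for v
    proof (rule ksign_sorted)
      have "mset (filter P (?s (mset v))) = mset (filter P v)" by simp
      then show "distinct (filter P (?s (mset v)))"
        using that mset_eq_imp_distinct_iff by blast
    qed simp
    have "ksign P (u @ w) = ksign P (u @ w) * (ksign P u * ksign P w) * (ksign P u * ksign P w)"
    proof -
      have "(ksign P u * ksign P w) * (ksign P u * ksign P w) = (ksign P u * ksign P u) * (ksign P w * ksign P w)"
        by (simp only: mult_ac)
      then show ?thesis
        by (simp only: ksign_square[OF d(1)] ksign_square[OF d(2)] mult.assoc[of "ksign P (u @ w)"] mult_1_right)
    qed
    also have "\<dots> = ksign P (?s (mset u) @ ?s (mset w)) * (ksign P u * ksign P w)"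
      using ksign_mset_eq[of u "?s (mset u)" w "?s (mset w)" P] ds d by simp
    finally show ?thesis by simp
  qed
  finally show "fmult P (word_fun P u) (word_fun P w) m = word_fun P (u @ w) m"
    by (simp add: word_fun_def)
qed

lemma sum_PiE_Un:
  assumes "S \<inter> T = {}"
  shows "(\<Sum>k\<in>PiE (S \<union> T) D. F (restrict k S) (restrict k T)) =
         (\<Sum>k\<in>PiE S D. \<Sum>l\<in>PiE T D. F k l)"
proof -
  have "(\<Sum>k\<in>PiE S D. \<Sum>l\<in>PiE T D. F k l) = (\<Sum>(k, l)\<in>PiE S D \<times> PiE T D. F k l)"
    by (simp add: sum.cartesian_product)
  also have "\<dots> = (\<Sum>k\<in>PiE (S \<union> T) D. F (restrict k S) (restrict k T))"
  proof (rule sum.reindex_bij_witness[where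
          i = "\<lambda>k. (restrict k S, restrict k T)" and
          j = "\<lambda>(k, l) h. if h \<in> S then k h else l h"])
    fix z assume "z \<in> PiE S D \<times> PiE T D"
    then obtain a b where z: "z = (a, b)" "a \<in> PiE S D" "b \<in> PiE T D" by auto
    have r: "restrict (\<lambda>h. if h \<in> S then a h else b h) S = a"
      "restrict (\<lambda>h. if h \<in> S then a h else b h) T = b"
      using assms z by (auto simp: PiE_iff extensional_def fun_eq_iff restrict_def)
    show "(restrict ((\<lambda>(k, l) h. if h \<in> S then k h else l h) z) S,
           restrict ((\<lambda>(k, l) h. if h \<in> S then k h else l h) z) T) = z"
      "F (restrict ((\<lambda>(k, l) h. if h \<in> S then k h else l h) z) S)
         (restrict ((\<lambda>(k, l) h. if h \<in> S then k h else l h) z) T) = (case z of (k, l) \<Rightarrow> F k l)"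
      unfolding z(1) prod.case r by simp_all
    show "(\<lambda>(k, l) h. if h \<in> S then k h else l h) z \<in> PiE (S \<union> T) D"
      using z by (auto simp: PiE_iff extensional_def)
  qed (auto simp: PiE_iff extensional_def fun_eq_iff)
  finally show ?thesis by simp
qed

text \<open>The third assumption says that factor \<open>x\<close> sees only the restriction of the
  colouring to \<open>S x\<close>. Colourings of the disjoint pieces then glue to colourings of the
  union, and words multiply by concatenation.\<close>

lemma fprod_list_sum_words:
  assumes "distinct xs"
    and "\<And>x y. x \<in> set xs \<Longrightarrow> y \<in> set xs \<Longrightarrow> x \<noteq> y \<Longrightarrow> S x \<inter> S y = {}"
    and "\<And>x k l. x \<in> set xs \<Longrightarrow> (\<And>h. h \<in> S x \<Longrightarrow> k h = l h) \<Longrightarrow> c x k = c x l \<and> w x k = w x l"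
  shows "fprod_list P (map (\<lambda>x. \<Sum>k\<in>PiE (S x) D. fscale (c x k) (word_fun P (w x k))) xs) =
         (\<Sum>k\<in>PiE (\<Union>x\<in>set xs. S x) D.
            fscale (\<Prod>x\<in>set xs. c x k) (word_fun P (concat (map (\<lambda>x. w x k) xs))))"
  using assms
proof (induction xs)
  case Nil
  then show ?case by (simp add: fprod_list_def word_fun_Nil)
next
  case (Cons x xs)
  let ?T = "\<Union>x\<in>set xs. S x"
  have disj: "S x \<inter> ?T = {}"
    using Cons.prems(1,2) by fastforce
  have IH: "fprod_list P (map (\<lambda>x. \<Sum>k\<in>PiE (S x) D. fscale (c x k) (word_fun P (w x k))) xs) =
         (\<Sum>k\<in>PiE ?T D. fscale (\<Prod>x\<in>set xs. c x k) (word_fun P (concat (map (\<lambda>x. w x k) xs))))"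
  proof (rule Cons.IH)
    show "c y k = c y l \<and> w y k = w y l" if "y \<in> set xs" "\<And>h. h \<in> S y \<Longrightarrow> k h = l h" for y k l
      by (rule Cons.prems(3)) (use that in simp_all)
    show "S y \<inter> S z = {}" if "y \<in> set xs" "z \<in> set xs" "y \<noteq> z" for y z
      by (rule Cons.prems(2)) (use that in simp_all)
  qed (use Cons.prems(1) in simp)
  have "fprod_list P (map (\<lambda>x. \<Sum>k\<in>PiE (S x) D. fscale (c x k) (word_fun P (w x k))) (x # xs)) =
        (\<Sum>k\<in>PiE (S x) D. \<Sum>l\<in>PiE ?T D.
          fscale (c x k * (\<Prod>x\<in>set xs. c x l)) (word_fun P (w x k @ concat (map (\<lambda>x. w x l) xs))))"
    using IH by (simp add: fprod_list_def fmult_sum fmult_fscale fmult_word)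
  also have "\<dots> = (\<Sum>k\<in>PiE (S x \<union> ?T) D.
          fscale (c x (restrict k (S x)) * (\<Prod>x\<in>set xs. c x (restrict k ?T)))
            (word_fun P (w x (restrict k (S x)) @ concat (map (\<lambda>x. w x (restrict k ?T)) xs))))"
    by (rule sum_PiE_Un[OF disj, symmetric])
  also have "\<dots> = (\<Sum>k\<in>PiE (S x \<union> ?T) D.
          fscale (c x k * (\<Prod>x\<in>set xs. c x k)) (word_fun P (w x k @ concat (map (\<lambda>x. w x k) xs))))"
  proof (rule sum.cong[OF refl])
    fix k
    have 1: "c x (restrict k (S x)) = c x k \<and> w x (restrict k (S x)) = w x k"
      by (rule Cons.prems(3)) auto
    have 2: "c y (restrict k ?T) = c y k \<and> w y (restrict k ?T) = w y k" if "y \<in> set xs" for y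
      by (rule Cons.prems(3)) (use that in auto)
    have 3: "map (\<lambda>y. w y (restrict k ?T)) xs = map (\<lambda>y. w y k) xs"
      using 2 by simp
    have 4: "(\<Prod>y\<in>set xs. c y (restrict k ?T)) = (\<Prod>y\<in>set xs. c y k)"
      using 2 by simp
    show "fscale (c x (restrict k (S x)) * (\<Prod>x\<in>set xs. c x (restrict k ?T)))
            (word_fun P (w x (restrict k (S x)) @ concat (map (\<lambda>x. w x (restrict k ?T)) xs))) =
          fscale (c x k * (\<Prod>x\<in>set xs. c x k)) (word_fun P (w x k @ concat (map (\<lambda>x. w x k) xs)))"
      by (simp only: 1 3 4)
  qed
  finally show ?case using Cons.prems(1) by simp
qed

section \<open>Labelled expansions\<close>

text \<open>As for exponential generating functions, the factor \<open>fact (card S)\<close> turns a product of functions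
  into a sum over the distributions of \<open>S\<close> among the factors.\<close>

definition labelled_part :: "nat set \<Rightarrow> nat set \<Rightarrow> ffun \<Rightarrow> ffun" where
  "labelled_part U S f = (\<lambda>m. if size m = card S \<and> set_mset m \<subseteq> U then fact (card S) * f m else 0)"

text \<open>Each coefficient in \<open>\<hbar>\<close> is a component of the symmetric tensor of
  \<open>f\<close>, normalized as in \<open>vertex_tensor\<close>. Keeping the whole series
  postpones the choice of a genus at the vertex.\<close>

definition vertex_series :: "(nat \<Rightarrow> bool) \<Rightarrow> ffun \<Rightarrow> nat list \<Rightarrow> real fls" where
  "vertex_series P f w = fls_const (ksign P w * (\<Prod>x\<in>set w. fact (count (mset w) x))) * f (mset w)"

text \<open>With \<open>N = card S\<close>, the number of words that sort to a given monomial is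
  \<open>N!\<close> divided by the factorials of its multiplicities, and the factorials in
  \<open>vertex_series\<close> restore \<open>N!\<close>. The two Koszul signs multiply to 1; where
  an odd letter repeats, \<open>f\<close> itself vanishes.\<close>

lemma labelled_part_eq_sum:
  assumes S: "finite S" and U: "finite U" and f: "\<And>m. m \<notin> monomials P UNIV \<Longrightarrow> f m = 0"
  shows "labelled_part U S f = (\<Sum>k\<in>PiE S (\<lambda>_. U).
           fscale (vertex_series P f (map k (sorted_list_of_set S)))
             (word_fun P (map k (sorted_list_of_set S))))"
proof
  fix m
  let ?L = "sorted_list_of_set S"
  let ?W = "{w. set w \<subseteq> U \<and> length w = card S}"
  have bij: "bij_betw (\<lambda>k. map k ?L) (PiE S (\<lambda>_. U)) ?W"
  proof (rule bij_betw_imageI)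
    show "inj_on (\<lambda>k. map k ?L) (PiE S (\<lambda>_. U))"
      using S by (intro inj_onI) (auto intro: PiE_ext)
    show "(\<lambda>k. map k ?L) ` (PiE S (\<lambda>_. U)) = ?W"
    proof (intro set_eqI iffI)
      fix w assume w: "w \<in> ?W"
      define k where "k = (\<lambda>h\<in>S. w ! (THE i. i < card S \<and> ?L ! i = h))"
      have "k (?L ! i) = w ! i" if "i < card S" for i
      proof -
        have "(THE j. j < card S \<and> ?L ! j = ?L ! i) = i"
          using that by (intro the_equality) (auto simp: nth_eq_iff_index_eq)
        moreover have "?L ! i \<in> S" using that S by (metis nth_mem length_sorted_list_of_set set_sorted_list_of_set)
        ultimately show ?thesis by (simp add: k_def)
      qed
      then have wk: "w = map k ?L"
        using w by (auto intro: nth_equalityI)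
      moreover have "k \<in> PiE S (\<lambda>_. U)"
      proof (rule PiE_I)
        fix h assume "h \<in> S"
        then have "k h \<in> set (map k ?L)" using S by simp
        then show "k h \<in> U" using w wk by auto
      qed (simp add: k_def)
      ultimately show "w \<in> (\<lambda>k. map k ?L) ` (PiE S (\<lambda>_. U))" by blast
    qed (use S in auto)
  qed
  have "(\<Sum>k\<in>PiE S (\<lambda>_. U). fscale (vertex_series P f (map k ?L)) (word_fun P (map k ?L))) m =
        (\<Sum>k\<in>PiE S (\<lambda>_. U). vertex_series P f (map k ?L) * word_fun P (map k ?L) m)"
    by (simp add: sum_ffun_apply fscale_def)
  also have "\<dots> = (\<Sum>w\<in>?W. vertex_series P f w * word_fun P w m)"
    by (rule sum.reindex_bij_betw[OF bij])
  also have "\<dots> = (\<Sum>w\<in>{w\<in>?W. mset w = m}. vertex_series P f w * word_fun P w m)"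
    using finite_lists_length_eq[OF U, of "card S"]
    by (intro sum.mono_neutral_right) (auto simp: word_fun_def)
  also have "\<dots> = (\<Sum>w\<in>{w\<in>?W. mset w = m}. fls_const (\<Prod>x\<in>set_mset m. fact (count m x)) * f m)"
  proof (rule sum.cong[OF refl])
    fix w assume "w \<in> {w\<in>?W. mset w = m}"
    then have m: "m = mset w" by simp
    show "vertex_series P f w * word_fun P w m = fls_const (\<Prod>x\<in>set_mset m. fact (count m x)) * f m"
    proof (cases "distinct (filter P w)")
      case True
      show ?thesis
        using ksign_square[OF True]
        by (simp add: vertex_series_def word_fun_def m mult_ac fls_const_mult_const flip: mult.assoc)
    next
      case False
      then have "\<not> (\<forall>j\<in>#m. P j \<longrightarrow> count m j = 1)"
        by (auto simp: distinct_count_atmost_1 m split: if_splits)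
      then have "f m = 0" using f by (auto simp: monomials_def)
      then show ?thesis by (simp add: vertex_series_def m)
    qed
  qed
  also have "\<dots> = labelled_part U S f m"
  proof (cases "size m = card S \<and> set_mset m \<subseteq> U")
    case True
    then have "{w\<in>?W. mset w = m} = permutations_of_multiset m"
      by (auto simp: permutations_of_multiset_def)
    moreover have "card (permutations_of_multiset m) * (\<Prod>x\<in>set_mset m. fact (count m x)) = fact (size m)"
      using card_permutations_of_multiset[of m] by (metis dvd_div_mult_self)
    then have "real (card (permutations_of_multiset m)) * (\<Prod>x\<in>set_mset m. fact (count m x)) = fact (size m)"
    proof -
      assume "card (permutations_of_multiset m) * (\<Prod>x\<in>set_mset m. fact (count m x)) = fact (size m)"
      from arg_cong[OF this, of real] show ?thesis by simp
    qed
    then have "of_nat (card (permutations_of_multiset m)) * fls_const (\<Prod>x\<in>set_mset m. fact (count m x)) =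
        (of_nat (fact (size m)) :: real fls)"
      by (simp only: fls_of_nat fls_const_mult_const of_nat_fact)
    ultimately show ?thesis using True
      by (simp add: labelled_part_def flip: mult.assoc)
  next
    case False
    then have "{w\<in>?W. mset w = m} = {}" by auto
    then show ?thesis using False unfolding labelled_part_def by (simp only: sum.empty if_False)
  qed
  finally show "labelled_part U S f m = (\<Sum>k\<in>PiE S (\<lambda>_. U).
      fscale (vertex_series P f (map k ?L)) (word_fun P (map k ?L))) m" by simp
qed

text \<open>A splitting of the monomial into parts of sizes \<open>j\<close> and
  \<open>N - j\<close> is met by \<open>N choose j\<close> subsets \<open>A\<close>, and
  \<open>j! (N - j)! (N choose j) = N!\<close>.\<close>

lemma labelled_part_mult:
  assumes S: "finite S"
  shows "labelled_part U S (fmult P f g) =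
         (\<Sum>A\<in>Pow S. fmult P (labelled_part U A f) (labelled_part U (S - A) g))"
proof
  fix m
  let ?s = "\<lambda>u. fls_const (ksign P (sorted_list_of_multiset u @ sorted_list_of_multiset (m - u)))"
  let ?X = "{u. u \<subseteq># m}"
  let ?ok = "size m = card S \<and> set_mset m \<subseteq> U"
  have summand: "?s u * labelled_part U A f u * labelled_part U (S - A) g (m - u) =
      (if ?ok \<and> card A = size u then fact (size u) * fact (card S - size u) * (?s u * f u * g (m - u)) else 0)"
    if "u \<in> ?X" "A \<in> Pow S" for u A
  proof -
    have c: "card (S - A) = card S - card A" "card A \<le> card S"
      using that S by (auto simp: card_Diff_subset finite_subset card_mono)
    have s: "size (m - u) = size m - size u" "size u \<le> size m"
      using that by (auto simp: size_Diff_submset size_mset_mono)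
    have "m = u + (m - u)" using that by simp
    then have "set_mset m = set_mset u \<union> set_mset (m - u)" by (metis set_mset_union)
    then have ok: "?ok \<and> card A = size u \<longleftrightarrow>
        (size u = card A \<and> set_mset u \<subseteq> U) \<and> (size (m - u) = card (S - A) \<and> set_mset (m - u) \<subseteq> U)"
      using c s by auto
    show ?thesis
    proof (cases "?ok \<and> card A = size u")
      case True
      then have "size u = card A" "size (m - u) = card (S - A)" "card S - size u = card (S - A)"
        "set_mset u \<subseteq> U" "set_mset (m - u) \<subseteq> U"
        using ok c by simp_all
      then show ?thesis
        by (simp only: True labelled_part_def if_True simp_thms) (simp add: mult_ac)
    next
      case False
      then have "labelled_part U A f u = 0 \<or> labelled_part U (S - A) g (m - u) = 0"
        unfolding ok by (auto simp: labelled_part_def)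
      then show ?thesis by (auto simp only: False if_False mult_zero_left mult_zero_right)
    qed
  qed
  have "(\<Sum>A\<in>Pow S. fmult P (labelled_part U A f) (labelled_part U (S - A) g)) m =
     (\<Sum>A\<in>Pow S. \<Sum>u\<in>?X. if ?ok \<and> card A = size u
         then fact (size u) * fact (card S - size u) * (?s u * f u * g (m - u)) else 0)"
    unfolding sum_ffun_apply fmult_def by (intro sum.cong refl summand)
  also have "\<dots> = (\<Sum>u\<in>?X. \<Sum>A\<in>Pow S. if ?ok \<and> card A = size u
         then fact (size u) * fact (card S - size u) * (?s u * f u * g (m - u)) else 0)"
    by (rule sum.swap)
  also have "\<dots> = (\<Sum>u\<in>?X. if ?ok then fact (card S) * (?s u * f u * g (m - u)) else 0)"
  proof (rule sum.cong[OF refl])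
    fix u assume u: "u \<in> ?X"
    show "(\<Sum>A\<in>Pow S. if ?ok \<and> card A = size u
         then fact (size u) * fact (card S - size u) * (?s u * f u * g (m - u)) else 0) =
         (if ?ok then fact (card S) * (?s u * f u * g (m - u)) else 0)"
    proof (cases ?ok)
      case True
      then have le: "size u \<le> card S" using u size_mset_mono[of u m] by simp
      have "(\<Sum>A\<in>Pow S. if ?ok \<and> card A = size u
         then fact (size u) * fact (card S - size u) * (?s u * f u * g (m - u)) else 0) =
        (\<Sum>A\<in>{A. A \<subseteq> S \<and> card A = size u}.
            fact (size u) * fact (card S - size u) * (?s u * f u * g (m - u)))"
        using S True by (subst sum.inter_filter[symmetric]) (auto simp: Pow_def)
      also have "\<dots> = of_nat (fact (size u) * fact (card S - size u) * (card S choose size u)) *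
            (?s u * f u * g (m - u))"
        using n_subsets[OF S] by (simp add: mult_ac)
      finally show ?thesis
        using True binomial_fact_lemma[OF le] by simp
    next
      case False
      show ?thesis by (simp only: False simp_thms if_False sum.neutral_const)
    qed
  qed
  also have "\<dots> = labelled_part U S (fmult P f g) m"
  proof (cases ?ok)
    case False
    show ?thesis by (simp only: labelled_part_def False if_False sum.neutral_const)
  qed (simp add: labelled_part_def fmult_def sum_distrib_left)
  finally show "labelled_part U S (fmult P f g) m =
      (\<Sum>A\<in>Pow S. fmult P (labelled_part U A f) (labelled_part U (S - A) g)) m" by simp
qed

text \<open>Iterating the product rule distributes the labels among the factors; \<open>t h\<close>
  is the factor that receives \<open>h\<close>, later the vertex to which the half-edge
  \<open>h\<close> is attached.\<close>

lemma labelled_part_power: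
  fixes S :: "nat set"
  assumes S: "finite S" and vs: "distinct vs"
  shows "labelled_part U S (fprod_list P (replicate (length vs) f)) =
         (\<Sum>t\<in>PiE S (\<lambda>_. set vs).
            fprod_list P (map (\<lambda>v. labelled_part U {h\<in>S. t h = v} f) vs))"
  using S vs
proof (induction vs arbitrary: S)
  case Nil
  show ?case
  proof (cases "S = {}")
    case True
    then show ?thesis by (auto simp: labelled_part_def fprod_list_def fun_eq_iff)
  next
    case False
    then have "PiE S (\<lambda>_. {}) = ({} :: (nat \<Rightarrow> 'a) set)" by auto
    then show ?thesis using False Nil by (auto simp: labelled_part_def fprod_list_def fun_eq_iff)
  qed
next
  case (Cons v vs)
  let ?g = "\<lambda>S t. fprod_list P (map (\<lambda>v. labelled_part U {h\<in>S. t h = v} f) vs)"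
  have "labelled_part U S (fprod_list P (replicate (length (v # vs)) f)) =
        (\<Sum>A\<in>Pow S. fmult P (labelled_part U A f)
           (labelled_part U (S - A) (fprod_list P (replicate (length vs) f))))"
    using labelled_part_mult[OF Cons.prems(1)] by (simp add: fprod_list_def)
  also have "\<dots> = (\<Sum>A\<in>Pow S. \<Sum>t\<in>PiE (S - A) (\<lambda>_. set vs).
       fmult P (labelled_part U A f) (?g (S - A) t))"
  proof (rule sum.cong[OF refl])
    fix A
    have "labelled_part U (S - A) (fprod_list P (replicate (length vs) f)) =
        (\<Sum>t\<in>PiE (S - A) (\<lambda>_. set vs). ?g (S - A) t)"
      using Cons by simp
    then show "fmult P (labelled_part U A f)
           (labelled_part U (S - A) (fprod_list P (replicate (length vs) f))) =
        (\<Sum>t\<in>PiE (S - A) (\<lambda>_. set vs). fmult P (labelled_part U A f) (?g (S - A) t))"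
      using fmult_sum[of P "\<lambda>_. labelled_part U A f" "{()}" "?g (S - A)"] by simp
  qed
  also have "\<dots> = (\<Sum>(A, t)\<in>Sigma (Pow S) (\<lambda>A. PiE (S - A) (\<lambda>_. set vs)).
       fmult P (labelled_part U A f) (?g (S - A) t))"
    using Cons.prems(1) by (intro sum.Sigma) (auto intro: finite_PiE)
  also have "\<dots> = (\<Sum>t\<in>PiE S (\<lambda>_. set (v # vs)).
       fmult P (labelled_part U {h\<in>S. t h = v} f) (?g S t))"
  proof (rule sum.reindex_bij_witness[where
          i = "\<lambda>t. ({h\<in>S. t h = v}, restrict t (S - {h\<in>S. t h = v}))" and
          j = "\<lambda>(A, t) h. if h \<in> A then v else t h"])
    fix z assume z: "z \<in> Sigma (Pow S) (\<lambda>A. PiE (S - A) (\<lambda>_. set vs))"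
    obtain A t where At: "z = (A, t)" "A \<subseteq> S" "t \<in> PiE (S - A) (\<lambda>_. set vs)"
      using z by auto
    have tv: "t h \<noteq> v" if "h \<in> S" "h \<notin> A" for h
      using At that Cons.prems(2) by (auto simp: PiE_iff)
    have *: "{h \<in> S. (if h \<in> A then v else t h) = v} = A"
      using At tv by auto
    then show "(\<lambda>t. ({h \<in> S. t h = v}, restrict t (S - {h \<in> S. t h = v})))
        ((\<lambda>(A, t) h. if h \<in> A then v else t h) z) = z"
      using At by (auto simp: fun_eq_iff PiE_iff extensional_def restrict_def)
    show "(\<lambda>(A, t) h. if h \<in> A then v else t h) z \<in> PiE S (\<lambda>_. set (v # vs))"
      using At by (auto simp: PiE_iff extensional_def)
    have "{h \<in> S. (if h \<in> A then v else t h) = u} = {h \<in> S - A. t h = u}" if "u \<in> set vs" for u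
      using At that Cons.prems(2) by auto
    then have "?g S (\<lambda>h. if h \<in> A then v else t h) = ?g (S - A) t"
      by (intro arg_cong[of _ _ "fprod_list P"] map_cong refl) simp
    then show "fmult P (labelled_part U {h \<in> S. (\<lambda>(A, t) h. if h \<in> A then v else t h) z h = v} f)
          (?g S ((\<lambda>(A, t) h. if h \<in> A then v else t h) z)) =
        (case z of (A, t) \<Rightarrow> fmult P (labelled_part U A f) (?g (S - A) t))"
      using At * by simp
  next
    fix t assume t: "t \<in> PiE S (\<lambda>_. set (v # vs))"
    then show "(\<lambda>(A, t) h. if h \<in> A then v else t h)
        ({h \<in> S. t h = v}, restrict t (S - {h \<in> S. t h = v})) = t"
      by (auto simp: fun_eq_iff PiE_iff extensional_def)
    show "({h \<in> S. t h = v}, restrict t (S - {h \<in> S. t h = v}))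
        \<in> Sigma (Pow S) (\<lambda>A. PiE (S - A) (\<lambda>_. set vs))"
      using t by auto
  qed
  finally show ?case by (simp add: fprod_list_def)
qed

lemma fprod_list_power_expansion:
  fixes S :: "nat set"
  assumes N: "finite S" and U: "finite U" and vs: "distinct vs"
    and f: "\<And>m. m \<notin> monomials P UNIV \<Longrightarrow> f m = 0"
    and m: "size m = card S" "set_mset m \<subseteq> U"
  shows "fact (card S) * fprod_list P (replicate (length vs) f) m =
    (\<Sum>t\<in>PiE S (\<lambda>_. set vs). \<Sum>k\<in>PiE S (\<lambda>_. U).
       (\<Prod>v\<in>set vs. vertex_series P f (map k (sorted_list_of_set {h\<in>S. t h = v}))) *
       word_fun P (map k (concat (map (\<lambda>v. sorted_list_of_set {h\<in>S. t h = v}) vs))) m)"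
proof -
  let ?L = "\<lambda>t v. sorted_list_of_set {h\<in>S. t h = v}"
  have "fprod_list P (map (\<lambda>v. labelled_part U {h\<in>S. t h = v} f) vs) =
     (\<Sum>k\<in>PiE S (\<lambda>_. U). fscale (\<Prod>v\<in>set vs. vertex_series P f (map k (?L t v)))
        (word_fun P (map k (concat (map (?L t) vs)))))"
    if t: "t \<in> PiE S (\<lambda>_. set vs)" for t
  proof -
    have "fprod_list P (map (\<lambda>v. labelled_part U {h\<in>S. t h = v} f) vs) =
        fprod_list P (map (\<lambda>v. \<Sum>k\<in>PiE {h\<in>S. t h = v} (\<lambda>_. U).
          fscale (vertex_series P f (map k (?L t v))) (word_fun P (map k (?L t v)))) vs)"
      using labelled_part_eq_sum[OF _ U f] N by simp
    also have "\<dots> = (\<Sum>k\<in>PiE (\<Union>v\<in>set vs. {h\<in>S. t h = v}) (\<lambda>_. U).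
        fscale (\<Prod>v\<in>set vs. vertex_series P f (map k (?L t v)))
        (word_fun P (concat (map (\<lambda>v. map k (?L t v)) vs))))"
    proof (rule fprod_list_sum_words[OF vs])
      fix v and k l :: "nat \<Rightarrow> nat"
      assume "\<And>h. h \<in> {h\<in>S. t h = v} \<Longrightarrow> k h = l h"
      then have "map k (?L t v) = map l (?L t v)"
        using N by auto
      then show "vertex_series P f (map k (?L t v)) = vertex_series P f (map l (?L t v)) \<and>
          map k (?L t v) = map l (?L t v)" by metis
    qed auto
    also have "(\<Union>v\<in>set vs. {h\<in>S. t h = v}) = S" using t by auto
    finally show ?thesis by (simp add: map_concat o_def)
  qed
  then have "labelled_part U S (fprod_list P (replicate (length vs) f)) m =
    (\<Sum>t\<in>PiE S (\<lambda>_. set vs). \<Sum>k\<in>PiE S (\<lambda>_. U). fscale (\<Prod>v\<in>set vs. vertex_series P f (map k (?L t v)))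
        (word_fun P (map k (concat (map (?L t) vs)))) m)"
    by (simp add: labelled_part_power[OF N vs] sum_ffun_apply)
  then show ?thesis using m by (simp add: labelled_part_def fscale_def)
qed

lemma fprod_list_replicate_fscale:
  "fprod_list P (replicate n (fscale c f)) = fscale (c ^ n) (fprod_list P (replicate n f))"
  by (induction n) (simp_all add: fprod_list_def fmult_fscale)

section \<open>Wick's theorem\<close>

definition pair_list :: "('a \<Rightarrow> 'a) \<Rightarrow> 'a list \<Rightarrow> 'a list" where
  "pair_list fl E = concat (map (\<lambda>h. [h, fl h]) E)"

lemma pair_list_simps [simp]:
  "pair_list fl [] = []"
  "pair_list fl (h # E) = h # fl h # pair_list fl E"
  "pair_list fl (E @ E') = pair_list fl E @ pair_list fl E'"
  by (simp_all add: pair_list_def)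

lemma set_pair_list: "set (pair_list fl E) = set E \<union> fl ` set E"
  by (induction E) auto

lemma distinct_pair_list:
  assumes "distinct E" "set E \<subseteq> S" "\<And>h. h \<in> S \<Longrightarrow> fl (fl h) = h" "set E \<inter> fl ` set E = {}"
  shows "distinct (pair_list fl E)"
  using assms
proof (induction E)
  case (Cons h E)
  have "fl h \<noteq> h" using Cons.prems(4) by (metis IntI empty_iff imageI list.set_intros(1))
  moreover have "h \<notin> fl ` set E" "fl h \<notin> set E" using Cons.prems(4) by auto
  moreover have "fl h \<notin> fl ` set E"
  proof
    assume "fl h \<in> fl ` set E"
    then obtain g where "g \<in> set E" "fl h = fl g" by auto
    then show False using Cons.prems by (metis distinct.simps(2) list.set_intros subsetD)
  qed
  ultimately show ?case using Cons by (auto simp: set_pair_list)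
qed simp

text \<open>Extensional outside \<open>S\<close>, so that each fixed-point-free involution is
  counted once.\<close>

definition pairings :: "nat set \<Rightarrow> (nat \<Rightarrow> nat) set" where
  "pairings S = {\<tau>\<in>PiE S (\<lambda>_. S). \<forall>h\<in>S. \<tau> (\<tau> h) = h \<and> \<tau> h \<noteq> h}"

definition pairing_edges :: "nat set \<Rightarrow> (nat \<Rightarrow> nat) \<Rightarrow> nat list" where
  "pairing_edges S \<tau> = sorted_list_of_set {h\<in>S. h < \<tau> h}"

lemma finite_pairings: "finite S \<Longrightarrow> finite (pairings S)"
  unfolding pairings_def by (rule finite_subset[of _ "PiE S (\<lambda>_. S)"]) (auto intro: finite_PiE)

lemma pairing_list_props:
  assumes "finite S" "\<tau> \<in> pairings S"
  shows "distinct (pair_list \<tau> (pairing_edges S \<tau>))" "set (pair_list \<tau> (pairing_edges S \<tau>)) = S"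
proof -
  have \<tau>: "\<tau> h \<in> S" "\<tau> (\<tau> h) = h" "\<tau> h \<noteq> h" if "h \<in> S" for h
    using assms(2) that by (auto simp: pairings_def)
  have E: "set (pairing_edges S \<tau>) = {h\<in>S. h < \<tau> h}" "distinct (pairing_edges S \<tau>)"
    using assms(1) by (auto simp: pairing_edges_def)
  show "distinct (pair_list \<tau> (pairing_edges S \<tau>))"
    using E \<tau>(2) by (intro distinct_pair_list[of _ S]) auto
  show "set (pair_list \<tau> (pairing_edges S \<tau>)) = S"
  proof
    show "S \<subseteq> set (pair_list \<tau> (pairing_edges S \<tau>))"
    proof
      fix h assume h: "h \<in> S"
      show "h \<in> set (pair_list \<tau> (pairing_edges S \<tau>))"
      proof (cases "h < \<tau> h")
        case False
        then have "\<tau> h \<in> {h\<in>S. h < \<tau> h}" "h = \<tau> (\<tau> h)" using \<tau> h by (auto simp: less_le)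
        then show ?thesis unfolding set_pair_list E by blast
      qed (use h E in \<open>auto simp: set_pair_list\<close>)
    qed
  qed (use \<tau> E in \<open>auto simp: set_pair_list\<close>)
qed

text \<open>A pairing amounts to a partner \<open>g\<close> of \<open>h\<close> and a pairing of the
  rest; Wick's theorem is proved along this recursion.\<close>

lemma sum_pairings_insert:
  assumes "h \<notin> R"
  shows "(\<Sum>\<tau>\<in>pairings (insert h R). F \<tau>) =
         (\<Sum>(g, \<tau>)\<in>Sigma R (\<lambda>g. pairings (R - {g})). F (\<tau>(h := g, g := h)))"
proof (rule sum.reindex_bij_witness[where
      i = "\<lambda>(g, \<tau>). \<tau>(h := g, g := h)" and
      j = "\<lambda>\<tau>. (\<tau> h, restrict \<tau> (R - {\<tau> h}))"])
  fix \<tau> assume \<tau>: "\<tau> \<in> pairings (insert h R)"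
  then have t: "\<tau> h \<in> R" "\<tau> (\<tau> h) = h"
    by (auto simp: pairings_def)
  have ext: "\<tau> x = undefined" if "x \<noteq> h" "x \<notin> R" for x
    using \<tau> that by (auto simp: pairings_def PiE_iff extensional_def)
  have "(restrict \<tau> (R - {\<tau> h}))(h := \<tau> h, \<tau> h := h) = \<tau>"
    using t ext assms by (auto simp: fun_eq_iff)
  then show "(case (\<tau> h, restrict \<tau> (R - {\<tau> h})) of (g, \<tau>) \<Rightarrow> \<tau>(h := g, g := h)) = \<tau>"
    "(case (\<tau> h, restrict \<tau> (R - {\<tau> h})) of (g, \<tau>) \<Rightarrow> F (\<tau>(h := g, g := h))) = F \<tau>"
    by simp_all
  have inv: "\<tau> (\<tau> x) = x" "\<tau> x \<noteq> x" "\<tau> x \<in> insert h R" if "x \<in> R" for x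
    using \<tau> that by (auto simp: pairings_def)
  have "\<tau> x \<in> R - {\<tau> h}" if "x \<in> R - {\<tau> h}" for x
    using that inv[of x] t by (metis Diff_iff assms insertE insertI1 singletonD singletonI)
  then have "restrict \<tau> (R - {\<tau> h}) \<in> pairings (R - {\<tau> h})"
    using inv unfolding pairings_def by auto
  then show "(\<tau> h, restrict \<tau> (R - {\<tau> h})) \<in> Sigma R (\<lambda>g. pairings (R - {g}))"
    using t by simp
next
  fix z assume "z \<in> Sigma R (\<lambda>g. pairings (R - {g}))"
  then obtain g \<tau> where z: "z = (g, \<tau>)" "g \<in> R" "\<tau> \<in> pairings (R - {g})" by auto
  have \<tau>: "\<tau> x \<in> R - {g}" "\<tau> (\<tau> x) = x" "\<tau> x \<noteq> x" if "x \<in> R - {g}" for x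
    using z(3) that by (auto simp: pairings_def)
  have ext: "\<tau> x = undefined" if "x \<notin> R - {g}" for x
    using z(3) that by (auto simp: pairings_def PiE_iff extensional_def)
  have gh: "g \<noteq> h" using z(2) assms by auto
  have "restrict (\<tau>(h := g, g := h)) (R - {g}) = \<tau>"
    using ext assms by (auto simp: fun_eq_iff)
  then show "(((case z of (g, \<tau>) \<Rightarrow> \<tau>(h := g, g := h)) h,
      restrict (case z of (g, \<tau>) \<Rightarrow> \<tau>(h := g, g := h))
        (R - {(case z of (g, \<tau>) \<Rightarrow> \<tau>(h := g, g := h)) h}))) = z"
    using gh by (simp add: z(1))
  let ?t = "\<tau>(h := g, g := h)"
  have "?t x \<in> insert h R \<and> ?t (?t x) = x \<and> ?t x \<noteq> x" if "x \<in> insert h R" for x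
  proof (cases "x = h \<or> x = g")
    case False
    then have x: "x \<in> R - {g}" using that by auto
    then have "\<tau> x \<noteq> h" using \<tau>(1)[OF x] assms by auto
    then show ?thesis using \<tau>[OF x] False by auto
  qed (use gh z(2) in auto)
  moreover have "?t x = undefined" if "x \<notin> insert h R" for x
    using that ext[of x] z(2) by auto
  ultimately have "?t \<in> pairings (insert h R)"
    unfolding pairings_def PiE_iff extensional_def by blast
  then show "(case z of (g, \<tau>) \<Rightarrow> \<tau>(h := g, g := h)) \<in> pairings (insert h R)"
    by (simp add: z(1))
qed

section \<open>Gaussian moments of words of coordinates\<close>

locale gaussian_coords =
  fixes W :: "'w::real_vector grading" and c :: "'w coords"
  assumes even_x: "\<And>t. t < length (xvecs c) \<Longrightarrow> \<not> podd W c (xcoord c t)"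
    and odd_z: "\<And>t. t < length (zvecs c) \<Longrightarrow> podd W c (zcoord c t)"
    and even_length_z: "even (length (zvecs c))"
begin

abbreviation P :: "nat \<Rightarrow> bool" where "P \<equiv> podd W c"

text \<open>The sign sorts the word. It is 0 when an odd letter repeats, so the value of
  \<open>moment\<close> on such a multiset never matters.\<close>

definition word_moment :: "nat list \<Rightarrow> real fls" where
  "word_moment w = fls_const (ksign P w) * moment c (mset w)"

lemma coord_disjoint [simp]:
  "t < length (xvecs c) \<Longrightarrow> xcoord c t \<noteq> zcoord c t'"
  "t < length (xvecs c) \<Longrightarrow> zcoord c t' \<noteq> xcoord c t"
  by (auto simp: xcoord_def zcoord_def)

lemma coord_inj [simp]:
  "xcoord c t = xcoord c t' \<longleftrightarrow> t = t'" "zcoord c t = zcoord c t' \<longleftrightarrow> t = t'"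
  by (auto simp: xcoord_def zcoord_def)

text \<open>Integration by parts in one even coordinate. If the coordinate does not occur in
  \<open>m\<close>, the factor 0 matches the vanishing first moment, so the truncated difference of
  multisets is harmless.\<close>

lemma moment_x:
  assumes t: "t < length (xvecs c)"
  shows "moment c (add_mset (xcoord c t) m) =
    fls_const (eps c t * real (count m (xcoord c t))) * fls_X * moment c (m - {#xcoord c t#})"
proof -
  let ?a = "xcoord c t" and ?X = "{..<length (xvecs c)}"
  let ?x = "\<lambda>m t. x_moment (eps c t) (count m (xcoord c t))"
  let ?z = "\<lambda>m. \<Prod>t<length (zvecs c) div 2. z_moment (count m (zcoord c (2 * t))) (count m (zcoord c (2 * t + 1)))"
  have z: "?z (add_mset ?a m) = ?z (m - {#?a#})"
    using t by simp
  have split: "(\<Prod>t\<in>?X. ?x m' t) = ?x m' t * (\<Prod>t\<in>?X - {t}. ?x m' t)" for m'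
    using t by (intro prod.remove) auto
  have r: "(\<Prod>t\<in>?X - {t}. ?x (add_mset ?a m) t) = (\<Prod>t\<in>?X - {t}. ?x (m - {#?a#}) t)"
    by (intro prod.cong refl) auto
  have "?x (add_mset ?a m) t = fls_const (eps c t * real (count m ?a)) * fls_X * ?x (m - {#?a#}) t"
    by (cases "count m ?a") auto
  then show ?thesis
    unfolding moment_def z split[of "add_mset ?a m"] split[of "m - {#?a#}"] r
    by (simp add: mult_ac)
qed

definition odd_pair :: "nat \<Rightarrow> nat \<Rightarrow> bool" where
  "odd_pair a b \<longleftrightarrow> (\<exists>t<length (zvecs c) div 2.
     (a = zcoord c (2 * t) \<and> b = zcoord c (2 * t + 1)) \<or> (b = zcoord c (2 * t) \<and> a = zcoord c (2 * t + 1)))"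

lemma odd_pair_sym: "odd_pair a b \<Longrightarrow> odd_pair b a"
  by (auto simp: odd_pair_def)

lemma odd_pair_neq: "odd_pair a b \<Longrightarrow> a \<noteq> b"
  by (auto simp: odd_pair_def zcoord_def)

lemma odd_pair_odd: "odd_pair a b \<Longrightarrow> P a"
  unfolding odd_pair_def by (auto intro!: odd_z)

text \<open>Partners have consecutive numbers, so any other letter lies below both or above both,
  and the signs of moving the two partners past it cancel.\<close>

lemma odd_pair_less: "odd_pair a b \<Longrightarrow> x \<noteq> a \<Longrightarrow> x \<noteq> b \<Longrightarrow> x < a \<longleftrightarrow> x < b"
  by (auto simp: odd_pair_def zcoord_def)

lemma lcoord_cases:
  assumes "a \<in> lcoord c"
  obtains t where "t < length (xvecs c)" "a = xcoord c t" | b where "odd_pair a b"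
proof -
  from assms consider t where "t < length (xvecs c)" "a = xcoord c t"
    | t where "t < length (zvecs c)" "a = zcoord c t"
    by (auto simp: lcoord_def)
  then show thesis
  proof cases
    case 1
    then show ?thesis using that(1) by blast
  next
    case (2 t)
    have "t div 2 < length (zvecs c) div 2"
      using 2(1) even_length_z by (elim evenE) auto
    moreover have "t = 2 * (t div 2) \<or> t = 2 * (t div 2) + 1" by presburger
    ultimately show ?thesis using that(2) 2(2) unfolding odd_pair_def by metis
  qed
qed

text \<open>\<open>z_moment\<close> is non-zero only for the exponents (0, 0) and (1, 1).\<close>

lemma moment_pair_zero:
  assumes "odd_pair a b" "count m a \<noteq> count m b"
  shows "moment c m = 0"
proof -
  obtain t where t: "t < length (zvecs c) div 2"
    "count m (zcoord c (2 * t)) \<noteq> count m (zcoord c (2 * t + 1))"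
    using assms unfolding odd_pair_def by metis
  then have "z_moment (count m (zcoord c (2 * t))) (count m (zcoord c (2 * t + 1))) = 0"
    unfolding z_moment_def by presburger
  then have "(\<Prod>t<length (zvecs c) div 2.
     z_moment (count m (zcoord c (2 * t))) (count m (zcoord c (2 * t + 1)))) = 0"
    using t(1) by (intro prod_zero) auto
  then show ?thesis by (simp add: moment_def)
qed

lemma moment_pair_add:
  assumes ab: "odd_pair a b" and m: "a \<notin># m" "b \<notin># m"
  shows "moment c (add_mset a (add_mset b m)) = fls_X * moment c m"
proof -
  obtain t where t: "t < length (zvecs c) div 2" and
    tab: "a = zcoord c (2 * t) \<and> b = zcoord c (2 * t + 1) \<or> b = zcoord c (2 * t) \<and> a = zcoord c (2 * t + 1)"
    using ab unfolding odd_pair_def by blast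
  let ?Z = "{..<length (zvecs c) div 2}" and ?m = "add_mset a (add_mset b m)"
  let ?z = "\<lambda>m t. z_moment (count m (zcoord c (2 * t))) (count m (zcoord c (2 * t + 1)))"
  have x: "(\<Prod>t<length (xvecs c). x_moment (eps c t) (count ?m (xcoord c t))) =
        (\<Prod>t<length (xvecs c). x_moment (eps c t) (count m (xcoord c t)))"
    using tab by (intro prod.cong refl) auto
  have split: "(\<Prod>t\<in>?Z. ?z m' t) = ?z m' t * (\<Prod>t\<in>?Z - {t}. ?z m' t)" for m'
    using t by (intro prod.remove) auto
  have r: "(\<Prod>t\<in>?Z - {t}. ?z ?m t) = (\<Prod>t\<in>?Z - {t}. ?z m t)"
  proof (intro prod.cong refl)
    fix t' assume "t' \<in> ?Z - {t}"
    then have "t \<noteq> t'" by simp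
    then have "2 * t \<noteq> 2 * t'" "2 * t \<noteq> 2 * t' + 1" "2 * t + 1 \<noteq> 2 * t'" "2 * t + 1 \<noteq> 2 * t' + 1"
      by presburger+
    then show "?z ?m t' = ?z m t'" using tab by auto
  qed
  have "?z ?m t = fls_X" "?z m t = 1"
    using tab m odd_pair_neq[OF ab] by (auto simp: z_moment_def not_in_iff)
  then show ?thesis
    unfolding moment_def x split[of ?m] split[of m] r by (simp add: mult_ac)
qed

lemma word_moment_Nil: "word_moment [] = 1"
  by (simp add: word_moment_def moment_def z_moment_def)

lemma word_moment_pair_cases:
  assumes "odd_pair a b"
  shows "word_moment [a, x] = (if x = b then fls_const (ksign P [a, b]) * fls_X else 0)"
proof (cases "x = b")
  case True
  have "moment c {#a, b#} = fls_X"
    using moment_pair_add[OF assms, of "{#}"] word_moment_Nil by (simp add: word_moment_def)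
  then show ?thesis using True by (simp add: word_moment_def)
next
  case False
  show ?thesis
  proof (cases "x = a")
    case True
    then show ?thesis using False odd_pair_odd[OF assms] by (simp add: word_moment_def ksign_Cons)
  next
    case neq: False
    then have "moment c (mset [a, x]) = 0"
      using False odd_pair_neq[OF assms] by (intro moment_pair_zero[OF assms]) auto
    then show ?thesis using False by (simp add: word_moment_def)
  qed
qed

lemma word_moment_x_cases:
  assumes "t < length (xvecs c)"
  shows "word_moment [xcoord c t, x] = (if x = xcoord c t then fls_const (eps c t) * fls_X else 0)"
  using moment_x[OF assms, of "{#x#}"] even_x[OF assms] word_moment_Nil
  by (auto simp: word_moment_def ksign_Cons moment_def)

lemma word_moment_parity:
  assumes "a \<in> lcoord c" "word_moment [a, b] \<noteq> 0"
  shows "P a \<longleftrightarrow> P b"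
  using assms(1)
proof (cases rule: lcoord_cases)
  case (1 t)
  then show ?thesis using assms(2) word_moment_x_cases[of t b] by (auto split: if_splits)
next
  case (2 b')
  then show ?thesis
    using assms(2) word_moment_pair_cases[OF 2, of b] odd_pair_odd[OF 2] odd_pair_odd[OF odd_pair_sym[OF 2]]
    by (auto split: if_splits)
qed

text \<open>One step of Wick's theorem: the first letter is contracted with every later one. For an
  even letter this is integration by parts. An odd letter contracts only with its partner, and the
  cases are distinguished by the number of occurrences of that partner in \<open>u\<close>.\<close>

lemma word_moment_recursion:
  assumes "a \<in> lcoord c"
  shows "word_moment (a # u) = (\<Sum>t<length u.
    fls_const (if P a then (-1) ^ length (filter P (take t u)) else 1) *
    word_moment [a, u ! t] * word_moment (take t u @ drop (Suc t) u))"
    (is "_ = (\<Sum>t<length u. ?F t)")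
  using assms
proof (cases rule: lcoord_cases)
  case (1 s)
  have ev: "\<not> P a" using even_x 1 by simp
  have F: "?F t = (if u ! t = a then fls_const (eps c s) * fls_X *
       (fls_const (ksign P u) * moment c (mset u - {#a#})) else 0)" if t: "t < length u" for t
  proof (cases "u ! t = a")
    case True
    then have u: "u = take t u @ a # drop (Suc t) u" using t by (metis id_take_nth_drop)
    have "mset (take t u @ drop (Suc t) u) = mset u - {#a#}"
      by (subst (3) u) simp
    moreover have "ksign P u = ksign P (take t u @ drop (Suc t) u)"
      using ksign_move[of P "[]" "take t u" a "drop (Suc t) u"] ev u by (simp add: ksign_Cons)
    ultimately show ?thesis
      using True ev word_moment_x_cases[OF 1(1), of a] 1(2) by (simp add: word_moment_def)
  next
    case False
    then show ?thesis using word_moment_x_cases[OF 1(1), of "u ! t"] 1(2) by simp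
  qed
  have "(\<Sum>t<length u. ?F t) = (\<Sum>t\<in>{t. t < length u \<and> u ! t = a}. fls_const (eps c s) * fls_X *
       (fls_const (ksign P u) * moment c (mset u - {#a#})))"
    by (simp add: F sum.inter_filter[symmetric] lessThan_def cong: conj_cong)
  also have "card {t. t < length u \<and> u ! t = a} = count (mset u) a"
    by (simp add: count_mset count_list_eq_length_filter length_filter_conv_card eq_commute)
  then have "(\<Sum>t\<in>{t. t < length u \<and> u ! t = a}. fls_const (eps c s) * fls_X *
       (fls_const (ksign P u) * moment c (mset u - {#a#}))) = of_nat (count (mset u) a) *
       (fls_const (eps c s) * fls_X * (fls_const (ksign P u) * moment c (mset u - {#a#})))"
    by simp
  also have "\<dots> = word_moment (a # u)"
    using moment_x[OF 1(1), of "mset u"] ev 1(2)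
    by (simp add: word_moment_def ksign_Cons fls_of_nat mult_ac flip: fls_const_mult_const)
  finally show ?thesis by simp
next
  case (2 b)
  have Pa: "P a" and Pb: "P b" using odd_pair_odd 2 odd_pair_sym by blast+
  have ab: "a \<noteq> b" using odd_pair_neq[OF 2] .
  have F0: "?F t = 0" if "u ! t \<noteq> b" for t
    using word_moment_pair_cases[OF 2, of "u ! t"] that by simp
  have split: "(\<Sum>t<length u. ?F t) = ?F (length p) + (\<Sum>t\<in>{..<length u} - {length p}. ?F t)"
    if "u = p @ b # s" for p s
    using that by (intro sum.remove) auto
  show ?thesis
  proof (cases "b \<in> set u")
    case False
    then have "(\<Sum>t<length u. ?F t) = 0" by (intro sum.neutral ballI F0) (use nth_mem in fastforce)
    moreover have "moment c (mset (a # u)) = 0"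
      using False ab by (intro moment_pair_zero[OF 2]) (auto simp: count_mset count_list_0_iff)
    ultimately show ?thesis by (simp add: word_moment_def)
  next
    case True
    then obtain p s' where u: "u = p @ b # s'" "b \<notin> set p" by (metis split_list_first)
    show ?thesis
    proof (cases "b \<in> set s'")
      case False
      \<comment> \<open>The partner occurs exactly once, so a single term survives.\<close>
      have "?F t = 0" if "t \<in> {..<length u} - {length p}" for t
      proof (rule F0)
        from that have "u ! t \<in> set p \<or> u ! t \<in> set s'"
          unfolding u by (auto simp: nth_append nth_Cons' intro!: nth_mem)
        then show "u ! t \<noteq> b" using u False by auto
      qed
      then have sum: "(\<Sum>t<length u. ?F t) = fls_const ((-1) ^ length (filter P p)) *
          (fls_const (ksign P [a, b]) * fls_X) * word_moment (p @ s')"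
      proof -
        have at_p: "u ! length p = b" "take (length p) u = p" "drop (Suc (length p)) u = s'"
          using u by auto
        have "(\<Sum>t\<in>{..<length u} - {length p}. ?F t) = 0"
          using \<open>\<And>t. t \<in> {..<length u} - {length p} \<Longrightarrow> ?F t = 0\<close> by (intro sum.neutral ballI)
        moreover have "word_moment [a, b] = fls_const (ksign P [a, b]) * fls_X"
          using word_moment_pair_cases[OF 2, of b] by simp
        ultimately show ?thesis
          using split[OF u(1)] Pa unfolding at_p by (simp only: if_True add_0_right)
      qed
      show ?thesis
      proof (cases "a \<in> set u")
        case True
        \<comment> \<open>A second \<open>a\<close> kills the left side as a repeated odd letter,
          and the right side because the remaining word contains \<open>a\<close> without its
          partner.\<close>
        then have "word_moment (a # u) = 0" using Pa by (simp add: word_moment_def ksign_Cons)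
        moreover have "moment c (mset (p @ s')) = 0"
          using True u False ab
          by (intro moment_pair_zero[OF 2]) (auto simp: count_mset count_list_0_iff)
        then have "word_moment (p @ s') = 0" by (simp add: word_moment_def)
        ultimately show ?thesis using sum by simp
      next
        case af: False
        then have nab: "a \<notin> set (p @ s')" "b \<notin> set (p @ s')" using u False by auto
        have "length (filter (\<lambda>x. P x \<and> x < a) (p @ s')) = length (filter (\<lambda>x. P x \<and> x < b) (p @ s'))"
          using nab odd_pair_less[OF 2] by (intro arg_cong[of _ _ length] filter_cong refl) metis
        then have "ksign P (a # b # p @ s') = ksign P [a, b] * ksign P (p @ s')"
          using nab Pa Pb ab by (auto simp: ksign_Cons simp flip: power_add power_mult_distrib)
        then have "ksign P (a # u) = (-1) ^ length (filter P p) * (ksign P [a, b] * ksign P (p @ s'))"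
          using ksign_move[of P "[a]" p b s'] Pb by (simp add: u)
        moreover have "moment c (mset (a # u)) = fls_X * moment c (mset (p @ s'))"
          using moment_pair_add[OF 2, of "mset (p @ s')"] nab by (simp add: u)
        ultimately show ?thesis
          unfolding sum by (simp add: word_moment_def mult_ac flip: fls_const_mult_const)
      qed
    next
      case True
      \<comment> \<open>The partner occurs at least twice. The left side is 0, and the terms of its
        first two occurrences cancel: the second occurrence must cross the first, which costs one
        extra sign.\<close>
      then obtain q s where s': "s' = q @ b # s" "b \<notin> set q" by (metis split_list_first)
      let ?n = "length p + Suc (length q)"
      have u2: "u = (p @ b # q) @ b # s" using u s' by simp
      have un: "u ! length p = b" "u ! ?n = b" "?n < length u"
      proof -
        show "u ! length p = b" using u by simp
        have "?n = length (p @ b # q)" by simp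
        then show "u ! ?n = b" unfolding u2 by (simp only: nth_append_length)
        show "?n < length u" unfolding u2 by simp
      qed
      have "ksign P (a # u) = 0"
        using Pa Pb u s' by (auto simp: ksign_def)
      then have lhs: "word_moment (a # u) = 0" by (simp add: word_moment_def)
      have sq: "ksign P (p @ q @ b # s) = (-1) ^ length (filter P q) * ksign P (p @ b # q @ s)"
        using ksign_move[of P p q b s] Pb by simp
      have "word_moment (p @ q @ b # s) = fls_const ((-1) ^ length (filter P q)) * word_moment (p @ b # q @ s)"
        unfolding word_moment_def sq by (simp add: mult_ac flip: fls_const_mult_const)
      moreover have "take (length p) u @ drop (Suc (length p)) u = p @ q @ b # s"
        "take ?n u @ drop (Suc ?n) u = p @ b # q @ s"
        "take (length p) u = p" "take ?n u = p @ b # q"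
        using u s' by auto
      ultimately have "?F (length p) + ?F ?n = 0"
        using Pa Pb un by (simp add: mult_ac power_add flip: fls_const_mult_const)
      \<comment> \<open>Any further occurrence leaves at least two copies of the odd letter
        \<open>b\<close> in the remaining word.\<close>
      moreover have "?F t = 0" if t: "t < length u" "t \<noteq> length p" "t \<noteq> ?n" for t
      proof (cases "u ! t = b")
        case True
        have "card {length p, ?n, t} \<le> card {i. i < length u \<and> u ! i = b}"
          using un t True by (intro card_mono) auto
        then have "count (mset u) b \<ge> 3"
          using t by (simp add: count_mset count_list_eq_length_filter length_filter_conv_card eq_commute)
        moreover have "mset (take t u @ drop (Suc t) u) = mset u - {#b#}"
          using t(1) True by (subst (3) id_take_nth_drop[OF t(1)]) simp
        ultimately have "count (mset (take t u @ drop (Suc t) u)) b \<ge> 2"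
          by simp
        then have "count (mset (filter P (take t u @ drop (Suc t) u))) b \<ge> 2"
          unfolding mset_filter using Pb by (simp only: count_filter_mset if_True)
        then have "\<not> distinct (filter P (take t u @ drop (Suc t) u))"
          unfolding distinct_count_atmost_1 by (metis Suc_1 not_less_eq_eq zero_le one_le_numeral le_numeral_extra(4))
        then have "ksign P (take t u @ drop (Suc t) u) = 0"
          using ksign_nonzero_iff by blast
        then show ?thesis by (simp add: word_moment_def)
      qed (rule F0)
      then have "(\<Sum>t<length u. ?F t) = (\<Sum>t\<in>{length p, ?n}. ?F t)"
        using un by (intro sum.mono_neutral_right) auto
      then have "(\<Sum>t<length u. ?F t) = ?F (length p) + ?F ?n" by simp
      ultimately show ?thesis using lhs by metis
    qed
  qed
qed

end

section \<open>Sorted enumerations of finite sets\<close>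

lemma sorted_list_of_set_unique': "sorted xs \<Longrightarrow> distinct xs \<Longrightarrow> set xs = A \<Longrightarrow> sorted_list_of_set A = xs"
  by (metis sorted_list_of_set.idem_if_sorted_distinct)

lemma filter_mset_all: "(\<And>x. x \<in># a \<Longrightarrow> R x) \<Longrightarrow> filter_mset R a = a"
  using filter_mset_cong[of a a R "\<lambda>_. True"] by simp

lemma filter_mset_none: "(\<And>x. x \<in># a \<Longrightarrow> \<not> R x) \<Longrightarrow> filter_mset R a = {#}"
  using filter_mset_cong[of a a R "\<lambda>_. False"] by simp

lemma sorted_list_of_set_remove_nth:
  assumes "finite R" "t < card R"
  shows "take t (sorted_list_of_set R) @ drop (Suc t) (sorted_list_of_set R) =
         sorted_list_of_set (R - {sorted_list_of_set R ! t})"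
proof (rule sorted_list_of_set_unique'[symmetric])
  let ?xs = "sorted_list_of_set R"
  have eq: "?xs = take t ?xs @ ?xs ! t # drop (Suc t) ?xs"
    using assms by (intro id_take_nth_drop) simp
  have "sorted (take t ?xs @ ?xs ! t # drop (Suc t) ?xs)"
    by (subst eq[symmetric]) simp
  then show "sorted (take t ?xs @ drop (Suc t) ?xs)"
    by (auto simp: sorted_append)
  have d: "distinct (take t ?xs @ ?xs ! t # drop (Suc t) ?xs)"
    by (subst eq[symmetric]) simp
  then show "distinct (take t ?xs @ drop (Suc t) ?xs)" by auto
  have "set (take t ?xs @ ?xs ! t # drop (Suc t) ?xs) = R"
    by (subst eq[symmetric]) (use assms in simp)
  then show "set (take t ?xs @ drop (Suc t) ?xs) = R - {?xs ! t}"
    using d by auto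
qed

text \<open>Turns the sign of the recursion, which counts odd letters before a position, into a
  count of smaller elements, as in \<open>ksign\<close>.\<close>

lemma length_filter_take_sorted:
  assumes "finite R" "t < card R"
  shows "length (filter Q (take t (sorted_list_of_set R))) =
         card {x\<in>R. Q x \<and> x < sorted_list_of_set R ! t}"
proof -
  let ?xs = "sorted_list_of_set R"
  have eq: "?xs = take t ?xs @ ?xs ! t # drop (Suc t) ?xs"
    using assms by (intro id_take_nth_drop) simp
  have s: "sorted (take t ?xs @ ?xs ! t # drop (Suc t) ?xs)" "distinct (take t ?xs @ ?xs ! t # drop (Suc t) ?xs)"
    by (subst eq[symmetric], simp)+
  have "set (take t ?xs @ ?xs ! t # drop (Suc t) ?xs) = R"
    by (subst eq[symmetric]) (use assms in simp)
  then have "set (filter Q (take t ?xs)) = {x\<in>R. Q x \<and> x < ?xs ! t}"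
    using s by (fastforce simp: sorted_append less_le)
  moreover have "card (set (filter Q (take t ?xs))) = length (filter Q (take t ?xs))"
    by (intro distinct_card) simp
  ultimately show ?thesis by metis
qed

section \<open>Wick's formula as a sum over pairings\<close>

context gaussian_coords begin

definition pairing_term :: "(nat \<Rightarrow> nat) \<Rightarrow> nat set \<Rightarrow> (nat \<Rightarrow> nat) \<Rightarrow> real fls" where
  "pairing_term k S \<tau> = (\<Prod>h\<in>{h\<in>S. h < \<tau> h}. word_moment [k h, k (\<tau> h)])"

text \<open>As \<open>h\<close> is the least half-edge, its edge is enumerated first, and the
  enumeration of the remaining edges is unchanged.\<close>

lemma pairing_insert:
  assumes S: "finite R" "\<And>x. x \<in> R \<Longrightarrow> h < x" and g: "g \<in> R" and \<tau>: "\<tau> \<in> pairings (R - {g})"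
  shows "pairing_edges (insert h R) (\<tau>(h := g, g := h)) = h # pairing_edges (R - {g}) \<tau>"
    and "pairing_term k (insert h R) (\<tau>(h := g, g := h)) =
         word_moment [k h, k g] * pairing_term k (R - {g}) \<tau>"
    and "pair_list (\<tau>(h := g, g := h)) (pairing_edges (insert h R) (\<tau>(h := g, g := h))) =
         h # g # pair_list \<tau> (pairing_edges (R - {g}) \<tau>)"
proof -
  let ?t = "\<tau>(h := g, g := h)"
  have h: "h \<notin> R" using S(2)[of h] by auto
  have hg: "h < g" using S(2) g by auto
  have eq: "{x\<in>insert h R. x < ?t x} = insert h {x\<in>R - {g}. x < \<tau> x}" (is "?A = insert h ?B")
    using h hg by auto
  have fin: "finite ?B" "h \<notin> ?B" using S(1) h by auto
  have "sorted_list_of_set (insert h ?B) = h # sorted_list_of_set ?B"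
    using fin S(2) by (intro sorted_list_of_set_unique') (auto simp: less_imp_le)
  then show E: "pairing_edges (insert h R) ?t = h # pairing_edges (R - {g}) \<tau>"
    unfolding pairing_edges_def eq .
  have ne: "x \<noteq> h \<and> x \<noteq> g" if "x \<in> ?B" for x using that h by auto
  have "pairing_term k (insert h R) ?t =
      word_moment [k h, k (?t h)] * (\<Prod>x\<in>?B. word_moment [k x, k (?t x)])"
    unfolding pairing_term_def eq using fin by simp
  also have "(\<Prod>x\<in>?B. word_moment [k x, k (?t x)]) = pairing_term k (R - {g}) \<tau>"
    unfolding pairing_term_def
  proof (intro prod.cong refl)
    fix x assume "x \<in> ?B"
    then show "word_moment [k x, k (?t x)] = word_moment [k x, k (\<tau> x)]"
      using ne[of x] by simp
  qed
  also have th: "?t h = g" using hg by simp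
  finally show "pairing_term k (insert h R) ?t = word_moment [k h, k g] * pairing_term k (R - {g}) \<tau>" .
  have same: "[x, ?t x] = [x, \<tau> x]" if "x \<in> set (sorted_list_of_set ?B)" for x
    using ne[of x] that S(1) by simp
  have "pair_list ?t (pairing_edges (R - {g}) \<tau>) = pair_list \<tau> (pairing_edges (R - {g}) \<tau>)"
    unfolding pair_list_def pairing_edges_def
    by (intro arg_cong[of _ _ concat] map_cong refl same)
  then show "pair_list ?t (pairing_edges (insert h R) ?t) = h # g # pair_list \<tau> (pairing_edges (R - {g}) \<tau>)"
    unfolding E pair_list_simps th by (simp only:)
qed

text \<open>Induction by removing the least half-edge \<open>h\<close> and its partner. In the
  recursion, contracting \<open>h\<close> with \<open>g\<close> costs the sign of the odd half-edges
  below \<open>g\<close>; in \<open>ksign\<close> of the edge word the leading \<open>h\<close> has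
  no inversions and \<open>g\<close> has exactly these.\<close>

theorem word_moment_wick:
  assumes "finite S" "\<And>h. h \<in> S \<Longrightarrow> k h \<in> lcoord c"
  shows "word_moment (map k (sorted_list_of_set S)) =
     (\<Sum>\<tau>\<in>pairings S. fls_const (ksign (\<lambda>h. P (k h)) (pair_list \<tau> (pairing_edges S \<tau>))) * pairing_term k S \<tau>)"
  using assms
proof (induction "card S" arbitrary: S rule: less_induct)
  case less
  let ?Q = "\<lambda>h. P (k h)"
  let ?T = "\<lambda>S \<tau>. fls_const (ksign ?Q (pair_list \<tau> (pairing_edges S \<tau>))) * pairing_term k S \<tau>"
  show ?case
  proof (cases "S = {}")
    case True
    have "pairings {} = {\<lambda>_. undefined}" by (auto simp: pairings_def)
    then show ?thesis
      using True by (simp add: word_moment_Nil pairing_edges_def pairing_term_def)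
  next
    case False
    define h where "h = Min S"
    define R where "R = S - {h}"
    have "h \<in> S" using False less.prems(1) by (simp add: h_def)
    then have hS: "S = insert h R" "h \<notin> R" "finite R"
      using less.prems(1) by (auto simp: R_def)
    have lt: "h < x" if "x \<in> R" for x
    proof -
      have "h \<le> x" using less.prems(1) that by (simp add: h_def R_def)
      then show ?thesis using that hS(2) by (metis le_neq_implies_less)
    qed
    let ?r = "sorted_list_of_set R"
    have "sorted_list_of_set S = h # ?r"
      using hS lt by (intro sorted_list_of_set_unique') (auto simp: less_imp_le)
    then have "word_moment (map k (sorted_list_of_set S)) =
      (\<Sum>t<length (map k ?r). fls_const (if P (k h) then (-1) ^ length (filter P (take t (map k ?r))) else 1) *
        word_moment [k h, map k ?r ! t] * word_moment (take t (map k ?r) @ drop (Suc t) (map k ?r)))"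
      using word_moment_recursion[of "k h" "map k ?r"] less.prems(2) hS by simp
    also have "\<dots> = (\<Sum>t<card R. fls_const (if ?Q h then (-1) ^ card {x\<in>R. ?Q x \<and> x < ?r ! t} else 1) *
        word_moment [k h, k (?r ! t)] * word_moment (map k (sorted_list_of_set (R - {?r ! t}))))"
    proof (intro sum.cong)
      fix t assume "t \<in> {..<card R}"
      then have t: "t < card R" by simp
      have "length (filter P (take t (map k ?r))) = length (filter ?Q (take t ?r))"
        by (simp add: take_map filter_map o_def)
      then show "fls_const (if P (k h) then (-1) ^ length (filter P (take t (map k ?r))) else 1) *
        word_moment [k h, map k ?r ! t] * word_moment (take t (map k ?r) @ drop (Suc t) (map k ?r)) =
        fls_const (if ?Q h then (-1) ^ card {x\<in>R. ?Q x \<and> x < ?r ! t} else 1) *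
        word_moment [k h, k (?r ! t)] * word_moment (map k (sorted_list_of_set (R - {?r ! t})))"
        using t hS length_filter_take_sorted[OF hS(3) t, of ?Q] sorted_list_of_set_remove_nth[OF hS(3) t]
        by (simp add: take_map drop_map flip: map_append)
    qed simp
    also have "\<dots> = (\<Sum>g\<in>R. fls_const (if ?Q h then (-1) ^ card {x\<in>R. ?Q x \<and> x < g} else 1) *
        word_moment [k h, k g] * word_moment (map k (sorted_list_of_set (R - {g}))))"
      by (rule sum.reindex_bij_betw, rule bij_betw_nth) (use hS in auto)
    also have "\<dots> = (\<Sum>g\<in>R. \<Sum>\<tau>\<in>pairings (R - {g}). ?T S (\<tau>(h := g, g := h)))"
    proof (rule sum.cong[OF refl])
      fix g assume g: "g \<in> R"
      let ?s = "fls_const (if ?Q h then (-1) ^ card {x\<in>R. ?Q x \<and> x < g} else 1) :: real fls"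
      have IH: "word_moment (map k (sorted_list_of_set (R - {g}))) = (\<Sum>\<tau>\<in>pairings (R - {g}). ?T (R - {g}) \<tau>)"
      proof (rule less.hyps)
        have "R - {g} \<subset> S" using g hS by auto
        then show "card (R - {g}) < card S" using less.prems(1) by (intro psubset_card_mono) auto
      qed (use hS less.prems(2) in auto)
      have "?s * word_moment [k h, k g] * ?T (R - {g}) \<tau> = ?T S (\<tau>(h := g, g := h))"
        if \<tau>: "\<tau> \<in> pairings (R - {g})" for \<tau>
      proof (cases "word_moment [k h, k g] = 0")
        case True
        then show ?thesis using pairing_insert(2)[OF hS(3) lt g \<tau>, of k] hS(1) by simp
      next
        case False
        \<comment> \<open>The recursion makes the sign depend on the parity of \<open>h\<close>,
          \<open>ksign\<close> on that of \<open>g\<close>; a non-zero contraction forces the two to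
          agree.\<close>
        then have q: "?Q h \<longleftrightarrow> ?Q g"
          using word_moment_parity[of "k h" "k g"] less.prems(2) hS by auto
        let ?w = "pair_list \<tau> (pairing_edges (R - {g}) \<tau>)"
        have w: "distinct ?w" "set ?w = R - {g}"
          using pairing_list_props[OF _ \<tau>] hS by auto
        have fh: "filter (\<lambda>b. ?Q b \<and> b < h) (g # ?w) = []"
          using w g lt by (auto simp: filter_empty_conv dest: less_asym)
        have "length (filter (\<lambda>b. ?Q b \<and> b < g) ?w) = card (set (filter (\<lambda>b. ?Q b \<and> b < g) ?w))"
          by (rule distinct_card[symmetric]) (use w in simp)
        also have "set (filter (\<lambda>b. ?Q b \<and> b < g) ?w) = {x\<in>R. ?Q x \<and> x < g}"
          using w by auto
        finally have len: "length (filter (\<lambda>b. ?Q b \<and> b < g) ?w) = card {x\<in>R. ?Q x \<and> x < g}" .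
        have "h \<notin> set (g # ?w)" "g \<notin> set ?w" using w g hS by auto
        then have "ksign ?Q (h # g # ?w) = (if ?Q h then (-1) ^ card {x\<in>R. ?Q x \<and> x < g} else 1) * ksign ?Q ?w"
          unfolding ksign_Cons[of ?Q h] fh ksign_Cons[of ?Q g] len using q by simp
        then show ?thesis
          using pairing_insert(2,3)[OF hS(3) lt g \<tau>] hS(1)
          by (simp add: mult_ac flip: fls_const_mult_const)
      qed
      then show "?s * word_moment [k h, k g] * word_moment (map k (sorted_list_of_set (R - {g}))) =
          (\<Sum>\<tau>\<in>pairings (R - {g}). ?T S (\<tau>(h := g, g := h)))"
        unfolding IH sum_distrib_left by (intro sum.cong refl)
    qed
    also have "\<dots> = (\<Sum>(g, \<tau>)\<in>Sigma R (\<lambda>g. pairings (R - {g})). ?T S (\<tau>(h := g, g := h)))"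
      using hS by (intro sum.Sigma) (auto intro: finite_pairings)
    also have "\<dots> = (\<Sum>\<tau>\<in>pairings S. ?T S \<tau>)"
      unfolding hS(1) by (rule sum_pairings_insert[symmetric]) (use hS in auto)
    finally show ?thesis .
  qed
qed

text \<open>Each contraction removes two letters of equal parity. The integrated part is therefore
  even, and homology letters can be moved past it without a sign.\<close>

lemma word_moment_even:
  assumes "set u \<subseteq> lcoord c" "word_moment u \<noteq> 0"
  shows "even (length (filter P u))"
  using assms
proof (induction "length u" arbitrary: u rule: less_induct)
  case less
  show ?case
  proof (cases u)
    case (Cons a v)
    have a: "a \<in> lcoord c" using less.prems(1) Cons by simp
    have "(\<Sum>t<length v. fls_const (if P a then (-1) ^ length (filter P (take t v)) else 1) *
        word_moment [a, v ! t] * word_moment (take t v @ drop (Suc t) v)) \<noteq> 0"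
      using less.prems(2) unfolding Cons word_moment_recursion[OF a, of v] .
    then obtain t where "t \<in> {..<length v}"
      "fls_const (if P a then (-1) ^ length (filter P (take t v)) else 1) *
        word_moment [a, v ! t] * word_moment (take t v @ drop (Suc t) v) \<noteq> 0"
      by (rule sum.not_neutral_contains_not_neutral)
    then have t: "t < length v" "word_moment [a, v ! t] \<noteq> 0"
      "word_moment (take t v @ drop (Suc t) v) \<noteq> 0"
      unfolding mult_eq_0_iff by blast+
    have "even (length (filter P (take t v @ drop (Suc t) v)))"
    proof (rule less.hyps)
      show "set (take t v @ drop (Suc t) v) \<subseteq> lcoord c"
        using less.prems(1) Cons by (auto dest: in_set_takeD in_set_dropD)
    qed (use t Cons in auto)
    moreover have "filter P v = filter P (take t v @ v ! t # drop (Suc t) v)"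
      by (rule arg_cong[OF id_take_nth_drop[OF t(1)]])
    then have "length (filter P v) =
        length (filter P (take t v)) + (if P (v ! t) then 1 else 0) + length (filter P (drop (Suc t) v))"
      by simp
    ultimately show ?thesis
      using word_moment_parity[OF a t(2)] by (auto simp: Cons)
  qed simp
qed

section \<open>Symmetry and parity of the propagator\<close>

lemma word_moment_swap:
  "word_moment [b, a] = fls_const (if P a \<and> P b then -1 else 1) * word_moment [a, b]"
proof -
  have k: "ksign P [b, a] = (if P a \<and> P b then -1 else 1) * ksign P [a, b]"
    using ksign_swap[of P "[]" b a "[]"] unfolding append_Nil conj_commute[of "P b"] .
  have m: "mset [b, a] = mset [a, b]"
    unfolding mset.simps by (rule add_mset_commute)
  show ?thesis
    unfolding word_moment_def k m by (simp only: mult.assoc flip: fls_const_mult_const)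
qed

text \<open>Every contraction carries one factor \<open>\<hbar>\<close>; this is how the number of
  edges enters the exponent.\<close>

lemma word_moment_pair_sigma_inv:
  assumes "a \<in> lcoord c" "b \<in> lcoord c"
  shows "word_moment [a, b] = fls_X * fls_const (sigma_inv W c a b)"
proof -
  have disj: "hcoord c \<inter> lcoord c = {}"
    by (auto simp: hcoord_def lcoord_def xcoord_def zcoord_def)
  have "gauss_integral W c (word_fun P [a, b]) {#} =
      (if mset [a, b] \<in> monomials P (lcoord c) then integral_term c (word_fun P [a, b]) (mset [a, b]) {#} else 0)"
    unfolding gauss_integral_def
    by (rule formal_sum_single) (auto simp: integral_term_def word_fun_def)
  also have "\<dots> = word_moment [a, b]"
  proof (cases "mset [a, b] \<in> monomials P (lcoord c)")
    case False
    then have "ksign P [a, b] = 0"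
      using assms by (auto simp: monomials_def ksign_Cons split: if_splits)
    then show ?thesis using False by (simp add: word_moment_def)
  qed (simp add: integral_term_def word_fun_def word_moment_def)
  finally show ?thesis
    using sigma_inv_wick[OF assms even_length_z, of W] by (simp add: fscale_def)
qed

lemma sigma_inv_parity:
  assumes "a \<in> lcoord c" "b \<in> lcoord c" "sigma_inv W c a b \<noteq> 0"
  shows "P a \<longleftrightarrow> P b"
  using word_moment_parity[of a b] word_moment_pair_sigma_inv[of a b] assms by simp

lemma sigma_inv_swap:
  assumes "a \<in> lcoord c" "b \<in> lcoord c"
  shows "sigma_inv W c b a = (if P a \<and> P b then -1 else 1) * sigma_inv W c a b"
proof -
  have "fls_X * fls_const (sigma_inv W c b a) =
      fls_X * fls_const ((if P a \<and> P b then -1 else 1) * sigma_inv W c a b)"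
    using word_moment_swap[of b a] word_moment_pair_sigma_inv[OF assms] word_moment_pair_sigma_inv[OF assms(2,1)]
    by (simp add: mult_ac)
  from arg_cong[OF this, of "\<lambda>F. fls_nth F 1"] show ?thesis
    by (simp only: fls_X_times_conv_shift fls_shift_nth) simp
qed

text \<open>The part of the integral that comes from monomials of total degree \<open>N\<close>. It
  is a finite sum, hence linear without any summability condition, and \<open>N\<close> becomes the
  number of half-edges.\<close>

definition degree_integral :: "nat \<Rightarrow> ffun \<Rightarrow> nat multiset \<Rightarrow> real fls" where
  "degree_integral N E a =
     (\<Sum>b\<in>{b\<in>monomials P (lcoord c). size a + size b = N}. integral_term c E b a)"

lemma finite_lcoord: "finite (lcoord c)"
  by (simp add: lcoord_def)

lemma finite_hcoord: "finite (hcoord c)"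
  by (simp add: hcoord_def)

lemma hcoord_less_lcoord: "x \<in> hcoord c \<Longrightarrow> y \<in> lcoord c \<Longrightarrow> x < y"
  by (auto simp: hcoord_def lcoord_def xcoord_def zcoord_def)

lemma finite_bounded_multisets: "finite A \<Longrightarrow> finite {b. set_mset b \<subseteq> A \<and> size b \<le> n}"
proof (rule finite_subset)
  show "{b. set_mset b \<subseteq> A \<and> size b \<le> n} \<subseteq> mset ` {xs. set xs \<subseteq> A \<and> length xs \<le> n}"
    by (auto simp: image_iff) (metis ex_mset set_mset_mset size_mset)
qed (auto intro: finite_lists_length_le)

text \<open>Homology coordinates have the smaller numbers, so normal order puts \<open>w\<close>
  before \<open>u\<close>. The sign of exchanging the two blocks is trivial, because the moment of
  \<open>u\<close> vanishes unless \<open>u\<close> has an even number of odd letters.\<close>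

lemma degree_integral_word:
  assumes u: "set u \<subseteq> lcoord c" and w: "set w \<subseteq> hcoord c"
  shows "degree_integral (length u + length w) (word_fun P (u @ w)) a = word_moment u * word_fun P w a"
proof -
  let ?B = "{b\<in>monomials P (lcoord c). size a + size b = length u + length w}"
  have fin: "finite ?B"
    by (rule finite_subset[OF _ finite_bounded_multisets[OF finite_lcoord, of "length u + length w"]])
      (auto simp: monomials_def)
  \<comment> \<open>Filtering by \<open>hcoord c\<close> recovers the homology part of a monomial,
    so at most one \<open>b\<close> can match.\<close>
  have split: "a = mset w \<and> b = mset u"
    if "set_mset a \<subseteq> hcoord c" "set_mset b \<subseteq> lcoord c" "a + b = mset (u @ w)" for b
  proof -
    have d: "x \<notin> lcoord c" if "x \<in> hcoord c" for x using hcoord_less_lcoord[OF that] by blast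
    have "filter_mset (\<lambda>x. x \<in> hcoord c) a = a"
      "filter_mset (\<lambda>x. x \<in> hcoord c) (mset w) = mset w"
      using that(1) w by (auto intro!: filter_mset_all)
    moreover have "filter_mset (\<lambda>x. x \<in> hcoord c) b = {#}"
      "filter_mset (\<lambda>x. x \<in> hcoord c) (mset u) = {#}"
      using that(2) u d by (auto intro!: filter_mset_none)
    ultimately have "filter_mset (\<lambda>x. x \<in> hcoord c) (a + b) = a"
      "filter_mset (\<lambda>x. x \<in> hcoord c) (mset (u @ w)) = mset w"
      by (simp_all only: filter_union_mset mset_append add_0_left add_0_right)
    then have "a = mset w" using that(3) by simp
    then show ?thesis using that(3) by simp
  qed
  have "integral_term c (word_fun P (u @ w)) b a =
      (if b = mset u then (if a = mset w then fls_const (ksign P (u @ w)) * moment c (mset u) else 0) else 0)"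
    if b: "b \<in> ?B" for b
  proof (cases "set_mset a \<subseteq> hcoord c \<and> a + b = mset (u @ w)")
    case True
    then have "a = mset w" "b = mset u" using split[of b] b by (auto simp: monomials_def)
    then show ?thesis using True by (simp only: integral_term_def word_fun_def simp_thms if_True)
  next
    case False
    have "\<not> (b = mset u \<and> a = mset w)"
    proof
      assume "b = mset u \<and> a = mset w"
      then show False using False w by simp
    qed
    then show ?thesis using False unfolding integral_term_def word_fun_def by (simp del: mset_append)
  qed
  then have "degree_integral (length u + length w) (word_fun P (u @ w)) a =
      (if mset u \<in> ?B \<and> a = mset w then fls_const (ksign P (u @ w)) * moment c (mset u) else 0)"
  proof -
    assume *: "\<And>b. b \<in> ?B \<Longrightarrow> integral_term c (word_fun P (u @ w)) b a =
      (if b = mset u then (if a = mset w then fls_const (ksign P (u @ w)) * moment c (mset u) else 0) else 0)"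
    have "degree_integral (length u + length w) (word_fun P (u @ w)) a = (\<Sum>b\<in>?B.
      (if b = mset u then (if a = mset w then fls_const (ksign P (u @ w)) * moment c (mset u) else 0) else 0))"
      unfolding degree_integral_def by (intro sum.cong refl *)
    then show ?thesis using fin by (simp only: sum.delta) simp
  qed
  also have "\<dots> = (if a = mset w then fls_const (ksign P (u @ w)) * moment c (mset u) else 0)"
  proof (cases "mset u \<in> monomials P (lcoord c)")
    case False
    then obtain j where "j \<in> set u" "P j" "count (mset u) j \<noteq> 1"
      using u by (auto simp: monomials_def)
    have "\<not> distinct (filter P u)"
    proof
      assume "distinct (filter P u)"
      then have "count (mset (filter P u)) j = 1"
        using \<open>j \<in> set u\<close> \<open>P j\<close> by (simp only: distinct_count_atmost_1) simp
      then show False using \<open>P j\<close> \<open>count (mset u) j \<noteq> 1\<close> by simp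
    qed
    then have "ksign P (u @ w) = 0"
      using ksign_append_zero ksign_nonzero_iff by blast
    then show ?thesis by simp
  qed simp
  also have "\<dots> = word_moment u * word_fun P w a"
  proof -
    have "ksign P (u @ w) = (-1) ^ (length (filter P u) * length (filter P w)) * ksign P (w @ u)"
      using ksign_swap_blocks[of P "[]" u w "[]"] by simp
    also have "ksign P (w @ u) = ksign P w * ksign P u"
      by (rule ksign_append_less) (use u w hcoord_less_lcoord in blast)
    finally have eq: "ksign P (u @ w) = (-1) ^ (length (filter P u) * length (filter P w)) * (ksign P w * ksign P u)" .
    have "fls_const (ksign P (u @ w)) * moment c (mset u) =
        fls_const ((-1) ^ (length (filter P u) * length (filter P w)) * ksign P w) * word_moment u"
      unfolding eq word_moment_def by (simp only: mult_ac flip: fls_const_mult_const)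
    also have "\<dots> = fls_const (ksign P w) * word_moment u"
      using word_moment_even[OF u] by (cases "word_moment u = 0") auto
    finally show ?thesis by (simp add: word_fun_def mult.commute)
  qed
  finally show ?thesis .
qed

lemma degree_integral_perm:
  assumes "mset u = mset v"
  shows "fls_const (ksign (\<lambda>h. P (k h)) u) * degree_integral N (word_fun P (map k u)) a =
         fls_const (ksign (\<lambda>h. P (k h)) v) * degree_integral N (word_fun P (map k v)) a"
proof -
  have "ksign (\<lambda>h. P (k h)) u * ksign P (map k u) = ksign (\<lambda>h. P (k h)) v * ksign P (map k v)"
    using ksign_map_perm[OF assms, of P k "[]" "[]" "[]" "[]"] by simp
  moreover have "mset (map k u) = mset (map k v)" using assms by simp
  ultimately have "fls_const (ksign (\<lambda>h. P (k h)) u) * integral_term c (word_fun P (map k u)) b a =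
      fls_const (ksign (\<lambda>h. P (k h)) v) * integral_term c (word_fun P (map k v)) b a" for b
    unfolding integral_term_def word_fun_def
    by (simp flip: fls_const_mult_const mult.assoc) (simp add: fls_const_mult_const)
  then show ?thesis unfolding degree_integral_def sum_distrib_left by simp
qed

text \<open>The word is rearranged to the inner half-edges in increasing order followed by the legs.
  Reordering the inner ones into edge pairs then turns the Wick sign into the sign of the full
  target word.\<close>

theorem degree_integral_wick:
  assumes zs: "distinct zs" and k: "\<And>h. h \<in> set zs \<Longrightarrow> k h \<in> hcoord c \<union> lcoord c"
  defines "I \<equiv> {h\<in>set zs. k h \<in> lcoord c}" and "Lg \<equiv> sorted_list_of_set {h\<in>set zs. k h \<in> hcoord c}"
  shows "degree_integral (length zs) (word_fun P (map k zs)) a =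
    (\<Sum>\<tau>\<in>pairings I. fls_const (ksign (\<lambda>h. P (k h)) zs *
         ksign (\<lambda>h. P (k h)) (pair_list \<tau> (pairing_edges I \<tau>) @ Lg)) *
       pairing_term k I \<tau> * word_fun P (map k Lg) a)"
proof -
  let ?Q = "\<lambda>h. P (k h)" and ?in = "sorted_list_of_set I"
  have disj: "x \<notin> lcoord c" if "x \<in> hcoord c" for x using hcoord_less_lcoord[OF that] by blast
  have fin: "finite I" by (simp add: I_def)
  have sets: "set ?in = I" "set Lg = {h\<in>set zs. k h \<in> hcoord c}" "distinct Lg"
    using fin by (auto simp: Lg_def)
  have d: "distinct (?in @ Lg)" "set (?in @ Lg) = set zs"
    using sets k disj by (auto simp: I_def)
  have m: "mset zs = mset (?in @ Lg)"
    using set_eq_iff_mset_eq_distinct[of zs "?in @ Lg"] d zs by simp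
  have len: "length zs = length (map k ?in) + length (map k Lg)"
    using mset_eq_length[OF m] by simp
  \<comment> \<open>The square of \<open>ksign ?Q zs\<close> is 1, as the half-edges are distinct;
    one factor pays for the rearrangement, the other remains as the source sign.\<close>
  have "degree_integral (length zs) (word_fun P (map k zs)) a =
      fls_const (ksign ?Q zs * ksign ?Q zs) * degree_integral (length zs) (word_fun P (map k zs)) a"
    using zs by simp
  also have "\<dots> = fls_const (ksign ?Q zs) *
      (fls_const (ksign ?Q (?in @ Lg)) * degree_integral (length zs) (word_fun P (map k (?in @ Lg))) a)"
    using degree_integral_perm[OF m, of k "length zs" a]
    by (simp add: mult.assoc flip: fls_const_mult_const)
  also have "degree_integral (length zs) (word_fun P (map k (?in @ Lg))) a =
      word_moment (map k ?in) * word_fun P (map k Lg) a"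
    unfolding len map_append by (rule degree_integral_word) (use sets in \<open>auto simp: I_def\<close>)
  also have "word_moment (map k ?in) = (\<Sum>\<tau>\<in>pairings I.
      fls_const (ksign ?Q (pair_list \<tau> (pairing_edges I \<tau>))) * pairing_term k I \<tau>)"
    using fin by (intro word_moment_wick) (auto simp: I_def)
  also have "fls_const (ksign ?Q zs) * (fls_const (ksign ?Q (?in @ Lg)) * ((\<Sum>\<tau>\<in>pairings I.
      fls_const (ksign ?Q (pair_list \<tau> (pairing_edges I \<tau>))) * pairing_term k I \<tau>) * word_fun P (map k Lg) a)) =
    (\<Sum>\<tau>\<in>pairings I. fls_const (ksign ?Q zs * (ksign ?Q (?in @ Lg) *
         ksign ?Q (pair_list \<tau> (pairing_edges I \<tau>)))) *
       pairing_term k I \<tau> * word_fun P (map k Lg) a)"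
    unfolding sum_distrib_left sum_distrib_right
    by (intro sum.cong refl) (simp only: mult.assoc flip: fls_const_mult_const)
  also have "\<dots> = (\<Sum>\<tau>\<in>pairings I. fls_const (ksign ?Q zs * ksign ?Q (pair_list \<tau> (pairing_edges I \<tau>) @ Lg)) *
       pairing_term k I \<tau> * word_fun P (map k Lg) a)"
  proof (rule sum.cong[OF refl])
    fix \<tau> assume \<tau>: "\<tau> \<in> pairings I"
    let ?p = "pair_list \<tau> (pairing_edges I \<tau>)"
    have p: "distinct ?p" "set ?p = I" using pairing_list_props[OF fin \<tau>] by auto
    then have mp: "mset ?in = mset ?p" using set_eq_iff_mset_eq_distinct[of ?in ?p] sets by simp
    have "ksign ?Q (?in @ Lg) * ksign ?Q ?in = ksign ?Q (?p @ Lg) * ksign ?Q ?p"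
      using ksign_map_perm[OF mp, of ?Q "\<lambda>h. h" "[]" Lg "[]" "[]"] by simp
    moreover have "ksign ?Q ?in = 1" by (rule ksign_sorted) auto
    ultimately have "ksign ?Q (?in @ Lg) * ksign ?Q ?p = ksign ?Q (?p @ Lg) * (ksign ?Q ?p * ksign ?Q ?p)"
      by simp
    then have "ksign ?Q (?in @ Lg) * ksign ?Q ?p = ksign ?Q (?p @ Lg)"
      using p by simp
    then show "fls_const (ksign ?Q zs * (ksign ?Q (?in @ Lg) * ksign ?Q ?p)) *
       pairing_term k I \<tau> * word_fun P (map k Lg) a =
      fls_const (ksign ?Q zs * ksign ?Q (?p @ Lg)) * pairing_term k I \<tau> * word_fun P (map k Lg) a"
      by simp
  qed
  finally show ?thesis .
qed

end

section \<open>Contractions do not depend on choices\<close>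

text \<open>Stability is kept apart, because contractions are also needed for graphs assembled from
  arbitrary labelled data.\<close>

definition wf_graph :: "sgraph \<Rightarrow> bool" where
  "wf_graph G \<longleftrightarrow>
     finite (halves G) \<and> finite (verts G) \<and> att G ` halves G \<subseteq> verts G \<and>
     flip G ` halves G \<subseteq> halves G \<and> (\<forall>h\<in>halves G. flip G (flip G h) = h)"

lemma stable_graph_wf: "stable_graph G \<Longrightarrow> wf_graph G"
  by (simp add: stable_graph_def wf_graph_def)

definition inner_halves :: "sgraph \<Rightarrow> nat set" where
  "inner_halves G = {h\<in>halves G. flip G h \<noteq> h}"

definition leg_halves :: "sgraph \<Rightarrow> nat set" where
  "leg_halves G = {h\<in>halves G. flip G h = h}"

text \<open>The lists used in \<open>contraction\<close> depend on the numbering of the half-edges,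
  which an isomorphism need not respect. Arbitrary edge representatives, leg orders and orders at
  the vertices make transport along isomorphisms possible.\<close>

definition edge_choice :: "sgraph \<Rightarrow> nat list \<Rightarrow> bool" where
  "edge_choice G E \<longleftrightarrow> distinct E \<and> set E \<inter> flip G ` set E = {} \<and>
     set E \<union> flip G ` set E = inner_halves G"

definition leg_choice :: "sgraph \<Rightarrow> nat list \<Rightarrow> bool" where
  "leg_choice G Lg \<longleftrightarrow> distinct Lg \<and> set Lg = leg_halves G"

definition vertex_choice :: "sgraph \<Rightarrow> (nat \<Rightarrow> nat list) \<Rightarrow> bool" where
  "vertex_choice G L \<longleftrightarrow>
     (\<forall>v\<in>verts G. distinct (L v) \<and> set (L v) = {h\<in>halves G. att G h = v})"

lemma filter_sorted_list_of_set:
  "finite A \<Longrightarrow> filter R (sorted_list_of_set A) = sorted_list_of_set {x\<in>A. R x}"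
  by (rule sorted_list_of_set_unique'[symmetric]) (auto simp: sorted_wrt_filter)

lemma edge_choice_edge_list:
  assumes "wf_graph G"
  shows "edge_choice G (edge_list G)"
proof -
  have fl: "flip G h \<in> halves G" "flip G (flip G h) = h" if "h \<in> halves G" for h
    using assms that by (auto simp: wf_graph_def)
  have E: "set (edge_list G) = {h\<in>halves G. h < flip G h}" "distinct (edge_list G)"
    using assms by (auto simp: edge_list_def wf_graph_def)
  have "h \<in> set (edge_list G) \<union> flip G ` set (edge_list G)" if h: "h \<in> inner_halves G" for h
  proof (cases "h < flip G h")
    case False
    then have "flip G h \<in> set (edge_list G)" "h = flip G (flip G h)"
      using h fl unfolding E by (auto simp: inner_halves_def)
    then show ?thesis by blast
  qed (use h in \<open>auto simp: E inner_halves_def\<close>)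
  moreover have "set (edge_list G) \<union> flip G ` set (edge_list G) \<subseteq> inner_halves G"
    using fl by (auto simp: E inner_halves_def)
  moreover have "set (edge_list G) \<inter> flip G ` set (edge_list G) = {}"
    using fl by (auto simp: E)
  ultimately show ?thesis
    using E(2) unfolding edge_choice_def by blast
qed

lemma leg_choice_leg_list: "wf_graph G \<Longrightarrow> leg_choice G (leg_list G)"
  by (auto simp: leg_choice_def leg_list_def leg_halves_def wf_graph_def)

lemma vertex_choice_inner_legs: "wf_graph G \<Longrightarrow> vertex_choice G (\<lambda>v. inner_at G v @ legs_at G v)"
  by (auto simp: vertex_choice_def inner_at_def legs_at_def wf_graph_def)

lemma edge_choice_props:
  assumes G: "wf_graph G" and E: "edge_choice G E"
  shows "distinct (pair_list (flip G) E)" "set (pair_list (flip G) E) = inner_halves G"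
    "h \<in> set E \<Longrightarrow> h \<in> inner_halves G \<and> flip G h \<in> inner_halves G \<and> flip G (flip G h) = h"
proof -
  show "distinct (pair_list (flip G) E)"
    using assms by (intro distinct_pair_list[of _ "inner_halves G"])
      (auto simp: edge_choice_def wf_graph_def inner_halves_def)
  show "set (pair_list (flip G) E) = inner_halves G"
    using E by (simp add: set_pair_list edge_choice_def)
  show "h \<in> inner_halves G \<and> flip G h \<in> inner_halves G \<and> flip G (flip G h) = h" if "h \<in> set E"
    using assms that by (auto simp: edge_choice_def wf_graph_def inner_halves_def)
qed

lemma choice_lists:
  assumes G: "wf_graph G" and E: "edge_choice G E" and Lg: "leg_choice G Lg"
  shows "distinct (pair_list (flip G) E @ Lg)" "set (pair_list (flip G) E @ Lg) = halves G"
  using edge_choice_props[OF G E] Lg by (auto simp: leg_choice_def inner_halves_def leg_halves_def)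

lemma vertex_choice_lists:
  assumes G: "wf_graph G" and L: "vertex_choice G L" and vs: "distinct vs" "set vs = verts G"
  shows "distinct (concat (map L vs))" "set (concat (map L vs)) = halves G"
proof -
  have "distinct (concat (map L us))" if "distinct us" "set us \<subseteq> verts G" for us
    using that
  proof (induction us)
    case (Cons v us)
    have "set (L v) \<inter> set (concat (map L us)) = {}"
    proof -
      have "set (L u) \<inter> set (L v) = {}" if "u \<in> set us" for u
        using that Cons.prems L unfolding vertex_choice_def by fastforce
      then show ?thesis by auto
    qed
    then show ?case using Cons L by (auto simp: vertex_choice_def)
  qed simp
  then show "distinct (concat (map L vs))" using vs by simp
  show "set (concat (map L vs)) = halves G"
    using L vs G unfolding vertex_choice_def wf_graph_def by auto
qed

lemma colouring_coords:
  assumes "k \<in> colourings c G"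
  shows "h \<in> inner_halves G \<Longrightarrow> k h \<in> lcoord c" "h \<in> leg_halves G \<Longrightarrow> k h \<in> hcoord c"
  using assms by (auto simp: colourings_def inner_halves_def leg_halves_def dest!: PiE_mem)

abbreviation vertex_weight :: "(nat \<Rightarrow> bool) \<Rightarrow> ffun \<Rightarrow> nat \<Rightarrow> nat list \<Rightarrow> real" where
  "vertex_weight P f g w \<equiv> vertex_tensor P f g w []"

text \<open>The tensor sees only the concatenated word, so inner half-edges and legs at a vertex may
  be treated as one list.\<close>

lemma vertex_tensor_map:
  "vertex_tensor P f g (map k u) (map k w) = vertex_weight P f g (map k (u @ w))"
  by (simp add: vertex_tensor_def)

section \<open>Invariance of contractions under the auxiliary choices\<close>

context gaussian_coords begin

definition choice_term ::
  "ffun \<Rightarrow> sgraph \<Rightarrow> nat list \<Rightarrow> (nat \<Rightarrow> nat list) \<Rightarrow> nat list \<Rightarrow> nat list \<Rightarrow> (nat \<Rightarrow> nat) \<Rightarrow> ffun" where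
  "choice_term f G vs L E Lg k =
     fscale (fls_const (reorder_sign (\<lambda>h. P (k h)) (concat (map L vs)) (pair_list (flip G) E @ Lg) *
        (\<Prod>v\<in>set vs. vertex_weight P f (genus G v) (map k (L v))) *
        (\<Prod>h\<in>set E. sigma_inv W c (k h) (k (flip G h)))))
      (word_fun P (map k Lg))"

text \<open>The graded symmetry of the vertex tensors absorbs the sign of reordering the half-edges
  at each vertex.\<close>

lemma source_perm:
  assumes vs: "distinct vs" and L: "\<And>v. v \<in> set vs \<Longrightarrow> mset (L v) = mset (L' v)"
  shows "ksign (\<lambda>h. P (k h)) (concat (map L vs)) * (\<Prod>v\<in>set vs. vertex_weight P f (g v) (map k (L v))) =
         ksign (\<lambda>h. P (k h)) (concat (map L' vs)) * (\<Prod>v\<in>set vs. vertex_weight P f (g v) (map k (L' v)))"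
proof -
  let ?r = "\<lambda>w g. (\<Prod>x\<in>set_mset (mset w). fact (count (mset w) x)) * fls_nth (f (mset w)) (int g)"
  have w: "vertex_weight P f g w = ksign P w * ?r w g" for g w
    by (simp add: vertex_tensor_def)
  have "(\<Prod>v\<in>set vs. ?r (map k (L v)) (g v)) = (\<Prod>v\<in>set vs. ?r (map k (L' v)) (g v))"
    using L by (intro prod.cong refl) (simp only: mset_map)
  moreover have "ksign (\<lambda>h. P (k h)) (concat (map L vs)) * (\<Prod>v\<in>set vs. ksign P (map k (L v))) =
      ksign (\<lambda>h. P (k h)) (concat (map L' vs)) * (\<Prod>v\<in>set vs. ksign P (map k (L' v)))"
    using ksign_blocks[of vs L L' P k "[]" "[]"] L vs by (simp add: prod.distinct_set_conv_list)
  ultimately show ?thesis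
    unfolding w prod.distrib by (simp only: mult.assoc[symmetric])
qed

lemma legs_perm:
  assumes "mset Lg = mset Lg'"
  shows "fscale (fls_const (ksign (\<lambda>h. P (k h)) (p @ Lg))) (word_fun P (map k Lg)) =
         fscale (fls_const (ksign (\<lambda>h. P (k h)) (p @ Lg'))) (word_fun P (map k Lg'))"
proof
  fix m
  have "mset (map k Lg) = mset (map k Lg')" using assms by simp
  moreover have "ksign (\<lambda>h. P (k h)) (p @ Lg) * ksign P (map k Lg) =
      ksign (\<lambda>h. P (k h)) (p @ Lg') * ksign P (map k Lg')"
    using ksign_map_perm[OF assms, of P k p "[]" "[]" "[]"] by simp
  ultimately show "fscale (fls_const (ksign (\<lambda>h. P (k h)) (p @ Lg))) (word_fun P (map k Lg)) m =
      fscale (fls_const (ksign (\<lambda>h. P (k h)) (p @ Lg'))) (word_fun P (map k Lg')) m"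
    by (simp add: fscale_def word_fun_def fls_const_mult_const)
qed

text \<open>\<open>sigma_inv\<close> couples only coordinates of equal parity, so each pair of
  half-edges with a non-zero factor is even and commutes with the other pairs.\<close>

lemma edges_perm:
  assumes k: "\<And>h. h \<in> set E \<Longrightarrow> k h \<in> lcoord c \<and> k (fl h) \<in> lcoord c"
    and eq: "mset E = mset E'"
  shows "ksign (\<lambda>h. P (k h)) (pair_list fl E @ Lg) * (\<Prod>h\<leftarrow>E. sigma_inv W c (k h) (k (fl h))) =
         ksign (\<lambda>h. P (k h)) (pair_list fl E' @ Lg) * (\<Prod>h\<leftarrow>E'. sigma_inv W c (k h) (k (fl h)))"
proof (rule swap_invariant[OF _ eq])
  fix xs a b ys
  let ?Q = "\<lambda>h. P (k h)" and ?S = "\<lambda>h. sigma_inv W c (k h) (k (fl h))"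
  assume "mset (xs @ a # b # ys) = mset E"
  then have "a \<in> set E" by (metis in_set_conv_decomp set_mset_mset)
  then have "k a \<in> lcoord c" "k (fl a) \<in> lcoord c" using k by auto
  then have par: "?Q a \<longleftrightarrow> ?Q (fl a)" if "?S a \<noteq> 0"
    using sigma_inv_parity that by blast
  have "ksign ?Q (pair_list fl (xs @ a # b # ys) @ Lg) = ksign ?Q (pair_list fl (xs @ b # a # ys) @ Lg)"
    if "?S a \<noteq> 0"
  proof -
    have "even (length (filter ?Q [a, fl a]))" using par[OF that] by simp
    then show ?thesis
      using ksign_swap_blocks[of ?Q "pair_list fl xs" "[a, fl a]" "[b, fl b]" "pair_list fl ys @ Lg"]
      by simp
  qed
  then show "ksign ?Q (pair_list fl (xs @ a # b # ys) @ Lg) * (\<Prod>h\<leftarrow>xs @ a # b # ys. ?S h) =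
      ksign ?Q (pair_list fl (xs @ b # a # ys) @ Lg) * (\<Prod>h\<leftarrow>xs @ b # a # ys. ?S h)"
    by (cases "?S a = 0") (simp_all add: mult_ac)
qed

text \<open>Reversing an edge swaps two adjacent half-edges, and \<open>sigma_inv\<close> has the
  matching graded symmetry.\<close>

lemma edges_direction:
  assumes k: "\<And>h. h \<in> set E \<Longrightarrow> k h \<in> lcoord c \<and> k (fl h) \<in> lcoord c \<and> fl (fl h) = h"
    and e: "\<And>h. h \<in> set E \<Longrightarrow> e h = h \<or> e h = fl h"
  shows "ksign (\<lambda>h. P (k h)) (p @ pair_list fl (map e E) @ Lg) *
           (\<Prod>h\<leftarrow>map e E. sigma_inv W c (k h) (k (fl h))) =
         ksign (\<lambda>h. P (k h)) (p @ pair_list fl E @ Lg) * (\<Prod>h\<leftarrow>E. sigma_inv W c (k h) (k (fl h)))"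
  using assms
proof (induction E arbitrary: p)
  case (Cons h E)
  let ?Q = "\<lambda>h. P (k h)" and ?S = "\<lambda>h. sigma_inv W c (k h) (k (fl h))"
  let ?r = "pair_list fl (map e E) @ Lg"
  have one: "ksign ?Q (p @ e h # fl (e h) # ?r) * ?S (e h) = ksign ?Q (p @ h # fl h # ?r) * ?S h"
  proof (cases "e h = h")
    case False
    then have eh: "e h = fl h" using Cons.prems(2) by auto
    have *: "k h \<in> lcoord c" "k (fl h) \<in> lcoord c" "fl (fl h) = h" using Cons.prems(1) by auto
    show ?thesis
      unfolding eh *(3) ksign_swap[of ?Q p "fl h" h] sigma_inv_swap[OF *(1,2)] by auto
  qed simp
  have "ksign ?Q (p @ pair_list fl (map e (h # E)) @ Lg) * (\<Prod>h\<leftarrow>map e (h # E). ?S h) =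
      (ksign ?Q (p @ e h # fl (e h) # ?r) * ?S (e h)) * (\<Prod>h\<leftarrow>map e E. ?S h)"
    by (simp add: mult_ac)
  also have "\<dots> = ?S h * (ksign ?Q ((p @ [h, fl h]) @ ?r) * (\<Prod>h\<leftarrow>map e E. ?S h))"
    unfolding one by simp
  also have "\<dots> = ?S h * (ksign ?Q ((p @ [h, fl h]) @ pair_list fl E @ Lg) * (\<Prod>h\<leftarrow>E. ?S h))"
    by (subst Cons.IH) (use Cons.prems in auto)
  finally show ?case by simp
qed simp

lemma edges_choice:
  assumes G: "wf_graph G" and k: "k \<in> colourings c G" and E: "edge_choice G E" and E': "edge_choice G E'"
  shows "ksign (\<lambda>h. P (k h)) (pair_list (flip G) E @ Lg) * (\<Prod>h\<in>set E. sigma_inv W c (k h) (k (flip G h))) =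
         ksign (\<lambda>h. P (k h)) (pair_list (flip G) E' @ Lg) * (\<Prod>h\<in>set E'. sigma_inv W c (k h) (k (flip G h)))"
proof -
  \<comment> \<open>\<open>e\<close> turns each edge of \<open>E\<close> to the direction used in
    \<open>E'\<close>; what remains is a permutation of the edges.\<close>
  define e where "e = (\<lambda>h. if h \<in> set E' then h else flip G h)"
  have d: "distinct E" "distinct E'" using E E' by (auto simp: edge_choice_def)
  have fl: "flip G (flip G h) = h" if "h \<in> inner_halves G" for h
    using that G by (auto simp: wf_graph_def inner_halves_def)
  have in1: "h \<in> inner_halves G" if "h \<in> set E \<or> h \<in> set E'" for h
    using that E E' by (auto simp: edge_choice_def)
  have disj: "flip G h \<notin> set E" if "h \<in> set E" for h
    using that E by (auto simp: edge_choice_def)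
  have disj': "flip G h \<notin> set E'" if "h \<in> set E'" for h
    using that E' by (auto simp: edge_choice_def)
  have cover': "h \<in> set E' \<or> flip G h \<in> set E'" if h: "h \<in> inner_halves G" for h
  proof -
    have "h \<in> set E' \<union> flip G ` set E'" using h E' by (simp add: edge_choice_def)
    then show ?thesis using fl in1 by auto
  qed
  have cover: "h \<in> set E \<or> flip G h \<in> set E" if h: "h \<in> inner_halves G" for h
  proof -
    have "h \<in> set E \<union> flip G ` set E" using h E by (simp add: edge_choice_def)
    then show ?thesis using fl in1 by auto
  qed
  have inj: "inj_on e (set E)"
  proof (rule inj_onI)
    fix x y assume xy: "x \<in> set E" "y \<in> set E" "e x = e y"
    then have "x = y \<or> x = flip G y \<or> y = flip G x \<or> flip G x = flip G y"
      unfolding e_def by (simp split: if_splits)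
    moreover have "x \<noteq> flip G y" "y \<noteq> flip G x" using disj xy by blast+
    moreover have "flip G (flip G x) = x" "flip G (flip G y) = y" using fl in1 xy by blast+
    ultimately show "x = y" by metis
  qed
  have img: "e ` set E = set E'"
  proof
    show "e ` set E \<subseteq> set E'" using cover' in1 by (auto simp: e_def)
    show "set E' \<subseteq> e ` set E"
    proof
      fix h assume h: "h \<in> set E'"
      then consider "h \<in> set E" | "flip G h \<in> set E" using cover in1 by blast
      then show "h \<in> e ` set E"
      proof cases
        case 1 then show ?thesis using h by (force simp: e_def)
      next
        case 2
        have "e (flip G h) = h" using disj'[OF h] fl[OF in1] h by (simp add: e_def)
        then show ?thesis using 2 by force
      qed
    qed
  qed
  have m: "mset (map e E) = mset E'"
    using d inj img set_eq_iff_mset_eq_distinct[of "map e E" E'] by (simp add: distinct_map)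
  have kl: "k h \<in> lcoord c \<and> k (flip G h) \<in> lcoord c \<and> flip G (flip G h) = h" if "h \<in> set E \<or> h \<in> set E'" for h
    using that edge_choice_props(3)[OF G E, of h] edge_choice_props(3)[OF G E', of h] colouring_coords(1)[OF k] by blast
  let ?S = "\<lambda>h. sigma_inv W c (k h) (k (flip G h))" and ?Q = "\<lambda>h. P (k h)"
  have "ksign ?Q (pair_list (flip G) E @ Lg) * (\<Prod>h\<leftarrow>E. ?S h) =
        ksign ?Q (pair_list (flip G) (map e E) @ Lg) * (\<Prod>h\<leftarrow>map e E. ?S h)"
    using edges_direction[of E k "flip G" e "[]" Lg] kl by (simp add: e_def)
  also have "\<dots> = ksign ?Q (pair_list (flip G) E' @ Lg) * (\<Prod>h\<leftarrow>E'. ?S h)"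
  proof (rule edges_perm[OF _ m])
    fix h assume "h \<in> set (map e E)"
    then have "h \<in> set E'" using img by simp
    then show "k h \<in> lcoord c \<and> k (flip G h) \<in> lcoord c" using kl by blast
  qed
  finally show ?thesis using d by (simp add: prod.distinct_set_conv_list)
qed

lemma choice_term_ksign:
  assumes G: "wf_graph G" and vs: "distinct vs" "set vs = verts G"
    and L: "vertex_choice G L" and E: "edge_choice G E" and Lg: "leg_choice G Lg"
  shows "choice_term f G vs L E Lg k =
     fscale (fls_const ((ksign (\<lambda>h. P (k h)) (concat (map L vs)) *
        (\<Prod>v\<in>set vs. vertex_weight P f (genus G v) (map k (L v)))) *
        (ksign (\<lambda>h. P (k h)) (pair_list (flip G) E @ Lg) *
        (\<Prod>h\<in>set E. sigma_inv W c (k h) (k (flip G h))))))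
      (word_fun P (map k Lg))"
proof -
  have "reorder_sign (\<lambda>h. P (k h)) (concat (map L vs)) (pair_list (flip G) E @ Lg) =
      ksign (\<lambda>h. P (k h)) (concat (map L vs)) * ksign (\<lambda>h. P (k h)) (pair_list (flip G) E @ Lg)"
    using choice_lists[OF G E Lg] vertex_choice_lists[OF G L vs] by (intro reorder_sign_eq_ksign) auto
  then show ?thesis unfolding choice_term_def by (simp only: mult_ac)
qed

text \<open>The source factor and the edge factor are invariant separately, and the sign of
  reordering the legs is compensated by the word in the symmetric algebra. The vertex order is the
  same on both sides, since exchanging odd vertices does change the sign.\<close>

lemma choice_term_independent:
  assumes G: "wf_graph G" and vs: "distinct vs" "set vs = verts G" and k: "k \<in> colourings c G"
    and L: "vertex_choice G L" "vertex_choice G L'" and E: "edge_choice G E" "edge_choice G E'"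
    and Lg: "leg_choice G Lg" "leg_choice G Lg'"
  shows "choice_term f G vs L E Lg k = choice_term f G vs L' E' Lg' k"
proof -
  let ?Q = "\<lambda>h. P (k h)"
  let ?A = "\<lambda>L. ksign ?Q (concat (map L vs)) * (\<Prod>v\<in>set vs. vertex_weight P f (genus G v) (map k (L v)))"
  let ?B = "\<lambda>E Lg. ksign ?Q (pair_list (flip G) E @ Lg) * (\<Prod>h\<in>set E. sigma_inv W c (k h) (k (flip G h)))"
  have A: "?A L = ?A L'"
  proof (rule source_perm[OF vs(1)])
    fix v assume "v \<in> set vs"
    then show "mset (L v) = mset (L' v)"
      using L vs set_eq_iff_mset_eq_distinct[of "L v" "L' v"] by (simp add: vertex_choice_def)
  qed
  have B: "?B E Lg = ?B E' Lg" by (rule edges_choice[OF G k E])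
  have m: "mset Lg = mset Lg'"
    using Lg set_eq_iff_mset_eq_distinct[of Lg Lg'] by (simp add: leg_choice_def)
  let ?S = "(\<Prod>h\<in>set E'. sigma_inv W c (k h) (k (flip G h)))"
  have "choice_term f G vs L E Lg k = fscale (fls_const (?A L * ?B E Lg)) (word_fun P (map k Lg))"
    by (rule choice_term_ksign[OF G vs L(1) E(1) Lg(1)])
  also have "\<dots> = fscale (fls_const (?A L' * ?S))
      (fscale (fls_const (ksign ?Q (pair_list (flip G) E' @ Lg))) (word_fun P (map k Lg)))"
    unfolding A B by (simp add: mult_ac fls_const_mult_const)
  also have "\<dots> = fscale (fls_const (?A L' * ?B E' Lg')) (word_fun P (map k Lg'))"
    unfolding legs_perm[OF m] by (simp add: mult_ac fls_const_mult_const)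
  also have "\<dots> = choice_term f G vs L' E' Lg' k"
    by (rule choice_term_ksign[OF G vs L(2) E(2) Lg(2), symmetric])
  finally show ?thesis .
qed

lemma contraction_eq:
  assumes G: "wf_graph G" and vs: "distinct vs" "set vs = verts G"
    and L: "vertex_choice G L" and E: "edge_choice G E" and Lg: "leg_choice G Lg"
  shows "contraction W c f G vs = (\<Sum>k\<in>colourings c G. choice_term f G vs L E Lg k)"
proof -
  have "contraction W c f G vs = (\<Sum>k\<in>colourings c G.
      choice_term f G vs (\<lambda>v. inner_at G v @ legs_at G v) (edge_list G) (leg_list G) k)"
    unfolding contraction_def choice_term_def vertex_tensor_map pair_list_def vs(2) ..
  also have "\<dots> = (\<Sum>k\<in>colourings c G. choice_term f G vs L E Lg k)"
    by (intro sum.cong refl choice_term_independent[OF G vs] edge_choice_edge_list[OF G]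
        leg_choice_leg_list[OF G] vertex_choice_inner_legs[OF G] L E Lg)
  finally show ?thesis .
qed

text \<open>The images under \<open>\<psi>\<close> of the standard lists of \<open>G\<close> are
  admissible choices for \<open>G'\<close>, though not the standard ones, so
  \<open>contraction_eq\<close> applies to them; colourings correspond by composition with
  \<open>\<psi>\<close>.\<close>

lemma contraction_iso:
  assumes G: "wf_graph G" and G': "wf_graph G'" and iso: "graph_iso G G' \<phi> \<psi>"
    and vs: "distinct vs" "set vs = verts G"
  shows "contraction W c f G' (map \<phi> vs) = contraction W c f G vs"
proof -
  let ?L = "\<lambda>v. inner_at G v @ legs_at G v"
  have \<phi>: "bij_betw \<phi> (verts G) (verts G')" and \<psi>: "bij_betw \<psi> (halves G) (halves G')"
    and att: "\<And>h. h \<in> halves G \<Longrightarrow> att G' (\<psi> h) = \<phi> (att G h)"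
    and flip: "\<And>h. h \<in> halves G \<Longrightarrow> flip G' (\<psi> h) = \<psi> (flip G h)"
    and genus: "\<And>v. v \<in> verts G \<Longrightarrow> genus G' (\<phi> v) = genus G v"
    using iso by (auto simp: graph_iso_def)
  have inj: "inj_on \<psi> (halves G)" and img: "\<psi> ` halves G = halves G'"
    and injv: "inj_on \<phi> (verts G)" and imgv: "\<phi> ` verts G = verts G'"
    using \<phi> \<psi> by (auto simp: bij_betw_def)
  have fin: "flip G h \<in> halves G" "att G h \<in> verts G" if "h \<in> halves G" for h
    using that G by (auto simp: wf_graph_def)
  have flip_iff: "flip G' (\<psi> h) = \<psi> h \<longleftrightarrow> flip G h = h" if "h \<in> halves G" for h
    using that fin inj by (simp add: flip inj_on_eq_iff)
  let ?L' = "\<lambda>v'. map \<psi> (?L (the_inv_into (verts G) \<phi> v'))"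
  have inv: "the_inv_into (verts G) \<phi> (\<phi> v) = v" if "v \<in> verts G" for v
    by (rule the_inv_into_f_f[OF injv that])
  have L: "vertex_choice G ?L" "edge_choice G (edge_list G)" "leg_choice G (leg_list G)"
    using vertex_choice_inner_legs[OF G] edge_choice_edge_list[OF G] leg_choice_leg_list[OF G] .
  have inner: "\<psi> ` inner_halves G = inner_halves G'" and legs: "\<psi> ` leg_halves G = leg_halves G'"
    unfolding inner_halves_def leg_halves_def img[symmetric] using flip_iff by auto
  have c1: "vertex_choice G' ?L'"
    unfolding vertex_choice_def
  proof
    fix v' assume "v' \<in> verts G'"
    then obtain v where v: "v \<in> verts G" "v' = \<phi> v" using imgv by blast
    have Lv: "distinct (?L v)" "set (?L v) = {h\<in>halves G. att G h = v}"
      using L(1) v by (auto simp: vertex_choice_def)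
    have "inj_on \<psi> (set (?L v))" using inj Lv(2) by (auto intro: inj_on_subset)
    moreover have "\<psi> ` {h\<in>halves G. att G h = v} = {h'\<in>halves G'. att G' h' = v'}"
      unfolding v(2) img[symmetric] using att inj_on_eq_iff[OF injv fin(2) v(1)] by auto
    ultimately show "distinct (?L' v') \<and> set (?L' v') = {h'\<in>halves G'. att G' h' = v'}"
      using Lv v inv by (simp only: distinct_map set_map)
  qed
  have c2: "edge_choice G' (map \<psi> (edge_list G))"
  proof -
    let ?E = "set (edge_list G)"
    have E: "distinct (edge_list G)" "?E \<inter> flip G ` ?E = {}" "?E \<union> flip G ` ?E = inner_halves G"
      using L(2) by (auto simp: edge_choice_def)
    have sub: "?E \<subseteq> halves G" "flip G ` ?E \<subseteq> halves G" using E(3) by (auto simp: inner_halves_def)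
    have f: "flip G' ` \<psi> ` ?E = \<psi> ` flip G ` ?E"
      unfolding image_image using sub flip by (intro image_cong refl) auto
    have "\<psi> ` ?E \<inter> \<psi> ` flip G ` ?E = {}"
      using inj_on_image_Int[OF inj sub] E(2) by simp
    moreover have "\<psi> ` ?E \<union> \<psi> ` flip G ` ?E = inner_halves G'"
      unfolding inner[symmetric] E(3)[symmetric] by (simp add: image_Un)
    ultimately show ?thesis
      unfolding edge_choice_def set_map f using E(1) sub inj by (auto simp: distinct_map intro: inj_on_subset)
  qed
  have c3: "leg_choice G' (map \<psi> (leg_list G))"
    using L(3) legs inj by (auto simp: leg_choice_def distinct_map leg_halves_def intro: inj_on_subset)
  have d: "distinct (map \<phi> vs)" "set (map \<phi> vs) = verts G'"
    using vs injv imgv by (auto simp: distinct_map)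
  have "contraction W c f G' (map \<phi> vs) =
      (\<Sum>k'\<in>colourings c G'. choice_term f G' (map \<phi> vs) ?L' (map \<psi> (edge_list G)) (map \<psi> (leg_list G)) k')"
    by (rule contraction_eq[OF G' d c1 c2 c3])
  also have "\<dots> = (\<Sum>k\<in>colourings c G. choice_term f G vs ?L (edge_list G) (leg_list G) k)"
  proof (rule sum.reindex_bij_witness[where
        i = "\<lambda>k. \<lambda>h'\<in>halves G'. k (the_inv_into (halves G) \<psi> h')" and
        j = "\<lambda>k'. \<lambda>h\<in>halves G. k' (\<psi> h)"])
    fix k' assume k': "k' \<in> colourings c G'"
    have inv': "the_inv_into (halves G) \<psi> h' \<in> halves G" "\<psi> (the_inv_into (halves G) \<psi> h') = h'"
      if "h' \<in> halves G'" for h'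
      using that inj img by (auto intro: the_inv_into_into f_the_inv_into_f)
    show "(\<lambda>h'\<in>halves G'. (\<lambda>h\<in>halves G. k' (\<psi> h)) (the_inv_into (halves G) \<psi> h')) = k'"
      using k' inv' by (auto simp: colourings_def fun_eq_iff PiE_iff extensional_def)
    show "(\<lambda>h\<in>halves G. k' (\<psi> h)) \<in> colourings c G"
      unfolding colourings_def
    proof (rule PiE_I)
      fix h assume h: "h \<in> halves G"
      then have "k' (\<psi> h) \<in> (if flip G' (\<psi> h) = \<psi> h then hcoord c else lcoord c)"
        using k' img by (intro PiE_mem[of k' "halves G'"]) (auto simp: colourings_def)
      then show "(\<lambda>h\<in>halves G. k' (\<psi> h)) h \<in> (if flip G h = h then hcoord c else lcoord c)"
        using h flip_iff[OF h] by simp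
    qed simp
    let ?k = "\<lambda>h\<in>halves G. k' (\<psi> h)"
    have mapk: "map ?k xs = map k' (map \<psi> xs)" if "set xs \<subseteq> halves G" for xs
      using that by (auto simp: subset_iff)
    have concat: "concat (map ?L' (map \<phi> vs)) = map \<psi> (concat (map ?L vs))"
    proof -
      have "map ?L' (map \<phi> vs) = map (\<lambda>v. map \<psi> (?L v)) vs"
        using vs inv by simp
      then show ?thesis by (simp only: map_concat map_map o_def)
    qed
    have Eh: "set (edge_list G) \<subseteq> halves G" "set (leg_list G) \<subseteq> halves G"
      using L by (auto simp: edge_choice_def leg_choice_def inner_halves_def leg_halves_def)
    have pairs: "pair_list (flip G') (map \<psi> (edge_list G)) @ map \<psi> (leg_list G) =
        map \<psi> (pair_list (flip G) (edge_list G) @ leg_list G)"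
    proof -
      have "pair_list (flip G') (map \<psi> xs) = map \<psi> (pair_list (flip G) xs)" if "set xs \<subseteq> halves G" for xs
        using that by (induction xs) (auto simp: flip)
      then show ?thesis using Eh by simp
    qed
    let ?xs = "concat (map ?L vs)" and ?ys = "pair_list (flip G) (edge_list G) @ leg_list G"
    have sxy: "set ?xs \<union> set ?ys \<subseteq> halves G"
      using vertex_choice_lists[OF G L(1) vs] choice_lists[OF G L(2,3)] by blast
    have sign: "reorder_sign (\<lambda>h. P (k' h)) (map \<psi> ?xs) (map \<psi> ?ys) = reorder_sign (\<lambda>h. P (?k h)) ?xs ?ys"
    proof -
      have 1: "reorder_sign (\<lambda>h. P (k' h)) (map \<psi> ?xs) (map \<psi> ?ys) = reorder_sign (\<lambda>h. P (k' (\<psi> h))) ?xs ?ys"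
        by (rule reorder_sign_map) (use inj sxy in \<open>blast intro: inj_on_subset\<close>)
      have "(P (k' (\<psi> a)) \<and> P (k' (\<psi> b)) \<and> before ?xs a b \<and> before ?ys b a) =
          (P (?k a) \<and> P (?k b) \<and> before ?xs a b \<and> before ?ys b a)" for a b
      proof (cases "before ?xs a b")
        case True
        then have "a \<in> halves G" "b \<in> halves G" using before_in_set[OF True] sxy by blast+
        then show ?thesis by (simp only: restrict_apply' )
      qed (simp only: simp_thms)
      then have "reorder_sign (\<lambda>h. P (k' (\<psi> h))) ?xs ?ys = reorder_sign (\<lambda>h. P (?k h)) ?xs ?ys"
        unfolding reorder_sign_def by (simp only:)
      with 1 show ?thesis by (rule trans)
    qed
    have verts: "(\<Prod>v\<in>set (map \<phi> vs). vertex_weight P f (genus G' v) (map k' (?L' v))) =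
        (\<Prod>v\<in>set vs. vertex_weight P f (genus G v) (map ?k (?L v)))"
    proof -
      have "(\<Prod>v\<in>\<phi> ` set vs. vertex_weight P f (genus G' v) (map k' (?L' v))) =
          (\<Prod>v\<in>set vs. vertex_weight P f (genus G' (\<phi> v)) (map k' (?L' (\<phi> v))))"
        using vs injv by (subst prod.reindex) (auto simp: o_def)
      also have "\<dots> = (\<Prod>v\<in>set vs. vertex_weight P f (genus G v) (map ?k (?L v)))"
      proof (rule prod.cong[OF refl])
        fix v assume "v \<in> set vs"
        then have v: "v \<in> verts G" using vs by simp
        then have "set (?L v) \<subseteq> halves G" using L(1) unfolding vertex_choice_def by blast
        then show "vertex_weight P f (genus G' (\<phi> v)) (map k' (?L' (\<phi> v))) =
            vertex_weight P f (genus G v) (map ?k (?L v))"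
          unfolding inv[OF v] genus[OF v] by (simp only: mapk)
      qed
      finally show ?thesis by (simp only: set_map)
    qed
    have edges: "(\<Prod>h\<in>set (map \<psi> (edge_list G)). sigma_inv W c (k' h) (k' (flip G' h))) =
        (\<Prod>h\<in>set (edge_list G). sigma_inv W c (?k h) (?k (flip G h)))"
    proof -
      have "(\<Prod>h\<in>\<psi> ` set (edge_list G). sigma_inv W c (k' h) (k' (flip G' h))) =
          (\<Prod>h\<in>set (edge_list G). sigma_inv W c (k' (\<psi> h)) (k' (flip G' (\<psi> h))))"
        using Eh(1) inj by (subst prod.reindex) (auto simp: o_def intro: inj_on_subset)
      also have "\<dots> = (\<Prod>h\<in>set (edge_list G). sigma_inv W c (?k h) (?k (flip G h)))"
        using Eh(1) fin flip by (intro prod.cong refl) (auto simp: subset_iff)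
      finally show ?thesis by (simp only: set_map)
    qed
    show "choice_term f G vs ?L (edge_list G) (leg_list G) ?k =
        choice_term f G' (map \<phi> vs) ?L' (map \<psi> (edge_list G)) (map \<psi> (leg_list G)) k'"
      unfolding choice_term_def concat pairs sign verts edges mapk[OF Eh(2)] ..
  next
    fix k assume k: "k \<in> colourings c G"
    have inv': "the_inv_into (halves G) \<psi> (\<psi> h) = h" if "h \<in> halves G" for h
      using that inj by (rule the_inv_into_f_f[rotated])
    show "(\<lambda>h\<in>halves G. (\<lambda>h'\<in>halves G'. k (the_inv_into (halves G) \<psi> h')) (\<psi> h)) = k"
      using k inv' img by (auto simp: colourings_def fun_eq_iff PiE_iff extensional_def)
    show "(\<lambda>h'\<in>halves G'. k (the_inv_into (halves G) \<psi> h')) \<in> colourings c G'"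
      unfolding colourings_def
    proof (rule PiE_I)
      fix h' assume "h' \<in> halves G'"
      then obtain h where h: "h \<in> halves G" "h' = \<psi> h" using img by blast
      then show "(\<lambda>h'\<in>halves G'. k (the_inv_into (halves G) \<psi> h')) h' \<in>
          (if flip G' h' = h' then hcoord c else lcoord c)"
        using k inv' flip_iff[of h] img by (auto simp: colourings_def dest!: PiE_mem)
    qed simp
  qed
  also have "\<dots> = contraction W c f G vs"
    by (rule contraction_eq[OF G vs L, symmetric])
  finally show ?thesis .
qed

end

lemma fls_const_sum: "(\<Sum>x\<in>A. fls_const (g x)) = fls_const (\<Sum>x\<in>A. g x)"
  for g :: "_ \<Rightarrow> 'b::comm_monoid_add"
  by (induction A rule: infinite_finite_induct) (auto simp: fls_plus_const)

lemma fls_const_prod: "(\<Prod>x\<in>A. fls_const (g x)) = fls_const (\<Prod>x\<in>A. g x)"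
  for g :: "_ \<Rightarrow> 'b::comm_semiring_1"
  by (induction A rule: infinite_finite_induct) (auto simp: fls_const_mult_const)

lemma sign_cancel:
  fixes a b x y :: real
  assumes "a * x = b * y" "x * x = 1" "b * b = 1"
  shows "a * b = x * y"
  using assms by algebra

lemma average_sign:
  fixes n s A :: real
  assumes "n \<noteq> 0"
  shows "fls_const (1 / n) * (fls_const (if b then n * s else 0) * (fls_const A * w)) =
         fls_const (if b then A else 0) * (fls_const s * w)"
proof (cases b)
  case True
  have "fls_const (1 / n) * (fls_const (n * s) * (fls_const A * w)) =
      fls_const ((1 / n) * (n * s)) * (fls_const A * w)"
    by (simp only: mult.assoc flip: fls_const_mult_const)
  then show ?thesis using True assms by (simp add: mult.left_commute)
qed simp

section \<open>The amplitude as an average over vertex orders\<close>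

text \<open>As \<open>flip\<close> is an involution, reachability is symmetric and its classes are
  disjoint. The last claim keeps both halves of an edge in one component.\<close>

lemma components_props:
  assumes G: "wf_graph G"
  shows "finite (components G)" "C \<in> components G \<Longrightarrow> C \<subseteq> verts G" "\<Union>(components G) = verts G"
    "C \<in> components G \<Longrightarrow> C' \<in> components G \<Longrightarrow> C \<noteq> C' \<Longrightarrow> C \<inter> C' = {}"
    "C \<in> components G \<Longrightarrow> h \<in> halves G \<Longrightarrow> att G h \<in> C \<Longrightarrow> att G (flip G h) \<in> C"
proof -
  let ?r = "{(att G h, att G (flip G h)) | h. h \<in> halves G}"
  let ?C = "\<lambda>v. {u. (v, u) \<in> ?r\<^sup>*}"
  have comp: "components G = ?C ` verts G" by (simp add: components_def)
  have fl: "flip G h \<in> halves G" "flip G (flip G h) = h" "att G h \<in> verts G" if "h \<in> halves G" for h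
    using G that by (auto simp: wf_graph_def)
  have "sym ?r"
  proof (rule symI)
    fix x y assume "(x, y) \<in> ?r"
    then obtain h where "h \<in> halves G" "x = att G h" "y = att G (flip G h)" by blast
    then have "(y, x) = (att G (flip G h), att G (flip G (flip G h)))" "flip G h \<in> halves G"
      using fl by simp_all
    then show "(y, x) \<in> ?r" by blast
  qed
  then have sym: "sym (?r\<^sup>*)" by (rule sym_rtrancl)
  have verts: "u \<in> verts G" if "(v, u) \<in> ?r\<^sup>*" "v \<in> verts G" for u v
    using that by (induction rule: rtrancl_induct) (use fl in auto)
  have same: "?C v = ?C w" if "u \<in> ?C v" "u \<in> ?C w" for u v w
  proof -
    have vu: "(v, u) \<in> ?r\<^sup>*" "(w, u) \<in> ?r\<^sup>*" using that by (simp_all only: mem_Collect_eq)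
    have vw: "(v, w) \<in> ?r\<^sup>*" by (rule rtrancl_trans[OF vu(1) symD[OF sym vu(2)]])
    have wv: "(w, v) \<in> ?r\<^sup>*" by (rule symD[OF sym vw])
    show ?thesis
      using rtrancl_trans[OF vw] rtrancl_trans[OF wv] by (intro Collect_cong) blast
  qed
  show "finite (components G)" using G by (simp add: comp wf_graph_def)
  show "C \<in> components G \<Longrightarrow> C \<subseteq> verts G" unfolding comp using verts by blast
  show "\<Union>(components G) = verts G"
  proof
    show "verts G \<subseteq> \<Union>(components G)" unfolding comp by blast
  qed (use comp verts in blast)
  show "C \<in> components G \<Longrightarrow> C' \<in> components G \<Longrightarrow> C \<noteq> C' \<Longrightarrow> C \<inter> C' = {}"
    unfolding comp using same by blast
  show "att G (flip G h) \<in> C" if *: "C \<in> components G" "h \<in> halves G" "att G h \<in> C"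
  proof -
    obtain v where v: "C = ?C v" using *(1) comp by blast
    then have "(v, att G h) \<in> ?r\<^sup>*" using *(3) by simp
    moreover have "(att G h, att G (flip G h)) \<in> ?r" using *(2) by blast
    ultimately have "(v, att G (flip G h)) \<in> ?r\<^sup>*" by (rule rtrancl_into_rtrancl)
    then show ?thesis using v by simp
  qed
qed

lemma wf_subgraph:
  assumes G: "wf_graph G" and C: "C \<in> components G"
  shows "wf_graph (subgraph G C)"
proof -
  have "finite C" using components_props(2)[OF G C] G by (auto simp: wf_graph_def intro: finite_subset)
  then show ?thesis
    using G components_props(5)[OF G C] by (auto simp: wf_graph_def subgraph_def)
qed

lemma subgraph_simps [simp]:
  "verts (subgraph G C) = C" "halves (subgraph G C) = {h\<in>halves G. att G h \<in> C}"
  "flip (subgraph G C) = flip G" "att (subgraph G C) = att G" "genus (subgraph G C) = genus G"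
  by (simp_all add: subgraph_def)

lemma even_filter_pair_list:
  assumes "\<And>h. h \<in> set E \<Longrightarrow> Q h \<longleftrightarrow> Q (fl h)"
  shows "even (length (filter Q (pair_list fl E)))"
  using assms by (induction E) auto

text \<open>The blocks \<open>pl C\<close> are even, so all of them can be moved in front of the
  blocks \<open>lg C\<close> without a sign.\<close>

lemma ksign_concat_pairs:
  assumes "\<And>C. C \<in> set Cs \<Longrightarrow> even (length (filter Q (pl C)))"
  shows "ksign Q (p @ concat (map (\<lambda>C. pl C @ lg C) Cs)) =
         ksign Q (p @ concat (map pl Cs) @ concat (map lg Cs))"
  using assms
proof (induction Cs arbitrary: p)
  case (Cons C Cs)
  let ?PL = "concat (map pl Cs)" and ?LG = "concat (map lg Cs)"
  have ev: "even (length (filter Q ?PL))"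
    using Cons.prems by (induction Cs) auto
  have "ksign Q (p @ concat (map (\<lambda>C. pl C @ lg C) (C # Cs))) =
        ksign Q ((p @ pl C @ lg C) @ concat (map (\<lambda>C. pl C @ lg C) Cs))" by simp
  also have "\<dots> = ksign Q ((p @ pl C) @ lg C @ ?PL @ ?LG)"
    using Cons.IH[of "p @ pl C @ lg C"] Cons.prems by simp
  also have "\<dots> = ksign Q ((p @ pl C) @ ?PL @ lg C @ ?LG)"
    using ksign_swap_blocks[of Q "p @ pl C" "lg C" ?PL ?LG] ev by simp
  finally show ?case by simp
qed simp

section \<open>Odd vertices and averages over orders\<close>

context gaussian_coords begin

text \<open>The parity of the tensor at \<open>v\<close> under the colouring, which decides the sign
  of exchanging two vertices.\<close>

definition odd_vertex :: "sgraph \<Rightarrow> (nat \<Rightarrow> nat) \<Rightarrow> nat \<Rightarrow> bool" where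
  "odd_vertex G k v \<longleftrightarrow> odd (card {h\<in>halves G. att G h = v \<and> P (k h)})"

text \<open>The factor that depends on the order of the vertices; \<open>target_coeff\<close>
  depends only on the edges and the legs.\<close>

definition source_coeff :: "ffun \<Rightarrow> sgraph \<Rightarrow> nat list \<Rightarrow> (nat \<Rightarrow> nat list) \<Rightarrow> (nat \<Rightarrow> nat) \<Rightarrow> real" where
  "source_coeff f G vs L k = ksign (\<lambda>h. P (k h)) (concat (map L vs)) *
        (\<Prod>v\<in>set vs. vertex_weight P f (genus G v) (map k (L v)))"

definition target_coeff :: "sgraph \<Rightarrow> nat list \<Rightarrow> nat list \<Rightarrow> (nat \<Rightarrow> nat) \<Rightarrow> real" where
  "target_coeff G E Lg k = ksign (\<lambda>h. P (k h)) (pair_list (flip G) E @ Lg) *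
        (\<Prod>h\<in>set E. sigma_inv W c (k h) (k (flip G h)))"

lemma choice_term_coeff:
  assumes G: "wf_graph G" and vs: "distinct vs" "set vs = verts G"
    and L: "vertex_choice G L" and E: "edge_choice G E" and Lg: "leg_choice G Lg"
  shows "choice_term f G vs L E Lg k =
     fscale (fls_const (source_coeff f G vs L k * target_coeff G E Lg k)) (word_fun P (map k Lg))"
  using choice_term_ksign[OF assms] by (simp add: source_coeff_def target_coeff_def)

lemma sum_orders_source_coeff:
  assumes G: "wf_graph G" and vs: "distinct vs0" "set vs0 = verts G" and L: "vertex_choice G L"
  shows "(\<Sum>vs\<in>permutations_of_set (verts G). source_coeff f G vs L k) =
     (if card {v\<in>verts G. odd_vertex G k v} \<le> 1 then fact (card (verts G)) * source_coeff f G vs0 L k else 0)"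
proof (rule sum_permutations_of_set_sign)
  show "finite (verts G)" using G by (simp add: wf_graph_def)
  show "vs0 \<in> permutations_of_set (verts G)" using vs by (simp add: permutations_of_set_def)
  fix xs a b ys
  assume "xs @ a # b # ys \<in> permutations_of_set (verts G)"
  then have ab: "a \<in> verts G" "b \<in> verts G" by (auto simp: permutations_of_set_def)
  let ?Q = "\<lambda>h. P (k h)"
  have odd: "odd (length (filter ?Q (L v))) \<longleftrightarrow> odd_vertex G k v" if v: "v \<in> verts G" for v
  proof -
    have "length (filter ?Q (L v)) = card (set (filter ?Q (L v)))"
      using L v by (intro distinct_card[symmetric]) (simp add: vertex_choice_def)
    also have "set (filter ?Q (L v)) = {h\<in>halves G. att G h = v \<and> P (k h)}"
      using L v by (auto simp: vertex_choice_def)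
    finally show ?thesis by (simp add: odd_vertex_def)
  qed
  have "ksign ?Q (concat (map L (xs @ a # b # ys))) =
      (if odd_vertex G k a \<and> odd_vertex G k b then -1 else 1) * ksign ?Q (concat (map L (xs @ b # a # ys)))"
    using ksign_swap_blocks[of ?Q "concat (map L xs)" "L a" "L b" "concat (map L ys)"] odd ab
    by (auto simp: minus_one_power_iff)
  moreover have "set (xs @ a # b # ys) = set (xs @ b # a # ys)" by auto
  ultimately show "source_coeff f G (xs @ a # b # ys) L k =
      (if odd_vertex G k a \<and> odd_vertex G k b then -1 else 1) * source_coeff f G (xs @ b # a # ys) L k"
    unfolding source_coeff_def by (simp only: mult.assoc)
qed

text \<open>The vertex order enters only through \<open>source_coeff\<close>: colourings with two
  odd vertices cancel in the sum over orders, and the others give equal terms for all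
  orders.\<close>

lemma average_contraction:
  assumes G: "wf_graph G" and vs: "distinct vs0" "set vs0 = verts G"
    and L: "vertex_choice G L" and E: "edge_choice G E" and Lg: "leg_choice G Lg"
  shows "average_orders (verts G) (contraction W c f G) = (\<Sum>k\<in>colourings c G.
     fscale (fls_const (if card {v\<in>verts G. odd_vertex G k v} \<le> 1
        then source_coeff f G vs0 L k * target_coeff G E Lg k else 0)) (word_fun P (map k Lg)))"
proof
  fix m
  let ?n = "fact (card (verts G)) :: real" and ?V = "permutations_of_set (verts G)"
  have "average_orders (verts G) (contraction W c f G) m =
      fls_const (1 / ?n) * (\<Sum>vs\<in>?V. \<Sum>k\<in>colourings c G. choice_term f G vs L E Lg k m)"
  proof -
    have "contraction W c f G vs m = (\<Sum>k\<in>colourings c G. choice_term f G vs L E Lg k m)" if "vs \<in> ?V" for vs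
      using contraction_eq[OF G _ _ L E Lg, of vs f] that
      by (simp add: permutations_of_set_def sum_ffun_apply)
    then show ?thesis by (simp add: average_orders_def fscale_def sum_ffun_apply)
  qed
  also have "\<dots> = (\<Sum>k\<in>colourings c G. fls_const (1 / ?n) * (\<Sum>vs\<in>?V. choice_term f G vs L E Lg k m))"
    by (subst sum.swap) (simp only: sum_distrib_left)
  also have "\<dots> = (\<Sum>k\<in>colourings c G.
     fscale (fls_const (if card {v\<in>verts G. odd_vertex G k v} \<le> 1
        then source_coeff f G vs0 L k * target_coeff G E Lg k else 0)) (word_fun P (map k Lg)) m)"
  proof (rule sum.cong[OF refl])
    fix k
    have "(\<Sum>vs\<in>?V. choice_term f G vs L E Lg k m) =
        (\<Sum>vs\<in>?V. fls_const (source_coeff f G vs L k * target_coeff G E Lg k) * word_fun P (map k Lg) m)"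
      by (intro sum.cong refl)
        (simp add: permutations_of_set_def choice_term_coeff[OF G _ _ L E Lg] fscale_def)
    also have "\<dots> = fls_const ((\<Sum>vs\<in>?V. source_coeff f G vs L k) * target_coeff G E Lg k) * word_fun P (map k Lg) m"
      by (simp only: sum_distrib_right[symmetric] fls_const_sum)
    finally show "fls_const (1 / ?n) * (\<Sum>vs\<in>?V. choice_term f G vs L E Lg k m) =
      fscale (fls_const (if card {v\<in>verts G. odd_vertex G k v} \<le> 1
        then source_coeff f G vs0 L k * target_coeff G E Lg k else 0)) (word_fun P (map k Lg)) m"
      unfolding sum_orders_source_coeff[OF G vs L] fscale_def
      by (simp add: fls_const_mult_const flip: mult.assoc)
  qed
  finally show "average_orders (verts G) (contraction W c f G) m = (\<Sum>k\<in>colourings c G.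
     fscale (fls_const (if card {v\<in>verts G. odd_vertex G k v} \<le> 1
        then source_coeff f G vs0 L k * target_coeff G E Lg k else 0)) (word_fun P (map k Lg))) m"
    by (simp only: sum_ffun_apply)
qed

text \<open>If every edge contributes, the number of odd half-edges at the vertices of a component and the
  number of its odd legs have the same parity. Hence both kinds of averages only retain the
  colourings with at most one odd vertex, and these terms do not depend on any order.\<close>

theorem amplitude_eq_average:
  assumes G: "wf_graph G"
  shows "amplitude W c f G = average_orders (verts G) (contraction W c f G)"
proof -
  let ?K = "components G"
  let ?D = "\<lambda>h. if flip G h = h then hcoord c else lcoord c"
  define S where "S = (\<lambda>C. {h\<in>halves G. att G h \<in> C})"
  define V where "V = (\<lambda>C::nat set. sorted_list_of_set C)"
  define L where "L = (\<lambda>v. sorted_list_of_set {h\<in>halves G. att G h = v})"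
  define E where "E = (\<lambda>C. edge_list (subgraph G C))"
  define Lg where "Lg = (\<lambda>C. leg_list (subgraph G C))"
  note K = components_props[OF G]
  have finG: "finite (halves G)" "finite (verts G)" using G by (auto simp: wf_graph_def)
  have finC: "finite C" if "C \<in> ?K" for C
    using K(2)[OF that] finG by (auto intro: finite_subset)
  have Llist: "distinct (L v)" "set (L v) = {h\<in>halves G. att G h = v}" for v
    using finG by (auto simp: L_def)
  have VC: "distinct (V C)" "set (V C) = C" if "C \<in> ?K" for C
    using finC[OF that] by (auto simp: V_def)
  have sub: "wf_graph (subgraph G C)" if "C \<in> ?K" for C by (rule wf_subgraph[OF G that])
  have choiceC: "vertex_choice (subgraph G C) L" "edge_choice (subgraph G C) (E C)" "leg_choice (subgraph G C) (Lg C)"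
    if "C \<in> ?K" for C
    using edge_choice_edge_list[OF sub[OF that]] leg_choice_leg_list[OF sub[OF that]]
    by (auto simp: vertex_choice_def Llist E_def Lg_def)
  have colC: "colourings c (subgraph G C) = PiE (S C) ?D" for C
    by (simp add: colourings_def S_def)
  have colG: "colourings c G = PiE (halves G) ?D" by (simp add: colourings_def)
  have US: "(\<Union>C\<in>?K. S C) = halves G"
  proof
    show "halves G \<subseteq> (\<Union>C\<in>?K. S C)"
    proof
      fix h assume h: "h \<in> halves G"
      then have "att G h \<in> \<Union>?K" using G K(3) by (auto simp: wf_graph_def)
      then show "h \<in> (\<Union>C\<in>?K. S C)" using h by (auto simp: S_def)
    qed
  qed (auto simp: S_def)
  have disjS: "S C \<inter> S C' = {}" if "C \<in> ?K" "C' \<in> ?K" "C \<noteq> C'" for C C'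
    using K(4)[OF that] by (auto simp: S_def)
  obtain Cs0 where Cs0: "distinct Cs0" "set Cs0 = ?K"
    using finite_distinct_list[OF K(1)] by blast
  have inner: "inner_halves (subgraph G C) = inner_halves G \<inter> S C"
    and legs: "leg_halves (subgraph G C) = leg_halves G \<inter> S C" for C
    by (auto simp: inner_halves_def leg_halves_def S_def)
  have EC: "distinct (E C)" "set (E C) \<inter> flip G ` set (E C) = {}"
    "set (E C) \<union> flip G ` set (E C) = inner_halves G \<inter> S C"
    "distinct (Lg C)" "set (Lg C) = leg_halves G \<inter> S C" if "C \<in> ?K" for C
    using choiceC[OF that] inner legs by (auto simp: edge_choice_def leg_choice_def)
  let ?cond = "\<lambda>k C. card {v\<in>C. odd_vertex G k v} \<le> 1"
  define coef where "coef = (\<lambda>C k. if ?cond k C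
      then source_coeff f G (V C) L k * target_coeff G (E C) (Lg C) k else 0)"
  have conn: "connected_amplitude W c f (subgraph G C) =
     (\<Sum>k\<in>PiE (S C) ?D. fscale (fls_const (coef C k)) (word_fun P (map k (Lg C))))"
    if C: "C \<in> ?K" for C
  proof -
    have odd: "odd_vertex (subgraph G C) k v \<longleftrightarrow> odd_vertex G k v" if "v \<in> C" for v k
    proof -
      have "{h \<in> halves (subgraph G C). att (subgraph G C) h = v \<and> P (k h)} =
          {h \<in> halves G. att G h = v \<and> P (k h)}" using that by auto
      then show ?thesis unfolding odd_vertex_def by (simp only:)
    qed
    have odd': "{v\<in>C. odd_vertex (subgraph G C) k v} = {v\<in>C. odd_vertex G k v}" for k
      using odd by auto
    have st: "source_coeff f (subgraph G C) (V C) L k = source_coeff f G (V C) L k"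
      "target_coeff (subgraph G C) (E C) (Lg C) k = target_coeff G (E C) (Lg C) k" for k
      by (simp_all add: source_coeff_def target_coeff_def)
    have "average_orders (verts (subgraph G C)) (contraction W c f (subgraph G C)) =
      (\<Sum>k\<in>colourings c (subgraph G C). fscale (fls_const
        (if card {v\<in>verts (subgraph G C). odd_vertex (subgraph G C) k v} \<le> 1
          then source_coeff f (subgraph G C) (V C) L k * target_coeff (subgraph G C) (E C) (Lg C) k else 0))
        (word_fun P (map k (Lg C))))"
      by (rule average_contraction[OF sub[OF C] _ _ choiceC[OF C]]) (use VC[OF C] in simp_all)
    then show ?thesis
      unfolding connected_amplitude_def coef_def colC subgraph_simps(1) odd' st .
  qed
  have prodC: "fprod_list P (map (\<lambda>C. connected_amplitude W c f (subgraph G C)) Cs) =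
     (\<Sum>k\<in>colourings c G. fscale (fls_const (\<Prod>C\<in>?K. coef C k)) (word_fun P (map k (concat (map Lg Cs)))))"
    if Cs: "distinct Cs" "set Cs = ?K" for Cs
  proof -
    have "fprod_list P (map (\<lambda>C. connected_amplitude W c f (subgraph G C)) Cs) =
        fprod_list P (map (\<lambda>C. \<Sum>k\<in>PiE (S C) ?D. fscale (fls_const (coef C k)) (word_fun P (map k (Lg C)))) Cs)"
    proof (intro arg_cong[of _ _ "fprod_list P"] map_cong refl)
      fix C assume "C \<in> set Cs"
      then show "connected_amplitude W c f (subgraph G C) =
          (\<Sum>k\<in>PiE (S C) ?D. fscale (fls_const (coef C k)) (word_fun P (map k (Lg C))))"
        unfolding Cs(2) by (rule conn)
    qed
    also have "\<dots> = (\<Sum>k\<in>PiE (\<Union>C\<in>set Cs. S C) ?D. fscale (\<Prod>C\<in>set Cs. fls_const (coef C k))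
        (word_fun P (concat (map (\<lambda>C. map k (Lg C)) Cs))))"
    proof (rule fprod_list_sum_words[OF Cs(1)])
      \<comment> \<open>Gluing requires that the coefficient of a component depends only on the
        colours of its own half-edges.\<close>
      fix C and k l :: "nat \<Rightarrow> nat"
      assume "C \<in> set Cs" and kl: "\<And>h. h \<in> S C \<Longrightarrow> k h = l h"
      then have C: "C \<in> ?K" using Cs by simp
      have inS: "h \<in> S C" if "v \<in> C" "h \<in> set (L v)" for h v
        using that by (auto simp: Llist S_def)
      have Q: "ksign (\<lambda>h. P (k h)) xs = ksign (\<lambda>h. P (l h)) xs" if "set xs \<subseteq> S C" for xs
        using that
      proof (induction xs)
        case (Cons x xs)
        have "filter (\<lambda>b. P (k b) \<and> b < x) xs = filter (\<lambda>b. P (l b) \<and> b < x) xs"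
          using Cons.prems kl by (intro filter_cong refl) auto
        then show ?case using Cons kl by (simp add: ksign_Cons)
      qed simp
      have odd: "odd_vertex G k v \<longleftrightarrow> odd_vertex G l v" if "v \<in> C" for v
      proof -
        have "{h\<in>halves G. att G h = v \<and> P (k h)} = {h\<in>halves G. att G h = v \<and> P (l h)}"
          using kl that by (auto simp: S_def)
        then show ?thesis unfolding odd_vertex_def by (simp only:)
      qed
      have "source_coeff f G (V C) L k = source_coeff f G (V C) L l"
      proof -
        have lm: "map k (L v) = map l (L v)" if "v \<in> set (V C)" for v
          using kl inS[of v] that VC[OF C] by (intro map_cong refl) auto
        have "(\<Prod>v\<in>set (V C). vertex_weight P f (genus G v) (map k (L v))) =
            (\<Prod>v\<in>set (V C). vertex_weight P f (genus G v) (map l (L v)))"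
          by (intro prod.cong refl) (simp only: lm)
        moreover have "set (concat (map L (V C))) \<subseteq> S C"
          using inS VC[OF C] by auto
        ultimately show ?thesis
          using Q[of "concat (map L (V C))"] unfolding source_coeff_def by (simp only:)
      qed
      moreover have "target_coeff G (E C) (Lg C) k = target_coeff G (E C) (Lg C) l"
      proof -
        have sub: "set (pair_list (flip G) (E C) @ Lg C) \<subseteq> S C"
          using EC[OF C] by (auto simp: set_pair_list)
        have "(\<Prod>h\<in>set (E C). sigma_inv W c (k h) (k (flip G h))) = (\<Prod>h\<in>set (E C). sigma_inv W c (l h) (l (flip G h)))"
          using sub kl by (intro prod.cong refl) (auto simp: set_pair_list subset_iff)
        then show ?thesis unfolding target_coeff_def using Q[OF sub] by (simp only:)
      qed
      moreover have "{v\<in>C. odd_vertex G k v} = {v\<in>C. odd_vertex G l v}" using odd by auto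
      moreover have "map k (Lg C) = map l (Lg C)"
        using kl EC[OF C] by (intro map_cong refl) auto
      ultimately show "fls_const (coef C k) = fls_const (coef C l) \<and> map k (Lg C) = map l (Lg C)"
        unfolding coef_def by (simp only: simp_thms)
    next
      show "S C \<inter> S C' = {}" if "C \<in> set Cs" "C' \<in> set Cs" "C \<noteq> C'" for C C'
        using disjS that Cs by blast
    qed
    finally have 1: "fprod_list P (map (\<lambda>C. connected_amplitude W c f (subgraph G C)) Cs) =
      (\<Sum>k\<in>PiE (\<Union>C\<in>set Cs. S C) ?D. fscale (\<Prod>C\<in>set Cs. fls_const (coef C k))
        (word_fun P (concat (map (\<lambda>C. map k (Lg C)) Cs))))" .
    show ?thesis
      unfolding 1 Cs(2) US colG fls_const_prod map_concat map_map o_def ..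
  qed
  let ?legs = "\<lambda>Cs. concat (map Lg Cs)"
  let ?QC = "\<lambda>k C. odd (length (filter (\<lambda>h. P (k h)) (Lg C)))"
  have mset_legs: "mset (?legs Cs) = mset (?legs Cs0)" if "distinct Cs" "set Cs = ?K" for Cs
  proof -
    have "mset Cs = mset Cs0" using that Cs0 set_eq_iff_mset_eq_distinct[of Cs Cs0] by simp
    moreover have "mset (?legs Xs) = sum_mset (image_mset (\<lambda>C. mset (Lg C)) (mset Xs))" for Xs
      by (induction Xs) auto
    ultimately show ?thesis by (simp only:)
  qed
  \<comment> \<open>Exchanging two components permutes their leg words, so a component counts as odd
    according to its number of odd legs.\<close>
  have signs: "(\<Sum>Cs\<in>permutations_of_set ?K. ksign P (map k (?legs Cs))) =
      (if card {C\<in>?K. ?QC k C} \<le> 1 then fact (card ?K) * ksign P (map k (?legs Cs0)) else 0)" for k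
  proof (rule sum_permutations_of_set_sign[OF K(1)])
    show "Cs0 \<in> permutations_of_set ?K" using Cs0 by (simp add: permutations_of_set_def)
    fix xs a b ys
    have fl: "length (filter P (map k (Lg C))) = length (filter (\<lambda>h. P (k h)) (Lg C))" for C
      by (simp add: filter_map o_def)
    show "ksign P (map k (?legs (xs @ a # b # ys))) =
        (if ?QC k a \<and> ?QC k b then -1 else 1) * ksign P (map k (?legs (xs @ b # a # ys)))"
      using ksign_swap_blocks[of P "map k (?legs xs)" "map k (Lg a)" "map k (Lg b)" "map k (?legs ys)"]
      unfolding fl by (auto simp: minus_one_power_iff)
  qed
  define Vs where "Vs = concat (map V Cs0)"
  define E0 where "E0 = concat (map E Cs0)"
  have disjC: "C \<inter> C' = {}" if "C \<in> ?K" "C' \<in> ?K" "C \<noteq> C'" for C C' by (rule K(4)[OF that])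
  have dist: "distinct (concat (map g Cs))"
    if "distinct Cs" "set Cs \<subseteq> ?K" "\<And>C. C \<in> ?K \<Longrightarrow> distinct (g C)"
      "\<And>C C'. C \<in> ?K \<Longrightarrow> C' \<in> ?K \<Longrightarrow> C \<noteq> C' \<Longrightarrow> set (g C) \<inter> set (g C') = {}" for g :: "nat set \<Rightarrow> nat list" and Cs
    using that(1,2)
  proof (induction Cs)
    case (Cons C Cs)
    have "set (g C) \<inter> set (g C') = {}" if "C' \<in> set Cs" for C'
      using that(1) Cons.prems \<open>\<And>C C'. C \<in> ?K \<Longrightarrow> C' \<in> ?K \<Longrightarrow> C \<noteq> C' \<Longrightarrow> set (g C) \<inter> set (g C') = {}\<close>[of C C'] by auto
    then have "set (g C) \<inter> set (concat (map g Cs)) = {}" by auto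
    then show ?case using Cons that(3)[of C] by simp
  qed simp
  have Vs: "distinct Vs" "set Vs = verts G"
  proof -
    show "distinct Vs" unfolding Vs_def using VC disjC Cs0 by (intro dist) auto
    show "set Vs = verts G" unfolding Vs_def using VC Cs0 K(3) by auto
  qed
  have L0: "vertex_choice G L" by (simp add: vertex_choice_def Llist)
  have halvesU: "h \<in> halves G \<Longrightarrow> \<exists>C\<in>?K. h \<in> S C" for h using US by blast
  have E0: "edge_choice G E0"
    unfolding edge_choice_def
  proof (intro conjI)
    show "distinct E0" unfolding E0_def
    proof (rule dist)
      show "set (E C) \<inter> set (E C') = {}" if "C \<in> ?K" "C' \<in> ?K" "C \<noteq> C'" for C C'
        using EC(3)[OF that(1)] EC(3)[OF that(2)] disjS[OF that] by blast
    qed (use Cs0 EC in auto)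
    have setE0: "set E0 = (\<Union>C\<in>?K. set (E C))" by (simp add: E0_def Cs0)
    show "set E0 \<inter> flip G ` set E0 = {}"
    proof (rule ccontr)
      assume "set E0 \<inter> flip G ` set E0 \<noteq> {}"
      then obtain h where h: "h \<in> set E0" "h \<in> flip G ` set E0" by blast
      from h(1) obtain C where C: "C \<in> ?K" "h \<in> set (E C)" unfolding setE0 by (rule UN_E)
      from h(2) obtain g where g: "h = flip G g" "g \<in> set E0" by (rule imageE)
      from g(2) obtain C' where C': "C' \<in> ?K" "g \<in> set (E C')" unfolding setE0 by (rule UN_E)
      have hC': "h \<in> flip G ` set (E C')" using g(1) C'(2) by (rule image_eqI)
      have "h \<in> S C" "h \<in> S C'" using EC(3)[OF C(1)] EC(3)[OF C'(1)] C(2) hC' by blast+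
      then have "C = C'" using disjS[OF C(1) C'(1)] by blast
      then show False using EC(2)[OF C(1)] C(2) hC' by blast
    qed
    have "set E0 \<union> flip G ` set E0 = (\<Union>C\<in>?K. set (E C) \<union> flip G ` set (E C))"
      unfolding setE0 by blast
    also have "\<dots> = (\<Union>C\<in>?K. inner_halves G \<inter> S C)" using EC(3) by (intro SUP_cong refl) auto
    also have "\<dots> = inner_halves G" using halvesU by (auto simp: inner_halves_def)
    finally show "set E0 \<union> flip G ` set E0 = inner_halves G" .
  qed
  have Lg0: "leg_choice G (?legs Cs0)"
    unfolding leg_choice_def
  proof
    show "distinct (?legs Cs0)"
    proof (rule dist)
      show "set (Lg C) \<inter> set (Lg C') = {}" if "C \<in> ?K" "C' \<in> ?K" "C \<noteq> C'" for C C'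
        using EC(5)[OF that(1)] EC(5)[OF that(2)] disjS[OF that] by blast
    qed (use Cs0 EC in auto)
    have "set (?legs Cs0) = (\<Union>C\<in>?K. leg_halves G \<inter> S C)" using EC(5) Cs0 by auto
    then show "set (?legs Cs0) = leg_halves G" using halvesU by (auto simp: leg_halves_def)
  qed
  \<comment> \<open>The left conditions come from the average over the components and, inside
    \<open>coef\<close>, from the averages within them; the right condition comes from the single
    average over all vertices.\<close>
  have key: "(if card {C\<in>?K. ?QC k C} \<le> 1 then (\<Prod>C\<in>?K. coef C k) else 0) =
      (if card {v\<in>verts G. odd_vertex G k v} \<le> 1
        then source_coeff f G Vs L k * target_coeff G E0 (?legs Cs0) k else 0)"
    if k: "k \<in> colourings c G" for k
  proof -
    let ?Q = "\<lambda>h. P (k h)"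
    let ?s = "\<lambda>h. sigma_inv W c (k h) (k (flip G h))"
    have prodE: "(\<Prod>h\<in>set E0. ?s h) = (\<Prod>C\<in>?K. \<Prod>h\<in>set (E C). ?s h)"
    proof -
      have U: "set E0 = (\<Union>C\<in>?K. set (E C))" by (simp add: E0_def Cs0)
      have dj: "set (E C) \<inter> set (E C') = {}" if "C \<in> ?K" "C' \<in> ?K" "C \<noteq> C'" for C C'
        using EC(3)[OF that(1)] EC(3)[OF that(2)] disjS[OF that] by blast
      show ?thesis unfolding U by (rule prod.UNION_disjoint[OF K(1)]) (use dj in simp_all)
    qed
    show ?thesis
    \<comment> \<open>A vanishing edge factor kills both sides. Otherwise the two halves of every
      edge have equal parity, on which the parity counts rest.\<close>
    proof (cases "\<exists>h\<in>set E0. ?s h = 0")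
      case True
      then have z: "(\<Prod>h\<in>set E0. ?s h) = 0" by (auto intro: prod_zero)
      then obtain C where "C \<in> ?K" "(\<Prod>h\<in>set (E C). ?s h) = 0"
        unfolding prodE using K(1) by (auto simp: prod_zero_iff)
      then have "coef C k = 0" by (simp add: coef_def target_coeff_def)
      then have "(\<Prod>C\<in>?K. coef C k) = 0" using \<open>C \<in> ?K\<close> K(1) by (auto intro: prod_zero)
      moreover have "target_coeff G E0 (?legs Cs0) k = 0" using z by (simp add: target_coeff_def)
      ultimately show ?thesis by simp
    next
      case False
      have par: "?Q h \<longleftrightarrow> ?Q (flip G h)" if h: "h \<in> set E0" for h
      proof -
        have "h \<in> inner_halves G" "flip G h \<in> inner_halves G"
          using edge_choice_props(3)[OF G E0 h] by auto
        then show ?thesis using sigma_inv_parity[OF colouring_coords(1)[OF k] colouring_coords(1)[OF k]] False h by blast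
      qed
      have EE0: "set (E C) \<subseteq> set E0" if "C \<in> ?K" for C using that by (auto simp: E0_def Cs0)
      have evC: "even (length (filter ?Q (pair_list (flip G) (E C))))" if "C \<in> ?K" for C
        using par EE0[OF that] by (intro even_filter_pair_list) blast
      \<comment> \<open>The odd half-edges of a component are counted modulo 2 in two ways: edges
        contribute even numbers, which leaves the odd legs, and grouping by vertices leaves the odd
        vertices.\<close>
      have QC: "?QC k C \<longleftrightarrow> odd (card {v\<in>C. odd_vertex G k v})" if C: "C \<in> ?K" for C
      proof -
        note lists = choice_lists[OF sub[OF C] choiceC(2,3)[OF C]]
        have "length (filter ?Q (pair_list (flip G) (E C) @ Lg C)) = card (set (filter ?Q (pair_list (flip G) (E C) @ Lg C)))"
          using lists(1) by (intro distinct_card[symmetric] distinct_filter) simp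
        also have "set (filter ?Q (pair_list (flip G) (E C) @ Lg C)) = {h\<in>S C. ?Q h}"
          using lists(2) unfolding set_filter by (auto simp: S_def)
        also have "{h\<in>S C. ?Q h} = (\<Union>v\<in>C. {h\<in>halves G. att G h = v \<and> ?Q h})"
          by (auto simp: S_def)
        also have "card \<dots> = (\<Sum>v\<in>C. card {h\<in>halves G. att G h = v \<and> ?Q h})"
          using finC[OF C] finG by (intro card_UN_disjoint) auto
        finally have "length (filter ?Q (pair_list (flip G) (E C))) + length (filter ?Q (Lg C)) =
            (\<Sum>v\<in>C. card {h\<in>halves G. att G h = v \<and> ?Q h})" by simp
        moreover have "even (\<Sum>v\<in>C. card {h\<in>halves G. att G h = v \<and> ?Q h}) \<longleftrightarrow> even (card {v\<in>C. odd_vertex G k v})"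
          using finC[OF C] unfolding odd_vertex_def by (rule even_sum_iff)
        ultimately show ?thesis using evC[OF C] by (metis even_add)
      qed
      have cardV: "card {v\<in>verts G. odd_vertex G k v} = (\<Sum>C\<in>?K. card {v\<in>C. odd_vertex G k v})"
      proof -
        have "{v\<in>verts G. odd_vertex G k v} = (\<Union>C\<in>?K. {v\<in>C. odd_vertex G k v})" using K(3) by auto
        moreover have "card \<dots> = (\<Sum>C\<in>?K. card {v\<in>C. odd_vertex G k v})"
        proof (rule card_UN_disjoint[OF K(1)]; intro ballI impI)
          show "finite {v\<in>C. odd_vertex G k v}" if "C \<in> ?K" for C using finC[OF that] by simp
          show "{v\<in>C. odd_vertex G k v} \<inter> {v\<in>C'. odd_vertex G k v} = {}"
            if "C \<in> ?K" "C' \<in> ?K" "C \<noteq> C'" for C C' using disjC[OF that] by blast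
        qed
        ultimately show ?thesis by simp
      qed
      \<comment> \<open>If every component has at most one odd vertex, the components with an odd
        number of odd legs are exactly those that contain one, so both counts agree.\<close>
      have iff: "card {C\<in>?K. ?QC k C} \<le> 1 \<and> (\<forall>C\<in>?K. ?cond k C) \<longleftrightarrow> card {v\<in>verts G. odd_vertex G k v} \<le> 1"
      proof -
        have "card {C\<in>?K. ?QC k C} = card {v\<in>verts G. odd_vertex G k v}" if all: "\<forall>C\<in>?K. ?cond k C"
        proof -
          have "card {v\<in>C. odd_vertex G k v} = (if ?QC k C then 1 else 0)" if "C \<in> ?K" for C
            using QC[OF that] all that by (cases "card {v\<in>C. odd_vertex G k v}") auto
          then have "card {v\<in>verts G. odd_vertex G k v} = (\<Sum>C\<in>?K. if ?QC k C then 1 else 0)"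
            unfolding cardV by (intro sum.cong refl) auto
          also have "\<dots> = card {C\<in>?K. ?QC k C}" using K(1) by (simp add: sum.If_cases Int_def)
          finally show ?thesis by simp
        qed
        moreover have "\<forall>C\<in>?K. ?cond k C" if "card {v\<in>verts G. odd_vertex G k v} \<le> 1"
        proof
          fix C assume "C \<in> ?K"
          then have "card {v\<in>C. odd_vertex G k v} \<le> card {v\<in>verts G. odd_vertex G k v}"
            using K(2) finG by (intro card_mono) auto
          then show "?cond k C" using that by simp
        qed
        ultimately show ?thesis by auto
      qed
      let ?x = "\<lambda>C. concat (map L (V C))" and ?p = "\<lambda>C. pair_list (flip G) (E C)"
      let ?y = "\<lambda>C. ?p C @ Lg C"
      have xy: "distinct (?x C)" "set (?x C) = S C" "distinct (?y C)" "set (?y C) = S C" if C: "C \<in> ?K" for C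
        using vertex_choice_lists[OF sub[OF C] choiceC(1)[OF C], of "V C"] VC[OF C]
          choice_lists[OF sub[OF C] choiceC(2,3)[OF C]] by (auto simp: S_def)
      have m: "mset (?x C) = mset (?y C)" if "C \<in> set Cs0" for C
        using xy[of C] that Cs0 set_eq_iff_mset_eq_distinct[of "?x C" "?y C"] by simp
      have prodK: "(\<Prod>C\<leftarrow>Cs0. g C) = (\<Prod>C\<in>?K. g C)" for g :: "_ \<Rightarrow> real"
        using prod.distinct_set_conv_list[OF Cs0(1), of g] unfolding Cs0(2) by (rule sym)
      have X: "ksign ?Q (concat (map ?x Cs0)) * (\<Prod>C\<in>?K. ksign ?Q (?x C)) =
          ksign ?Q (concat (map ?y Cs0)) * (\<Prod>C\<in>?K. ksign ?Q (?y C))"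
      proof -
        have "ksign ?Q (concat (map ?x Cs0)) * (\<Prod>C\<leftarrow>Cs0. ksign ?Q (?x C)) =
            ksign ?Q (concat (map ?y Cs0)) * (\<Prod>C\<leftarrow>Cs0. ksign ?Q (?y C))"
          by (rule ksign_concat_perm) (rule m)
        then show ?thesis unfolding prodK .
      qed
      have sqx: "(\<Prod>C\<in>?K. ksign ?Q (?x C)) * (\<Prod>C\<in>?K. ksign ?Q (?x C)) = 1"
        using xy(1) by (simp flip: prod.distrib del: distinct_concat_iff)
      have dy: "distinct (concat (map ?y Cs0))"
        using dist[OF Cs0(1), of ?y] Cs0(2) xy(3,4) disjS by simp
      have Y: "concat (map ?x Cs0) = concat (map L Vs)"
        unfolding Vs_def by (induction Cs0) auto
      have Z: "ksign ?Q (concat (map ?y Cs0)) = ksign ?Q (pair_list (flip G) E0 @ ?legs Cs0)"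
      proof -
        have "pair_list (flip G) E0 = concat (map ?p Cs0)"
          unfolding E0_def by (induction Cs0) auto
        then show ?thesis using ksign_concat_pairs[of Cs0 ?Q ?p "[]" Lg] evC Cs0 by simp
      qed
      \<comment> \<open>By \<open>X\<close>, concatenating the component words costs the same
        correction at the source and at the target, so the total rearrangement sign is the product
        of the signs of the components.\<close>
      have sgn: "ksign ?Q (concat (map L Vs)) * ksign ?Q (pair_list (flip G) E0 @ ?legs Cs0) =
          (\<Prod>C\<in>?K. ksign ?Q (?x C)) * (\<Prod>C\<in>?K. ksign ?Q (?y C))"
      proof -
        have "ksign ?Q (concat (map ?y Cs0)) * ksign ?Q (concat (map ?y Cs0)) = 1"
          by (rule ksign_distinct_square[OF dy])
        from sign_cancel[OF X sqx this] show ?thesis unfolding Y Z .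
      qed
      have wts: "(\<Prod>v\<in>set Vs. vertex_weight P f (genus G v) (map k (L v))) =
          (\<Prod>C\<in>?K. \<Prod>v\<in>set (V C). vertex_weight P f (genus G v) (map k (L v)))"
      proof -
        have U: "set Vs = (\<Union>C\<in>?K. set (V C))" by (simp add: Vs_def Cs0)
        have dj: "set (V C) \<inter> set (V C') = {}" if "C \<in> ?K" "C' \<in> ?K" "C \<noteq> C'" for C C'
          using disjC[OF that] VC that by simp
        show ?thesis unfolding U by (rule prod.UNION_disjoint[OF K(1)]) (use dj in simp_all)
      qed
      have "source_coeff f G Vs L k * target_coeff G E0 (?legs Cs0) k =
          (ksign ?Q (concat (map L Vs)) * ksign ?Q (pair_list (flip G) E0 @ ?legs Cs0)) *
          ((\<Prod>C\<in>?K. \<Prod>v\<in>set (V C). vertex_weight P f (genus G v) (map k (L v))) *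
           (\<Prod>C\<in>?K. \<Prod>h\<in>set (E C). ?s h))"
        unfolding source_coeff_def target_coeff_def wts prodE by (simp only: mult_ac)
      also have "\<dots> = (\<Prod>C\<in>?K. source_coeff f G (V C) L k * target_coeff G (E C) (Lg C) k)"
        unfolding sgn source_coeff_def target_coeff_def prod.distrib by (simp only: mult_ac)
      finally have total: "source_coeff f G Vs L k * target_coeff G E0 (?legs Cs0) k =
          (\<Prod>C\<in>?K. source_coeff f G (V C) L k * target_coeff G (E C) (Lg C) k)" .
      have coefs: "(\<Prod>C\<in>?K. coef C k) = (if \<forall>C\<in>?K. ?cond k C
          then (\<Prod>C\<in>?K. source_coeff f G (V C) L k * target_coeff G (E C) (Lg C) k) else 0)"
      proof (cases "\<forall>C\<in>?K. ?cond k C")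
        case True
        then show ?thesis unfolding coef_def by (simp cong: prod.cong)
      next
        case False
        then obtain C where "C \<in> ?K" "coef C k = 0" unfolding coef_def by auto
        then have "(\<Prod>C\<in>?K. coef C k) = 0" using K(1) by (auto intro: prod_zero)
        then show ?thesis by (simp only: False if_False)
      qed
      show ?thesis unfolding total coefs using iff by auto
    qed
  qed
  have "amplitude W c f G = (\<Sum>k\<in>colourings c G. fscale (fls_const
      (if card {C\<in>?K. ?QC k C} \<le> 1 then (\<Prod>C\<in>?K. coef C k) else 0)) (word_fun P (map k (?legs Cs0))))"
  proof
    fix m :: "nat multiset"
    let ?n = "fact (card ?K) :: real" and ?PK = "permutations_of_set ?K"
    let ?w = "\<lambda>k. if m = mset (map k (?legs Cs0)) then 1 else 0 :: real fls"
    have word: "word_fun P (map k (?legs Cs)) m = fls_const (ksign P (map k (?legs Cs))) * ?w k" if "Cs \<in> ?PK" for k Cs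
      using mset_legs[of Cs] that by (simp add: word_fun_def permutations_of_set_def)
    have "amplitude W c f G m = fls_const (1 / ?n) * (\<Sum>Cs\<in>?PK. \<Sum>k\<in>colourings c G.
        fls_const (\<Prod>C\<in>?K. coef C k) * word_fun P (map k (?legs Cs)) m)"
      unfolding amplitude_def average_orders_def fscale_def sum_ffun_apply
      using prodC by (intro arg_cong[of _ _ "(*) _"] sum.cong refl)
        (simp add: permutations_of_set_def sum_ffun_apply fscale_def)
    also have "\<dots> = (\<Sum>k\<in>colourings c G. fls_const (1 / ?n) * (\<Sum>Cs\<in>?PK.
        fls_const (\<Prod>C\<in>?K. coef C k) * word_fun P (map k (?legs Cs)) m))"
      by (subst sum.swap) (simp only: sum_distrib_left)
    also have "\<dots> = (\<Sum>k\<in>colourings c G. fls_const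
      (if card {C\<in>?K. ?QC k C} \<le> 1 then (\<Prod>C\<in>?K. coef C k) else 0) * word_fun P (map k (?legs Cs0)) m)"
    proof (rule sum.cong[OF refl])
      fix k
      have Cs0in: "Cs0 \<in> ?PK" using Cs0 by (simp add: permutations_of_set_def)
      have "(\<Sum>Cs\<in>?PK. fls_const (\<Prod>C\<in>?K. coef C k) * word_fun P (map k (?legs Cs)) m) =
          (\<Sum>Cs\<in>?PK. fls_const (ksign P (map k (?legs Cs))) * (fls_const (\<Prod>C\<in>?K. coef C k) * ?w k))"
        by (intro sum.cong refl) (simp only: word mult_ac)
      also have "\<dots> = fls_const (\<Sum>Cs\<in>?PK. ksign P (map k (?legs Cs))) * (fls_const (\<Prod>C\<in>?K. coef C k) * ?w k)"
        by (simp only: sum_distrib_right[symmetric] fls_const_sum)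
      finally show "fls_const (1 / ?n) * (\<Sum>Cs\<in>?PK. fls_const (\<Prod>C\<in>?K. coef C k) * word_fun P (map k (?legs Cs)) m) =
          fls_const (if card {C\<in>?K. ?QC k C} \<le> 1 then (\<Prod>C\<in>?K. coef C k) else 0) * word_fun P (map k (?legs Cs0)) m"
        unfolding word[OF Cs0in] by (simp only: signs average_sign[OF fact_nonzero])
    qed
    finally show "amplitude W c f G m = (\<Sum>k\<in>colourings c G. fscale (fls_const
      (if card {C\<in>?K. ?QC k C} \<le> 1 then (\<Prod>C\<in>?K. coef C k) else 0)) (word_fun P (map k (?legs Cs0)))) m"
      by (simp only: sum_ffun_apply fscale_def)
  qed
  also have "\<dots> = average_orders (verts G) (contraction W c f G)"
    unfolding average_contraction[OF G Vs L0 E0 Lg0] by (intro sum.cong refl) (simp only: key)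
  finally show ?thesis .
qed

end

section \<open>The Euler characteristic\<close>

text \<open>Rank-nullity for a subspace in the span of a finite set, while the ambient space may be
  infinite-dimensional. Extending a basis of the kernel to \<open>S\<close> gives one inequality,
  lifting a basis of the image the other.\<close>

lemma (in vector_space) dim_kernel_image:
  assumes lin: "Vector_Spaces.linear scale scale f" and S: "subspace S"
    and fin: "finite T" "S \<subseteq> span T"
  shows "dim S = dim {x\<in>S. f x = 0} + dim (f ` S)"
proof -
  interpret f: Vector_Spaces.linear scale scale f by (rule lin)
  let ?N = "{x\<in>S. f x = 0}"
  obtain BN where BN: "BN \<subseteq> ?N" "independent BN" "?N \<subseteq> span BN" "card BN = dim ?N"
    using basis_exists[of ?N] by blast
  obtain B where B: "BN \<subseteq> B" "B \<subseteq> S" "independent B" "S \<subseteq> span B"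
    using maximal_independent_subset_extend[of BN S] BN by auto
  have finB: "finite B" using independent_span_bound[OF fin(1) B(3)] B(2) fin(2) by auto
  have finBN: "finite BN" using B(1) finB by (rule finite_subset)
  have "f ` S \<subseteq> span (f ` (B - BN))"
  proof
    fix y assume "y \<in> f ` S"
    then have "y \<in> f ` span B" using B(4) by auto
    then have "y \<in> span (f ` B)" by (simp add: f.span_image)
    moreover have "f ` B \<subseteq> span (f ` (B - BN))"
    proof
      fix z assume "z \<in> f ` B"
      then obtain b where "b \<in> B" "z = f b" by blast
      then show "z \<in> span (f ` (B - BN))"
      proof (cases "b \<in> BN")
        case True
        then have "f b = 0" using BN(1) by blast
        then show ?thesis using \<open>z = f b\<close> by (simp add: span_zero)
      next
        case False
        then have "z \<in> f ` (B - BN)" using \<open>b \<in> B\<close> \<open>z = f b\<close> by blast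
        then show ?thesis by (rule span_base)
      qed
    qed
    ultimately show "y \<in> span (f ` (B - BN))"
      using span_minimal[of "f ` B" "span (f ` (B - BN))"] by auto
  qed
  then have "dim (f ` S) \<le> card (f ` (B - BN))" using finB by (intro dim_le_card) auto
  also have "\<dots> \<le> card (B - BN)" using finB by (intro card_image_le) auto
  also have "\<dots> = card B - card BN" using finBN B(1) by (intro card_Diff_subset)
  also have "card B = dim S" using B by (intro basis_card_eq_dim)
  finally have 1: "dim (f ` S) \<le> dim S - dim ?N" using BN(4) by simp
  have le: "dim ?N \<le> dim S"
    using card_mono[OF finB B(1)] unfolding BN(4) basis_card_eq_dim[OF B(2) B(4) B(3)] .
  obtain B' where B': "B' \<subseteq> f ` S" "independent B'" "f ` S \<subseteq> span B'" "card B' = dim (f ` S)"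
    using basis_exists[of "f ` S"] by blast
  then obtain g where g: "\<And>b. b \<in> B' \<Longrightarrow> g b \<in> S \<and> f (g b) = b"
  proof -
    assume *: "\<And>g. (\<And>b. b \<in> B' \<Longrightarrow> g b \<in> S \<and> f (g b) = b) \<Longrightarrow> thesis"
    have "\<forall>b\<in>B'. \<exists>x. x \<in> S \<and> f x = b" using B'(1) by blast
    from bchoice[OF this] obtain g where "\<forall>b\<in>B'. g b \<in> S \<and> f (g b) = b" by blast
    then show thesis using *[of g] by blast
  qed
  have "f ` S \<subseteq> span (f ` B)" using B(4) by (auto simp: f.span_image)
  then have finB': "finite B'"
    using independent_span_bound[of "f ` B" B'] B' finB by auto
  have "S \<subseteq> span (BN \<union> g ` B')"
  proof
    fix x assume x: "x \<in> S"
    have "f ` g ` B' = B'" using g by (force simp: image_iff)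
    then have "f x \<in> f ` span (g ` B')"
      using B'(3) x f.span_image[of "g ` B'"] by auto
    then obtain y where y: "y \<in> span (g ` B')" "f y = f x" by auto
    have "y \<in> S" using y(1) span_minimal[of "g ` B'" S] g S by auto
    then have "x - y \<in> ?N" using x S y(2) by (auto simp: subspace_diff f.diff)
    then have "x - y \<in> span (BN \<union> g ` B')" using BN(3) span_mono[of BN "BN \<union> g ` B'"] by blast
    moreover have "y \<in> span (BN \<union> g ` B')" using y(1) span_mono[of "g ` B'" "BN \<union> g ` B'"] by blast
    ultimately have "(x - y) + y \<in> span (BN \<union> g ` B')" by (rule span_add)
    then show "x \<in> span (BN \<union> g ` B')" by simp
  qed
  then have "dim S \<le> card (BN \<union> g ` B')" using finBN finB' by (intro dim_le_card) auto
  also have "\<dots> \<le> card BN + card (g ` B')" by (rule card_Un_le)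
  also have "\<dots> \<le> dim ?N + dim (f ` S)" using BN(4) B'(4) card_image_le[OF finB', of g] by simp
  finally show ?thesis using 1 le by simp
qed

section \<open>Dimensions of the chain groups\<close>

interpretation fun_space: vector_space "\<lambda>(a::real) (c::nat \<Rightarrow> real) x. a * c x"
  by unfold_locales (auto simp: fun_eq_iff algebra_simps)

definition supported :: "nat set \<Rightarrow> (nat \<Rightarrow> real) set" where
  "supported A = {c. \<forall>v. v \<notin> A \<longrightarrow> c v = 0}"

definition unit_chain :: "nat \<Rightarrow> nat \<Rightarrow> real" where
  "unit_chain v = (\<lambda>x. if x = v then 1 else 0)"

lemma sum_chain_apply: "(\<Sum>v\<in>A. F v) x = (\<Sum>v\<in>A. F v x)" for F :: "'k \<Rightarrow> nat \<Rightarrow> real"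
  by (induction A rule: infinite_finite_induct) auto

lemma supported_span:
  assumes "finite A"
  shows "supported A \<subseteq> fun_space.span (unit_chain ` A)"
proof
  fix c assume c: "c \<in> supported A"
  have "c = (\<Sum>v\<in>A. (\<lambda>x. c v * unit_chain v x))"
  proof
    fix x
    have "(\<Sum>v\<in>A. c v * unit_chain v x) = (\<Sum>v\<in>A. if v = x then c v else 0)"
      by (intro sum.cong refl) (auto simp: unit_chain_def)
    also have "\<dots> = c x" using assms c by (auto simp: supported_def)
    finally show "c x = (\<Sum>v\<in>A. (\<lambda>x. c v * unit_chain v x)) x" by (simp add: sum_chain_apply)
  qed
  also have "\<dots> \<in> fun_space.span (unit_chain ` A)"
    by (intro fun_space.span_sum fun_space.span_scale fun_space.span_base) auto
  finally show "c \<in> fun_space.span (unit_chain ` A)" .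
qed

lemma dim_supported:
  assumes fin: "finite A"
  shows "chain_dim (supported A) = card A"
proof (rule fun_space.dim_unique)
  have inj: "inj_on unit_chain A"
    by (intro inj_onI) (metis unit_chain_def zero_neq_one)
  show "unit_chain ` A \<subseteq> supported A" by (auto simp: supported_def unit_chain_def)
  show "supported A \<subseteq> fun_space.span (unit_chain ` A)" by (rule supported_span[OF fin])
  show "card (unit_chain ` A) = card A" using inj by (rule card_image)
  show "fun_space.independent (unit_chain ` A)"
  proof
    assume "fun_space.dependent (unit_chain ` A)"
    then obtain u w where u: "w \<in> A" "u (unit_chain w) \<noteq> 0"
      "(\<Sum>b\<in>unit_chain ` A. (\<lambda>x. u b * b x)) = 0"
      using fin by (auto simp: fun_space.dependent_finite)
    have "(\<Sum>v\<in>A. (\<lambda>x. u (unit_chain v) * unit_chain v x)) w = 0"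
      using u(3) inj by (simp add: sum.reindex o_def)
    then have "(\<Sum>v\<in>A. u (unit_chain v) * unit_chain v w) = 0" by (simp add: sum_chain_apply)
    moreover have "(\<Sum>v\<in>A. u (unit_chain v) * unit_chain v w) = (\<Sum>v\<in>A. if v = w then u (unit_chain v) else 0)"
      by (intro sum.cong refl) (auto simp: unit_chain_def)
    ultimately show False using fin u(1,2) by simp
  qed
qed

lemma linear_funI:
  assumes "\<And>c d x. f (c + d) x = f c x + f d x" "\<And>a c x. f (\<lambda>x. a * c x) x = a * f c x"
  shows "Vector_Spaces.linear (\<lambda>(a::real) (c::nat \<Rightarrow> real) x. a * c x) (\<lambda>(a::real) (c::nat \<Rightarrow> real) x. a * c x) f"
  by unfold_locales (use assms in \<open>auto simp: fun_eq_iff algebra_simps\<close>)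

lemma subspace_chains1: "fun_space.subspace (chains1 G)"
  by (auto simp: fun_space.subspace_def chains1_def)

lemma chains1_supported: "chains1 G \<subseteq> supported (halves G)"
  by (auto simp: chains1_def supported_def)

text \<open>A 1-chain is determined by its values on the smaller half of each edge, and these values
  are arbitrary; on a leg it equals its own negative. Rank-nullity for the restriction
  \<open>?f\<close> turns this into a dimension.\<close>

lemma dim_chains1:
  assumes G: "wf_graph G"
  shows "chain_dim (chains1 G) = length (edge_list G)"
proof -
  let ?E = "set (edge_list G)"
  let ?f = "\<lambda>(c::nat \<Rightarrow> real) x. if x \<in> ?E then c x else 0"
  have finH: "finite (halves G)" using G by (simp add: wf_graph_def)
  have fl: "flip G h \<in> halves G" "flip G (flip G h) = h" if "h \<in> halves G" for h
    using G that by (auto simp: wf_graph_def)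
  have E: "?E = {h\<in>halves G. h < flip G h}" "distinct (edge_list G)"
    using finH by (auto simp: edge_list_def)
  have "{c\<in>chains1 G. ?f c = 0} = {0}"
  proof (intro equalityI subsetI)
    fix c assume c: "c \<in> {c\<in>chains1 G. ?f c = 0}"
    have z: "c h = 0" if "h \<in> ?E" for h
    proof -
      have "?f c h = 0" using c by (simp add: fun_eq_iff del: split_paired_All)
      then show ?thesis using that by simp
    qed
    have "c h = 0" for h
    proof (cases "h \<in> halves G")
      case True
      then have neg: "c (flip G h) = - c h" using c by (auto simp: chains1_def)
      consider "h < flip G h" | "flip G h < h" | "flip G h = h" by linarith
      then show ?thesis
      proof cases
        case 1 then show ?thesis using z True E by auto
      next
        case 2
        then have "flip G h \<in> ?E" using fl True E by auto
        then show ?thesis using z neg by fastforce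
      next
        case 3 then show ?thesis using neg by simp
      qed
    qed (use c in \<open>auto simp: chains1_def\<close>)
    then show "c \<in> {0}" by (auto simp: fun_eq_iff)
  qed (auto simp: chains1_def fun_eq_iff)
  moreover have "?f ` chains1 G = supported ?E"
  proof (intro equalityI subsetI)
    fix c assume c: "c \<in> supported ?E"
    \<comment> \<open>The antisymmetric extension of \<open>c\<close> from one half of each edge to
      both.\<close>
    define d where "d = (\<lambda>h. if h \<in> ?E then c h else if h \<in> halves G \<and> flip G h \<in> ?E then - c (flip G h) else 0)"
    have "d \<in> chains1 G"
      unfolding chains1_def
    proof (safe)
      fix h assume "h \<notin> halves G"
      then show "d h = 0" using E by (auto simp: d_def)
    next
      fix h assume h: "h \<in> halves G"
      show "d (flip G h) = - d h"
        using h fl[OF h] unfolding d_def E by (cases "flip G h" h rule: linorder_cases) auto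
    qed
    moreover have "?f d = c" using c by (auto simp: d_def supported_def fun_eq_iff)
    ultimately show "c \<in> ?f ` chains1 G" by blast
  qed (auto simp: supported_def)
  moreover have "chain_dim (chains1 G) = chain_dim {c\<in>chains1 G. ?f c = 0} + chain_dim (?f ` chains1 G)"
    by (rule fun_space.dim_kernel_image[OF linear_funI subspace_chains1, of _ "unit_chain ` halves G"])
      (use finH supported_span[OF finH] chains1_supported in auto)
  moreover have "chain_dim ({0} :: (nat \<Rightarrow> real) set) = 0"
    using fun_space.dim_le_card[of "{0}" "{}"] by simp
  ultimately show ?thesis
    using dim_supported[of ?E] distinct_card[OF E(2)] by simp
qed

text \<open>The rank of the boundary map enters both Betti numbers and cancels in their
  difference.\<close>

lemma euler_char_eq:
  assumes G: "wf_graph G"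
  shows "euler_char G = int (card (verts G)) - int (length (edge_list G)) - (\<Sum>v\<in>verts G. int (genus G v))"
proof -
  have fin: "finite (halves G)" "finite (verts G)" using G by (auto simp: wf_graph_def)
  have "chain_dim (chains1 G) = chain_dim {c\<in>chains1 G. bdry G c = 0} + chain_dim (bdry G ` chains1 G)"
    by (rule fun_space.dim_kernel_image[OF linear_funI subspace_chains1, of _ "unit_chain ` halves G"])
      (use fin supported_span[OF fin(1)] chains1_supported in
        \<open>auto simp: bdry_def sum.distrib sum_distrib_left\<close>)
  moreover have "chain_dim (chains0 G) = card (verts G)"
    using dim_supported[OF fin(2)] by (simp add: chains0_def supported_def)
  moreover have "(0 :: nat \<Rightarrow> real) = (\<lambda>v. 0)" by (simp add: fun_eq_iff)
  ultimately show ?thesis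
    unfolding euler_char_def total_genus_def betti0_def betti1_def
    using dim_chains1[OF G] by simp
qed

section \<open>Counting labelled graphs\<close>

text \<open>The maps are \<open>undefined\<close> outside the graph, so equal labelled structures
  are equal records; the bound \<open>B\<close> on the genera makes the set finite.\<close>

definition labelled_graphs :: "nat \<Rightarrow> nat \<Rightarrow> nat \<Rightarrow> sgraph set" where
  "labelled_graphs n N B = {G. stable_graph G \<and> verts G = {..<n} \<and> halves G = {..<N} \<and>
     att G \<in> PiE {..<N} (\<lambda>_. {..<n}) \<and> flip G \<in> PiE {..<N} (\<lambda>_. {..<N}) \<and>
     genus G \<in> PiE {..<n} (\<lambda>_. {..B})}"

lemma finite_labelled_graphs: "finite (labelled_graphs n N B)"
proof (rule finite_subset)
  let ?T = "(PiE {..<N} (\<lambda>_. {..<n})) \<times> (PiE {..<N} (\<lambda>_. {..<N})) \<times> (PiE {..<n} (\<lambda>_. {..B}))"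
  let ?g = "\<lambda>(a, fl, g). \<lparr>halves = {..<N}, verts = {..<n}, att = a, flip = fl, genus = g\<rparr>"
  show "labelled_graphs n N B \<subseteq> ?g ` ?T"
  proof
    fix G assume G: "G \<in> labelled_graphs n N B"
    then have "G = ?g (att G, flip G, genus G)" by (simp add: labelled_graphs_def)
    then show "G \<in> ?g ` ?T" using G by (auto simp: labelled_graphs_def intro!: image_eqI)
  qed
  show "finite (?g ` ?T)" by (auto intro!: finite_imageI finite_cartesian_product finite_PiE)
qed

section \<open>Isomorphisms, automorphisms and relabellings\<close>

lemma graph_iso_cong:
  assumes "wf_graph G" "\<And>v. v \<in> verts G \<Longrightarrow> \<phi> v = \<phi>' v" "\<And>h. h \<in> halves G \<Longrightarrow> \<psi> h = \<psi>' h"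
  shows "graph_iso G G' \<phi> \<psi> \<longleftrightarrow> graph_iso G G' \<phi>' \<psi>'"
proof -
  have a: "att G h \<in> verts G" "flip G h \<in> halves G" if "h \<in> halves G" for h
    using assms(1) that by (auto simp: wf_graph_def)
  have "bij_betw \<phi> (verts G) (verts G') \<longleftrightarrow> bij_betw \<phi>' (verts G) (verts G')"
    "bij_betw \<psi> (halves G) (halves G') \<longleftrightarrow> bij_betw \<psi>' (halves G) (halves G')"
    using assms(2,3) by (intro bij_betw_cong; simp)+
  then show ?thesis
    unfolding graph_iso_def using a assms(2,3) by simp
qed

lemma graph_iso_comp:
  assumes "wf_graph G" "graph_iso G G' \<phi> \<psi>" "graph_iso G' G'' \<phi>' \<psi>'"
  shows "graph_iso G G'' (\<phi>' \<circ> \<phi>) (\<psi>' \<circ> \<psi>)"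
proof -
  have a: "att G h \<in> verts G" "flip G h \<in> halves G" if "h \<in> halves G" for h
    using assms(1) that by (auto simp: wf_graph_def)
  have b: "\<phi> v \<in> verts G'" if "v \<in> verts G" for v
    using assms(2) that by (auto simp: graph_iso_def bij_betw_def)
  have d: "\<psi> h \<in> halves G'" if "h \<in> halves G" for h
    using assms(2) that by (auto simp: graph_iso_def bij_betw_def)
  show ?thesis
    using assms(2,3) a b d unfolding graph_iso_def
    by (auto intro: bij_betw_trans)
qed

lemma graph_iso_inv:
  assumes G: "wf_graph G" and iso: "graph_iso G G' \<phi> \<psi>"
  shows "graph_iso G' G (the_inv_into (verts G) \<phi>) (the_inv_into (halves G) \<psi>)"
proof -
  let ?p = "the_inv_into (verts G) \<phi>" and ?q = "the_inv_into (halves G) \<psi>"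
  have bij: "bij_betw \<phi> (verts G) (verts G')" "bij_betw \<psi> (halves G) (halves G')"
    using iso by (auto simp: graph_iso_def)
  have inj: "inj_on \<phi> (verts G)" "inj_on \<psi> (halves G)" using bij by (auto simp: bij_betw_def)
  have a: "att G h \<in> verts G" "flip G h \<in> halves G" if "h \<in> halves G" for h
    using G that by (auto simp: wf_graph_def)
  show ?thesis
    unfolding graph_iso_def
  proof (intro conjI ballI)
    show "bij_betw ?p (verts G') (verts G)" "bij_betw ?q (halves G') (halves G)"
      using bij by (auto intro: bij_betw_the_inv_into)
  next
    fix h' assume "h' \<in> halves G'"
    then obtain h where h: "h \<in> halves G" "h' = \<psi> h" using bij(2) by (auto simp: bij_betw_def)
    have q: "?q h' = h" using h inj by (simp add: the_inv_into_f_f)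
    show "att G (?q h') = ?p (att G' h')"
      using iso h a[OF h(1)] inj unfolding q by (simp add: graph_iso_def the_inv_into_f_f)
    show "flip G (?q h') = ?q (flip G' h')"
      using iso h a[OF h(1)] inj unfolding q by (simp add: graph_iso_def the_inv_into_f_f)
  next
    fix v' assume "v' \<in> verts G'"
    then obtain v where v: "v \<in> verts G" "v' = \<phi> v" using bij(1) by (auto simp: bij_betw_def)
    then show "genus G (?p v') = genus G' v'"
      using iso inj by (simp add: graph_iso_def the_inv_into_f_f)
  qed
qed

definition isomorphic :: "sgraph \<Rightarrow> sgraph \<Rightarrow> bool" where
  "isomorphic G G' \<longleftrightarrow> (\<exists>\<phi> \<psi>. graph_iso G G' \<phi> \<psi>)"

lemma graph_iso_refl: "graph_iso G G id id"
  by (simp add: graph_iso_def)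

lemma isomorphic_equivp:
  "equiv {G. stable_graph G} {(G, G'). stable_graph G \<and> stable_graph G' \<and> isomorphic G G'}"
proof (rule equivI)
  show "refl_on {G. stable_graph G} {(G, G'). stable_graph G \<and> stable_graph G' \<and> isomorphic G G'}"
    unfolding refl_on_def isomorphic_def using graph_iso_refl by blast
  show "sym {(G, G'). stable_graph G \<and> stable_graph G' \<and> isomorphic G G'}"
    unfolding sym_def isomorphic_def using graph_iso_inv stable_graph_wf by blast
  show "trans {(G, G'). stable_graph G \<and> stable_graph G' \<and> isomorphic G G'}"
    unfolding trans_def isomorphic_def using graph_iso_comp stable_graph_wf by blast
qed auto

lemma bij_betw_map_permutes:
  assumes "set xs = A" "distinct xs"
  shows "bij_betw (\<lambda>\<alpha>. map \<alpha> xs) {\<alpha>. \<alpha> permutes A} (permutations_of_set A)"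
proof -
  have fin: "finite A" using assms by auto
  have inj: "inj_on (\<lambda>\<alpha>. map \<alpha> xs) {\<alpha>. \<alpha> permutes A}"
  proof (rule inj_onI)
    fix \<alpha> \<beta> assume ab: "\<alpha> \<in> {\<alpha>. \<alpha> permutes A}" "\<beta> \<in> {\<alpha>. \<alpha> permutes A}" "map \<alpha> xs = map \<beta> xs"
    show "\<alpha> = \<beta>"
    proof
      fix x show "\<alpha> x = \<beta> x"
        using ab assms by (cases "x \<in> A") (auto simp: permutes_def)
    qed
  qed
  have sub: "(\<lambda>\<alpha>. map \<alpha> xs) ` {\<alpha>. \<alpha> permutes A} \<subseteq> permutations_of_set A"
    using assms by (auto simp: permutations_of_set_def distinct_map permutes_image permutes_inj_on)
  have "(\<lambda>\<alpha>. map \<alpha> xs) ` {\<alpha>. \<alpha> permutes A} = permutations_of_set A"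
    by (rule card_subset_eq[OF _ sub])
      (use fin card_permutations[OF refl fin] card_image[OF inj] in simp_all)
  with inj show ?thesis by (simp add: bij_betw_def)
qed

lemma card_Aut_pos: "wf_graph G \<Longrightarrow> finite (Aut G) \<and> card (Aut G) > 0"
proof -
  assume G: "wf_graph G"
  have "Aut G \<subseteq> {\<alpha>. \<alpha> permutes verts G} \<times> {\<beta>. \<beta> permutes halves G}"
    by (auto simp: Aut_def)
  then have fin: "finite (Aut G)"
    using G by (rule_tac finite_subset) (auto simp: wf_graph_def intro: finite_permutations)
  have "(id, id) \<in> Aut G" by (simp add: Aut_def graph_iso_refl permutes_id)
  then show ?thesis using fin by (auto simp: card_gt_0_iff)
qed

lemma stable_graph_iso:
  assumes G: "stable_graph G" and iso: "graph_iso G G' \<phi> \<psi>"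
  shows "stable_graph G'"
proof -
  have wf: "wf_graph G" by (rule stable_graph_wf[OF G])
  have a: "att G h \<in> verts G" "flip G h \<in> halves G" "flip G (flip G h) = h" if "h \<in> halves G" for h
    using wf that by (auto simp: wf_graph_def)
  have img: "\<phi> ` verts G = verts G'" "\<psi> ` halves G = halves G'"
    and inj: "inj_on \<phi> (verts G)" "inj_on \<psi> (halves G)"
    using iso by (auto simp: graph_iso_def bij_betw_def)
  have att: "att G' (\<psi> h) = \<phi> (att G h)" and flip: "flip G' (\<psi> h) = \<psi> (flip G h)" if "h \<in> halves G" for h
    using iso that by (auto simp: graph_iso_def)
  have genus: "genus G' (\<phi> v) = genus G v" if "v \<in> verts G" for v
    using iso that by (auto simp: graph_iso_def)
  have H: "att G' h' \<in> verts G' \<and> flip G' h' \<in> halves G' \<and> flip G' (flip G' h') = h'" if "h' \<in> halves G'" for h'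
  proof -
    obtain h where h: "h \<in> halves G" "h' = \<psi> h" using \<open>h' \<in> halves G'\<close> img(2) by blast
    show ?thesis
      unfolding h(2) att[OF h(1)] flip[OF h(1)] flip[OF a(2)[OF h(1)]] a(3)[OF h(1)]
      using a[OF h(1)] img by blast
  qed
  have "2 * genus G' v' + card {h\<in>halves G'. att G' h = v'} \<ge> 3" if "v' \<in> verts G'" for v'
  proof -
    obtain v where v: "v \<in> verts G" "v' = \<phi> v" using \<open>v' \<in> verts G'\<close> img(1) by blast
    have "{h\<in>halves G'. att G' h = v'} = \<psi> ` {h\<in>halves G. att G h = v}"
    proof (intro equalityI subsetI)
      fix h' assume h': "h' \<in> {h\<in>halves G'. att G' h = v'}"
      then obtain h where h: "h \<in> halves G" "h' = \<psi> h" using img(2) by blast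
      then have "\<phi> (att G h) = \<phi> v" using h' att[OF h(1)] v by simp
      then have "att G h = v" by (rule inj_onD[OF inj(1) _ a(1)[OF h(1)] v(1)])
      then show "h' \<in> \<psi> ` {h\<in>halves G. att G h = v}" using h by blast
    qed (use att img v in auto)
    moreover have "card (\<psi> ` {h\<in>halves G. att G h = v}) = card {h\<in>halves G. att G h = v}"
      by (intro card_image inj_on_subset[OF inj(2)]) auto
    ultimately show ?thesis using G v genus[OF v(1)] by (simp add: stable_graph_def)
  qed
  moreover have "finite (halves G')" "finite (verts G')"
    unfolding img[symmetric] using G by (simp_all add: stable_graph_def)
  ultimately show ?thesis using H by (auto simp: stable_graph_def)
qed

text \<open>The structure is transported along the relabelling; since the maps of a labelled graph
  are \<open>undefined\<close> outside it, the result is unique as a record.\<close>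

lemma labelled_transport:
  assumes G: "stable_graph G" and B: "\<And>v. v \<in> verts G \<Longrightarrow> genus G v \<le> B"
    and p: "bij_betw p (verts G) {..<n}" and q: "bij_betw q (halves G) {..<N}"
  shows "\<exists>!G'. G' \<in> labelled_graphs n N B \<and> graph_iso G G' p q"
proof -
  have wf: "wf_graph G" by (rule stable_graph_wf[OF G])
  have a: "att G h \<in> verts G" "flip G h \<in> halves G" if "h \<in> halves G" for h
    using wf that by (auto simp: wf_graph_def)
  define p' where "p' = the_inv_into (verts G) p"
  define q' where "q' = the_inv_into (halves G) q"
  have inj: "inj_on p (verts G)" "inj_on q (halves G)" and img: "p ` verts G = {..<n}" "q ` halves G = {..<N}"
    using p q unfolding bij_betw_def by blast+
  have inv: "p' (p v) = v" if "v \<in> verts G" for v unfolding p'_def using inj(1) that by (rule the_inv_into_f_f)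
  have invq: "q' (q h) = h" if "h \<in> halves G" for h unfolding q'_def using inj(2) that by (rule the_inv_into_f_f)
  have memp: "p v < n" if "v \<in> verts G" for v using img(1) that by blast
  have memq: "q h < N" if "h \<in> halves G" for h using img(2) that by blast
  have memp': "p' v \<in> verts G" if "v < n" for v
    unfolding p'_def using the_inv_into_into[OF inj(1), of v "verts G"] img(1) that by auto
  have memq': "q' h \<in> halves G" if "h < N" for h
    unfolding q'_def using the_inv_into_into[OF inj(2), of h "halves G"] img(2) that by auto
  define G' where "G' = \<lparr>halves = {..<N}, verts = {..<n}, att = (\<lambda>h\<in>{..<N}. p (att G (q' h))),
     flip = (\<lambda>h\<in>{..<N}. q (flip G (q' h))), genus = (\<lambda>v\<in>{..<n}. genus G (p' v))\<rparr>"
  have sel: "halves G' = {..<N}" "verts G' = {..<n}" "att G' = (\<lambda>h\<in>{..<N}. p (att G (q' h)))"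
    "flip G' = (\<lambda>h\<in>{..<N}. q (flip G (q' h)))" "genus G' = (\<lambda>v\<in>{..<n}. genus G (p' v))"
    by (simp_all add: G'_def)
  have att': "att G' (q h) = p (att G h)" and flip': "flip G' (q h) = q (flip G h)" if "h \<in> halves G" for h
    using memq[OF that] invq[OF that] by (simp_all add: sel)
  have genus': "genus G' (p v) = genus G v" if "v \<in> verts G" for v
    using memp[OF that] inv[OF that] by (simp add: sel)
  have iso: "graph_iso G G' p q"
    unfolding graph_iso_def sel(1,2) using p q att' flip' genus' by blast
  have "G' \<in> labelled_graphs n N B"
  proof -
    have "p (att G (q' x)) < n" "q (flip G (q' x)) < N" if "x < N" for x
      using memp[OF a(1)[OF memq'[OF that]]] memq[OF a(2)[OF memq'[OF that]]] .
    moreover have "genus G (p' x) \<le> B" if "x < n" for x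
      using B[OF memp'[OF that]] .
    ultimately show ?thesis
      using stable_graph_iso[OF G iso] unfolding labelled_graphs_def mem_Collect_eq sel by auto
  qed
  moreover have "G1 = G'" if G1: "G1 \<in> labelled_graphs n N B" "graph_iso G G1 p q" for G1
  proof -
    have c1: "att G1 (q h) = p (att G h)" "flip G1 (q h) = q (flip G h)" if "h \<in> halves G" for h
      using G1(2) that by (auto simp: graph_iso_def)
    have c2: "genus G1 (p v) = genus G v" if "v \<in> verts G" for v
      using G1(2) that by (auto simp: graph_iso_def)
    have ext: "x = y" if "x \<in> PiE A T" "y \<in> PiE A T'" "\<And>z. z \<in> A \<Longrightarrow> x z = y z"
      for x y :: "nat \<Rightarrow> nat" and A T T'
    proof (rule HOL.ext)
      fix z show "x z = y z"
        using that(3)[of z] PiE_arb[OF that(1), of z] PiE_arb[OF that(2), of z] by (cases "z \<in> A") simp_all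
    qed
    have lg: "att G1 \<in> PiE {..<N} (\<lambda>_. {..<n})" "flip G1 \<in> PiE {..<N} (\<lambda>_. {..<N})" "genus G1 \<in> PiE {..<n} (\<lambda>_. {..B})"
      "verts G1 = {..<n}" "halves G1 = {..<N}"
      using G1(1) by (auto simp: labelled_graphs_def)
    have lg': "att G' \<in> PiE {..<N} (\<lambda>_. UNIV)" "flip G' \<in> PiE {..<N} (\<lambda>_. UNIV)" "genus G' \<in> PiE {..<n} (\<lambda>_. UNIV)"
      by (simp_all add: sel)
    have "att G1 = att G'" "flip G1 = flip G'"
    proof -
      have *: "att G1 h' = att G' h' \<and> flip G1 h' = flip G' h'" if "h' \<in> {..<N}" for h'
      proof -
        obtain h where h: "h \<in> halves G" "h' = q h" using img(2) \<open>h' \<in> {..<N}\<close> by blast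
        show ?thesis unfolding h(2) using c1[OF h(1)] att'[OF h(1)] flip'[OF h(1)] by simp
      qed
      show "att G1 = att G'" by (rule ext[OF lg(1) lg'(1)]) (use * in blast)
      show "flip G1 = flip G'" by (rule ext[OF lg(2) lg'(2)]) (use * in blast)
    qed
    moreover have "genus G1 = genus G'"
    proof (rule ext[OF lg(3) lg'(3)])
      fix v' assume "v' \<in> {..<n}"
      then obtain v where v: "v \<in> verts G" "v' = p v" using img(1) by blast
      show "genus G1 v' = genus G' v'" unfolding v(2) using c2[OF v(1)] genus'[OF v(1)] by simp
    qed
    ultimately show ?thesis using lg(4,5) sel(1,2) by (intro sgraph.equality) auto
  qed
  ultimately show ?thesis using iso by blast
qed

lemma permutes_extend:
  assumes "bij_betw g0 A Y" "bij_betw g A Y"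
  shows "\<exists>\<gamma>. \<gamma> permutes A \<and> (\<forall>x\<in>A. g0 (\<gamma> x) = g x)"
proof -
  let ?\<gamma> = "\<lambda>x. if x \<in> A then the_inv_into A g0 (g x) else x"
  have "bij_betw (the_inv_into A g0 \<circ> g) A A"
    by (rule bij_betw_trans[OF assms(2) bij_betw_the_inv_into[OF assms(1)]])
  moreover have "bij_betw ?\<gamma> A A \<longleftrightarrow> bij_betw (the_inv_into A g0 \<circ> g) A A"
    by (rule bij_betw_cong) simp
  ultimately have "?\<gamma> permutes A" by (intro bij_imp_permutes) simp_all
  moreover have "g0 (?\<gamma> x) = g x" if "x \<in> A" for x
  proof -
    have "g x \<in> g0 ` A" using assms that by (auto simp: bij_betw_def)
    then show ?thesis using that assms(1) by (simp add: bij_betw_def f_the_inv_into_f)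
  qed
  ultimately show ?thesis by blast
qed

text \<open>Double count of the relabellings \<open>(\<alpha>, \<beta>)\<close> together with the
  labelled graphs they produce: each pair produces one graph, and each labelled graph isomorphic to
  \<open>G\<close> comes from a coset of \<open>Aut G\<close>. \<open>F\<close> takes a vertex order
  because its invariance is assumed only under simultaneous transport of the graph and the
  order.\<close>

lemma orbit_count:
  fixes F :: "sgraph \<Rightarrow> nat list \<Rightarrow> 'b::{comm_ring_1,semiring_char_0}"
  assumes G: "stable_graph G" and n: "card (verts G) = n" and N: "card (halves G) = N"
    and B: "\<And>v. v \<in> verts G \<Longrightarrow> genus G v \<le> B"
    and F: "\<And>G' \<phi> \<psi> vs. stable_graph G' \<Longrightarrow> graph_iso G G' \<phi> \<psi> \<Longrightarrow> vs \<in> permutations_of_set (verts G) \<Longrightarrow>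
      F G' (map \<phi> vs) = F G vs"
  shows "fact N * (\<Sum>vs\<in>permutations_of_set (verts G). F G vs) =
     of_nat (card (Aut G)) * (\<Sum>G'\<in>{G'\<in>labelled_graphs n N B. isomorphic G G'}. F G' [0..<n])"
proof -
  have wf: "wf_graph G" by (rule stable_graph_wf[OF G])
  have fin: "finite (verts G)" "finite (halves G)" using wf by (auto simp: wf_graph_def)
  have a: "att G h \<in> verts G" "flip G h \<in> halves G" if "h \<in> halves G" for h
    using wf that by (auto simp: wf_graph_def)
  obtain \<phi>0 where \<phi>0: "bij_betw \<phi>0 (verts G) {..<n}"
    using ex_bij_betw_finite_nat[OF fin(1)] n by (auto simp: atLeast0LessThan)
  obtain \<psi>0 where \<psi>0: "bij_betw \<psi>0 (halves G) {..<N}"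
    using ex_bij_betw_finite_nat[OF fin(2)] N by (auto simp: atLeast0LessThan)
  let ?A = "{\<alpha>. \<alpha> permutes verts G}" and ?B = "{\<beta>. \<beta> permutes halves G}"
  let ?X = "labelled_graphs n N B"
  let ?iso = "\<lambda>\<alpha> \<beta> G'. graph_iso G G' (\<phi>0 \<circ> \<alpha>) (\<psi>0 \<circ> \<beta>)"
  have finAB: "finite ?A" "finite ?B" using fin by (auto intro: finite_permutations)
  have bij: "bij_betw (\<phi>0 \<circ> \<alpha>) (verts G) {..<n}" "bij_betw (\<psi>0 \<circ> \<beta>) (halves G) {..<N}"
    if "\<alpha> \<in> ?A" "\<beta> \<in> ?B" for \<alpha> \<beta>
    using that \<phi>0 \<psi>0 by (auto intro!: bij_betw_trans permutes_imp_bij)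
  have ex1: "\<exists>!G'. G' \<in> ?X \<and> ?iso \<alpha> \<beta> G'" if ab: "\<alpha> \<in> ?A" "\<beta> \<in> ?B" for \<alpha> \<beta>
    by (rule labelled_transport[OF G B bij[OF ab]])
  have side1: "(\<Sum>\<alpha>\<in>?A. \<Sum>\<beta>\<in>?B. \<Sum>G'\<in>{G'\<in>?X. ?iso \<alpha> \<beta> G'}. F G' [0..<n]) =
      fact N * (\<Sum>vs\<in>permutations_of_set (verts G). F G vs)"
  proof -
    let ?i = "the_inv_into (verts G) \<phi>0"
    \<comment> \<open>The order of \<open>verts G\<close> that \<open>\<phi>0\<close> carries to
      \<open>[0..<n]\<close>. Relabelling by \<open>\<alpha>\<close> pulls \<open>[0..<n]\<close>
      back to \<open>map (inv \<alpha>) ?vs0\<close>, and these lists run through all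
      orders.\<close>
    let ?vs0 = "map ?i [0..<n]"
    have inj0: "inj_on \<phi>0 (verts G)" and img0: "\<phi>0 ` verts G = {..<n}" using \<phi>0 by (auto simp: bij_betw_def)
    have bi: "bij_betw ?i {..<n} (verts G)" using bij_betw_the_inv_into[OF \<phi>0] .
    have vs0: "set ?vs0 = verts G" "distinct ?vs0"
      using bi by (auto simp: bij_betw_def distinct_map atLeast0LessThan)
    have "(\<Sum>G'\<in>{G'\<in>?X. ?iso \<alpha> \<beta> G'}. F G' [0..<n]) = F G (map (inv \<alpha>) ?vs0)"
      if ab: "\<alpha> \<in> ?A" "\<beta> \<in> ?B" for \<alpha> \<beta>
    proof -
      obtain G' where G': "G' \<in> ?X" "?iso \<alpha> \<beta> G'" and uniq: "{G'\<in>?X. ?iso \<alpha> \<beta> G'} = {G'}"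
        using ex1[OF ab] by blast
      have perm: "map (inv \<alpha>) ?vs0 \<in> permutations_of_set (verts G)"
        using bij_betw_apply[OF bij_betw_map_permutes[OF vs0], of "inv \<alpha>"] permutes_inv[of \<alpha> "verts G"] ab
        by blast
      have "map (\<phi>0 \<circ> \<alpha>) (map (inv \<alpha>) ?vs0) = map \<phi>0 ?vs0"
        using ab permutes_inverses(1)[of \<alpha> "verts G"] by simp
      also have "\<dots> = [0..<n]"
        using f_the_inv_into_f[OF inj0] img0 by (intro nth_equalityI) auto
      finally have "F G' [0..<n] = F G (map (inv \<alpha>) ?vs0)"
        using F[OF _ G'(2) perm] G'(1) by (simp add: labelled_graphs_def)
      then show ?thesis unfolding uniq by simp
    qed
    then have "(\<Sum>\<alpha>\<in>?A. \<Sum>\<beta>\<in>?B. \<Sum>G'\<in>{G'\<in>?X. ?iso \<alpha> \<beta> G'}. F G' [0..<n]) =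
        (\<Sum>\<alpha>\<in>?A. \<Sum>\<beta>\<in>?B. F G (map (inv \<alpha>) ?vs0))"
      by (intro sum.cong refl)
    also have "\<dots> = fact N * (\<Sum>\<alpha>\<in>?A. F G (map (inv \<alpha>) ?vs0))"
      using card_permutations[OF N fin(2)] by (simp add: sum_distrib_left)
    also have "(\<Sum>\<alpha>\<in>?A. F G (map (inv \<alpha>) ?vs0)) = (\<Sum>\<alpha>\<in>?A. F G (map \<alpha> ?vs0))"
      by (rule sum.reindex_bij_witness[where i = inv and j = inv])
        (auto simp: permutes_inv permutes_inv_inv)
    also have "\<dots> = (\<Sum>vs\<in>permutations_of_set (verts G). F G vs)"
      by (rule sum.reindex_bij_betw[OF bij_betw_map_permutes[OF vs0]])
    finally show ?thesis .
  qed
  \<comment> \<open>One relabelling \<open>(\<alpha>0, \<beta>0)\<close> onto \<open>G'\<close>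
    serves as base point; the others differ from it by automorphisms of \<open>G\<close>.\<close>
  have fiber: "card {(\<alpha>, \<beta>). \<alpha> \<in> ?A \<and> \<beta> \<in> ?B \<and> ?iso \<alpha> \<beta> G'} = (if isomorphic G G' then card (Aut G) else 0)"
    if G': "G' \<in> ?X" for G'
  proof (cases "isomorphic G G'")
    case False
    then have "{(\<alpha>, \<beta>). \<alpha> \<in> ?A \<and> \<beta> \<in> ?B \<and> ?iso \<alpha> \<beta> G'} = {}" unfolding isomorphic_def by blast
    then show ?thesis using False by (simp only: card.empty if_False)
  next
    case True
    then obtain \<phi>' \<psi>' where iso': "graph_iso G G' \<phi>' \<psi>'" unfolding isomorphic_def by blast
    have "bij_betw \<phi>' (verts G) {..<n}" "bij_betw \<psi>' (halves G) {..<N}"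
      using iso' G' by (auto simp: graph_iso_def labelled_graphs_def)
    from permutes_extend[OF \<phi>0 this(1)] permutes_extend[OF \<psi>0 this(2)]
    obtain \<alpha>0 \<beta>0 where ab0: "\<alpha>0 permutes verts G \<and> (\<forall>v\<in>verts G. \<phi>0 (\<alpha>0 v) = \<phi>' v)"
      "\<beta>0 permutes halves G \<and> (\<forall>h\<in>halves G. \<psi>0 (\<beta>0 h) = \<psi>' h)"
      by (elim exE)
    have \<alpha>0: "\<alpha>0 permutes verts G" "\<And>v. v \<in> verts G \<Longrightarrow> \<phi>0 (\<alpha>0 v) = \<phi>' v"
      and \<beta>0: "\<beta>0 permutes halves G" "\<And>h. h \<in> halves G \<Longrightarrow> \<psi>0 (\<beta>0 h) = \<psi>' h"
      using ab0 by blast+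
    have iso0: "?iso \<alpha>0 \<beta>0 G'"
      using iso' graph_iso_cong[OF wf, of "\<phi>0 \<circ> \<alpha>0" \<phi>' "\<psi>0 \<circ> \<beta>0" \<psi>'] \<alpha>0 \<beta>0 by simp
    have "bij_betw (\<lambda>(a, b). (\<alpha>0 \<circ> a, \<beta>0 \<circ> b)) (Aut G) {(\<alpha>, \<beta>). \<alpha> \<in> ?A \<and> \<beta> \<in> ?B \<and> ?iso \<alpha> \<beta> G'}"
    proof (rule bij_betwI[where g = "\<lambda>(\<alpha>, \<beta>). (inv \<alpha>0 \<circ> \<alpha>, inv \<beta>0 \<circ> \<beta>)"])
      show "(\<lambda>(a, b). (\<alpha>0 \<circ> a, \<beta>0 \<circ> b)) \<in> Aut G \<rightarrow> {(\<alpha>, \<beta>). \<alpha> \<in> ?A \<and> \<beta> \<in> ?B \<and> ?iso \<alpha> \<beta> G'}"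
      proof
        fix z assume "z \<in> Aut G"
        then obtain x y where z: "z = (x, y)" "x permutes verts G" "y permutes halves G" "graph_iso G G x y"
          by (auto simp: Aut_def)
        have "graph_iso G G' ((\<phi>0 \<circ> \<alpha>0) \<circ> x) ((\<psi>0 \<circ> \<beta>0) \<circ> y)"
          by (rule graph_iso_comp[OF wf z(4) iso0])
        then show "(case z of (a, b) \<Rightarrow> (\<alpha>0 \<circ> a, \<beta>0 \<circ> b)) \<in> {(\<alpha>, \<beta>). \<alpha> \<in> ?A \<and> \<beta> \<in> ?B \<and> ?iso \<alpha> \<beta> G'}"
          using z \<alpha>0(1) \<beta>0(1) by (simp add: permutes_compose comp_assoc)
      qed
      show "(\<lambda>(\<alpha>, \<beta>). (inv \<alpha>0 \<circ> \<alpha>, inv \<beta>0 \<circ> \<beta>)) \<in> {(\<alpha>, \<beta>). \<alpha> \<in> ?A \<and> \<beta> \<in> ?B \<and> ?iso \<alpha> \<beta> G'} \<rightarrow> Aut G"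
      proof
        fix z assume "z \<in> {(\<alpha>, \<beta>). \<alpha> \<in> ?A \<and> \<beta> \<in> ?B \<and> ?iso \<alpha> \<beta> G'}"
        then obtain x y where z: "z = (x, y)" "x permutes verts G" "y permutes halves G" "?iso x y G'" by blast
        let ?a = "inv \<alpha>0 \<circ> x" and ?b = "inv \<beta>0 \<circ> y"
        have p: "?a permutes verts G" "?b permutes halves G"
          using z \<alpha>0(1) \<beta>0(1) by (auto intro: permutes_compose permutes_inv)
        have ab: "\<alpha>0 (?a v) = x v" "\<beta>0 (?b h) = y h" for v h
          using permutes_inverses(1)[OF \<alpha>0(1)] permutes_inverses(1)[OF \<beta>0(1)] by simp_all
        have injp: "inj_on (\<phi>0 \<circ> \<alpha>0) (verts G)" "inj_on (\<psi>0 \<circ> \<beta>0) (halves G)"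
          using iso0 by (auto simp: graph_iso_def bij_betw_def)
        have "graph_iso G G ?a ?b"
          unfolding graph_iso_def
        proof (intro conjI ballI)
          show "bij_betw ?a (verts G) (verts G)" "bij_betw ?b (halves G) (halves G)"
            using p by (auto intro: permutes_imp_bij)
        next
          fix h assume h: "h \<in> halves G"
          have bh: "?b h \<in> halves G" using permutes_in_image[OF p(2)] h by blast
          have av: "?a (att G h) \<in> verts G" using permutes_in_image[OF p(1)] a(1)[OF h] by blast
          have bf: "?b (flip G h) \<in> halves G" using permutes_in_image[OF p(2)] a(2)[OF h] by blast
          have "(\<phi>0 \<circ> \<alpha>0) (att G (?b h)) = att G' ((\<psi>0 \<circ> \<beta>0) (?b h))"
            using iso0 bh unfolding graph_iso_def by metis
          also have "\<dots> = att G' ((\<psi>0 \<circ> y) h)" using ab(2)[of h] by (simp only: o_apply)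
          also have "\<dots> = (\<phi>0 \<circ> x) (att G h)" using z(4) h unfolding graph_iso_def by blast
          also have "\<dots> = (\<phi>0 \<circ> \<alpha>0) (?a (att G h))" using ab(1)[of "att G h"] by (simp only: o_apply)
          finally show "att G (?b h) = ?a (att G h)"
            using inj_onD[OF injp(1) _ a(1)[OF bh] av] by blast
          have "(\<psi>0 \<circ> \<beta>0) (flip G (?b h)) = flip G' ((\<psi>0 \<circ> \<beta>0) (?b h))"
            using iso0 bh unfolding graph_iso_def by metis
          also have "\<dots> = flip G' ((\<psi>0 \<circ> y) h)" using ab(2)[of h] by (simp only: o_apply)
          also have "\<dots> = (\<psi>0 \<circ> y) (flip G h)" using z(4) h unfolding graph_iso_def by blast
          also have "\<dots> = (\<psi>0 \<circ> \<beta>0) (?b (flip G h))" using ab(2)[of "flip G h"] by (simp only: o_apply)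
          finally show "flip G (?b h) = ?b (flip G h)"
            using inj_onD[OF injp(2) _ a(2)[OF bh] bf] by blast
        next
          fix v assume v: "v \<in> verts G"
          have av: "?a v \<in> verts G" using permutes_in_image[OF p(1)] v by blast
          have "genus G (?a v) = genus G' ((\<phi>0 \<circ> \<alpha>0) (?a v))"
            using iso0 av unfolding graph_iso_def by metis
          also have "\<dots> = genus G' ((\<phi>0 \<circ> x) v)" using ab(1)[of v] by (simp only: o_apply)
          also have "\<dots> = genus G v" using z(4) v unfolding graph_iso_def by blast
          finally show "genus G (?a v) = genus G v" .
        qed
        then show "(case z of (\<alpha>, \<beta>) \<Rightarrow> (inv \<alpha>0 \<circ> \<alpha>, inv \<beta>0 \<circ> \<beta>)) \<in> Aut G"
          using p z(1) by (simp add: Aut_def)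
      qed
    qed (use permutes_inv_o[OF \<alpha>0(1)] permutes_inv_o[OF \<beta>0(1)] in \<open>auto simp: comp_assoc[symmetric]\<close>)
    then show ?thesis using True bij_betw_same_card by fastforce
  qed
  have "(\<Sum>\<alpha>\<in>?A. \<Sum>\<beta>\<in>?B. \<Sum>G'\<in>{G'\<in>?X. ?iso \<alpha> \<beta> G'}. F G' [0..<n]) =
      (\<Sum>\<alpha>\<in>?A. \<Sum>\<beta>\<in>?B. \<Sum>G'\<in>?X. if ?iso \<alpha> \<beta> G' then F G' [0..<n] else 0)"
    by (intro sum.cong refl sum.inter_filter finite_labelled_graphs)
  also have "\<dots> = (\<Sum>z\<in>?A \<times> ?B. \<Sum>G'\<in>?X. if ?iso (fst z) (snd z) G' then F G' [0..<n] else 0)"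
    by (rule trans[OF sum.cartesian_product[where B = ?B]]) (rule sum.cong[OF refl], simp add: case_prod_beta)
  also have "\<dots> = (\<Sum>G'\<in>?X. \<Sum>z\<in>?A \<times> ?B. if ?iso (fst z) (snd z) G' then F G' [0..<n] else 0)"
    by (rule sum.swap)
  also have "\<dots> = (\<Sum>G'\<in>?X. of_nat (if isomorphic G G' then card (Aut G) else 0) * F G' [0..<n])"
  proof (rule sum.cong[OF refl])
    fix G' assume G': "G' \<in> ?X"
    have "(\<Sum>z\<in>?A \<times> ?B. if ?iso (fst z) (snd z) G' then F G' [0..<n] else 0) =
        (\<Sum>z\<in>{z\<in>?A \<times> ?B. ?iso (fst z) (snd z) G'}. F G' [0..<n])"
      using finAB by (intro sum.inter_filter[symmetric]) auto
    also have "{z\<in>?A \<times> ?B. ?iso (fst z) (snd z) G'} = {(\<alpha>, \<beta>). \<alpha> \<in> ?A \<and> \<beta> \<in> ?B \<and> ?iso \<alpha> \<beta> G'}"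
      by auto
    finally show "(\<Sum>z\<in>?A \<times> ?B. if ?iso (fst z) (snd z) G' then F G' [0..<n] else 0) =
        of_nat (if isomorphic G G' then card (Aut G) else 0) * F G' [0..<n]"
      unfolding sum_constant fiber[OF G'] .
  qed
  also have "\<dots> = of_nat (card (Aut G)) * (\<Sum>G'\<in>{G'\<in>?X. isomorphic G G'}. F G' [0..<n])"
    unfolding sum_distrib_left sum.inter_filter[OF finite_labelled_graphs]
    by (intro sum.cong refl) simp
  finally show ?thesis using side1 by simp
qed

section \<open>Coefficients\<close>

text \<open>Any finite set that contains the contributing exponents will do, which avoids computing
  subdegrees.\<close>

lemma fls_times_nth_cover:
  fixes A C :: "real fls"
  assumes "finite T" "\<And>i. fls_nth A i \<noteq> 0 \<Longrightarrow> fls_nth C (J - i) \<noteq> 0 \<Longrightarrow> i \<in> T"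
  shows "fls_nth (A * C) J = (\<Sum>i\<in>T. fls_nth A i * fls_nth C (J - i))"
proof -
  let ?D = "{fls_subdegree A..J - fls_subdegree C}"
  have "fls_nth (A * C) J = (\<Sum>i\<in>?D. fls_nth A i * fls_nth C (J - i))"
    by (rule fls_times_nth(2))
  also have "\<dots> = (\<Sum>i\<in>T \<union> ?D. fls_nth A i * fls_nth C (J - i))"
  proof (rule sum.mono_neutral_left)
    show "\<forall>i\<in>T \<union> ?D - ?D. fls_nth A i * fls_nth C (J - i) = 0"
    proof
      fix i assume "i \<in> T \<union> ?D - ?D"
      then have "i < fls_subdegree A \<or> J - i < fls_subdegree C" by auto
      then show "fls_nth A i * fls_nth C (J - i) = 0" by auto
    qed
  qed (use assms(1) in auto)
  also have "\<dots> = (\<Sum>i\<in>T. fls_nth A i * fls_nth C (J - i))"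
    by (rule sum.mono_neutral_right) (use assms in auto)
  finally show ?thesis .
qed

lemma fls_times_nth_nonzero:
  fixes A C :: "real fls"
  assumes "fls_nth (A * C) K \<noteq> 0"
  shows "\<exists>i. fls_nth A i \<noteq> 0 \<and> fls_nth C (K - i) \<noteq> 0"
proof (rule ccontr)
  assume "\<not> ?thesis"
  then have "fls_nth (A * C) K = (\<Sum>i\<in>{}. fls_nth A i * fls_nth C (K - i))"
    by (intro fls_times_nth_cover) auto
  then show False using assms by simp
qed

lemma fls_const_times_nth [simp]: "fls_nth (fls_const r * A) K = r * fls_nth A K" for A :: "real fls"
proof -
  have "fls_nth (fls_const r * A) K = (\<Sum>i\<in>{0}. fls_nth (fls_const r) i * fls_nth A (K - i))"
    by (rule fls_times_nth_cover) (simp_all split: if_splits)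
  then show ?thesis by simp
qed

text \<open>Taking a coefficient of the product over the vertices chooses a power of
  \<open>\<hbar>\<close> at each of them, that is, its genus. These powers are non-negative with sum
  \<open>J\<close>, so none exceeds \<open>B\<close>.\<close>

lemma fls_prod_nth:
  fixes F :: "nat \<Rightarrow> real fls"
  assumes "finite A" "\<And>v i. v \<in> A \<Longrightarrow> i < 0 \<Longrightarrow> fls_nth (F v) i = 0" "J \<le> int B"
  shows "fls_nth (\<Prod>v\<in>A. F v) J = (\<Sum>g\<in>PiE A (\<lambda>_. {..B}).
      if (\<Sum>v\<in>A. int (g v)) = J then \<Prod>v\<in>A. fls_nth (F v) (int (g v)) else 0)"
  using assms
proof (induction A arbitrary: J rule: finite_induct)
  case (insert x A)
  let ?H = "\<lambda>A J g. if (\<Sum>v\<in>A. int (g v)) = J then \<Prod>v\<in>A. fls_nth (F v) (int (g v)) else 0"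
  let ?T = "{..B}"
  have neg: "fls_nth (\<Prod>v\<in>A. F v) j = 0" if "j < 0" for j
  proof -
    have "fls_nth (\<Prod>v\<in>A. F v) j = (\<Sum>g\<in>PiE A (\<lambda>_. ?T). ?H A j g)"
      by (rule insert.IH) (use insert.prems that in auto)
    also have "\<dots> = 0"
    proof (intro sum.neutral ballI)
      fix g
      have "(\<Sum>v\<in>A. int (g v)) \<ge> 0" by (intro sum_nonneg) auto
      then show "?H A j g = 0" using that by auto
    qed
    finally show ?thesis .
  qed
  have "fls_nth (\<Prod>v\<in>insert x A. F v) J = fls_nth (F x * (\<Prod>v\<in>A. F v)) J"
    using insert.hyps by simp
  also have "\<dots> = (\<Sum>i\<in>int ` ?T. fls_nth (F x) i * fls_nth (\<Prod>v\<in>A. F v) (J - i))"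
  proof (rule fls_times_nth_cover)
    fix i assume i: "fls_nth (F x) i \<noteq> 0" "fls_nth (\<Prod>v\<in>A. F v) (J - i) \<noteq> 0"
    then have "0 \<le> i" using insert.prems(1)[of x i] by (cases "i < 0") auto
    moreover have "0 \<le> J - i" using neg[of "J - i"] i(2) by (cases "J - i < 0") auto
    ultimately have "i = int (nat i)" "nat i \<in> ?T" using insert.prems(2) by auto
    then show "i \<in> int ` ?T" by blast
  qed simp
  also have "\<dots> = (\<Sum>i\<in>?T. fls_nth (F x) (int i) * fls_nth (\<Prod>v\<in>A. F v) (J - int i))"
    by (subst sum.reindex) auto
  also have "\<dots> = (\<Sum>i\<in>?T. \<Sum>g\<in>PiE A (\<lambda>_. ?T). ?H (insert x A) J (g(x := i)))"
  proof (rule sum.cong[OF refl])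
    fix i
    have "fls_nth (\<Prod>v\<in>A. F v) (J - int i) = (\<Sum>g\<in>PiE A (\<lambda>_. ?T). ?H A (J - int i) g)"
      by (rule insert.IH) (use insert.prems in auto)
    moreover have "fls_nth (F x) (int i) * ?H A (J - int i) g = ?H (insert x A) J (g(x := i))" for g
    proof -
      have "(\<Sum>v\<in>A. int ((g(x := i)) v)) = (\<Sum>v\<in>A. int (g v))"
        "(\<Prod>v\<in>A. fls_nth (F v) (int ((g(x := i)) v))) = (\<Prod>v\<in>A. fls_nth (F v) (int (g v)))"
        using insert.hyps by (auto intro!: sum.cong prod.cong)
      then show ?thesis using insert.hyps by auto
    qed
    ultimately show "fls_nth (F x) (int i) * fls_nth (\<Prod>v\<in>A. F v) (J - int i) =
        (\<Sum>g\<in>PiE A (\<lambda>_. ?T). ?H (insert x A) J (g(x := i)))"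
      by (simp only: sum_distrib_left)
  qed
  also have "\<dots> = (\<Sum>z\<in>?T \<times> PiE A (\<lambda>_. ?T). ?H (insert x A) J ((snd z)(x := fst z)))"
    by (rule trans[OF sum.cartesian_product]) (rule sum.cong[OF refl], simp add: case_prod_beta)
  also have "\<dots> = (\<Sum>g\<in>PiE (insert x A) (\<lambda>_. ?T). ?H (insert x A) J g)"
  proof -
    have inj: "inj_on (\<lambda>(y, g). g(x := y)) (?T \<times> PiE A (\<lambda>_. ?T))"
      by (rule inj_combinator) (use insert.hyps in simp)
    show ?thesis
      unfolding PiE_insert_eq sum.reindex[OF inj] by (rule sum.cong[OF refl]) (simp add: case_prod_beta)
  qed
  finally show ?case .
qed simp

lemma formal_sum_nth:
  assumes "formal_summable g J" "finite T" "T \<subseteq> J" "\<And>j. j \<in> J \<Longrightarrow> fls_nth (g j m) K \<noteq> 0 \<Longrightarrow> j \<in> T"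
  shows "fls_nth (formal_sum g J m) K = (\<Sum>j\<in>T. fls_nth (g j m) K)"
proof -
  obtain K0 where K0: "\<And>j K. j \<in> J \<Longrightarrow> K < K0 \<Longrightarrow> fls_nth (g j m) K = 0"
    using assms(1) unfolding formal_summable_def by blast
  have "fls_nth (formal_sum g J m) K = (\<Sum>j\<in>{j\<in>J. fls_nth (g j m) K \<noteq> 0}. fls_nth (g j m) K)"
    unfolding formal_sum_def by (rule nth_Abs_fls_lower_bound[of K0]) (use K0 in auto)
  also have "\<dots> = (\<Sum>j\<in>T. fls_nth (g j m) K)"
    by (rule sum.mono_neutral_left) (use assms in auto)
  finally show ?thesis .
qed

lemma mult_inverse_cancel: "a * b = 1 \<Longrightarrow> a * (b * s) = s" for a b s :: "'a::comm_ring_1"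
  by (simp flip: mult.assoc)

lemma fls_const_inverse_of_nat:
  "n \<noteq> 0 \<Longrightarrow> fls_const (1 / real n) * (of_nat n :: real fls) = 1"
  by (simp add: fls_of_nat fls_const_mult_const)

lemma fls_const_inverse_fact: "fls_const (1 / fact n) * (fact n :: real fls) = 1"
proof -
  have "(fact n :: real fls) = of_nat (fact n)" by (rule of_nat_fact[symmetric])
  then show ?thesis using fls_const_inverse_of_nat[of "fact n"] by simp
qed

section \<open>Numerical invariants and bounds for graphs\<close>

lemma edge_count:
  assumes G: "wf_graph G"
  shows "card (halves G) = 2 * length (edge_list G) + length (leg_list G)"
proof -
  note E = edge_choice_edge_list[OF G] and Lg = leg_choice_leg_list[OF G]
  have "length (pair_list (flip G) (edge_list G) @ leg_list G) = card (halves G)"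
    using distinct_card[OF choice_lists(1)[OF G E Lg]] choice_lists(2)[OF G E Lg] by simp
  moreover have "length (pair_list fl E) = 2 * length E" for fl :: "nat \<Rightarrow> nat" and E
    by (induction E) auto
  ultimately show ?thesis by simp
qed

text \<open>\<open>edge_list\<close> depends on the numbering, but the number of legs is invariant,
  and \<open>edge_count\<close> recovers the number of edges from it.\<close>

lemma euler_char_iso:
  assumes G: "wf_graph G" and G': "wf_graph G'" and iso: "graph_iso G G' \<phi> \<psi>"
  shows "euler_char G' = euler_char G"
proof -
  have \<phi>: "bij_betw \<phi> (verts G) (verts G')" and \<psi>: "bij_betw \<psi> (halves G) (halves G')"
    using iso by (auto simp: graph_iso_def)
  have fl: "flip G h \<in> halves G" if "h \<in> halves G" for h using that G by (auto simp: wf_graph_def)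
  have inj: "inj_on \<psi> (halves G)" using \<psi> by (simp add: bij_betw_def)
  have "\<psi> ` leg_halves G = leg_halves G'"
  proof -
    have "flip G' (\<psi> h) = \<psi> h \<longleftrightarrow> flip G h = h" if "h \<in> halves G" for h
      using that fl iso inj by (simp add: graph_iso_def inj_on_eq_iff)
    moreover have "halves G' = \<psi> ` halves G" using \<psi> by (simp add: bij_betw_def)
    ultimately show ?thesis unfolding leg_halves_def by auto
  qed
  moreover have "inj_on \<psi> (leg_halves G)" by (rule inj_on_subset[OF inj]) (auto simp: leg_halves_def)
  ultimately have "card (leg_halves G') = card (leg_halves G)" by (metis card_image)
  then have "length (leg_list G') = length (leg_list G)"
    using leg_choice_leg_list[OF G] leg_choice_leg_list[OF G'] distinct_card
    unfolding leg_choice_def by metis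
  then have "length (edge_list G') = length (edge_list G)"
    using edge_count[OF G] edge_count[OF G'] bij_betw_same_card[OF \<psi>] by simp
  moreover have "(\<Sum>v\<in>verts G'. int (genus G' v)) = (\<Sum>v\<in>verts G. int (genus G v))"
    by (subst sum.reindex_bij_betw[OF \<phi>, symmetric]) (use iso in \<open>auto simp: graph_iso_def\<close>)
  ultimately show ?thesis
    unfolding euler_char_eq[OF G] euler_char_eq[OF G'] using bij_betw_same_card[OF \<phi>] by simp
qed

lemma sum_valence:
  assumes G: "wf_graph G"
  shows "(\<Sum>v\<in>verts G. card {h\<in>halves G. att G h = v}) = card (halves G)"
proof -
  have "halves G = (\<Union>v\<in>verts G. {h\<in>halves G. att G h = v})" using G by (auto simp: wf_graph_def)
  moreover have "card \<dots> = (\<Sum>v\<in>verts G. card {h\<in>halves G. att G h = v})"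
    using G by (intro card_UN_disjoint) (auto simp: wf_graph_def)
  ultimately show ?thesis by simp
qed

text \<open>By stability every vertex contributes at least 1 to \<open>-2\<chi>(G) + |Leg(G)|\<close>, which bounds the
  size of the graphs contributing to a given coefficient.\<close>

lemma stable_graph_bounds:
  assumes st: "stable_graph G" and w: "w = 2 * (- euler_char G) + int (length (leg_list G))"
  shows "int (card (verts G)) \<le> w" "int (card (halves G)) \<le> 3 * w" "v \<in> verts G \<Longrightarrow> int (genus G v) \<le> 3 * w"
proof -
  have G: "wf_graph G" by (rule stable_graph_wf[OF st])
  let ?n = "int (card (verts G))" and ?g = "\<Sum>v\<in>verts G. int (genus G v)"
  have weq: "w = int (card (halves G)) + 2 * ?g - 2 * ?n"
    unfolding w euler_char_eq[OF G] using edge_count[OF G] by simp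
  have "(\<Sum>v\<in>verts G. 3) \<le> (\<Sum>v\<in>verts G. 2 * genus G v + card {h\<in>halves G. att G h = v})"
    using st by (intro sum_mono) (simp add: stable_graph_def)
  then have "3 * card (verts G) \<le> 2 * (\<Sum>v\<in>verts G. genus G v) + card (halves G)"
    by (simp add: sum.distrib sum_valence[OF G] sum_distrib_left)
  then have "3 * ?n \<le> 2 * ?g + int (card (halves G))" by (simp flip: of_nat_sum)
  then show 1: "?n \<le> w" using weq by simp
  \<comment> \<open>Both remaining bounds come from \<open>weq\<close>: the half-edges and twice the
    genera add up to \<open>w + 2 * ?n\<close>, which is at most \<open>3 * w\<close>.\<close>
  have g0: "?g \<ge> 0" by (intro sum_nonneg) auto
  then show "int (card (halves G)) \<le> 3 * w" using 1 weq by simp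
  show "int (genus G v) \<le> 3 * w" if "v \<in> verts G"
  proof -
    have "int (genus G v) \<le> ?g"
      using G that by (intro member_le_sum) (auto simp: wf_graph_def)
    then show ?thesis using 1 weq by simp
  qed
qed

section \<open>Sums over isomorphism classes and over labelled graphs\<close>

context gaussian_coords begin

definition labelled_term :: "ffun \<Rightarrow> nat multiset \<Rightarrow> sgraph \<Rightarrow> nat list \<Rightarrow> real fls" where
  "labelled_term f m G vs = fls_X_intpow (- euler_char G) * contraction W c f G vs m"

text \<open>Sorts the classes into finite families, one for each pair \<open>(n, N)\<close> of the
  labelled expansion.\<close>

definition classes_of_type :: "nat \<Rightarrow> nat \<Rightarrow> nat \<Rightarrow> sgraph set set" where
  "classes_of_type n N B = {\<G>\<in>iso_classes. \<G> \<inter> labelled_graphs n N B \<noteq> {}}"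

lemma iso_class_eq:
  assumes "\<G> \<in> iso_classes" "G \<in> \<G>"
  shows "\<G> = {G'. stable_graph G' \<and> isomorphic G G'}"
proof -
  let ?r = "{(G, G'). stable_graph G \<and> stable_graph G' \<and> isomorphic G G'}"
  have "\<G> \<in> {G. stable_graph G} // ?r" using assms(1) by (simp add: iso_classes_def isomorphic_def)
  then obtain x where x: "\<G> = ?r `` {x}" by (rule quotientE)
  then have xG: "(x, G) \<in> ?r" using assms(2) by blast
  have "\<G> = ?r `` {G}" unfolding x by (rule equiv_class_eq[OF isomorphic_equivp xG])
  then show ?thesis using xG by auto
qed

lemma iso_class_rep:
  assumes "\<G> \<in> iso_classes"
  defines "G \<equiv> SOME G. G \<in> \<G>"
  shows "stable_graph G" "G \<in> \<G>" "\<G> = {G'. stable_graph G' \<and> isomorphic G G'}"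
proof -
  let ?r = "{(G, G'). stable_graph G \<and> stable_graph G' \<and> isomorphic G G'}"
  have q: "\<G> \<in> {G. stable_graph G} // ?r" using assms(1) by (simp add: iso_classes_def isomorphic_def)
  have "\<G> \<noteq> {}" using in_quotient_imp_non_empty[OF isomorphic_equivp q] .
  then show G: "G \<in> \<G>" unfolding G_def by (meson ex_in_conv someI_ex)
  have sub: "\<G> \<subseteq> {G. stable_graph G}" using in_quotient_imp_subset[OF isomorphic_equivp q] .
  then show "stable_graph G" using G by blast
  show "\<G> = {G'. stable_graph G' \<and> isomorphic G G'}" by (rule iso_class_eq[OF assms(1) G])
qed

text \<open>The factor \<open>1 / n!\<close> is the one of the average over vertex orders; the orbit
  count trades the factor \<open>|Aut(G)|\<close> for \<open>N!\<close>.\<close>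

lemma class_term_eq:
  assumes cls: "\<G> \<in> classes_of_type n N B"
  shows "class_term W c f \<G> m =
     fls_const (1 / (fact n * fact N)) * (\<Sum>G'\<in>\<G> \<inter> labelled_graphs n N B. labelled_term f m G' [0..<n])"
proof -
  define G where "G = (SOME G. G \<in> \<G>)"
  have iso: "\<G> \<in> iso_classes" using cls by (simp add: classes_of_type_def)
  have st: "stable_graph G" and eq: "\<G> = {G'. stable_graph G' \<and> isomorphic G G'}"
    using iso_class_rep[OF iso] unfolding G_def by blast+
  have wf: "wf_graph G" by (rule stable_graph_wf[OF st])
  obtain G1 where G1: "G1 \<in> labelled_graphs n N B" "isomorphic G G1"
    using cls eq unfolding classes_of_type_def by blast
  then obtain \<phi> \<psi> where i1: "graph_iso G G1 \<phi> \<psi>" unfolding isomorphic_def by blast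
  have b: "bij_betw \<phi> (verts G) {..<n}" "bij_betw \<psi> (halves G) {..<N}"
    using i1 G1(1) by (auto simp: graph_iso_def labelled_graphs_def)
  have n: "card (verts G) = n" "card (halves G) = N"
    using bij_betw_same_card[OF b(1)] bij_betw_same_card[OF b(2)] by simp_all
  have B: "genus G v \<le> B" if "v \<in> verts G" for v
  proof -
    have "\<phi> v \<in> {..<n}" using b(1) that by (auto simp: bij_betw_def)
    then have "genus G1 (\<phi> v) \<le> B" using G1(1) by (auto simp: labelled_graphs_def)
    then show ?thesis using i1 that by (simp add: graph_iso_def)
  qed
  let ?S = "\<Sum>vs\<in>permutations_of_set (verts G). labelled_term f m G vs"
  let ?T = "\<Sum>G'\<in>{G'\<in>labelled_graphs n N B. isomorphic G G'}. labelled_term f m G' [0..<n]"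
  have orbit: "fact N * ?S = of_nat (card (Aut G)) * ?T"
  proof (rule orbit_count[OF st n B])
    fix G' \<phi> \<psi> vs
    assume a: "stable_graph G'" "graph_iso G G' \<phi> \<psi>" "vs \<in> permutations_of_set (verts G)"
    then show "labelled_term f m G' (map \<phi> vs) = labelled_term f m G vs"
      using contraction_iso[OF wf stable_graph_wf[OF a(1)] a(2), of vs f]
        euler_char_iso[OF wf stable_graph_wf[OF a(1)] a(2)]
      by (simp add: labelled_term_def permutations_of_set_def)
  qed
  have set: "{G'\<in>labelled_graphs n N B. isomorphic G G'} = \<G> \<inter> labelled_graphs n N B"
    unfolding eq by (auto simp: labelled_graphs_def)
  have "class_term W c f \<G> m = fls_const (1 / real (card (Aut G))) * (fls_const (1 / fact n) * ?S)"
  proof -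
    have a: "amplitude W c f G m = fls_const (1 / fact n) *
        (\<Sum>vs\<in>permutations_of_set (verts G). contraction W c f G vs m)"
      unfolding amplitude_eq_average[OF wf] average_orders_def n(1) by (simp only: fscale_def sum_ffun_apply)
    have S: "?S = fls_X_intpow (- euler_char G) * (\<Sum>vs\<in>permutations_of_set (verts G). contraction W c f G vs m)"
      by (simp only: labelled_term_def sum_distrib_left)
    show ?thesis
      unfolding class_term_def G_def[symmetric] graph_term_def fscale_def a S by (simp only: mult_ac)
  qed
  also have "?S = fls_const (1 / fact N) * (fact N * ?S)"
    by (rule mult_inverse_cancel[OF fls_const_inverse_fact, symmetric])
  also have "fls_const (1 / real (card (Aut G))) * (fls_const (1 / fact n) * (fls_const (1 / fact N) * (fact N * ?S))) =
      fls_const (1 / (fact n * fact N)) * ?T"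
  proof -
    have "card (Aut G) \<noteq> 0" using card_Aut_pos[OF wf] by linarith
    then have "fls_const (1 / real (card (Aut G))) * (of_nat (card (Aut G)) * ?T) = ?T"
      by (intro mult_inverse_cancel fls_const_inverse_of_nat)
    moreover have "fls_const (1 / (fact n * fact N)) = fls_const (1 / fact n) * (fls_const (1 / fact N) :: real fls)"
      by (simp add: fls_const_mult_const)
    moreover have "x * (y * (z * (u * t))) = y * (z * (x * (u * t)))" for x y z u t :: "real fls"
      by (simp only: mult_ac)
    ultimately show ?thesis unfolding orbit by (simp only: mult.assoc)
  qed
  finally show ?thesis unfolding set .
qed

lemma finite_classes_of_type: "finite (classes_of_type n N B)"
proof (rule finite_subset)
  let ?r = "\<lambda>G. {G'. stable_graph G' \<and> isomorphic G G'}"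
  show "classes_of_type n N B \<subseteq> ?r ` labelled_graphs n N B"
  proof
    fix \<G> assume "\<G> \<in> classes_of_type n N B"
    then obtain G where G: "\<G> \<in> iso_classes" "G \<in> \<G>" "G \<in> labelled_graphs n N B"
      by (auto simp: classes_of_type_def)
    have "\<G> = ?r G" by (rule iso_class_eq[OF G(1,2)])
    then show "\<G> \<in> ?r ` labelled_graphs n N B" using G(3) by blast
  qed
qed (simp add: finite_labelled_graphs)

lemma iso_classes_disjoint: "\<G> \<in> iso_classes \<Longrightarrow> \<G>' \<in> iso_classes \<Longrightarrow> \<G> \<noteq> \<G>' \<Longrightarrow> \<G> \<inter> \<G>' = {}"
  unfolding iso_classes_def isomorphic_def[symmetric] using quotient_disj[OF isomorphic_equivp] by blast

text \<open>The isomorphism classes partition the labelled graphs.\<close>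

lemma sum_class_terms:
  "(\<Sum>\<G>\<in>classes_of_type n N B. class_term W c f \<G> m) =
     fls_const (1 / (fact n * fact N)) * (\<Sum>G\<in>labelled_graphs n N B. labelled_term f m G [0..<n])"
proof -
  let ?X = "labelled_graphs n N B"
  have "(\<Sum>\<G>\<in>classes_of_type n N B. class_term W c f \<G> m) =
      (\<Sum>\<G>\<in>classes_of_type n N B. fls_const (1 / (fact n * fact N)) *
        (\<Sum>G\<in>\<G> \<inter> ?X. labelled_term f m G [0..<n]))"
    by (intro sum.cong refl class_term_eq)
  also have "\<dots> = fls_const (1 / (fact n * fact N)) *
      (\<Sum>\<G>\<in>classes_of_type n N B. \<Sum>G\<in>\<G> \<inter> ?X. labelled_term f m G [0..<n])"
    by (simp only: sum_distrib_left)
  also have "(\<Sum>\<G>\<in>classes_of_type n N B. \<Sum>G\<in>\<G> \<inter> ?X. labelled_term f m G [0..<n]) =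
      (\<Sum>G\<in>(\<Union>\<G>\<in>classes_of_type n N B. \<G> \<inter> ?X). labelled_term f m G [0..<n])"
  proof (rule sum.UNION_disjoint[symmetric, OF finite_classes_of_type])
    show "\<forall>\<G>\<in>classes_of_type n N B. finite (\<G> \<inter> ?X)" using finite_labelled_graphs by blast
    show "\<forall>\<G>\<in>classes_of_type n N B. \<forall>\<G>'\<in>classes_of_type n N B.
        \<G> \<noteq> \<G>' \<longrightarrow> (\<G> \<inter> ?X) \<inter> (\<G>' \<inter> ?X) = {}"
      using iso_classes_disjoint unfolding classes_of_type_def by blast
  qed
  also have "(\<Union>\<G>\<in>classes_of_type n N B. \<G> \<inter> ?X) = ?X"
  proof (intro equalityI subsetI)
    fix G assume G: "G \<in> ?X"
    let ?R = "{(G, G'). stable_graph G \<and> stable_graph G' \<and> isomorphic G G'}"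
    have st: "stable_graph G" using G by (simp add: labelled_graphs_def)
    then have "?R `` {G} \<in> iso_classes"
      unfolding iso_classes_def isomorphic_def[symmetric] by (intro quotientI) simp
    moreover have "G \<in> ?R `` {G}" using st graph_iso_refl by (auto simp: isomorphic_def)
    ultimately show "G \<in> (\<Union>\<G>\<in>classes_of_type n N B. \<G> \<inter> ?X)"
      using G unfolding classes_of_type_def by blast
  qed blast
  finally show ?thesis .
qed

text \<open>The contraction contains no \<open>\<hbar>\<close>, so the exponent in the term of a
  graph comes from its Euler characteristic alone, and a non-zero coefficient fixes the number of
  legs.\<close>

lemma contraction_const:
  "\<exists>r. contraction W c f G vs m = fls_const r \<and> (r \<noteq> 0 \<longrightarrow> size m = length (leg_list G))"
proof -
  let ?w = "\<lambda>k. if m = mset (map k (leg_list G)) then ksign P (map k (leg_list G)) else 0"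
  have word: "word_fun P (map k (leg_list G)) m = fls_const (?w k)" for k
    by (simp add: word_fun_def)
  define r where "r = (\<lambda>k. reorder_sign (\<lambda>h. P (k h)) (concat (map (\<lambda>v. inner_at G v @ legs_at G v) vs))
      (concat (map (\<lambda>h. [h, flip G h]) (edge_list G)) @ leg_list G) *
      (\<Prod>v\<in>verts G. vertex_tensor P f (genus G v) (map k (inner_at G v)) (map k (legs_at G v))) *
      (\<Prod>h\<in>set (edge_list G). sigma_inv W c (k h) (k (flip G h))))"
  have r: "contraction W c f G vs m = fls_const (\<Sum>k\<in>colourings c G. r k * ?w k)"
    unfolding contraction_def sum_ffun_apply fscale_def word fls_const_mult_const fls_const_sum r_def ..
  have "size m = length (leg_list G)" if nz: "(\<Sum>k\<in>colourings c G. r k * ?w k) \<noteq> 0"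
  proof -
    obtain k where "k \<in> colourings c G" "r k * ?w k \<noteq> 0"
      using nz by (rule sum.not_neutral_contains_not_neutral)
    then have "m = mset (map k (leg_list G))" by (auto split: if_splits)
    then show ?thesis by simp
  qed
  then show ?thesis using r by blast
qed

text \<open>A contributing class has \<open>K = - euler_char G\<close> and \<open>size m\<close>
  legs, so \<open>2 * K + size m\<close> is the number \<open>w\<close> of the stability bounds, and
  vertices, half-edges and genera are at most \<open>3 * w\<close>.\<close>

lemma class_term_nonzero:
  assumes iso: "\<G> \<in> iso_classes" and nz: "fls_nth (class_term W c f \<G> m) K \<noteq> 0"
  shows "\<exists>n N. n \<le> nat (3 * (2 * K + size m)) \<and> N \<le> nat (3 * (2 * K + size m)) \<and> 0 \<le> 2 * K + size m \<and>
     (\<forall>B\<ge>nat (3 * (2 * K + size m)). \<G> \<in> classes_of_type n N B)"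
proof -
  define G where "G = (SOME G. G \<in> \<G>)"
  have st: "stable_graph G" and eq: "\<G> = {G'. stable_graph G' \<and> isomorphic G G'}"
    using iso_class_rep[OF iso] unfolding G_def by blast+
  have wf: "wf_graph G" by (rule stable_graph_wf[OF st])
  let ?w = "2 * K + int (size m)"
  have "\<forall>vs. \<exists>r. contraction W c f G vs m = fls_const r \<and> (r \<noteq> 0 \<longrightarrow> size m = length (leg_list G))"
    using contraction_const by blast
  then obtain r where r: "\<forall>vs. contraction W c f G vs m = fls_const (r vs) \<and> (r vs \<noteq> 0 \<longrightarrow> size m = length (leg_list G))"
    by (rule choice[THEN exE])
  have amp: "amplitude W c f G m = fls_const (1 / fact (card (verts G)) * (\<Sum>vs\<in>permutations_of_set (verts G). r vs))"
    unfolding amplitude_eq_average[OF wf] average_orders_def fscale_def sum_ffun_apply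
    using r by (simp add: fls_const_sum fls_const_mult_const)
  have ct: "class_term W c f \<G> m = fls_X_intpow (- euler_char G) *
      fls_const (1 / real (card (Aut G)) * (1 / fact (card (verts G)) * (\<Sum>vs\<in>permutations_of_set (verts G). r vs)))"
    unfolding class_term_def G_def[symmetric] graph_term_def fscale_def amp by (simp add: fls_const_mult_const mult.assoc)
  have K: "K = - euler_char G" and nzr: "(\<Sum>vs\<in>permutations_of_set (verts G). r vs) \<noteq> 0"
    using nz unfolding ct fls_X_intpow_times_conv_shift(1) fls_shift_nth fls_const_nth by (auto split: if_splits)
  obtain vs where "vs \<in> permutations_of_set (verts G)" "r vs \<noteq> 0"
    using nzr by (rule sum.not_neutral_contains_not_neutral)
  then have m: "size m = length (leg_list G)" using r by blast
  have w: "?w = 2 * (- euler_char G) + int (length (leg_list G))" using K m by simp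
  note bounds = stable_graph_bounds[OF st w]
  have "\<G> \<in> classes_of_type (card (verts G)) (card (halves G)) B" if B: "B \<ge> nat (3 * ?w)" for B
  proof -
    have fin: "finite (verts G)" "finite (halves G)" using wf by (auto simp: wf_graph_def)
    obtain p where p: "bij_betw p (verts G) {..<card (verts G)}"
      using ex_bij_betw_finite_nat[OF fin(1)] by (auto simp: atLeast0LessThan)
    obtain q where q: "bij_betw q (halves G) {..<card (halves G)}"
      using ex_bij_betw_finite_nat[OF fin(2)] by (auto simp: atLeast0LessThan)
    have gB: "genus G v \<le> B" if "v \<in> verts G" for v
    proof -
      have "nat (int (genus G v)) \<le> nat (3 * ?w)" using bounds(3)[OF that] by (rule nat_mono)
      then show ?thesis using B by simp
    qed
    obtain G' where G': "G' \<in> labelled_graphs (card (verts G)) (card (halves G)) B" "graph_iso G G' p q"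
      using labelled_transport[OF st gB p q] by blast
    then have "stable_graph G'" by (simp add: labelled_graphs_def)
    then have "G' \<in> \<G>" unfolding eq isomorphic_def using G'(2) by blast
    then show ?thesis using iso G'(1) unfolding classes_of_type_def by blast
  qed
  moreover have w0: "0 \<le> ?w" using bounds(1) by linarith
  moreover have "nat (int (card (verts G))) \<le> nat (3 * ?w)"
  proof (rule nat_mono)
    have "x \<le> 3 * x" if "0 \<le> x" for x :: int using that by simp
    then have "?w \<le> 3 * ?w" using w0 .
    with bounds(1) show "int (card (verts G)) \<le> 3 * ?w" by (rule order_trans)
  qed
  moreover have "nat (int (card (halves G))) \<le> nat (3 * ?w)"
    by (rule nat_mono) (rule bounds(2))
  ultimately show ?thesis
    by (intro exI[of _ "card (verts G)"] exI[of _ "card (halves G)"]) simp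
qed

lemma classes_of_type_unique:
  assumes "\<G> \<in> classes_of_type n N B" "\<G> \<in> classes_of_type n' N' B'"
  shows "n = n' \<and> N = N'"
proof -
  have iso: "\<G> \<in> iso_classes" using assms(1) by (simp add: classes_of_type_def)
  define G where "G = (SOME G. G \<in> \<G>)"
  have eq: "\<G> = {G'. stable_graph G' \<and> isomorphic G G'}"
    using iso_class_rep[OF iso] unfolding G_def by blast
  have "card (verts G) = n \<and> card (halves G) = N" if cls: "\<G> \<in> classes_of_type n N B" for n N B
  proof -
    obtain G1 where G1: "G1 \<in> labelled_graphs n N B" "isomorphic G G1"
      using cls eq unfolding classes_of_type_def by blast
    then obtain \<phi> \<psi> where "graph_iso G G1 \<phi> \<psi>" unfolding isomorphic_def by blast
    then have b: "bij_betw \<phi> (verts G) {..<n}" "bij_betw \<psi> (halves G) {..<N}"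
      using G1(1) by (auto simp: graph_iso_def labelled_graphs_def)
    then show ?thesis using bij_betw_same_card[OF b(1)] bij_betw_same_card[OF b(2)] by simp
  qed
  then show ?thesis using assms by blast
qed

lemma summable_class_terms: "formal_summable (class_term W c f) iso_classes"
  unfolding formal_summable_def
proof (intro conjI allI)
  fix m :: "nat multiset" and K :: int
  let ?B = "nat (3 * (2 * K + int (size m)))"
  show "finite {\<G>\<in>iso_classes. fls_nth (class_term W c f \<G> m) K \<noteq> 0}"
  proof (rule finite_subset)
    show "{\<G>\<in>iso_classes. fls_nth (class_term W c f \<G> m) K \<noteq> 0} \<subseteq>
        (\<Union>(n, N)\<in>{..?B} \<times> {..?B}. classes_of_type n N ?B)"
    proof
      fix \<G> assume "\<G> \<in> {\<G>\<in>iso_classes. fls_nth (class_term W c f \<G> m) K \<noteq> 0}"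
      then obtain n N where "n \<le> ?B" "N \<le> ?B" "\<G> \<in> classes_of_type n N ?B"
        using class_term_nonzero[of \<G> f m K] by blast
      then show "\<G> \<in> (\<Union>(n, N)\<in>{..?B} \<times> {..?B}. classes_of_type n N ?B)"
        by (intro UN_I[of "(n, N)"] SigmaI) (simp_all only: prod.case atMost_iff)
    qed
    show "finite (\<Union>(n, N)\<in>{..?B} \<times> {..?B}. classes_of_type n N ?B)"
      by (intro finite_UN_I) (auto simp: finite_classes_of_type)
  qed
next
  fix m :: "nat multiset"
  show "\<exists>K0. \<forall>\<G>\<in>iso_classes. \<forall>K<K0. fls_nth (class_term W c f \<G> m) K = 0"
  \<comment> \<open>A contribution requires \<open>0 \<le> 2 * K + size m\<close>, hence
    \<open>K \<ge> - size m\<close>.\<close>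
  proof (intro exI[of _ "- int (size m)"] ballI allI impI)
    fix \<G> K assume "\<G> \<in> iso_classes" "K < - int (size m)"
    then show "fls_nth (class_term W c f \<G> m) K = 0"
      using class_term_nonzero[of \<G> f m K] by linarith
  qed
qed

text \<open>The genus bound \<open>Bg\<close> is separate from the bound on vertices and half-edges,
  because the expansion of the \<open>n\<close>-th power at the exponent \<open>K + n\<close> may
  need a larger one.\<close>

lemma formal_sum_class_terms:
  assumes B: "B \<ge> nat (3 * (2 * K + int (size m)))" "Bg \<ge> nat (3 * (2 * K + int (size m)))"
  shows "fls_nth (formal_sum (class_term W c f) iso_classes m) K =
     (\<Sum>n\<le>B. \<Sum>N\<le>B. 1 / (fact n * fact N) *
        (\<Sum>G\<in>labelled_graphs n N Bg. fls_nth (labelled_term f m G [0..<n]) K))"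
proof -
  let ?I = "{..B} \<times> {..B}"
  let ?T = "\<Union>(n, N)\<in>?I. classes_of_type n N Bg"
  have "fls_nth (formal_sum (class_term W c f) iso_classes m) K = (\<Sum>\<G>\<in>?T. fls_nth (class_term W c f \<G> m) K)"
  proof (rule formal_sum_nth[OF summable_class_terms])
    show "finite ?T" using finite_classes_of_type by auto
    show "?T \<subseteq> iso_classes" by (auto simp: classes_of_type_def)
    fix \<G> assume a: "\<G> \<in> iso_classes" "fls_nth (class_term W c f \<G> m) K \<noteq> 0"
    obtain n N where nN: "n \<le> nat (3 * (2 * K + int (size m)))" "N \<le> nat (3 * (2 * K + int (size m)))"
      "\<forall>B\<ge>nat (3 * (2 * K + int (size m))). \<G> \<in> classes_of_type n N B"
      using class_term_nonzero[OF a] by blast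
    have "n \<le> B" "N \<le> B" using order_trans[OF nN(1) B(1)] order_trans[OF nN(2) B(1)] .
    moreover have "\<G> \<in> classes_of_type n N Bg" using nN(3) B(2) by blast
    ultimately show "\<G> \<in> ?T" by auto
  qed
  also have "\<dots> = (\<Sum>z\<in>?I. \<Sum>\<G>\<in>(case z of (n, N) \<Rightarrow> classes_of_type n N Bg). fls_nth (class_term W c f \<G> m) K)"
  proof (rule sum.UNION_disjoint)
    show "\<forall>z\<in>?I. finite (case z of (n, N) \<Rightarrow> classes_of_type n N Bg)"
      using finite_classes_of_type by auto
    show "\<forall>z\<in>?I. \<forall>z'\<in>?I. z \<noteq> z' \<longrightarrow> (case z of (n, N) \<Rightarrow> classes_of_type n N Bg) \<inter>
        (case z' of (n, N) \<Rightarrow> classes_of_type n N Bg) = {}"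
    proof (intro ballI impI equals0I)
      fix z z' \<G>
      assume ne: "z \<noteq> z'" and G: "\<G> \<in> (case z of (n, N) \<Rightarrow> classes_of_type n N Bg) \<inter>
        (case z' of (n, N) \<Rightarrow> classes_of_type n N Bg)"
      obtain n N n' N' where z: "z = (n, N)" "z' = (n', N')" by (metis surj_pair)
      then have "\<G> \<in> classes_of_type n N Bg" "\<G> \<in> classes_of_type n' N' Bg" using G by simp_all
      from classes_of_type_unique[OF this] show False using ne z by simp
    qed
  qed (simp add: finite_cartesian_product)
  also have "\<dots> = (\<Sum>z\<in>?I. 1 / (fact (fst z) * fact (snd z)) *
        (\<Sum>G\<in>labelled_graphs (fst z) (snd z) Bg. fls_nth (labelled_term f m G [0..<fst z]) K))"
  proof (rule sum.cong[OF refl])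
    fix z
    have "(\<Sum>\<G>\<in>classes_of_type n N Bg. fls_nth (class_term W c f \<G> m) K) = 1 / (fact n * fact N) *
        (\<Sum>G\<in>labelled_graphs n N Bg. fls_nth (labelled_term f m G [0..<n]) K)" for n N
      using arg_cong[OF sum_class_terms[of f m n N Bg], of "\<lambda>F. fls_nth F K"]
      by (simp only: fls_nth_sum fls_const_times_nth)
    then show "(\<Sum>\<G>\<in>(case z of (n, N) \<Rightarrow> classes_of_type n N Bg). fls_nth (class_term W c f \<G> m) K) =
        1 / (fact (fst z) * fact (snd z)) *
        (\<Sum>G\<in>labelled_graphs (fst z) (snd z) Bg. fls_nth (labelled_term f m G [0..<fst z]) K)"
      by (simp only: case_prod_beta)
  qed
  also have "\<dots> = (\<Sum>n\<le>B. \<Sum>N\<le>B. 1 / (fact n * fact N) *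
        (\<Sum>G\<in>labelled_graphs n N Bg. fls_nth (labelled_term f m G [0..<n]) K))"
    by (rule sym, rule trans[OF sum.cartesian_product]) (rule sum.cong[OF refl], simp add: case_prod_beta)
  finally show ?thesis .
qed

end

section \<open>The integral of a power\<close>

definition involutions :: "nat set \<Rightarrow> (nat \<Rightarrow> nat) set" where
  "involutions S = {\<phi>\<in>PiE S (\<lambda>_. S). \<forall>h\<in>S. \<phi> (\<phi> h) = h}"

definition labelled_graph ::
  "nat \<Rightarrow> nat \<Rightarrow> (nat \<Rightarrow> nat) \<Rightarrow> (nat \<Rightarrow> nat) \<Rightarrow> (nat \<Rightarrow> nat) \<Rightarrow> sgraph" where
  "labelled_graph n N t \<phi> g = \<lparr>halves = {..<N}, verts = {..<n}, att = t, flip = \<phi>, genus = g\<rparr>"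

lemma labelled_graph_simps [simp]:
  "halves (labelled_graph n N t \<phi> g) = {..<N}" "verts (labelled_graph n N t \<phi> g) = {..<n}"
  "att (labelled_graph n N t \<phi> g) = t" "flip (labelled_graph n N t \<phi> g) = \<phi>"
  "genus (labelled_graph n N t \<phi> g) = g"
  by (simp_all add: labelled_graph_def)

lemma finite_involutions: "finite S \<Longrightarrow> finite (involutions S)"
  unfolding involutions_def by (rule finite_subset[of _ "PiE S (\<lambda>_. S)"]) (auto intro: finite_PiE)

lemma wf_labelled_graph:
  "t \<in> PiE {..<N} (\<lambda>_. {..<n}) \<Longrightarrow> \<phi> \<in> involutions {..<N} \<Longrightarrow> wf_graph (labelled_graph n N t \<phi> g)"
  unfolding wf_graph_def involutions_def labelled_graph_simps by (auto simp: PiE_iff)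

text \<open>Unstable data contribute 0, so attaching maps, involutions and genera may be summed
  independently, as they appear in the expansion of a power.\<close>

lemma sum_labelled_graphs:
  fixes F :: "sgraph \<Rightarrow> 'b::comm_monoid_add"
  assumes F: "\<And>t \<phi> g. t \<in> PiE {..<N} (\<lambda>_. {..<n}) \<Longrightarrow> \<phi> \<in> involutions {..<N} \<Longrightarrow>
    \<not> stable_graph (labelled_graph n N t \<phi> g) \<Longrightarrow> F (labelled_graph n N t \<phi> g) = 0"
  shows "(\<Sum>G\<in>labelled_graphs n N B. F G) =
    (\<Sum>t\<in>PiE {..<N} (\<lambda>_. {..<n}). \<Sum>\<phi>\<in>involutions {..<N}. \<Sum>g\<in>PiE {..<n} (\<lambda>_. {..B}).
       F (labelled_graph n N t \<phi> g))"
proof -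
  let ?T = "PiE {..<N} (\<lambda>_. {..<n})" and ?I = "involutions {..<N}" and ?g = "PiE {..<n} (\<lambda>_. {..B})"
  let ?X = "?T \<times> ?I \<times> ?g"
  let ?G = "\<lambda>z. labelled_graph n N (fst z) (fst (snd z)) (snd (snd z))"
  let ?Y = "{z\<in>?X. stable_graph (?G z)}"
  have fin: "finite ?X" by (intro finite_cartesian_product finite_PiE finite_involutions) auto
  have img: "labelled_graphs n N B = ?G ` ?Y"
  proof (intro equalityI subsetI)
    fix G assume G: "G \<in> labelled_graphs n N B"
    have eq: "G = ?G (att G, flip G, genus G)" using G by (simp add: labelled_graphs_def labelled_graph_def)
    have st: "stable_graph G" and hv: "halves G = {..<N}" and af: "att G \<in> ?T" "genus G \<in> ?g"
      "flip G \<in> PiE {..<N} (\<lambda>_. {..<N})"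
      using G by (simp_all add: labelled_graphs_def)
    have "flip G \<in> ?I" using st hv af(3) by (simp add: involutions_def stable_graph_def)
    moreover have "stable_graph (?G (att G, flip G, genus G))" using st eq by simp
    ultimately have "(att G, flip G, genus G) \<in> ?Y" using af(1,2) by simp
    with eq show "G \<in> ?G ` ?Y" by (rule image_eqI)
  next
    fix G assume "G \<in> ?G ` ?Y"
    then show "G \<in> labelled_graphs n N B" by (auto simp: labelled_graphs_def involutions_def)
  qed
  have inj: "inj_on ?G ?Y"
  proof (rule inj_onI)
    fix z z' assume "?G z = ?G z'"
    then have "att (?G z) = att (?G z')" "flip (?G z) = flip (?G z')" "genus (?G z) = genus (?G z')" by simp_all
    then show "z = z'" by (simp add: prod_eq_iff)
  qed
  have "(\<Sum>G\<in>labelled_graphs n N B. F G) = (\<Sum>z\<in>?Y. F (?G z))"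
    unfolding img sum.reindex[OF inj] by simp
  also have "\<dots> = (\<Sum>z\<in>?X. F (?G z))"
    by (rule sum.mono_neutral_left[OF fin]) (use F in auto)
  also have "\<dots> = (\<Sum>t\<in>?T. \<Sum>z\<in>?I \<times> ?g. F (labelled_graph n N t (fst z) (snd z)))"
    by (rule sym, rule trans[OF sum.cartesian_product]) (rule sum.cong[OF refl], simp add: case_prod_beta)
  also have "\<dots> = (\<Sum>t\<in>?T. \<Sum>\<phi>\<in>?I. \<Sum>g\<in>?g. F (labelled_graph n N t \<phi> g))"
    by (rule sum.cong[OF refl], rule sym, rule trans[OF sum.cartesian_product])
      (rule sum.cong[OF refl], simp add: case_prod_beta)
  finally show ?thesis .
qed

text \<open>Half-edges outside \<open>I\<close> become legs, that is, fixed points of the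
  involution.\<close>

definition extend_pairing :: "nat set \<Rightarrow> nat set \<Rightarrow> (nat \<Rightarrow> nat) \<Rightarrow> nat \<Rightarrow> nat" where
  "extend_pairing S I \<tau> = (\<lambda>h. if h \<in> I then \<tau> h else if h \<in> S then h else undefined)"

lemma extend_pairing_props:
  assumes "\<tau> \<in> pairings I" "I \<subseteq> S"
  defines "\<phi> \<equiv> extend_pairing S I \<tau>"
  shows "\<phi> \<in> involutions S" "{h\<in>S. \<phi> h = h} = S - I" "{h\<in>S. h < \<phi> h} = {h\<in>I. h < \<tau> h}"
    "restrict \<phi> I = \<tau>"
proof -
  have \<tau>: "\<tau> h \<in> I" "\<tau> (\<tau> h) = h" "\<tau> h \<noteq> h" if "h \<in> I" for h
    using assms(1) that by (auto simp: pairings_def)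
  show "\<phi> \<in> involutions S"
    unfolding involutions_def
  proof (intro CollectI conjI PiE_I ballI)
    fix h assume "h \<in> S"
    then show "\<phi> h \<in> S" "\<phi> (\<phi> h) = h"
      using \<tau>[of h] subsetD[OF assms(2), of "\<tau> h"] by (simp_all add: \<phi>_def extend_pairing_def)
  next
    show "\<phi> h = undefined" if "h \<notin> S" for h
      using that subsetD[OF assms(2), of h] by (auto simp: \<phi>_def extend_pairing_def)
  qed
  show "{h\<in>S. \<phi> h = h} = S - I" "{h\<in>S. h < \<phi> h} = {h\<in>I. h < \<tau> h}"
    using \<tau> assms(2) by (auto simp: \<phi>_def extend_pairing_def)
  show "restrict \<phi> I = \<tau>"
    using assms(1) by (auto simp: \<phi>_def extend_pairing_def pairings_def PiE_def extensional_def)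
qed

text \<open>Wick's theorem gives a colouring first and then a pairing of the half-edges coloured in
  \<open>L\<close>; graphs need the involution first and then the compatible colourings. As
  \<open>H\<close> and \<open>L\<close> are disjoint, colours determine legs, and the two
  descriptions are in bijection.\<close>

lemma sum_colourings_pairings:
  fixes F :: "(nat \<Rightarrow> nat) \<Rightarrow> (nat \<Rightarrow> nat) \<Rightarrow> 'b::comm_monoid_add"
  assumes S: "finite S" and HL: "finite H" "finite L" "H \<inter> L = {}"
  shows "(\<Sum>k\<in>PiE S (\<lambda>_. H \<union> L). \<Sum>\<tau>\<in>pairings {h\<in>S. k h \<in> L}. F k (extend_pairing S {h\<in>S. k h \<in> L} \<tau>)) =
    (\<Sum>\<phi>\<in>involutions S. \<Sum>k\<in>PiE S (\<lambda>h. if \<phi> h = h then H else L). F k \<phi>)"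
proof -
  let ?A = "Sigma (PiE S (\<lambda>_. H \<union> L)) (\<lambda>k. pairings {h\<in>S. k h \<in> L})"
  let ?B = "Sigma (involutions S) (\<lambda>\<phi>. PiE S (\<lambda>h. if \<phi> h = h then H else L))"
  let ?I = "\<lambda>k. {h\<in>S. k h \<in> L}"
  have "(\<Sum>k\<in>PiE S (\<lambda>_. H \<union> L). \<Sum>\<tau>\<in>pairings (?I k). F k (extend_pairing S (?I k) \<tau>)) =
      (\<Sum>z\<in>?A. F (fst z) (extend_pairing S (?I (fst z)) (snd z)))"
    by (rule trans[OF sum.Sigma]) (use S HL in \<open>auto intro!: finite_PiE finite_pairings simp: case_prod_beta\<close>)
  also have "\<dots> = (\<Sum>y\<in>?B. F (snd y) (fst y))"
  proof (rule sum.reindex_bij_witness[where i = "\<lambda>y. (snd y, restrict (fst y) (?I (snd y)))"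
        and j = "\<lambda>z. (extend_pairing S (?I (fst z)) (snd z), fst z)"])
    fix z assume "z \<in> ?A"
    then obtain k \<tau> where z: "z = (k, \<tau>)" and k: "k \<in> PiE S (\<lambda>_. H \<union> L)" and \<tau>: "\<tau> \<in> pairings (?I k)" by blast
    let ?\<phi> = "extend_pairing S (?I k) \<tau>"
    have sub: "?I k \<subseteq> S" by blast
    note \<phi> = extend_pairing_props[OF \<tau> sub]
    show "(snd (extend_pairing S (?I (fst z)) (snd z), fst z),
        restrict (fst (extend_pairing S (?I (fst z)) (snd z), fst z))
          (?I (snd (extend_pairing S (?I (fst z)) (snd z), fst z)))) = z"
      unfolding z using \<phi>(4) by simp
    have "k h \<in> (if ?\<phi> h = h then H else L)" if "h \<in> S" for h
    proof -
      have "k h \<in> H \<union> L" using k that by (rule PiE_mem)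
      moreover have "?\<phi> h = h \<longleftrightarrow> k h \<notin> L" using \<phi>(2) that by blast
      ultimately show ?thesis by auto
    qed
    then have "k \<in> PiE S (\<lambda>h. if ?\<phi> h = h then H else L)"
      using PiE_arb[OF k] by (intro PiE_I)
    then show "(extend_pairing S (?I (fst z)) (snd z), fst z) \<in> ?B"
      unfolding z using \<phi>(1) by simp
    show "F (snd (extend_pairing S (?I (fst z)) (snd z), fst z)) (fst (extend_pairing S (?I (fst z)) (snd z), fst z)) =
        F (fst z) (extend_pairing S (?I (fst z)) (snd z))" by simp
  next
    fix y assume "y \<in> ?B"
    then obtain \<phi> k where y: "y = (\<phi>, k)" and \<phi>: "\<phi> \<in> involutions S"
      and k: "k \<in> PiE S (\<lambda>h. if \<phi> h = h then H else L)" by blast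
    have \<phi>S: "\<phi> h \<in> S" "\<phi> (\<phi> h) = h" if "h \<in> S" for h using \<phi> that by (auto simp: involutions_def)
    have kk: "k h \<in> (if \<phi> h = h then H else L)" if "h \<in> S" for h using k that by (rule PiE_mem)
    have kL: "k h \<in> L \<longleftrightarrow> \<phi> h \<noteq> h" if "h \<in> S" for h
      using kk[OF that] HL(3) by (auto split: if_splits)
    have "k \<in> PiE S (\<lambda>_. H \<union> L)"
    proof (rule PiE_I)
      show "k h \<in> H \<union> L" if "h \<in> S" for h using kk[OF that] by (cases "\<phi> h = h") auto
      show "k h = undefined" if "h \<notin> S" for h using k that by (rule PiE_arb)
    qed
    moreover have "restrict \<phi> (?I k) \<in> pairings (?I k)"
    proof -
      have "\<phi> h \<in> ?I k" "\<phi> h \<noteq> h" "\<phi> (\<phi> h) = h" if "h \<in> ?I k" for h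
        using that \<phi>S[of h] kL[of h] kL[of "\<phi> h"] by auto
      then show ?thesis unfolding pairings_def by simp
    qed
    ultimately show "(snd y, restrict (fst y) (?I (snd y))) \<in> ?A" unfolding y by simp
    have "extend_pairing S (?I k) (restrict \<phi> (?I k)) = \<phi>"
    proof
      fix h show "extend_pairing S (?I k) (restrict \<phi> (?I k)) h = \<phi> h"
        using kL[of h] \<phi> by (auto simp: extend_pairing_def involutions_def PiE_def extensional_def)
    qed
    then show "(extend_pairing S (?I (fst (snd y, restrict (fst y) (?I (snd y)))))
        (snd (snd y, restrict (fst y) (?I (snd y)))), fst (snd y, restrict (fst y) (?I (snd y)))) = y"
      unfolding y by simp
  qed
  also have "\<dots> = (\<Sum>\<phi>\<in>involutions S. \<Sum>k\<in>PiE S (\<lambda>h. if \<phi> h = h then H else L). F k \<phi>)"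
    by (rule sym, rule trans[OF sum.Sigma])
      (use S HL in \<open>auto intro!: finite_PiE finite_involutions simp: case_prod_beta\<close>)
  finally show ?thesis .
qed

section \<open>The integral of a word as a sum over involutions\<close>

context gaussian_coords begin

text \<open>This is the restriction to the homology and \<open>\<L>_s\<close>: monomials with a
  coordinate on the image of \<open>d\<close> are never reached, so the half-edges need only the
  remaining colours.\<close>

lemma degree_integral_cong:
  assumes "\<And>m. size m = N \<Longrightarrow> set_mset m \<subseteq> hcoord c \<union> lcoord c \<Longrightarrow> E m = E' m"
  shows "degree_integral N E a = degree_integral N E' a"
  unfolding degree_integral_def
proof (rule sum.cong[OF refl])
  fix b assume "b \<in> {b\<in>monomials P (lcoord c). size a + size b = N}"
  then have "size (a + b) = N" "set_mset b \<subseteq> lcoord c" by (auto simp: monomials_def)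
  then show "integral_term c E b a = integral_term c E' b a"
    unfolding integral_term_def using assms[of "a + b"] by auto
qed

lemma degree_integral_sum:
  "degree_integral N (\<lambda>m. \<Sum>i\<in>A. F i m) a = (\<Sum>i\<in>A. degree_integral N (F i) a)"
proof -
  have "integral_term c (\<lambda>m. \<Sum>i\<in>A. F i m) b a = (\<Sum>i\<in>A. integral_term c (F i) b a)" for b
    by (simp add: integral_term_def sum_distrib_right)
  then show ?thesis unfolding degree_integral_def by (simp only: sum.swap[of _ A])
qed

lemma degree_integral_scale: "degree_integral N (\<lambda>m. x * F m) a = x * degree_integral N F a"
  unfolding degree_integral_def integral_term_def sum_distrib_left
  by (rule sum.cong[OF refl]) (simp add: mult.assoc)

text \<open>The edge and leg part of a contribution; it depends on a graph only through its
  half-edges and its involution.\<close>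

definition flip_weight :: "nat set \<Rightarrow> (nat \<Rightarrow> nat) \<Rightarrow> (nat \<Rightarrow> nat) \<Rightarrow> real" where
  "flip_weight S \<phi> k =
     ksign (\<lambda>h. P (k h)) (pair_list \<phi> (sorted_list_of_set {h\<in>S. h < \<phi> h}) @ sorted_list_of_set {h\<in>S. \<phi> h = h}) *
     (\<Prod>h\<in>{h\<in>S. h < \<phi> h}. sigma_inv W c (k h) (k (\<phi> h)))"

lemma degree_integral_word_involutions:
  assumes zs: "distinct zs" "set zs = S" and k: "k \<in> PiE S (\<lambda>_. hcoord c \<union> lcoord c)"
  defines "I \<equiv> {h\<in>S. k h \<in> lcoord c}"
  shows "degree_integral (length zs) (word_fun P (map k zs)) a = (\<Sum>\<tau>\<in>pairings I.
     (\<lambda>\<phi>. fls_X ^ card {h\<in>S. h < \<phi> h} * fls_const (ksign (\<lambda>h. P (k h)) zs * flip_weight S \<phi> k) *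
        word_fun P (map k (sorted_list_of_set {h\<in>S. \<phi> h = h})) a) (extend_pairing S I \<tau>))"
proof -
  have fin: "finite S" using zs by auto
  have kU: "k h \<in> hcoord c \<union> lcoord c" if "h \<in> set zs" for h using k that zs by blast
  have sub: "I \<subseteq> S" by (auto simp: I_def)
  have legs: "{h\<in>S. k h \<in> hcoord c} = S - I"
    using kU zs(2) hcoord_less_lcoord by (fastforce simp: I_def)
  have wick: "degree_integral (length zs) (word_fun P (map k zs)) a = (\<Sum>\<tau>\<in>pairings I.
      fls_const (ksign (\<lambda>h. P (k h)) zs * ksign (\<lambda>h. P (k h))
          (pair_list \<tau> (pairing_edges I \<tau>) @ sorted_list_of_set {h\<in>S. k h \<in> hcoord c})) * pairing_term k I \<tau> *
          word_fun P (map k (sorted_list_of_set {h\<in>S. k h \<in> hcoord c})) a)"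
    using degree_integral_wick[OF zs(1) kU, where a = a] unfolding zs(2) I_def .
  show ?thesis
  proof (rule trans[OF wick sum.cong[OF refl]])
    fix \<tau> assume \<tau>: "\<tau> \<in> pairings I"
    let ?\<phi> = "extend_pairing S I \<tau>"
    note \<phi> = extend_pairing_props[OF \<tau> sub]
    have eq: "?\<phi> h = \<tau> h" if "h \<in> I" for h using that by (simp add: extend_pairing_def)
    have kl: "k h \<in> lcoord c \<and> k (\<tau> h) \<in> lcoord c" if "h \<in> I" for h
      using \<tau> that by (auto simp: pairings_def I_def)
    have "pairing_term k I \<tau> = (\<Prod>h\<in>{h\<in>I. h < \<tau> h}. fls_X * fls_const (sigma_inv W c (k h) (k (?\<phi> h))))"
      unfolding pairing_term_def
    proof (rule prod.cong[OF refl])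
      fix h assume "h \<in> {h\<in>I. h < \<tau> h}"
      then have h: "h \<in> I" by simp
      show "word_moment [k h, k (\<tau> h)] = fls_X * fls_const (sigma_inv W c (k h) (k (?\<phi> h)))"
        unfolding eq[OF h] using kl[OF h] by (intro word_moment_pair_sigma_inv) auto
    qed
    then have pt: "pairing_term k I \<tau> = fls_X ^ card {h\<in>S. h < ?\<phi> h} *
        fls_const (\<Prod>h\<in>{h\<in>S. h < ?\<phi> h}. sigma_inv W c (k h) (k (?\<phi> h)))"
      unfolding \<phi>(3) by (simp add: prod.distrib fls_const_prod)
    have fI: "finite I" using fin sub finite_subset by blast
    have pl: "pair_list \<tau> (pairing_edges I \<tau>) = pair_list ?\<phi> (sorted_list_of_set {h\<in>S. h < ?\<phi> h})"
      unfolding \<phi>(3) pair_list_def pairing_edges_def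
      by (intro arg_cong[of _ _ concat] map_cong) (use fI eq in auto)
    have "fls_const (ksign (\<lambda>h. P (k h)) zs * ksign (\<lambda>h. P (k h))
          (pair_list \<tau> (pairing_edges I \<tau>) @ sorted_list_of_set {h\<in>S. k h \<in> hcoord c})) * pairing_term k I \<tau> =
        fls_X ^ card {h\<in>S. h < ?\<phi> h} * fls_const (ksign (\<lambda>h. P (k h)) zs * flip_weight S ?\<phi> k)"
      unfolding pl pt legs \<phi>(2)[symmetric] flip_weight_def
      by (simp only: fls_const_mult_const[symmetric] mult_ac)
    then show "fls_const (ksign (\<lambda>h. P (k h)) zs * ksign (\<lambda>h. P (k h))
          (pair_list \<tau> (pairing_edges I \<tau>) @ sorted_list_of_set {h\<in>S. k h \<in> hcoord c})) * pairing_term k I \<tau> *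
          word_fun P (map k (sorted_list_of_set {h\<in>S. k h \<in> hcoord c})) a =
        fls_X ^ card {h\<in>S. h < ?\<phi> h} * fls_const (ksign (\<lambda>h. P (k h)) zs * flip_weight S ?\<phi> k) *
          word_fun P (map k (sorted_list_of_set {h\<in>S. ?\<phi> h = h})) a"
      unfolding legs \<phi>(2) by (simp only:)
  qed
qed

end

section \<open>Powers of \<open>f\<close> and labelled graphs\<close>

context gaussian_coords begin

abbreviation halves_at :: "nat \<Rightarrow> (nat \<Rightarrow> nat) \<Rightarrow> nat \<Rightarrow> nat list" where
  "halves_at N t v \<equiv> sorted_list_of_set {h\<in>{..<N}. t h = v}"

abbreviation flip_colourings :: "nat \<Rightarrow> (nat \<Rightarrow> nat) \<Rightarrow> (nat \<Rightarrow> nat) set" where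
  "flip_colourings N \<phi> \<equiv> PiE {..<N} (\<lambda>h. if \<phi> h = h then hcoord c else lcoord c)"

lemma halves_at_props:
  assumes "t \<in> PiE {..<N} (\<lambda>_. {..<n})"
  shows "distinct (concat (map (halves_at N t) [0..<n]))"
    "set (concat (map (halves_at N t) [0..<n])) = {..<N}"
    "length (concat (map (halves_at N t) [0..<n])) = N"
proof -
  \<comment> \<open>An auxiliary graph with legs only, to which the general facts about words of
    half-edges apply.\<close>
  let ?G = "labelled_graph n N t (restrict id {..<N}) (\<lambda>_. 0)"
  have wf: "wf_graph ?G" by (rule wf_labelled_graph[OF assms]) (auto simp: involutions_def)
  have vc: "vertex_choice ?G (halves_at N t)" unfolding vertex_choice_def by simp
  show d: "distinct (concat (map (halves_at N t) [0..<n]))"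
    by (rule vertex_choice_lists(1)[OF wf vc]) auto
  show s: "set (concat (map (halves_at N t) [0..<n])) = {..<N}"
    using vertex_choice_lists(2)[OF wf vc, of "[0..<n]"] by (simp add: atLeast0LessThan)
  show "length (concat (map (halves_at N t) [0..<n])) = N"
    using distinct_card[OF d] unfolding s by simp
qed

text \<open>The power contributes the attaching map \<open>t\<close>, Wick's theorem the involution
  \<open>\<phi>\<close>; the genera are still hidden in \<open>vertex_series\<close>.\<close>

lemma degree_integral_power:
  assumes f: "\<And>m. m \<notin> monomials P UNIV \<Longrightarrow> f m = 0"
  shows "fact N * degree_integral N (fprod_list P (replicate n f)) a =
    (\<Sum>t\<in>PiE {..<N} (\<lambda>_. {..<n}). \<Sum>\<phi>\<in>involutions {..<N}. \<Sum>k\<in>flip_colourings N \<phi>.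
       (\<Prod>v<n. vertex_series P f (map k (halves_at N t v))) *
       (fls_X ^ card {h\<in>{..<N}. h < \<phi> h} *
        fls_const (ksign (\<lambda>h. P (k h)) (concat (map (halves_at N t) [0..<n])) * flip_weight {..<N} \<phi> k) *
        word_fun P (map k (sorted_list_of_set {h\<in>{..<N}. \<phi> h = h})) a))"
proof -
  let ?T = "PiE {..<N} (\<lambda>_. {..<n})" and ?K = "PiE {..<N} (\<lambda>_. hcoord c \<union> lcoord c)"
  let ?Z = "\<lambda>t. concat (map (halves_at N t) [0..<n])"
  let ?V = "\<lambda>t k. \<Prod>v<n. vertex_series P f (map k (halves_at N t v))"
  let ?R = "\<lambda>t k \<phi>. fls_X ^ card {h\<in>{..<N}. h < \<phi> h} *
        fls_const (ksign (\<lambda>h. P (k h)) (?Z t) * flip_weight {..<N} \<phi> k) *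
        word_fun P (map k (sorted_list_of_set {h\<in>{..<N}. \<phi> h = h})) a"
  have "fact N * degree_integral N (fprod_list P (replicate n f)) a =
      degree_integral N (\<lambda>m. fact N * fprod_list P (replicate n f) m) a"
    by (rule degree_integral_scale[symmetric])
  also have "\<dots> = degree_integral N (\<lambda>m. \<Sum>t\<in>?T. \<Sum>k\<in>?K. ?V t k * word_fun P (map k (?Z t)) m) a"
  proof (rule degree_integral_cong)
    fix m assume m: "size m = N" "set_mset m \<subseteq> hcoord c \<union> lcoord c"
    have fin: "finite (hcoord c \<union> lcoord c)" using finite_hcoord finite_lcoord by simp
    have "size m = card {..<N}" using m(1) by simp
    from fprod_list_power_expansion[where S = "{..<N}" and vs = "[0..<n]" and f = f and P = P, OF _ fin _ f this m(2)]
    show "fact N * fprod_list P (replicate n f) m = (\<Sum>t\<in>?T. \<Sum>k\<in>?K. ?V t k * word_fun P (map k (?Z t)) m)"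
      by (simp add: atLeast0LessThan)
  qed
  also have "\<dots> = (\<Sum>t\<in>?T. \<Sum>k\<in>?K. ?V t k * degree_integral N (word_fun P (map k (?Z t))) a)"
    by (simp only: degree_integral_sum degree_integral_scale)
  also have "\<dots> = (\<Sum>t\<in>?T. \<Sum>\<phi>\<in>involutions {..<N}. \<Sum>k\<in>flip_colourings N \<phi>. ?V t k * ?R t k \<phi>)"
  proof (rule sum.cong[OF refl])
    fix t assume t: "t \<in> ?T"
    note Z = halves_at_props[OF t]
    have "(\<Sum>k\<in>?K. ?V t k * degree_integral N (word_fun P (map k (?Z t))) a) =
        (\<Sum>k\<in>?K. \<Sum>\<tau>\<in>pairings {h\<in>{..<N}. k h \<in> lcoord c}.
           ?V t k * ?R t k (extend_pairing {..<N} {h\<in>{..<N}. k h \<in> lcoord c} \<tau>))"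
    proof (rule sum.cong[OF refl])
      fix k assume k: "k \<in> ?K"
      show "?V t k * degree_integral N (word_fun P (map k (?Z t))) a =
        (\<Sum>\<tau>\<in>pairings {h\<in>{..<N}. k h \<in> lcoord c}.
           ?V t k * ?R t k (extend_pairing {..<N} {h\<in>{..<N}. k h \<in> lcoord c} \<tau>))"
      proof -
        have wick: "degree_integral N (word_fun P (map k (?Z t))) a =
            (\<Sum>\<tau>\<in>pairings {h\<in>{..<N}. k h \<in> lcoord c}.
               ?R t k (extend_pairing {..<N} {h\<in>{..<N}. k h \<in> lcoord c} \<tau>))"
          using degree_integral_word_involutions[OF Z(1,2) k, where a = a] unfolding Z(3) .
        show ?thesis unfolding wick by (rule sum_distrib_left)
      qed
    qed
    also have "\<dots> = (\<Sum>\<phi>\<in>involutions {..<N}. \<Sum>k\<in>flip_colourings N \<phi>. ?V t k * ?R t k \<phi>)"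
      by (rule sum_colourings_pairings) (use finite_hcoord finite_lcoord hcoord_less_lcoord in \<open>fastforce+\<close>)
    finally show "(\<Sum>k\<in>?K. ?V t k * degree_integral N (word_fun P (map k (?Z t))) a) =
      (\<Sum>\<phi>\<in>involutions {..<N}. \<Sum>k\<in>flip_colourings N \<phi>. ?V t k * ?R t k \<phi>)" .
  qed
  finally show ?thesis .
qed

text \<open>The prefactor shifts exponents by minus the Euler characteristic, so the coefficient at
  \<open>K\<close> selects the genera whose sum is \<open>K + n\<close> minus the number of
  edges.\<close>

lemma labelled_term_nth:
  assumes t: "t \<in> PiE {..<N} (\<lambda>_. {..<n})" and \<phi>: "\<phi> \<in> involutions {..<N}"
  shows "fls_nth (labelled_term f a (labelled_graph n N t \<phi> g) [0..<n]) K =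
    (if (\<Sum>v<n. int (g v)) = K + int n - int (card {h\<in>{..<N}. h < \<phi> h})
     then \<Sum>k\<in>flip_colourings N \<phi>. (\<Prod>v<n. vertex_weight P f (g v) (map k (halves_at N t v))) *
       (ksign (\<lambda>h. P (k h)) (concat (map (halves_at N t) [0..<n])) * flip_weight {..<N} \<phi> k *
        fls_nth (word_fun P (map k (sorted_list_of_set {h\<in>{..<N}. \<phi> h = h})) a) 0)
     else 0)"
proof -
  let ?G = "labelled_graph n N t \<phi> g"
  have wf: "wf_graph ?G" by (rule wf_labelled_graph[OF t \<phi>])
  have edges: "edge_list ?G = sorted_list_of_set {h\<in>{..<N}. h < \<phi> h}"
    unfolding edge_list_def labelled_graph_simps by (rule filter_sorted_list_of_set) simp
  have legs: "leg_list ?G = sorted_list_of_set {h\<in>{..<N}. \<phi> h = h}"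
    unfolding leg_list_def labelled_graph_simps by (rule filter_sorted_list_of_set) simp
  have vc: "vertex_choice ?G (halves_at N t)"
    unfolding vertex_choice_def by simp
  have vs: "distinct [0..<n]" "set [0..<n] = verts ?G" by auto
  have col: "colourings c ?G = flip_colourings N \<phi>" by (simp add: colourings_def)
  let ?w = "\<lambda>k. word_fun P (map k (sorted_list_of_set {h\<in>{..<N}. \<phi> h = h})) a"
  let ?r = "\<lambda>k. (\<Prod>v<n. vertex_weight P f (g v) (map k (halves_at N t v))) *
       (ksign (\<lambda>h. P (k h)) (concat (map (halves_at N t) [0..<n])) * flip_weight {..<N} \<phi> k *
        fls_nth (?w k) 0)"
  have "contraction W c f ?G [0..<n] a =
      (\<Sum>k\<in>flip_colourings N \<phi>. choice_term f ?G [0..<n] (halves_at N t) (edge_list ?G) (leg_list ?G) k a)"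
    unfolding contraction_eq[OF wf vs vc edge_choice_edge_list[OF wf] leg_choice_leg_list[OF wf]] sum_ffun_apply col ..
  also have "\<dots> = (\<Sum>k\<in>flip_colourings N \<phi>. fls_const (?r k))"
  proof (rule sum.cong[OF refl])
    fix k
    have w: "?w k = fls_const (fls_nth (?w k) 0)" by (simp add: word_fun_def)
    show "choice_term f ?G [0..<n] (halves_at N t) (edge_list ?G) (leg_list ?G) k a = fls_const (?r k)"
    proof -
      let ?Z = "concat (map (halves_at N t) [0..<n])"
      let ?E = "sorted_list_of_set {h\<in>{..<N}. h < \<phi> h}" and ?L = "sorted_list_of_set {h\<in>{..<N}. \<phi> h = h}"
      have sets: "set [0..<n] = {..<n}" "set ?E = {h\<in>{..<N}. h < \<phi> h}" by auto
      have "choice_term f ?G [0..<n] (halves_at N t) (edge_list ?G) (leg_list ?G) k a =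
          fls_const ((ksign (\<lambda>h. P (k h)) ?Z * (\<Prod>v<n. vertex_weight P f (g v) (map k (halves_at N t v)))) *
            (ksign (\<lambda>h. P (k h)) (pair_list \<phi> ?E @ ?L) *
              (\<Prod>h\<in>{h\<in>{..<N}. h < \<phi> h}. sigma_inv W c (k h) (k (\<phi> h))))) * ?w k"
        using fun_cong[OF choice_term_ksign[OF wf vs vc edge_choice_edge_list[OF wf] leg_choice_leg_list[OF wf],
              where f = f and k = k], of a]
        unfolding fscale_def legs edges labelled_graph_simps sets .
      also have "\<dots> = fls_const ((ksign (\<lambda>h. P (k h)) ?Z * (\<Prod>v<n. vertex_weight P f (g v) (map k (halves_at N t v)))) *
            flip_weight {..<N} \<phi> k) * fls_const (fls_nth (?w k) 0)"
        using w unfolding flip_weight_def by (simp only:)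
      also have "\<dots> = fls_const (?r k)"
        unfolding fls_const_mult_const by (rule arg_cong[of _ _ fls_const]) (simp only: mult_ac)
      finally show ?thesis .
    qed
  qed
  also have "\<dots> = fls_const (\<Sum>k\<in>flip_colourings N \<phi>. ?r k)" by (rule fls_const_sum)
  finally have con: "contraction W c f ?G [0..<n] a = fls_const (\<Sum>k\<in>flip_colourings N \<phi>. ?r k)" .
  have len: "length (edge_list ?G) = card {h\<in>{..<N}. h < \<phi> h}"
    unfolding edges by simp
  have eu: "K + euler_char ?G = 0 \<longleftrightarrow>
      (\<Sum>v<n. int (g v)) = K + int n - int (card {h\<in>{..<N}. h < \<phi> h})"
    unfolding euler_char_eq[OF wf] len by auto
  show ?thesis
    unfolding labelled_term_def con fls_X_intpow_times_conv_shift(1) fls_shift_nth fls_const_nth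
    using eu by simp
qed

text \<open>At an unstable vertex the genus and the valence give weight at most 2, where
  \<open>f\<close> has no terms.\<close>

lemma labelled_term_unstable:
  assumes t: "t \<in> PiE {..<N} (\<lambda>_. {..<n})" and \<phi>: "\<phi> \<in> involutions {..<N}"
    and f: "\<And>m g. fls_nth (f m) g \<noteq> 0 \<Longrightarrow> 2 * g + int (size m) > 2"
    and un: "\<not> stable_graph (labelled_graph n N t \<phi> g)"
  shows "fls_nth (labelled_term f a (labelled_graph n N t \<phi> g) [0..<n]) K = 0"
proof -
  have wf: "wf_graph (labelled_graph n N t \<phi> g)" by (rule wf_labelled_graph[OF t \<phi>])
  then obtain v where v: "v < n" "2 * g v + card {h\<in>{..<N}. t h = v} < 3"
    using un unfolding stable_graph_def wf_graph_def labelled_graph_simps by (auto simp: not_le)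
  have "vertex_weight P f (g v) (map k (halves_at N t v)) = 0" for k
  proof -
    have "size (mset (map k (halves_at N t v))) = card {h\<in>{..<N}. t h = v}" by simp
    then have "\<not> 2 * int (g v) + int (size (mset (map k (halves_at N t v)))) > 2" using v(2) by linarith
    then have "fls_nth (f (mset (map k (halves_at N t v)))) (int (g v)) = 0" using f by blast
    then show ?thesis by (simp add: vertex_tensor_def)
  qed
  then have zero: "(\<Prod>v<n. vertex_weight P f (g v) (map k (halves_at N t v))) = 0" for k
    using v(1) by (intro prod_zero) auto
  show ?thesis unfolding labelled_term_nth[OF t \<phi>] zero by simp
qed

text \<open>The shift by \<open>n\<close> anticipates the division by \<open>\<hbar>^n\<close> in
  the exponential. At that exponent the genera sum to at most \<open>K + n\<close>, so the
  truncation at \<open>B\<close> loses nothing.\<close>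

theorem degree_integral_power_nth:
  assumes f: "\<forall>m. m \<notin> monomials P UNIV \<longrightarrow> f m = 0"
    and w: "\<forall>m g. fls_nth (f m) g \<noteq> 0 \<longrightarrow> g \<ge> 0 \<and> 2 * g + int (size m) > 2"
    and B: "K + int n \<le> int B"
  shows "fact N * fls_nth (degree_integral N (fprod_list P (replicate n f)) a) (K + int n) =
     (\<Sum>G\<in>labelled_graphs n N B. fls_nth (labelled_term f a G [0..<n]) K)"
proof -
  let ?T = "PiE {..<N} (\<lambda>_. {..<n})" and ?g = "PiE {..<n} (\<lambda>_. {..B})"
  let ?w = "\<lambda>k \<phi>. word_fun P (map k (sorted_list_of_set {h\<in>{..<N}. \<phi> h = h})) a"
  let ?V = "\<lambda>t k g. \<Prod>v<n. vertex_weight P f (g v) (map k (halves_at N t v))"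
  let ?s = "\<lambda>t k \<phi>. ksign (\<lambda>h. P (k h)) (concat (map (halves_at N t) [0..<n])) * flip_weight {..<N} \<phi> k"
  let ?e = "\<lambda>\<phi>. card {h\<in>{..<N}. h < \<phi> h}"
  let ?c = "\<lambda>\<phi> g. (\<Sum>v<n. int (g v)) = K + int n - int (?e \<phi>)"
  have vertex: "fls_nth (\<Prod>v<n. vertex_series P f (map k (halves_at N t v))) J =
      (\<Sum>g\<in>?g. if (\<Sum>v<n. int (g v)) = J then ?V t k g else 0)" if "J \<le> int B" for J k t
  proof -
    let ?F = "\<lambda>v. vertex_series P f (map k (halves_at N t v))"
    have nth: "fls_nth (vertex_series P f u) j =
        ksign P u * (\<Prod>x\<in>set u. fact (count (mset u) x)) * fls_nth (f (mset u)) j" for u j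
      unfolding vertex_series_def by simp
    have "fls_nth (?F v) j = 0" if "j < 0" for v j
    proof -
      have "fls_nth (f (mset (map k (halves_at N t v)))) j = 0" using w that by (meson not_le)
      then show ?thesis unfolding nth by simp
    qed
    then have "fls_nth (\<Prod>v<n. ?F v) J =
        (\<Sum>g\<in>?g. if (\<Sum>v<n. int (g v)) = J then \<Prod>v<n. fls_nth (?F v) (int (g v)) else 0)"
      using that by (intro fls_prod_nth) auto
    then show ?thesis unfolding nth vertex_tensor_def append_Nil2 .
  qed
  \<comment> \<open>The edges shift the exponent by their number, and what remains is a coefficient
    of the product over the vertices, expanded by genera.\<close>
  have summand: "fls_nth ((\<Prod>v<n. vertex_series P f (map k (halves_at N t v))) *
        (fls_X ^ ?e \<phi> * fls_const (?s t k \<phi>) * ?w k \<phi>)) (K + int n) =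
      (\<Sum>g\<in>?g. if ?c \<phi> g then ?V t k g * (?s t k \<phi> * fls_nth (?w k \<phi>) 0) else 0)" for t k \<phi>
  proof -
    have wc: "?w k \<phi> = fls_const (fls_nth (?w k \<phi>) 0)" by (simp add: word_fun_def)
    let ?A = "\<Prod>v<n. vertex_series P f (map k (halves_at N t v))"
    have "?A * (fls_X ^ ?e \<phi> * fls_const (?s t k \<phi>) * ?w k \<phi>) =
        fls_const (?s t k \<phi> * fls_nth (?w k \<phi>) 0) * (fls_X ^ ?e \<phi> * ?A)"
      by (subst wc) (simp only: fls_const_mult_const[symmetric] mult_ac)
    then have "fls_nth (?A * (fls_X ^ ?e \<phi> * fls_const (?s t k \<phi>) * ?w k \<phi>)) (K + int n) =
        ?s t k \<phi> * fls_nth (?w k \<phi>) 0 * fls_nth ?A (K + int n - int (?e \<phi>))"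
      by (simp only: fls_const_times_nth fls_X_power_times_conv_shift(1) fls_shift_nth) simp
    also have "fls_nth ?A (K + int n - int (?e \<phi>)) = (\<Sum>g\<in>?g. if ?c \<phi> g then ?V t k g else 0)"
      by (rule vertex) (use B in linarith)
    also have "?s t k \<phi> * fls_nth (?w k \<phi>) 0 * \<dots> =
        (\<Sum>g\<in>?g. if ?c \<phi> g then ?V t k g * (?s t k \<phi> * fls_nth (?w k \<phi>) 0) else 0)"
    proof -
      have "x * (if b then y else 0) = (if b then y * x else 0)" for x y :: real and b by simp
      then show ?thesis unfolding sum_distrib_left by (simp only:)
    qed
    finally show ?thesis .
  qed
  have "fact N * fls_nth (degree_integral N (fprod_list P (replicate n f)) a) (K + int n) =
      fls_nth (fact N * degree_integral N (fprod_list P (replicate n f)) a) (K + int n)"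
  proof -
    have "(fact N :: real fls) = fls_const (fact N)" by (metis fls_of_nat of_nat_fact)
    then show ?thesis by simp
  qed
  also have "\<dots> = (\<Sum>t\<in>?T. \<Sum>\<phi>\<in>involutions {..<N}. \<Sum>k\<in>flip_colourings N \<phi>.
      \<Sum>g\<in>?g. if ?c \<phi> g then ?V t k g * (?s t k \<phi> * fls_nth (?w k \<phi>) 0) else 0)"
    by (subst degree_integral_power) (use f in blast, simp only: fls_nth_sum summand)
  also have "\<dots> = (\<Sum>t\<in>?T. \<Sum>\<phi>\<in>involutions {..<N}. \<Sum>g\<in>?g.
      fls_nth (labelled_term f a (labelled_graph n N t \<phi> g) [0..<n]) K)"
  proof (rule sum.cong[OF refl], rule sum.cong[OF refl])
    fix t \<phi> assume t: "t \<in> ?T" and \<phi>: "\<phi> \<in> involutions {..<N}"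
    have "(\<Sum>k\<in>flip_colourings N \<phi>. \<Sum>g\<in>?g. if ?c \<phi> g then ?V t k g * (?s t k \<phi> * fls_nth (?w k \<phi>) 0) else 0) =
        (\<Sum>g\<in>?g. \<Sum>k\<in>flip_colourings N \<phi>. if ?c \<phi> g then ?V t k g * (?s t k \<phi> * fls_nth (?w k \<phi>) 0) else 0)"
      by (rule sum.swap)
    also have "\<dots> = (\<Sum>g\<in>?g. fls_nth (labelled_term f a (labelled_graph n N t \<phi> g) [0..<n]) K)"
      unfolding labelled_term_nth[OF t \<phi>] by (rule sum.cong[OF refl]) simp
    finally show "(\<Sum>k\<in>flip_colourings N \<phi>. \<Sum>g\<in>?g. if ?c \<phi> g then ?V t k g * (?s t k \<phi> * fls_nth (?w k \<phi>) 0) else 0) =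
        (\<Sum>g\<in>?g. fls_nth (labelled_term f a (labelled_graph n N t \<phi> g) [0..<n]) K)" .
  qed
  also have "\<dots> = (\<Sum>G\<in>labelled_graphs n N B. fls_nth (labelled_term f a G [0..<n]) K)"
    by (rule sum_labelled_graphs[symmetric]) (use labelled_term_unstable w in blast)
  finally show ?thesis .
qed

end

section \<open>Summability and comparison of coefficients\<close>

text \<open>Weights are integers, so weight greater than 2 means at least 3, and weights add under
  multiplication.\<close>

lemma fprod_list_replicate_weight:
  assumes w: "\<forall>m g. fls_nth (f m) g \<noteq> 0 \<longrightarrow> g \<ge> 0 \<and> 2 * g + int (size m) > 2"
    and nz: "fls_nth (fprod_list P (replicate n f) m) K \<noteq> 0"
  shows "K \<ge> 0 \<and> 2 * K + int (size m) \<ge> 3 * int n"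
  using nz
proof (induction n arbitrary: m K)
  case 0
  then show ?case by (auto simp: fprod_list_def split: if_splits)
next
  case (Suc n)
  let ?F = "fprod_list P (replicate n f)"
  have "fls_nth (fmult P f ?F m) K \<noteq> 0" using Suc.prems by (simp add: fprod_list_def)
  then have "(\<Sum>u\<in>{u. u \<subseteq># m}. fls_nth (fls_const
      (ksign P (sorted_list_of_multiset u @ sorted_list_of_multiset (m - u))) * f u * ?F (m - u)) K) \<noteq> 0"
    unfolding fmult_def fls_nth_sum .
  then obtain u where u: "u \<subseteq># m" "fls_nth (fls_const
      (ksign P (sorted_list_of_multiset u @ sorted_list_of_multiset (m - u))) * f u * ?F (m - u)) K \<noteq> 0"
    by (rule sum.not_neutral_contains_not_neutral) simp
  obtain i where i: "fls_nth (f u) i \<noteq> 0" "fls_nth (?F (m - u)) (K - i) \<noteq> 0"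
    using fls_times_nth_nonzero[OF u(2)] by auto
  have "size m = size u + size (m - u)"
    using u(1) by (metis size_union subset_mset.add_diff_inverse)
  then have "int (size m) = int (size u) + int (size (m - u))" by simp
  then show ?case using w i(1) Suc.IH[OF i(2)] unfolding of_nat_Suc by (force simp: algebra_simps)
qed

lemma fexp_term_eq:
  "fexp_term P (\<lambda>m. f m / fls_X) n =
     fscale (fls_const (1 / fact n) * fls_X_inv ^ n) (fprod_list P (replicate n f))"
proof -
  have "(\<lambda>m. f m / fls_X) = fscale fls_X_inv f"
    by (rule ext) (simp add: fscale_def fls_divide_X fls_X_inv_times_conv_shift)
  then show ?thesis
    unfolding fexp_term_def by (simp add: fprod_list_replicate_fscale)
qed

lemma fexp_term_nth:
  "fls_nth (fexp_term P (\<lambda>m. f m / fls_X) n m) K =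
     1 / fact n * fls_nth (fprod_list P (replicate n f) m) (K + int n)"
  unfolding fexp_term_eq fscale_def mult.assoc
  by (simp only: fls_const_times_nth fls_X_inv_power_times_conv_shift fls_shift_nth)

context
  fixes P :: "nat \<Rightarrow> bool" and f :: ffun
  assumes weight: "\<forall>m g. fls_nth (f m) g \<noteq> 0 \<longrightarrow> g \<ge> 0 \<and> 2 * g + int (size m) > 2"
begin

text \<open>Dividing by \<open>\<hbar>^n\<close> lowers the weight by \<open>2n\<close>; of at least
  \<open>3n\<close> at least \<open>n\<close> remains, which bounds \<open>n\<close>.\<close>

lemma fexp_term_nonzero:
  assumes "fls_nth (fexp_term P (\<lambda>m. f m / fls_X) n m) K \<noteq> 0"
  shows "K + int n \<ge> 0 \<and> int n \<le> 2 * K + int (size m)"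
proof -
  have "fls_nth (fprod_list P (replicate n f) m) (K + int n) \<noteq> 0"
    using assms unfolding fexp_term_nth by auto
  from fprod_list_replicate_weight[OF weight this] show ?thesis
    unfolding distrib_left by (intro conjI) linarith+
qed

lemma summable_fexp_term: "formal_summable (fexp_term P (\<lambda>m. f m / fls_X)) UNIV"
  unfolding formal_summable_def
proof (intro conjI allI)
  fix m :: "nat multiset" and K :: int
  show "finite {n\<in>UNIV. fls_nth (fexp_term P (\<lambda>m. f m / fls_X) n m) K \<noteq> 0}"
  proof (rule finite_subset[of _ "{..nat (2 * K + int (size m))}"])
    show "{n\<in>UNIV. fls_nth (fexp_term P (\<lambda>m. f m / fls_X) n m) K \<noteq> 0} \<subseteq> {..nat (2 * K + int (size m))}"
    proof
      fix n assume "n \<in> {n\<in>UNIV. fls_nth (fexp_term P (\<lambda>m. f m / fls_X) n m) K \<noteq> 0}"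
      then have "int n \<le> 2 * K + int (size m)" using fexp_term_nonzero by blast
      then show "n \<in> {..nat (2 * K + int (size m))}" by simp
    qed
  qed simp
next
  fix m :: "nat multiset"
  show "\<exists>K0. \<forall>n\<in>UNIV. \<forall>K<K0. fls_nth (fexp_term P (\<lambda>m. f m / fls_X) n m) K = 0"
  proof (intro exI[of _ "- int (size m)"] ballI allI impI)
    fix n K assume K: "K < - int (size m)"
    show "fls_nth (fexp_term P (\<lambda>m. f m / fls_X) n m) K = 0"
    proof (rule ccontr)
      assume "fls_nth (fexp_term P (\<lambda>m. f m / fls_X) n m) K \<noteq> 0"
      from fexp_term_nonzero[OF this] K show False by linarith
    qed
  qed
qed

lemma fexp_nth:
  assumes "B \<ge> nat (2 * K + int (size m))"
  shows "fls_nth (fexp P (\<lambda>m. f m / fls_X) m) K = (\<Sum>n\<le>B. fls_nth (fexp_term P (\<lambda>m. f m / fls_X) n m) K)"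
  unfolding fexp_def
proof (rule formal_sum_nth[OF summable_fexp_term])
  fix n assume "fls_nth (fexp_term P (\<lambda>m. f m / fls_X) n m) K \<noteq> 0"
  then have "int n \<le> 2 * K + int (size m)" using fexp_term_nonzero by blast
  then show "n \<in> {..B}" using assms by simp
qed auto

text \<open>The second inequality combines \<open>K \<ge> - n\<close> with
  \<open>n \<le> 2 * K + size m\<close>. It bounds how much degree the integration can convert into
  powers of \<open>\<hbar>\<close>.\<close>

lemma fexp_nonzero:
  assumes "fls_nth (fexp P (\<lambda>m. f m / fls_X) m) K \<noteq> 0"
  shows "0 \<le> 2 * K + int (size m) \<and> 0 \<le> 3 * K + int (size m)"
proof -
  obtain n where "fls_nth (fexp_term P (\<lambda>m. f m / fls_X) n m) K \<noteq> 0"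
    using assms unfolding fexp_nth[OF order_refl] by (rule sum.not_neutral_contains_not_neutral)
  from fexp_term_nonzero[OF this] show ?thesis by (intro conjI) linarith+
qed

end

section \<open>The integral of the exponential\<close>

context gaussian_coords begin

text \<open>Moments are homogeneous: a monomial of degree \<open>2k\<close> integrates to a multiple
  \<open>r\<close> of \<open>\<hbar>^k\<close>. The alternative \<open>r = 0\<close> covers the
  vanishing moments, such as those of odd degree.\<close>

lemma integral_term_nth:
  assumes "set_mset b \<subseteq> lcoord c"
  shows "\<exists>r k. (r = 0 \<or> 2 * k = size b) \<and> (\<forall>E a K. fls_nth (integral_term c E b a) K =
       (if set_mset a \<subseteq> hcoord c then r * fls_nth (E (a + b)) (K - int k) else 0))"
proof -
  obtain r k where rk: "moment c b = fls_const r * fls_X ^ k" "r = 0 \<or> 2 * k = size b"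
    using hbar_homogeneous_moment[OF assms even_length_z] unfolding hbar_homogeneous_def by blast
  have "fls_nth (F * moment c b) K = r * fls_nth F (K - int k)" for F K
  proof -
    have "F * moment c b = fls_const r * (fls_X ^ k * F)" unfolding rk(1) by (simp only: mult_ac)
    then show ?thesis by (simp only: fls_const_times_nth fls_X_power_times_conv_shift(1) fls_shift_nth) simp
  qed
  then have "fls_nth (integral_term c E b a) K =
      (if set_mset a \<subseteq> hcoord c then r * fls_nth (E (a + b)) (K - int k) else 0)" for E a K
    unfolding integral_term_def by simp
  with rk(2) show ?thesis by blast
qed

context
  fixes f :: ffun
  assumes weight: "\<forall>m g. fls_nth (f m) g \<noteq> 0 \<longrightarrow> g \<ge> 0 \<and> 2 * g + int (size m) > 2"
begin

abbreviation exponential :: ffun where "exponential \<equiv> fexp P (\<lambda>m. f m / fls_X)"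

text \<open>Integration keeps the weight, trading \<open>size b = 2k\<close> coordinates for
  \<open>\<hbar>^k\<close>. At the exponent \<open>K - k\<close> the second bound of
  \<open>fexp_nonzero\<close> becomes \<open>k \<le> 3 * K + size a\<close>, which gives the bound
  on the degree.\<close>

lemma integral_term_nonzero:
  assumes b: "set_mset b \<subseteq> lcoord c" and nz: "fls_nth (integral_term c exponential b a) K \<noteq> 0"
  shows "0 \<le> 2 * K + int (size a) \<and> int (size a + size b) \<le> 3 * (2 * K + int (size a))"
proof -
  obtain r k where r: "r = 0 \<or> 2 * k = size b"
    and rk: "\<forall>E a K. fls_nth (integral_term c E b a) K =
       (if set_mset a \<subseteq> hcoord c then r * fls_nth (E (a + b)) (K - int k) else 0)"
    using integral_term_nth[OF b] by blast
  have nz': "r \<noteq> 0" "fls_nth (exponential (a + b)) (K - int k) \<noteq> 0"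
    using nz rk by (auto split: if_splits)
  have "int (size b) = 2 * int k" using r nz'(1) by auto
  with fexp_nonzero[OF weight nz'(2)] show ?thesis by (auto simp: algebra_simps)
qed

lemma summable_integral_term: "formal_summable (integral_term c exponential) (monomials P (lcoord c))"
  unfolding formal_summable_def
proof (intro conjI allI)
  fix a :: "nat multiset" and K :: int
  let ?S = "{b. set_mset b \<subseteq> lcoord c \<and> size b \<le> nat (3 * (2 * K + int (size a)))}"
  show "finite {b\<in>monomials P (lcoord c). fls_nth (integral_term c exponential b a) K \<noteq> 0}"
  proof (rule finite_subset)
    show "finite ?S" by (rule finite_bounded_multisets[OF finite_lcoord])
    show "{b\<in>monomials P (lcoord c). fls_nth (integral_term c exponential b a) K \<noteq> 0} \<subseteq> ?S"
    proof
      fix b assume "b \<in> {b\<in>monomials P (lcoord c). fls_nth (integral_term c exponential b a) K \<noteq> 0}"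
      then have b: "set_mset b \<subseteq> lcoord c" "fls_nth (integral_term c exponential b a) K \<noteq> 0"
        by (auto simp: monomials_def)
      have "int (size a + size b) \<le> 3 * (2 * K + int (size a))" using integral_term_nonzero[OF b] by blast
      then have "int (size b) \<le> 3 * (2 * K + int (size a))" unfolding of_nat_add by linarith
      then show "b \<in> ?S" using b(1) by simp
    qed
  qed
next
  fix a :: "nat multiset"
  show "\<exists>K0. \<forall>b\<in>monomials P (lcoord c). \<forall>K<K0. fls_nth (integral_term c exponential b a) K = 0"
  proof (intro exI[of _ "- int (size a)"] ballI allI impI)
    fix b K assume b: "b \<in> monomials P (lcoord c)" and K: "K < - int (size a)"
    show "fls_nth (integral_term c exponential b a) K = 0"
    proof (rule ccontr)
      assume nz: "fls_nth (integral_term c exponential b a) K \<noteq> 0"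
      have "set_mset b \<subseteq> lcoord c" using b by (simp add: monomials_def)
      from integral_term_nonzero[OF this nz] K show False by linarith
    qed
  qed
qed

lemma degree_integral_fexp_term_nth:
  "fls_nth (degree_integral N (fexp_term P (\<lambda>m. f m / fls_X) n) a) K =
     1 / fact n * fls_nth (degree_integral N (fprod_list P (replicate n f)) a) (K + int n)"
  unfolding fexp_term_eq fscale_def degree_integral_scale mult.assoc
  by (simp only: fls_const_times_nth fls_X_inv_power_times_conv_shift fls_shift_nth)

text \<open>In each coefficient only finitely many powers \<open>n\<close> and degrees
  \<open>N\<close> contribute, so the formal sums of the exponential and of the integral become one
  finite double sum.\<close>

lemma gauss_integral_nth:
  assumes B: "B \<ge> nat (3 * (2 * K + int (size a)))"
  shows "fls_nth (gauss_integral W c exponential a) K =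
     (\<Sum>n\<le>B. \<Sum>N\<le>B. fls_nth (degree_integral N (fexp_term P (\<lambda>m. f m / fls_X) n) a) K)"
proof -
  let ?M = "monomials P (lcoord c)"
  let ?S = "{b\<in>?M. size a + size b \<le> B}"
  let ?e = "fexp_term P (\<lambda>m. f m / fls_X)"
  have fin: "finite ?S"
    by (rule finite_subset[OF _ finite_bounded_multisets[OF finite_lcoord, of B]]) (auto simp: monomials_def)
  have "fls_nth (gauss_integral W c exponential a) K = (\<Sum>b\<in>?S. fls_nth (integral_term c exponential b a) K)"
    unfolding gauss_integral_def
  proof (rule formal_sum_nth[OF summable_integral_term fin])
    fix b assume b: "b \<in> ?M" "fls_nth (integral_term c exponential b a) K \<noteq> 0"
    have "set_mset b \<subseteq> lcoord c" using b(1) by (simp add: monomials_def)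
    from integral_term_nonzero[OF this b(2)]
    have "int (size a + size b) \<le> 3 * (2 * K + int (size a))" by blast
    then have "nat (int (size a + size b)) \<le> nat (3 * (2 * K + int (size a)))" by (rule nat_mono)
    then have "size a + size b \<le> B" using B by simp
    then show "b \<in> ?S" using b(1) by simp
  qed blast
  also have "\<dots> = (\<Sum>b\<in>?S. \<Sum>n\<le>B. fls_nth (integral_term c (?e n) b a) K)"
  proof (rule sum.cong[OF refl])
    fix b assume "b \<in> ?S"
    then have b: "set_mset b \<subseteq> lcoord c" by (simp add: monomials_def)
    obtain r k where r: "r = 0 \<or> 2 * k = size b"
      and rk: "\<forall>E a K. fls_nth (integral_term c E b a) K =
         (if set_mset a \<subseteq> hcoord c then r * fls_nth (E (a + b)) (K - int k) else 0)"
      using integral_term_nth[OF b] by blast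
    have "r * fls_nth (exponential (a + b)) (K - int k) = (\<Sum>n\<le>B. r * fls_nth (?e n (a + b)) (K - int k))"
    proof (cases "r = 0")
      case False
      then have "int (size b) = 2 * int k" using r by auto
      \<comment> \<open>The weight is the same before and after integration, so one truncation of
        the exponential serves all \<open>b\<close>.\<close>
      then have eq: "2 * (K - int k) + int (size (a + b)) = 2 * K + int (size a)" by simp
      have "nat x \<le> nat (3 * x)" for x :: int by simp
      then have "B \<ge> nat (2 * (K - int k) + int (size (a + b)))" unfolding eq using B by (rule order_trans)
      from fexp_nth[OF weight this] show ?thesis by (simp only: sum_distrib_left)
    qed simp
    then show "fls_nth (integral_term c exponential b a) K = (\<Sum>n\<le>B. fls_nth (integral_term c (?e n) b a) K)"
      using rk by simp
  qed
  also have "\<dots> = (\<Sum>n\<le>B. \<Sum>b\<in>?S. fls_nth (integral_term c (?e n) b a) K)" by (rule sum.swap)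
  also have "\<dots> = (\<Sum>n\<le>B. \<Sum>N\<le>B. fls_nth (degree_integral N (?e n) a) K)"
  proof (rule sum.cong[OF refl])
    fix n
    have "(\<Sum>b\<in>?S. fls_nth (integral_term c (?e n) b a) K) =
        (\<Sum>N\<le>B. \<Sum>b\<in>{b\<in>?S. size a + size b = N}. fls_nth (integral_term c (?e n) b a) K)"
      by (rule sum.group[symmetric]) (use fin in auto)
    also have "\<dots> = (\<Sum>N\<le>B. fls_nth (degree_integral N (?e n) a) K)"
    proof (rule sum.cong[OF refl])
      fix N assume "N \<in> {..B}"
      then have "{b\<in>?S. size a + size b = N} = {b\<in>?M. size a + size b = N}" by auto
      then show "(\<Sum>b\<in>{b\<in>?S. size a + size b = N}. fls_nth (integral_term c (?e n) b a) K) =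
          fls_nth (degree_integral N (?e n) a) K"
        unfolding degree_integral_def fls_nth_sum by simp
    qed
    finally show "(\<Sum>b\<in>?S. fls_nth (integral_term c (?e n) b a) K) =
      (\<Sum>N\<le>B. fls_nth (degree_integral N (?e n) a) K)" .
  qed
  finally show ?thesis .
qed

theorem gauss_integral_eq_graph_sum:
  assumes f: "\<forall>m. m \<notin> monomials P UNIV \<longrightarrow> f m = 0"
  shows "gauss_integral W c exponential = formal_sum (class_term W c f) iso_classes"
proof (rule ext, rule fls_eqI)
  fix a :: "nat multiset" and K :: int
  let ?B = "nat (3 * (2 * K + int (size a)))"
  \<comment> \<open>Genera sum to at most \<open>K + n\<close> with \<open>n \<le> ?B\<close>;
    \<open>nat K\<close> also covers negative \<open>K\<close>.\<close>
  let ?Bg = "?B + nat K"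
  have "fls_nth (degree_integral N (fexp_term P (\<lambda>m. f m / fls_X) n) a) K = 1 / (fact n * fact N) *
      (\<Sum>G\<in>labelled_graphs n N ?Bg. fls_nth (labelled_term f a G [0..<n]) K)" if "n \<le> ?B" for n N
  proof -
    have "int n \<le> int ?B" using that by (rule of_nat_mono)
    moreover have "K \<le> int (nat K)" by simp
    ultimately have "K + int n \<le> int ?Bg" unfolding of_nat_add add.commute[of K] by (rule add_mono)
    note main = degree_integral_power_nth[OF f weight this, of N a]
    show ?thesis unfolding degree_integral_fexp_term_nth main[symmetric] by simp
  qed
  then have "(\<Sum>n\<le>?B. \<Sum>N\<le>?B. fls_nth (degree_integral N (fexp_term P (\<lambda>m. f m / fls_X) n) a) K) =
      (\<Sum>n\<le>?B. \<Sum>N\<le>?B. 1 / (fact n * fact N) *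
        (\<Sum>G\<in>labelled_graphs n N ?Bg. fls_nth (labelled_term f a G [0..<n]) K))"
    by (intro sum.cong refl) simp
  then show "fls_nth (gauss_integral W c exponential a) K =
      fls_nth (formal_sum (class_term W c f) iso_classes a) K"
    unfolding gauss_integral_nth[OF order_refl] using formal_sum_class_terms[OF order_refl, of K a ?Bg f] by simp
qed

end
end

section \<open>From adapted coordinates to the graph formula\<close>

lemma adapted_coords_gaussian:
  assumes W: "odd_symplectic W d \<omega>" and c: "adapted_coords W d \<omega> i s c"
  shows "gaussian_coords W c"
proof
  have sup: "W False \<inter> W True = {0}" using W by (simp add: odd_symplectic_def super_space_def)
  have basis: "basis_list (xvecs c @ zvecs c) (range s)" and x: "set (xvecs c) \<subseteq> W False"
    and z: "set (zvecs c) \<subseteq> W True" and ev: "even (length (zvecs c))"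
    using c unfolding adapted_coords_def by blast+
  \<comment> \<open>A basis contains no zero vector, so an even basis vector cannot be odd as
    well.\<close>
  have nz: "0 \<notin> set (xvecs c)"
    using basis dependent_zero[of "set (xvecs c @ zvecs c)"] by (auto simp: basis_list_def)
  show "\<not> podd W c (xcoord c t)" if t: "t < length (xvecs c)" for t
  proof
    assume "podd W c (xcoord c t)"
    then have "xvecs c ! t \<in> W True"
      using t by (simp add: podd_def xcoord_def vecs_def nth_append)
    moreover have mem: "xvecs c ! t \<in> set (xvecs c)" using t by simp
    ultimately have "xvecs c ! t \<in> W False \<inter> W True" using x by blast
    then show False using sup nz mem by simp
  qed
  show "podd W c (zcoord c t)" if t: "t < length (zvecs c)" for t
  proof -
    have "zvecs c ! t \<in> set (zvecs c)" using t by simp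
    then show ?thesis using z t by (auto simp: podd_def zcoord_def vecs_def nth_append)
  qed
  show "even (length (zvecs c))" by (rule ev)
qed

theorem theoremA7:
  fixes W :: "'w::real_vector grading"
    and d s :: "'w \<Rightarrow> 'w"
    and \<omega> :: "'w \<Rightarrow> 'w \<Rightarrow> real"
    and i :: "'w set \<Rightarrow> 'w"
    and p :: "'w \<Rightarrow> 'w set"
    and c :: "'w coords"
    and f :: ffun
  assumes "odd_symplectic W d \<omega>"
    and "cyclic_sdr (parity_rev W) d (shift_form W \<omega>) i p s"
    and "adapted_coords W d \<omega> i s c"
    and "f \<in> hfun (podd W c) {..<length (vecs c)}"
  shows "formal_summable (fexp_term (podd W c) (\<lambda>m. f m / fls_X)) UNIV \<and>
         formal_summable (integral_term c (fexp (podd W c) (\<lambda>m. f m / fls_X)))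
           (monomials (podd W c) (lcoord c)) \<and>
         formal_summable (class_term W c f) iso_classes \<and>
         gauss_integral W c (fexp (podd W c) (\<lambda>m. f m / fls_X)) =
           formal_sum (class_term W c f) iso_classes"
proof -
  interpret gaussian_coords W c by (rule adapted_coords_gaussian[OF assms(1,3)])
  have weight: "\<forall>m g. fls_nth (f m) g \<noteq> 0 \<longrightarrow> g \<ge> 0 \<and> 2 * g + int (size m) > 2"
    using assms(4) unfolding hfun_def by blast
  have zero: "\<forall>m. m \<notin> monomials (podd W c) UNIV \<longrightarrow> f m = 0"
    
    using assms(4) by (auto simp: hfun_def monomials_def)
  show ?thesis
    by (intro conjI summable_fexp_term[OF weight] summable_integral_term[OF weight]
      summable_class_terms gauss_integral_eq_graph_sum[OF weight zero])
qed

end
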